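(* Let $G$ be a finite group with a (not necessarily faithful) representation $V=\mathbb{C}^n$, and let $\mathcal C$ be a set of representatives of the conjugacy classes of $G$. Let $d$ be the number of conjugacy classes of $g\in G$ such that $\operatorname{codim}V^g=2$ and $\chi_g\equiv1$. (i) The families $\{a_g\}_{g\in G}$ of skew-symmetric bilinear forms on $V$ corresponding to graded Hecke algebras form a vector space of dimension $$d+\sum_{\substack{g\in\mathcal C\\ V^g=V}}\dim\bigl(\textstyle\bigwedge^2(V)\bigr)^{Z(g)}.$$ (ii) All graded Hecke algebras arise in the following way. For each $g\in\mathcal C$ with $\operatorname{codim}V^g=2$ and $\chi_g\equiv1$, define a skew-symmetric bilinear form $a_g:V\times V\to\mathbb{C}$ by setting $a_g(w_1,w_2)$ equal to an arbitrary scalar for a fixed basis $\{w_1,w_2\}$ of $(V^g)^\perp$, $a_g(V^g,V)=0$, and set $a_{h^{-1}gh}(v,w)=a_g(h(v),h(w))$ for all $h\in G$, $v,w\in V$. For each $g\in\mathcal C$ with $V^g=V$, define $a_g$ by any choice of $Z(g)$-invariant linear functional on $\bigwedge^2(V)$, and set $a_{h^{-1}gh}(v,w)=a_g(h(v),h(w))$ for all $h\in G$, $v,w\in V$. For all $g\in G$ not conjugate to an element of either of these two kinds, set $a_g=0$.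
   Context: Fix a $G$-invariant Hermitian inner product on $V$. For $g\in G$: $V^g=\{v\in V:g(v)=v\}$; $Z(g)$ is the centralizer of $g$ in $G$; for $h\in Z(g)$, $h^\perp=h|_{(V^g)^\perp}$ and $\chi_g(h)=\det(h^\perp)$, a linear character of $Z(g)$. The skew group algebra $R\#G$ ($R=S(V)$ or $T(V)$) is $R\otimes\mathbb{C}G$ with product $(r\otimes g)(s\otimes h)=r\,g(s)\otimes gh$; write $\overline g$ for $1\otimes g$. Graded Hecke algebra: given skew-symmetric bilinear forms $a_g:V\times V\to\mathbb{C}$ ($g\in G$), let $$A=(T(V)\#G)\Big/\Bigl(vw-wv-\sum_{g\in G}a_g(v,w)\overline g:\ v,w\in V\Bigr),$$ filtered by giving elements of $V$ degree 1 and elements of $G$ degree 0. $A$ is called a graded Hecke algebra if the associated graded algebra $\mathrm{gr}A$ is isomorphic to $S(V)\#G$ (equivalently, $A$ is isomorphic to $S(V)\#G$ as a vector space via a choice of linear section $S(V)\hookrightarrow T(V)$ of the canonical projection). *)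

theory Defs
  imports
    "HOL-Analysis.Analysis"
    "HOL-Algebra.QuotRing"
    "HOL-Algebra.Module"
    "HOL-Library.Function_Algebras"
begin

section \<open>Representations, fixed spaces and the characters \<open>\<chi>\<^sub>g\<close>\<close>

definition centralizer :: "('g, 'm) monoid_scheme \<Rightarrow> 'g \<Rightarrow> 'g set" where
  "centralizer G g = {h \<in> carrier G. h \<otimes>\<^bsub>G\<^esub> g = g \<otimes>\<^bsub>G\<^esub> h}"

definition conj_class :: "('g, 'm) monoid_scheme \<Rightarrow> 'g \<Rightarrow> 'g set" where
  "conj_class G g = {inv\<^bsub>G\<^esub> h \<otimes>\<^bsub>G\<^esub> g \<otimes>\<^bsub>G\<^esub> h | h. h \<in> carrier G}"

definition class_representatives :: "('g, 'm) monoid_scheme \<Rightarrow> 'g set \<Rightarrow> bool" where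
  "class_representatives G C \<longleftrightarrow>
     C \<subseteq> carrier G \<and> (\<forall>g\<in>carrier G. \<exists>!c. c \<in> C \<and> c \<in> conj_class G g)"

definition matrix_representation ::
  "('g, 'm) monoid_scheme \<Rightarrow> ('g \<Rightarrow> complex^'n^'n) \<Rightarrow> bool" where
  "matrix_representation G \<rho> \<longleftrightarrow>
     \<rho> \<one>\<^bsub>G\<^esub> = mat 1 \<and>
     (\<forall>g\<in>carrier G. \<forall>h\<in>carrier G. \<rho> (g \<otimes>\<^bsub>G\<^esub> h) = \<rho> g ** \<rho> h)"

definition hermitian_inner_product ::
  "(complex^'n \<Rightarrow> complex^'n \<Rightarrow> complex) \<Rightarrow> bool" where
  "hermitian_inner_product ip \<longleftrightarrow>
     (\<forall>u v w. ip (u + v) w = ip u w + ip v w) \<and>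
     (\<forall>c v w. ip (c *s v) w = c * ip v w) \<and>
     (\<forall>v w. ip w v = cnj (ip v w)) \<and>
     (\<forall>v. v \<noteq> 0 \<longrightarrow> ip v v \<in> \<real> \<and> Re (ip v v) > 0)"

definition invariant_form ::
  "('g, 'm) monoid_scheme \<Rightarrow> ('g \<Rightarrow> complex^'n^'n) \<Rightarrow>
   (complex^'n \<Rightarrow> complex^'n \<Rightarrow> complex) \<Rightarrow> bool" where
  "invariant_form G \<rho> ip \<longleftrightarrow> (\<forall>g\<in>carrier G. \<forall>v w. ip (\<rho> g *v v) (\<rho> g *v w) = ip v w)"

definition fixed_space :: "complex^'n^'n \<Rightarrow> (complex^'n) set" where
  "fixed_space M = {v. M *v v = v}"

definition orth_compl ::
  "(complex^'n \<Rightarrow> complex^'n \<Rightarrow> complex) \<Rightarrow> (complex^'n) set \<Rightarrow> (complex^'n) set" where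
  "orth_compl ip W = {v. \<forall>w\<in>W. ip v w = 0}"

definition codim :: "(complex^'n) set \<Rightarrow> nat" where
  "codim W = vec.dim (UNIV :: (complex^'n) set) - vec.dim W"

definition is_basis_of :: "(complex^'n) set \<Rightarrow> (complex^'n) set \<Rightarrow> bool" where
  "is_basis_of B W \<longleftrightarrow> vec.independent B \<and> vec.span B = W"

text \<open>
  The determinant of an endomorphism \<open>f\<close> of a subspace \<open>W\<close>: the Leibniz formula for the
  matrix of \<open>f\<close> in some basis \<open>B\<close> of \<open>W\<close>, with rows and columns indexed by \<open>B\<close> itself.
\<close>

definition det_on :: "(complex^'n) set \<Rightarrow> (complex^'n \<Rightarrow> complex^'n) \<Rightarrow> complex" where
  "det_on W f =
     (let B = (SOME B. is_basis_of B W) in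
      \<Sum>p | p permutes B. of_int (sign p) * (\<Prod>b\<in>B. vec.representation B (f b) (p b)))"

definition chi ::
  "('g \<Rightarrow> complex^'n^'n) \<Rightarrow> (complex^'n \<Rightarrow> complex^'n \<Rightarrow> complex) \<Rightarrow> 'g \<Rightarrow> 'g \<Rightarrow> complex" where
  "chi \<rho> ip g h = det_on (orth_compl ip (fixed_space (\<rho> g))) (\<lambda>v. \<rho> h *v v)"

definition codim2_trivial_chi ::
  "('g, 'm) monoid_scheme \<Rightarrow> ('g \<Rightarrow> complex^'n^'n) \<Rightarrow>
   (complex^'n \<Rightarrow> complex^'n \<Rightarrow> complex) \<Rightarrow> 'g \<Rightarrow> bool" where
  "codim2_trivial_chi G \<rho> ip g \<longleftrightarrow>
     codim (fixed_space (\<rho> g)) = 2 \<and> (\<forall>h\<in>centralizer G g. chi \<rho> ip g h = 1)"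

definition num_codim2_trivial_chi_classes ::
  "('g, 'm) monoid_scheme \<Rightarrow> ('g \<Rightarrow> complex^'n^'n) \<Rightarrow>
   (complex^'n \<Rightarrow> complex^'n \<Rightarrow> complex) \<Rightarrow> nat" where
  "num_codim2_trivial_chi_classes G \<rho> ip =
     card {conj_class G g | g. g \<in> carrier G \<and> codim2_trivial_chi G \<rho> ip g}"


section \<open>The exterior square of \<open>V = \<complex>\<^sup>n\<close>\<close>

text \<open>
  \<open>V \<otimes> V\<close> is the space of coordinate arrays with respect to the basis \<open>e\<^sub>i \<otimes> e\<^sub>j\<close>;
  the exterior square is its quotient by the span of all \<open>v \<otimes> v\<close>.
\<close>

definition tensor2 :: "complex^'n \<Rightarrow> complex^'n \<Rightarrow> complex^('n \<times> 'n)" where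
  "tensor2 v w = (\<chi> p. v $ fst p * w $ snd p)"

definition tensor2_map :: "complex^'n^'n \<Rightarrow> complex^('n \<times> 'n) \<Rightarrow> complex^('n \<times> 'n)" where
  "tensor2_map M t = (\<chi> p. \<Sum>q\<in>UNIV. M $ fst p $ fst q * M $ snd p $ snd q * t $ q)"

definition ext2_rel :: "complex^('n::finite \<times> 'n) \<Rightarrow> complex^('n \<times> 'n) \<Rightarrow> bool" where
  "ext2_rel s t \<longleftrightarrow> s - t \<in> vec.span (range (\<lambda>v. tensor2 v v))"

lemma equivp_ext2_rel: "equivp ext2_rel"
proof (rule equivpI)
  show "reflp (ext2_rel :: complex^('n::finite \<times> 'n) \<Rightarrow> _)"
    by (rule reflpI) (simp add: ext2_rel_def vec.span_zero)
  show "symp (ext2_rel :: complex^('n::finite \<times> 'n) \<Rightarrow> _)"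
  proof (rule sympI)
    fix s t :: "complex^('n \<times> 'n)"
    assume "ext2_rel s t"
    then show "ext2_rel t s"
      using vec.span_neg[of "s - t"] by (simp add: ext2_rel_def)
  qed
  show "transp (ext2_rel :: complex^('n::finite \<times> 'n) \<Rightarrow> _)"
  proof (rule transpI)
    fix s t u :: "complex^('n \<times> 'n)"
    assume "ext2_rel s t" and "ext2_rel t u"
    then show "ext2_rel s u"
      using vec.span_add[of "s - t" _ "t - u"] by (simp add: ext2_rel_def)
  qed
qed

quotient_type (overloaded) 'n ext2 = "complex^('n::finite \<times> 'n)" / ext2_rel
  by (rule equivp_ext2_rel)

instantiation ext2 :: (finite) ab_group_add
begin

lift_definition zero_ext2 :: "'a ext2" is 0 .

lift_definition plus_ext2 :: "'a ext2 \<Rightarrow> 'a ext2 \<Rightarrow> 'a ext2" is "(+)"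
  unfolding ext2_rel_def by (simp only: add_diff_add vec.span_add)

lift_definition uminus_ext2 :: "'a ext2 \<Rightarrow> 'a ext2" is uminus
  unfolding ext2_rel_def by (simp only: minus_diff_minus vec.span_neg)

definition minus_ext2 :: "'a ext2 \<Rightarrow> 'a ext2 \<Rightarrow> 'a ext2" where
  "minus_ext2 x y = x + - y"

instance
proof
  fix x y z :: "'a ext2"
  show "x + y + z = x + (y + z)"
    by transfer (simp add: ext2_rel_def algebra_simps vec.span_zero)
  show "x + y = y + x"
    by transfer (simp add: ext2_rel_def algebra_simps vec.span_zero)
  show "0 + x = x"
    by transfer (simp add: ext2_rel_def vec.span_zero)
  show "- x + x = 0"
    by transfer (simp add: ext2_rel_def vec.span_zero)
  show "x - y = x + - y"
    by (simp add: minus_ext2_def)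
qed

end

lift_definition ext2_scale :: "complex \<Rightarrow> 'n::finite ext2 \<Rightarrow> 'n ext2" is "(*s)"
  unfolding ext2_rel_def by (simp only: vec.scale_right_diff_distrib[symmetric] vec.span_scale)

global_interpretation ext2: vector_space ext2_scale
  defines ext2_dim = ext2.dim
  by standard
     (transfer, simp add: ext2_rel_def vec.span_zero vector_add_ldistrib vector_sadd_rdistrib
        vector_smult_assoc)+

lift_definition wedge :: "complex^'n \<Rightarrow> complex^'n \<Rightarrow> 'n::finite ext2" is tensor2 .

lemma tensor2_map_diff: "tensor2_map M (s - t) = tensor2_map M s - tensor2_map M t"
  by (simp add: tensor2_map_def vec_eq_iff right_diff_distrib sum_subtractf)

lemma tensor2_map_tensor2: "tensor2_map M (tensor2 v w) = tensor2 (M *v v) (M *v w)"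
proof -
  have "(\<Sum>q\<in>UNIV. M $ i $ fst q * M $ j $ snd q * (v $ fst q * w $ snd q)) =
        (\<Sum>k\<in>UNIV. M $ i $ k * v $ k) * (\<Sum>l\<in>UNIV. M $ j $ l * w $ l)" for i j
    unfolding sum_product sum.cartesian_product UNIV_Times_UNIV
    by (rule sum.cong) (auto simp: mult_ac)
  then show ?thesis
    by (simp add: tensor2_map_def tensor2_def vec_eq_iff matrix_vector_mult_def)
qed

lemma linear_tensor2_map: "Vector_Spaces.linear (*s) (*s) (tensor2_map M)"
  by (rule Vector_Spaces.linear_iff[THEN iffD2])
     (simp_all add: vec.vector_space_axioms tensor2_map_def vec_eq_iff distrib_left sum.distrib sum_distrib_left mult_ac)

lift_definition ext2_map :: "complex^'n^'n \<Rightarrow> 'n::finite ext2 \<Rightarrow> 'n ext2" is tensor2_map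
proof -
  fix M :: "complex^'n^'n" and s t :: "complex^('n \<times> 'n)"
  assume "ext2_rel s t"
  then have "tensor2_map M (s - t) \<in> tensor2_map M ` vec.span (range (\<lambda>v. tensor2 v v))"
    by (simp add: ext2_rel_def)
  also have "\<dots> = vec.span (tensor2_map M ` range (\<lambda>v. tensor2 v v))"
    by (rule vec.linear_span_image[OF linear_tensor2_map, symmetric])
  also have "\<dots> \<subseteq> vec.span (range (\<lambda>v. tensor2 v v))"
    by (rule vec.span_mono) (auto simp: tensor2_map_tensor2)
  finally show "ext2_rel (tensor2_map M s) (tensor2_map M t)"
    by (simp add: ext2_rel_def tensor2_map_diff)
qed

definition ext2_invariants ::
  "('g \<Rightarrow> complex^'n^'n) \<Rightarrow> 'g set \<Rightarrow> 'n::finite ext2 set" where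
  "ext2_invariants \<rho> H = {x. \<forall>h\<in>H. ext2_map (\<rho> h) x = x}"

definition invariant_ext2_functional ::
  "('g \<Rightarrow> complex^'n^'n) \<Rightarrow> 'g set \<Rightarrow> ('n::finite ext2 \<Rightarrow> complex) \<Rightarrow> bool" where
  "invariant_ext2_functional \<rho> H \<phi> \<longleftrightarrow>
     Vector_Spaces.linear ext2_scale (*) \<phi> \<and> (\<forall>h\<in>H. \<forall>x. \<phi> (ext2_map (\<rho> h) x) = \<phi> x)"


section \<open>Complex algebras\<close>

text \<open>
  A (noncommutative) complex algebra is a record of type \<open>(complex, 'a) module\<close>: a ring
  together with a scalar multiplication.  The locale \<open>algebra\<close> of the library is not used
  because it demands a commutative multiplication.
\<close>

definition quot_alg :: "(complex, 'a) module \<Rightarrow> 'a set \<Rightarrow> (complex, 'a set) module" where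
  "quot_alg A I =
     \<lparr>carrier = a_rcosets\<^bsub>A\<^esub> I, mult = rcoset_mult A I, one = I +>\<^bsub>A\<^esub> \<one>\<^bsub>A\<^esub>,
      zero = I, add = set_add A,
      smult = (\<lambda>c X. \<Union>x\<in>X. I +>\<^bsub>A\<^esub> (c \<odot>\<^bsub>A\<^esub> x))\<rparr>"

definition algebra_iso ::
  "(complex, 'a) module \<Rightarrow> (complex, 'b) module \<Rightarrow> ('a \<Rightarrow> 'b) \<Rightarrow> bool" where
  "algebra_iso A B f \<longleftrightarrow>
     f \<in> ring_iso A B \<and> (\<forall>c. \<forall>x\<in>carrier A. f (c \<odot>\<^bsub>A\<^esub> x) = c \<odot>\<^bsub>B\<^esub> f x)"

text \<open>The associated graded algebra \<open>\<Oplus>\<^sub>k F\<^sub>k / F\<^bsub>k-1\<^esub>\<close> of a filtration, with \<open>F\<^bsub>-1\<^esub> = 0\<close>.\<close>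

definition filt_prev :: "(complex, 'a) module \<Rightarrow> (nat \<Rightarrow> 'a set) \<Rightarrow> nat \<Rightarrow> 'a set" where
  "filt_prev A F k = (case k of 0 \<Rightarrow> {\<zero>\<^bsub>A\<^esub>} | Suc j \<Rightarrow> F j)"

text \<open>
  The vector space \<open>F\<^sub>k / F\<^bsub>k-1\<^esub>\<close>; the fields \<open>mult\<close> and \<open>one\<close> of this record carry no meaning.
\<close>

definition gr_piece ::
  "(complex, 'a) module \<Rightarrow> (nat \<Rightarrow> 'a set) \<Rightarrow> nat \<Rightarrow> (complex, 'a set) module" where
  "gr_piece A F k = quot_alg (A\<lparr>carrier := F k\<rparr>) (filt_prev A F k)"

definition gr_piece_mult ::
  "(complex, 'a) module \<Rightarrow> (nat \<Rightarrow> 'a set) \<Rightarrow> nat \<Rightarrow> nat \<Rightarrow> 'a set \<Rightarrow> 'a set \<Rightarrow> 'a set" where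
  "gr_piece_mult A F i j X Y =
     (\<Union>x\<in>X. \<Union>y\<in>Y. filt_prev A F (i + j) +>\<^bsub>A\<^esub> (x \<otimes>\<^bsub>A\<^esub> y))"

definition assoc_graded ::
  "(complex, 'a) module \<Rightarrow> (nat \<Rightarrow> 'a set) \<Rightarrow> (complex, nat \<Rightarrow> 'a set) module" where
  "assoc_graded A F =
     \<lparr>carrier = {x. (\<forall>k. x k \<in> carrier (gr_piece A F k)) \<and>
                    finite {k. x k \<noteq> \<zero>\<^bsub>gr_piece A F k\<^esub>}},
      mult = (\<lambda>x y k. \<Oplus>\<^bsub>gr_piece A F k\<^esub>i\<in>{..k}. gr_piece_mult A F i (k - i) (x i) (y (k - i))),
      one = (\<lambda>k. if k = 0 then filt_prev A F 0 +>\<^bsub>A\<^esub> \<one>\<^bsub>A\<^esub> else \<zero>\<^bsub>gr_piece A F k\<^esub>),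
      zero = (\<lambda>k. \<zero>\<^bsub>gr_piece A F k\<^esub>),
      add = (\<lambda>x y k. x k \<oplus>\<^bsub>gr_piece A F k\<^esub> y k),
      smult = (\<lambda>c x k. c \<odot>\<^bsub>gr_piece A F k\<^esub> x k)\<rparr>"

definition assoc_graded_component ::
  "(complex, 'a) module \<Rightarrow> (nat \<Rightarrow> 'a set) \<Rightarrow> nat \<Rightarrow> (nat \<Rightarrow> 'a set) set" where
  "assoc_graded_component A F k =
     {x \<in> carrier (assoc_graded A F). \<forall>j. j \<noteq> k \<longrightarrow> x j = \<zero>\<^bsub>gr_piece A F j\<^esub>}"


section \<open>The tensor algebra and the symmetric algebra of \<open>V\<close>\<close>

text \<open>
  A tensor is given by its coordinates in the basis
  \<open>e\<^bsub>i1\<^esub> \<otimes> \<dots> \<otimes> e\<^bsub>ik\<^esub>\<close> of \<open>T(V)\<close>, indexed by the words \<open>[i1, \<dots>, ik]\<close>.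
\<close>

definition tensor_algebra :: "(complex, 'n list \<Rightarrow> complex) module" where
  "tensor_algebra =
     \<lparr>carrier = {t. finite {w. t w \<noteq> 0}},
      mult = (\<lambda>s t w. \<Sum>k\<le>length w. s (take k w) * t (drop k w)),
      one = (\<lambda>w. if w = [] then 1 else 0),
      zero = (\<lambda>w. 0),
      add = (\<lambda>s t w. s w + t w),
      smult = (\<lambda>c t w. c * t w)\<rparr>"

definition tensor_incl :: "complex^'n \<Rightarrow> 'n list \<Rightarrow> complex" where
  "tensor_incl v = (\<lambda>w. if length w = 1 then v $ hd w else 0)"

definition tensor_degree :: "nat \<Rightarrow> ('n list \<Rightarrow> complex) set" where
  "tensor_degree k = {t \<in> carrier tensor_algebra. \<forall>w. t w \<noteq> 0 \<longrightarrow> length w = k}"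

definition tensor_degree_le :: "nat \<Rightarrow> ('n list \<Rightarrow> complex) set" where
  "tensor_degree_le k = {t \<in> carrier tensor_algebra. \<forall>w. t w \<noteq> 0 \<longrightarrow> length w \<le> k}"

text \<open>The operator \<open>M \<otimes> \<dots> \<otimes> M\<close> on each \<open>V\<^bsup>\<otimes>k\<^esup>\<close>.\<close>

definition tensor_action :: "complex^'n^'n \<Rightarrow> ('n list \<Rightarrow> complex) \<Rightarrow> ('n list \<Rightarrow> complex)" where
  "tensor_action M t =
     (\<lambda>u. \<Sum>w | length w = length u. (\<Prod>k<length u. M $ (u ! k) $ (w ! k)) * t w)"

definition sym_ideal :: "('n::finite list \<Rightarrow> complex) set" where
  "sym_ideal =
     Idl\<^bsub>tensor_algebra\<^esub>
       {tensor_incl v \<otimes>\<^bsub>tensor_algebra\<^esub> tensor_incl w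
          \<ominus>\<^bsub>tensor_algebra\<^esub> tensor_incl w \<otimes>\<^bsub>tensor_algebra\<^esub> tensor_incl v
        | v w :: complex^'n. True}"

definition sym_algebra :: "(complex, ('n::finite list \<Rightarrow> complex) set) module" where
  "sym_algebra = quot_alg tensor_algebra sym_ideal"

definition sym_degree :: "nat \<Rightarrow> ('n::finite list \<Rightarrow> complex) set set" where
  "sym_degree k = {sym_ideal +>\<^bsub>tensor_algebra\<^esub> t | t. t \<in> tensor_degree k}"

definition sym_action ::
  "complex^'n^'n \<Rightarrow> ('n list \<Rightarrow> complex) set \<Rightarrow> ('n list \<Rightarrow> complex) set" where
  "sym_action M X = tensor_action M ` X"


section \<open>Skew group algebras\<close>

text \<open>
  For a finite group \<open>G\<close>, an element \<open>\<Sum>\<^sub>g r\<^sub>g \<otimes> g\<close> of \<open>R # G\<close> is the function \<open>g \<mapsto> r\<^sub>g\<close> on \<open>G\<close>.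
  In the product, \<open>(r \<otimes> g)(s \<otimes> h) = r g(s) \<otimes> gh\<close> contributes to \<open>k = gh\<close>.
\<close>

definition skew_group_algebra ::
  "('g, 'm) monoid_scheme \<Rightarrow> (complex, 'r) module \<Rightarrow> ('g \<Rightarrow> 'r \<Rightarrow> 'r) \<Rightarrow>
   (complex, 'g \<Rightarrow> 'r) module" where
  "skew_group_algebra G R act =
     \<lparr>carrier = carrier G \<rightarrow>\<^sub>E carrier R,
      mult = (\<lambda>x y. \<lambda>k\<in>carrier G.
                \<Oplus>\<^bsub>R\<^esub>g\<in>carrier G. x g \<otimes>\<^bsub>R\<^esub> act g (y (inv\<^bsub>G\<^esub> g \<otimes>\<^bsub>G\<^esub> k))),
      one = (\<lambda>k\<in>carrier G. if k = \<one>\<^bsub>G\<^esub> then \<one>\<^bsub>R\<^esub> else \<zero>\<^bsub>R\<^esub>),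
      zero = (\<lambda>k\<in>carrier G. \<zero>\<^bsub>R\<^esub>),
      add = (\<lambda>x y. \<lambda>k\<in>carrier G. x k \<oplus>\<^bsub>R\<^esub> y k),
      smult = (\<lambda>c x. \<lambda>k\<in>carrier G. c \<odot>\<^bsub>R\<^esub> x k)\<rparr>"

definition skew_elem ::
  "('g, 'm) monoid_scheme \<Rightarrow> (complex, 'r) module \<Rightarrow> 'r \<Rightarrow> 'g \<Rightarrow> 'g \<Rightarrow> 'r" where
  "skew_elem G R r g = (\<lambda>k\<in>carrier G. if k = g then r else \<zero>\<^bsub>R\<^esub>)"

definition tensor_skew ::
  "('g, 'm) monoid_scheme \<Rightarrow> ('g \<Rightarrow> complex^'n^'n) \<Rightarrow> (complex, 'g \<Rightarrow> 'n list \<Rightarrow> complex) module"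
  where
  "tensor_skew G \<rho> = skew_group_algebra G tensor_algebra (\<lambda>g. tensor_action (\<rho> g))"

definition sym_skew ::
  "('g, 'm) monoid_scheme \<Rightarrow> ('g \<Rightarrow> complex^'n^'n) \<Rightarrow>
   (complex, 'g \<Rightarrow> ('n list \<Rightarrow> complex) set) module" where
  "sym_skew G \<rho> = skew_group_algebra G sym_algebra (\<lambda>g. sym_action (\<rho> g))"

text \<open>The grading of \<open>S(V) # G\<close> with \<open>V\<close> in degree 1 and \<open>G\<close> in degree 0.\<close>

definition sym_skew_degree ::
  "('g, 'm) monoid_scheme \<Rightarrow> nat \<Rightarrow> ('g \<Rightarrow> ('n::finite list \<Rightarrow> complex) set) set" where
  "sym_skew_degree G k = carrier G \<rightarrow>\<^sub>E sym_degree k"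


section \<open>Graded Hecke algebras\<close>

definition skew_bilinear_form :: "(complex^'n \<Rightarrow> complex^'n \<Rightarrow> complex) \<Rightarrow> bool" where
  "skew_bilinear_form b \<longleftrightarrow>
     (\<forall>u v w. b (u + v) w = b u w + b v w) \<and> (\<forall>c v w. b (c *s v) w = c * b v w) \<and>
     (\<forall>u v w. b u (v + w) = b u v + b u w) \<and> (\<forall>c v w. b v (c *s w) = c * b v w) \<and>
     (\<forall>v w. b w v = - b v w)"

text \<open>A family indexed by the elements of \<open>G\<close>, normalised to be zero off \<open>carrier G\<close>.\<close>

definition form_family ::
  "('g, 'm) monoid_scheme \<Rightarrow> ('g \<Rightarrow> complex^'n \<Rightarrow> complex^'n \<Rightarrow> complex) \<Rightarrow> bool" where
  "form_family G a \<longleftrightarrow>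
     (\<forall>g\<in>carrier G. skew_bilinear_form (a g)) \<and> (\<forall>g. g \<notin> carrier G \<longrightarrow> a g = 0)"

definition hecke_vec ::
  "('g, 'm) monoid_scheme \<Rightarrow> complex^'n \<Rightarrow> 'g \<Rightarrow> 'n list \<Rightarrow> complex" where
  "hecke_vec G v = skew_elem G tensor_algebra (tensor_incl v) \<one>\<^bsub>G\<^esub>"

definition hecke_grp ::
  "('g, 'm) monoid_scheme \<Rightarrow> 'g \<Rightarrow> 'g \<Rightarrow> 'n list \<Rightarrow> complex" where
  "hecke_grp G g = skew_elem G tensor_algebra \<one>\<^bsub>tensor_algebra\<^esub> g"

definition hecke_relation ::
  "('g, 'm) monoid_scheme \<Rightarrow> ('g \<Rightarrow> complex^'n^'n) \<Rightarrow>
   ('g \<Rightarrow> complex^'n \<Rightarrow> complex^'n \<Rightarrow> complex) \<Rightarrow>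
   complex^'n \<Rightarrow> complex^'n \<Rightarrow> 'g \<Rightarrow> 'n list \<Rightarrow> complex" where
  "hecke_relation G \<rho> a v w =
     (let T = tensor_skew G \<rho> in
        hecke_vec G v \<otimes>\<^bsub>T\<^esub> hecke_vec G w \<ominus>\<^bsub>T\<^esub> hecke_vec G w \<otimes>\<^bsub>T\<^esub> hecke_vec G v
          \<ominus>\<^bsub>T\<^esub> (\<Oplus>\<^bsub>T\<^esub>g\<in>carrier G. a g v w \<odot>\<^bsub>T\<^esub> hecke_grp G g))"

definition hecke_ideal ::
  "('g, 'm) monoid_scheme \<Rightarrow> ('g \<Rightarrow> complex^'n^'n) \<Rightarrow>
   ('g \<Rightarrow> complex^'n \<Rightarrow> complex^'n \<Rightarrow> complex) \<Rightarrow> ('g \<Rightarrow> 'n::finite list \<Rightarrow> complex) set" where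
  "hecke_ideal G \<rho> a = Idl\<^bsub>tensor_skew G \<rho>\<^esub> {hecke_relation G \<rho> a v w | v w. True}"

definition hecke_quotient ::
  "('g, 'm) monoid_scheme \<Rightarrow> ('g \<Rightarrow> complex^'n^'n) \<Rightarrow>
   ('g \<Rightarrow> complex^'n \<Rightarrow> complex^'n \<Rightarrow> complex) \<Rightarrow>
   (complex, ('g \<Rightarrow> 'n::finite list \<Rightarrow> complex) set) module" where
  "hecke_quotient G \<rho> a = quot_alg (tensor_skew G \<rho>) (hecke_ideal G \<rho> a)"

definition hecke_filtration ::
  "('g, 'm) monoid_scheme \<Rightarrow> ('g \<Rightarrow> complex^'n^'n) \<Rightarrow>
   ('g \<Rightarrow> complex^'n \<Rightarrow> complex^'n \<Rightarrow> complex) \<Rightarrow>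
   nat \<Rightarrow> ('g \<Rightarrow> 'n::finite list \<Rightarrow> complex) set set" where
  "hecke_filtration G \<rho> a k =
     {hecke_ideal G \<rho> a +>\<^bsub>tensor_skew G \<rho>\<^esub> x | x. x \<in> carrier G \<rightarrow>\<^sub>E tensor_degree_le k}"

text \<open>
  The isomorphism is one of graded algebras.  It is not required to be the canonical map, but
  the components are finite-dimensional and \<open>S(V) # G\<close> maps onto the associated graded algebra
  canonically, so a dimension count makes that map an isomorphism as well.
\<close>

definition graded_hecke ::
  "('g, 'm) monoid_scheme \<Rightarrow> ('g \<Rightarrow> complex^'n::finite^'n) \<Rightarrow>
   ('g \<Rightarrow> complex^'n \<Rightarrow> complex^'n \<Rightarrow> complex) \<Rightarrow> bool" where
  "graded_hecke G \<rho> a \<longleftrightarrow>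
     (let A = hecke_quotient G \<rho> a; F = hecke_filtration G \<rho> a in
      \<exists>f. algebra_iso (assoc_graded A F) (sym_skew G \<rho>) f \<and>
          (\<forall>k. f ` assoc_graded_component A F k = sym_skew_degree G k))"

definition graded_hecke_families ::
  "('g, 'm) monoid_scheme \<Rightarrow> ('g \<Rightarrow> complex^'n::finite^'n) \<Rightarrow>
   ('g \<Rightarrow> complex^'n \<Rightarrow> complex^'n \<Rightarrow> complex) set" where
  "graded_hecke_families G \<rho> = {a. form_family G a \<and> graded_hecke G \<rho> a}"

definition family_scale ::
  "complex \<Rightarrow> ('g \<Rightarrow> complex^'n \<Rightarrow> complex^'n \<Rightarrow> complex) \<Rightarrow>
   'g \<Rightarrow> complex^'n \<Rightarrow> complex^'n \<Rightarrow> complex" where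
  "family_scale c a = (\<lambda>g v w. c * a g v w)"

global_interpretation families: vector_space family_scale
  defines families_dim = families.dim
  by standard (simp_all add: family_scale_def fun_eq_iff algebra_simps)

text \<open>
  The family \<open>a\<close> built from scalars \<open>c\<close> and functionals \<open>\<phi>\<close>; only the values of \<open>w1\<close>, \<open>w2\<close>, \<open>c\<close>
  at representatives of the first kind, and of \<open>\<phi>\<close> at those acting trivially, are used.
\<close>

definition constructed_family ::
  "('g, 'm) monoid_scheme \<Rightarrow> ('g \<Rightarrow> complex^'n::finite^'n) \<Rightarrow>
   (complex^'n \<Rightarrow> complex^'n \<Rightarrow> complex) \<Rightarrow> 'g set \<Rightarrow>
   ('g \<Rightarrow> complex^'n) \<Rightarrow> ('g \<Rightarrow> complex^'n) \<Rightarrow> ('g \<Rightarrow> complex) \<Rightarrow> ('g \<Rightarrow> 'n ext2 \<Rightarrow> complex) \<Rightarrow>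
   ('g \<Rightarrow> complex^'n \<Rightarrow> complex^'n \<Rightarrow> complex) \<Rightarrow> bool" where
  "constructed_family G \<rho> ip C w1 w2 c \<phi> a \<longleftrightarrow>
     form_family G a \<and>
     (\<forall>g\<in>C. codim2_trivial_chi G \<rho> ip g \<longrightarrow>
        a g (w1 g) (w2 g) = c g \<and>
        (\<forall>u\<in>fixed_space (\<rho> g). \<forall>v. a g u v = 0)) \<and>
     (\<forall>g\<in>C. fixed_space (\<rho> g) = UNIV \<longrightarrow> (\<forall>v w. a g v w = \<phi> g (wedge v w))) \<and>
     (\<forall>g\<in>C. codim2_trivial_chi G \<rho> ip g \<or> fixed_space (\<rho> g) = UNIV \<longrightarrow>
        (\<forall>h\<in>carrier G. \<forall>v w.
           a (inv\<^bsub>G\<^esub> h \<otimes>\<^bsub>G\<^esub> g \<otimes>\<^bsub>G\<^esub> h) v w = a g (\<rho> h *v v) (\<rho> h *v w))) \<and>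
     (\<forall>g\<in>carrier G.
        \<not> (\<exists>g'\<in>C. g \<in> conj_class G g' \<and>
                (codim2_trivial_chi G \<rho> ip g' \<or> fixed_space (\<rho> g') = UNIV)) \<longrightarrow>
        (\<forall>v w. a g v w = 0))"

end

theory Submission
  imports Defs "HOL-Algebra.Multiplicative_Group" "HOL-Library.Multiset"
begin

text \<open>
  A family \<open>a\<close> yields a graded Hecke algebra if and only if it is invariant, that is
  \<open>a\<^bsub>h\<^sup>-\<^sup>1gh\<^esub>(v, w) = a\<^sub>g(h v, h w)\<close>, and satisfies for each \<open>g\<close> the Jacobi identity
  \<open>a\<^sub>g(u, v)(g w - w) + a\<^sub>g(v, w)(g u - u) + a\<^sub>g(w, u)(g v - v) = 0\<close>.
  The two conditions make the overlaps of the rewriting rule that sorts words resolvable,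
  so that the sorted words \<open>w \<otimes> g\<close> are independent in the quotient; conversely they are
  relations in degree at most one, which the dimension count for \<open>gr A\<close> forces to vanish.

  If \<open>codim V\<^sup>g = 1\<close> or \<open>codim V\<^sup>g > 2\<close>, the two conditions give \<open>a\<^sub>g = 0\<close>; if \<open>codim V\<^sup>g = 2\<close>, then
  \<open>V\<^sup>g\<close> lies in the radical of \<open>a\<^sub>g\<close>, which leaves one scalar, and \<open>Z(g)\<close> acts on it by \<open>\<chi>\<^sub>g\<close>; if
  \<open>V\<^sup>g = V\<close>, only the invariance under \<open>Z(g)\<close> is left.
\<close>

section \<open>The tensor algebra\<close>

text \<open>The Jacobi identity is what the identity [u,[v,w]] + [v,[w,u]] + [w,[u,v]] = 0 of T(V)
  leaves behind when each inner commutator is replaced by the sum of the a_g(v,w) g and g is moved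
  past the third vector. Invariance arises in the same way from h [v,w] h^-1 = [h v, h w]. These
  consequences have degree at most one, so the converse needs gr A only in degrees 0 and 1. The
  isomorphism there need not be the canonical map; that a surjective endomorphism of a
  finite-dimensional space is injective bridges the gap. In the direct part the difficulty is that
  rewriting a word depends on the place chosen. A linear functional on T(V) # G is defined by
  recursion along a chosen descent, and its values are shown to be independent of the choice; hence
  it vanishes on the ideal, while its initial values can be set so that it reads off one coefficient
  of a leading term. In codimension two the Jacobi identity does not restrict the scalar, because
  its left-hand side is alternating in three arguments and lives on the plane V / V^g.\<close>

lemma sum_fun_apply: "(\<Sum>i\<in>I. f i) x = (\<Sum>i\<in>I. f i x)"
  by (induction I rule: infinite_finite_induct) auto

definition tensor_mult :: "('n list \<Rightarrow> complex) \<Rightarrow> ('n list \<Rightarrow> complex) \<Rightarrow> 'n list \<Rightarrow> complex"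
    (infixl "\<odot>\<odot>" 70) where
  "s \<odot>\<odot> t = (\<lambda>w. \<Sum>k\<le>length w. s (take k w) * t (drop k w))"

lemma tensor_mult_Nil: "(s \<odot>\<odot> t) [] = s [] * t []"
  by (simp add: tensor_mult_def)

text \<open>The cut is either before the first letter or behind it. This recursion replaces the
  convolution formula: identities for products become inductions on the word.\<close>

lemma tensor_mult_Cons: "(s \<odot>\<odot> t) (i # w) = s [] * t (i # w) + ((\<lambda>v. s (i # v)) \<odot>\<odot> t) w"
  unfolding tensor_mult_def by (simp add: sum.atMost_Suc_shift del: sum.atMost_Suc)

lemma tensor_mult_add_left: "(s + s') \<odot>\<odot> t = s \<odot>\<odot> t + s' \<odot>\<odot> t"
  by (simp add: tensor_mult_def fun_eq_iff distrib_right sum.distrib)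

lemma tensor_mult_add_right: "s \<odot>\<odot> (t + t') = s \<odot>\<odot> t + s \<odot>\<odot> t'"
  by (simp add: tensor_mult_def fun_eq_iff distrib_left sum.distrib)

lemma tensor_mult_zero_left [simp]: "0 \<odot>\<odot> t = 0"
  by (simp add: tensor_mult_def fun_eq_iff)

lemma tensor_mult_zero_right [simp]: "s \<odot>\<odot> 0 = 0"
  by (simp add: tensor_mult_def fun_eq_iff)

lemma tensor_mult_sum_left:
  fixes s :: "'i \<Rightarrow> 'n list \<Rightarrow> complex"
  shows "sum s I \<odot>\<odot> t = (\<Sum>i\<in>I. s i \<odot>\<odot> t)"
  by (rule ext, unfold tensor_mult_def sum_fun_apply sum_distrib_right, rule sum.swap)

lemma tensor_mult_sum_right:
  fixes t :: "'i \<Rightarrow> 'n list \<Rightarrow> complex"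
  shows "s \<odot>\<odot> sum t I = (\<Sum>i\<in>I. s \<odot>\<odot> t i)"
  by (rule ext, unfold tensor_mult_def sum_fun_apply sum_distrib_left, rule sum.swap)

definition tensor_scale :: "complex \<Rightarrow> ('n list \<Rightarrow> complex) \<Rightarrow> 'n list \<Rightarrow> complex" where
  "tensor_scale c t = (\<lambda>w. c * t w)"

lemma tensor_mult_scale_left: "tensor_scale c s \<odot>\<odot> t = tensor_scale c (s \<odot>\<odot> t)"
  by (simp add: tensor_mult_def tensor_scale_def fun_eq_iff sum_distrib_left mult_ac)

lemma tensor_mult_scale_right: "s \<odot>\<odot> tensor_scale c t = tensor_scale c (s \<odot>\<odot> t)"
  by (simp add: tensor_mult_def tensor_scale_def fun_eq_iff sum_distrib_left mult_ac)

lemma tensor_mult_assoc: "(s \<odot>\<odot> t) \<odot>\<odot> r = s \<odot>\<odot> (t \<odot>\<odot> r)"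
proof
  fix w
  show "((s \<odot>\<odot> t) \<odot>\<odot> r) w = (s \<odot>\<odot> (t \<odot>\<odot> r)) w"
  proof (induction w arbitrary: s t r)
    case Nil
    then show ?case by (simp add: tensor_mult_Nil)
  next
    case (Cons i w)
    \<comment> \<open>Removing the first letter \<open>i\<close> is a Fox derivative: D(s t) =
      s(empty word) D t + (D s) t. This brings the induction hypothesis into play for the derived
      tensor.\<close>
    have eq: "(\<lambda>v. (s \<odot>\<odot> t) (i # v)) = tensor_scale (s []) (\<lambda>v. t (i # v)) + (\<lambda>v. s (i # v)) \<odot>\<odot> t"
      by (simp add: fun_eq_iff tensor_mult_Cons tensor_scale_def)
    show ?case
      unfolding tensor_mult_Cons[of "s \<odot>\<odot> t"] eq
      unfolding tensor_mult_Cons[of s "t \<odot>\<odot> r"] tensor_mult_Nil tensor_mult_add_left tensor_mult_scale_left plus_fun_apply Cons.IH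
      by (simp add: tensor_mult_Cons tensor_scale_def algebra_simps)
  qed
qed

section \<open>Words and decomposable tensors\<close>

definition word_tensor :: "'n list \<Rightarrow> 'n list \<Rightarrow> complex" where
  "word_tensor v = (\<lambda>w. if w = v then 1 else 0)"

text \<open>Decomposable tensors in coordinates. A matrix moves a word out of the word basis, but
  maps decomposable tensors to decomposable tensors; the defining relations are therefore written
  with these.\<close>

fun tensor_of_vectors :: "(complex^'n) list \<Rightarrow> 'n list \<Rightarrow> complex" where
  "tensor_of_vectors [] [] = 1"
| "tensor_of_vectors [] (i # w) = 0"
| "tensor_of_vectors (v # vs) [] = 0"
| "tensor_of_vectors (v # vs) (i # w) = v $ i * tensor_of_vectors vs w"

lemma tensor_of_vectors_length: "length w \<noteq> length vs \<Longrightarrow> tensor_of_vectors vs w = 0"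
  by (induction vs w rule: tensor_of_vectors.induct) auto

lemma tensor_of_vectors_Nil: "tensor_of_vectors [] = (word_tensor [] :: 'n::finite list \<Rightarrow> complex)"
proof
  fix w :: "'n list"
  show "tensor_of_vectors [] w = word_tensor [] w"
    by (cases w) (auto simp: word_tensor_def)
qed

lemma word_tensor_mult_left:
  "(word_tensor u \<odot>\<odot> t) w = (if take (length u) w = u then t (drop (length u) w) else 0)"
proof (induction u arbitrary: w t)
  case Nil
  show ?case
    by (cases w) (simp_all add: tensor_mult_Nil tensor_mult_Cons word_tensor_def fun_eq_iff
        tensor_mult_zero_left[unfolded zero_fun_def])
next
  case (Cons i u)
  show ?case
  proof (cases w)
    case Nil
    then show ?thesis by (simp add: tensor_mult_Nil word_tensor_def)
  next
    case w: (Cons j w')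
    have "(\<lambda>v. word_tensor (i # u) (j # v)) = (if i = j then word_tensor u else 0)"
      by (auto simp: word_tensor_def fun_eq_iff)
    then show ?thesis
      using Cons.IH by (auto simp: w tensor_mult_Cons word_tensor_def)
  qed
qed

lemma tensor_mult_one_left [simp]: "word_tensor [] \<odot>\<odot> t = t"
  by (simp add: fun_eq_iff word_tensor_mult_left)

lemma word_tensor_mult: "word_tensor u \<odot>\<odot> word_tensor v = word_tensor (u @ v)"
proof
  fix w
  have "(take (length u) w = u \<and> drop (length u) w = v) = (w = u @ v)"
    by (metis append_eq_conv_conj append_take_drop_id)
  then show "(word_tensor u \<odot>\<odot> word_tensor v) w = word_tensor (u @ v) w"
    by (simp add: word_tensor_mult_left) (auto simp: word_tensor_def)
qed

lemma tensor_mult_one_right [simp]: "t \<odot>\<odot> word_tensor [] = t"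
proof
  fix w
  show "(t \<odot>\<odot> word_tensor []) w = t w"
    by (induction w arbitrary: t) (simp_all add: tensor_mult_Nil tensor_mult_Cons word_tensor_def)
qed

lemma tensor_of_vectors_append:
  "tensor_of_vectors (us @ vs) = tensor_of_vectors us \<odot>\<odot> tensor_of_vectors vs"
proof
  fix w
  show "tensor_of_vectors (us @ vs) w = (tensor_of_vectors us \<odot>\<odot> tensor_of_vectors vs) w"
  proof (induction us arbitrary: w)
    case Nil
    then show ?case by (simp add: tensor_of_vectors_Nil)
  next
    case (Cons u us)
    show ?case
    proof (cases w)
      case w: (Cons i w')
      have "(\<lambda>v. tensor_of_vectors (u # us) (i # v)) = tensor_scale (u $ i) (tensor_of_vectors us)"
        by (simp add: tensor_scale_def fun_eq_iff)
      then show ?thesis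
        by (simp add: w tensor_mult_Cons tensor_mult_scale_left Cons.IH) (simp add: tensor_scale_def)
    qed (simp add: tensor_mult_Nil)
  qed
qed

lemma tensor_incl_eq:
  fixes v :: "complex^'n::finite"
  shows "tensor_incl v = tensor_of_vectors [v]"
proof
  fix w :: "'n list"
  show "tensor_incl v w = tensor_of_vectors [v] w"
    by (cases w rule: remdups_adj.cases) (auto simp: tensor_incl_def)
qed

lemma tensor_of_axes: "tensor_of_vectors (map (\<lambda>i. axis i 1) u) = word_tensor u"
proof
  fix w
  show "tensor_of_vectors (map (\<lambda>i. axis i 1) u) w = word_tensor u w"
    by (induction u arbitrary: w; case_tac w) (auto simp: word_tensor_def axis_def)
qed

section \<open>The action of a matrix on tensors\<close>

lemma finite_words_of_length: "finite {w :: 'n::finite list. length w = k}"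
  using finite_lists_length_eq[of "UNIV :: 'n set" k] by simp

lemma words_Suc: "{w. length w = Suc k} = (\<Union>i. (#) i ` {w. length w = k})"
  by (auto simp: length_Suc_conv)

lemma sum_words_Suc:
  fixes f :: "'n::finite list \<Rightarrow> 'a::comm_monoid_add"
  shows "(\<Sum>w | length w = Suc k. f w) = (\<Sum>i\<in>UNIV. \<Sum>w | length w = k. f (i # w))"
proof -
  have "(\<Sum>w | length w = Suc k. f w) = (\<Sum>i\<in>UNIV. sum f ((#) i ` {w. length w = k}))"
    unfolding words_Suc by (rule sum.UNION_disjoint) (auto simp: finite_words_of_length)
  then show ?thesis
    by (simp add: sum.reindex)
qed

text \<open>The entry of the tensor power of \<open>M\<close> in row \<open>u\<close> and column
  \<open>w\<close>. It is meant for words of equal length only, since a shorter \<open>w\<close>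
  would be read beyond its end; all uses carry a length condition.\<close>

definition word_coeff :: "complex^'n^'n \<Rightarrow> 'n list \<Rightarrow> 'n list \<Rightarrow> complex" where
  "word_coeff M u w = (\<Prod>k<length u. M $ (u ! k) $ (w ! k))"

lemma word_coeff_Nil [simp]: "word_coeff M [] w = 1"
  by (simp add: word_coeff_def)

lemma word_coeff_Cons [simp]: "word_coeff M (i # u) (j # w) = M $ i $ j * word_coeff M u w"
  by (simp add: word_coeff_def prod.lessThan_Suc_shift del: prod.lessThan_Suc)

lemma tensor_action_eq:
  "tensor_action M t u = (\<Sum>w | length w = length u. word_coeff M u w * t w)"
  by (simp add: tensor_action_def word_coeff_def)

lemma tensor_action_Nil: "tensor_action M t [] = t []"
  by (simp add: tensor_action_eq)

lemma tensor_action_Cons: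
  fixes M :: "complex^'n::finite^'n"
  shows "tensor_action M t (i # u) = (\<Sum>j\<in>UNIV. M $ i $ j * tensor_action M (\<lambda>v. t (j # v)) u)"
  by (simp add: tensor_action_eq sum_words_Suc sum_distrib_left mult.assoc)

lemma tensor_action_add: "tensor_action M (s + t) = tensor_action M s + tensor_action M t"
  by (simp add: tensor_action_eq fun_eq_iff distrib_left sum.distrib)

lemma tensor_action_scale: "tensor_action M (tensor_scale c t) = tensor_scale c (tensor_action M t)"
  by (simp add: tensor_action_eq tensor_scale_def fun_eq_iff sum_distrib_left mult_ac)

lemma tensor_action_zero [simp]: "tensor_action M 0 = 0"
  by (simp add: tensor_action_eq fun_eq_iff)

lemma tensor_action_sum:
  fixes t :: "'i \<Rightarrow> 'n::finite list \<Rightarrow> complex"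
  shows "tensor_action M (sum t I) = (\<Sum>i\<in>I. tensor_action M (t i))"
  by (rule ext, unfold tensor_action_eq sum_fun_apply sum_distrib_left, rule sum.swap)

text \<open>The same derivative argument as for associativity. The derivative of an acted tensor is
  a combination of acted derivatives with a row of \<open>M\<close> as coefficients, which is what
  \<open>eq2\<close> records.\<close>

lemma tensor_action_mult:
  fixes M :: "complex^'n::finite^'n"
  shows "tensor_action M (s \<odot>\<odot> t) = tensor_action M s \<odot>\<odot> tensor_action M t"
proof
  fix w
  show "tensor_action M (s \<odot>\<odot> t) w = (tensor_action M s \<odot>\<odot> tensor_action M t) w"
  proof (induction w arbitrary: s t)
    case Nil
    then show ?case by (simp add: tensor_action_Nil tensor_mult_Nil)
  next
    case (Cons i w)
    have eq: "(\<lambda>v. (s \<odot>\<odot> t) (j # v)) = tensor_scale (s []) (\<lambda>v. t (j # v)) + (\<lambda>v. s (j # v)) \<odot>\<odot> t"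
      for j by (simp add: fun_eq_iff tensor_mult_Cons tensor_scale_def)
    have eq2: "(\<lambda>v. tensor_action M s (i # v)) =
        (\<Sum>j\<in>UNIV. tensor_scale (M $ i $ j) (tensor_action M (\<lambda>v. s (j # v))))"
      by (simp add: fun_eq_iff tensor_action_Cons sum_fun_apply tensor_scale_def)
    show ?case
      unfolding tensor_action_Cons[of M "s \<odot>\<odot> t"] tensor_mult_Cons[of _ _ i w] eq eq2
        tensor_action_add tensor_action_scale
        tensor_mult_sum_left tensor_mult_scale_left sum_fun_apply tensor_action_Nil plus_fun_apply
      by (simp add: Cons.IH tensor_action_Cons tensor_scale_def sum_distrib_left distrib_left
          sum.distrib mult_ac)
  qed
qed

lemma tensor_action_one:
  "tensor_action M (word_tensor []) = word_tensor []"
  by (auto simp: fun_eq_iff tensor_action_eq word_tensor_def intro!: sum.neutral)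

lemma tensor_action_mat_1:
  fixes t :: "'n::finite list \<Rightarrow> complex"
  shows "tensor_action (mat 1) t = t"
proof
  fix w
  show "tensor_action (mat 1) t w = t w"
    by (induction w arbitrary: t)
      (simp_all add: tensor_action_Nil tensor_action_Cons[unfolded mat_def] mat_def if_distribR
        if_distrib[of "\<lambda>x. x * _"] cong: if_cong)
qed

lemma matrix_matrix_mult_component: "(M ** N) $ i $ k = (\<Sum>j\<in>UNIV. M $ i $ j * N $ j $ k)"
  by (simp add: matrix_matrix_mult_def)

lemma tensor_action_comp:
  fixes M N :: "complex^'n::finite^'n"
  shows "tensor_action M (tensor_action N t) = tensor_action (M ** N) t"
proof
  fix w
  show "tensor_action M (tensor_action N t) w = tensor_action (M ** N) t w"
  proof (induction w arbitrary: t)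
    case Nil
    then show ?case by (simp add: tensor_action_Nil)
  next
    case (Cons i w)
    have eq: "(\<lambda>v. tensor_action N t (j # v)) =
        (\<Sum>k\<in>UNIV. tensor_scale (N $ j $ k) (tensor_action N (\<lambda>v. t (k # v))))" for j
      by (simp add: fun_eq_iff tensor_action_Cons sum_fun_apply tensor_scale_def)
    have "tensor_action M (tensor_action N t) (i # w) =
        (\<Sum>j\<in>UNIV. \<Sum>k\<in>UNIV. M $ i $ j * (N $ j $ k * tensor_action (M ** N) (\<lambda>v. t (k # v)) w))"
      unfolding tensor_action_Cons[of M] eq tensor_action_sum tensor_action_scale sum_fun_apply
      by (simp add: tensor_scale_def Cons.IH sum_distrib_left)
    also have "\<dots> = tensor_action (M ** N) t (i # w)"
      unfolding tensor_action_Cons[of "M ** N"]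
      by (subst sum.swap)
        (simp add: matrix_matrix_mult_component sum_distrib_right mult.assoc)
    finally show ?case .
  qed
qed

lemma tensor_action_vectors:
  fixes M :: "complex^'n::finite^'n"
  shows "tensor_action M (tensor_of_vectors vs) = tensor_of_vectors (map ((*v) M) vs)"
proof
  fix w
  show "tensor_action M (tensor_of_vectors vs) w = tensor_of_vectors (map ((*v) M) vs) w"
  proof (induction vs arbitrary: w)
    case Nil
    then show ?case by (simp add: tensor_of_vectors_Nil tensor_action_one)
  next
    case (Cons v vs)
    show ?case
    proof (cases w)
      case w: (Cons i w')
      have "(\<lambda>u. tensor_of_vectors (v # vs) (j # u)) = tensor_scale (v $ j) (tensor_of_vectors vs)"
        for j by (simp add: tensor_scale_def fun_eq_iff)
      then show ?thesis
        by (simp add: w tensor_action_Cons tensor_action_scale)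
          (simp add: tensor_scale_def Cons.IH matrix_vector_mult_def[of M v] sum_distrib_right mult.assoc)
    qed (simp add: tensor_action_Nil)
  qed
qed

section \<open>The ring of finitely supported tensors\<close>

definition finite_support :: "('n list \<Rightarrow> complex) \<Rightarrow> bool" where
  "finite_support t \<longleftrightarrow> finite {w. t w \<noteq> 0}"

text \<open>The alphabet is finite, so there are finitely many words up to a given length. Closure
  properties can thus be checked by bounding lengths instead of exhibiting finite sets.\<close>

lemma finite_support_bound:
  fixes t :: "'n::finite list \<Rightarrow> complex"
  shows "finite_support t \<longleftrightarrow> (\<exists>N. \<forall>w. t w \<noteq> 0 \<longrightarrow> length w \<le> N)"
proof
  assume "finite_support t"
  then have "finite (length ` {w. t w \<noteq> 0})" by (simp add: finite_support_def)
  then obtain N where "\<forall>n \<in> length ` {w. t w \<noteq> 0}. n \<le> N"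
    using finite_nat_set_iff_bounded_le by blast
  then show "\<exists>N. \<forall>w. t w \<noteq> 0 \<longrightarrow> length w \<le> N" by blast
next
  assume "\<exists>N. \<forall>w. t w \<noteq> 0 \<longrightarrow> length w \<le> N"
  then obtain N where "\<forall>w. t w \<noteq> 0 \<longrightarrow> length w \<le> N" by blast
  then have "{w. t w \<noteq> 0} \<subseteq> {w. set w \<subseteq> UNIV \<and> length w \<le> N}" by auto
  then show "finite_support t"
    unfolding finite_support_def by (rule finite_subset) (rule finite_lists_length_le, simp)
qed

lemma tensor_algebra_simps [simp]:
  "t \<in> carrier tensor_algebra \<longleftrightarrow> finite_support t"
  "s \<otimes>\<^bsub>tensor_algebra\<^esub> t = s \<odot>\<odot> t"
  "s \<oplus>\<^bsub>tensor_algebra\<^esub> t = s + t"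
  "\<one>\<^bsub>tensor_algebra\<^esub> = word_tensor []"
  "\<zero>\<^bsub>tensor_algebra\<^esub> = 0"
  "c \<odot>\<^bsub>tensor_algebra\<^esub> t = tensor_scale c t"
  by (simp_all add: tensor_algebra_def finite_support_def tensor_mult_def word_tensor_def
      tensor_scale_def fun_eq_iff)

lemma finite_support_zero [simp]: "finite_support 0"
  by (simp add: finite_support_def)

lemma finite_support_word [simp]: "finite_support (word_tensor w)"
  by (simp add: finite_support_def word_tensor_def)

lemma finite_support_add [intro]: "finite_support s \<Longrightarrow> finite_support t \<Longrightarrow> finite_support (s + t)"
  unfolding finite_support_def
  by (rule finite_subset[of _ "{w. s w \<noteq> 0} \<union> {w. t w \<noteq> 0}"]) auto

lemma finite_support_uminus [intro]: "finite_support s \<Longrightarrow> finite_support (- s)"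
  by (simp add: finite_support_def)

lemma finite_support_diff [intro]: "finite_support s \<Longrightarrow> finite_support t \<Longrightarrow> finite_support (s - t)"
  unfolding finite_support_def
  by (rule finite_subset[of _ "{w. s w \<noteq> 0} \<union> {w. t w \<noteq> 0}"]) auto

lemma finite_support_scale [intro]: "finite_support s \<Longrightarrow> finite_support (tensor_scale c s)"
  unfolding finite_support_def tensor_scale_def
  by (rule finite_subset[of _ "{w. s w \<noteq> 0}"]) auto

lemma finite_support_sum [intro]:
  assumes "\<And>i. i \<in> I \<Longrightarrow> finite_support (f i)"
  shows "finite_support (sum f I)"
proof (cases "finite I")
  case True
  have "{w. sum f I w \<noteq> 0} \<subseteq> (\<Union>i\<in>I. {w. f i w \<noteq> 0})"
    by (auto simp: sum_fun_apply elim: sum.not_neutral_contains_not_neutral)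
  then show ?thesis
    using True assms unfolding finite_support_def by (meson finite_UN finite_subset)
qed simp

lemma finite_support_vectors [simp]:
  fixes vs :: "(complex^'n::finite) list"
  shows "finite_support (tensor_of_vectors vs)"
  unfolding finite_support_bound
  by (intro exI[of _ "length vs"] allI impI) (use tensor_of_vectors_length in force)

lemma tensor_mult_length_le:
  assumes "(s \<odot>\<odot> t) w \<noteq> 0" "\<And>w. s w \<noteq> 0 \<Longrightarrow> length w \<le> m" "\<And>w. t w \<noteq> 0 \<Longrightarrow> length w \<le> n"
  shows "length w \<le> m + n"
proof -
  obtain k where k: "k \<le> length w" "s (take k w) * t (drop k w) \<noteq> 0"
    using sum.not_neutral_contains_not_neutral[OF assms(1)[unfolded tensor_mult_def]] by auto
  then have "s (take k w) \<noteq> 0" and "t (drop k w) \<noteq> 0" by auto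
  then have "length (take k w) \<le> m" and "length (drop k w) \<le> n" using assms(2,3) by blast+
  with k(1) show ?thesis by simp
qed

lemma finite_support_mult [intro]:
  fixes s t :: "'n::finite list \<Rightarrow> complex"
  assumes "finite_support s" "finite_support t"
  shows "finite_support (s \<odot>\<odot> t)"
proof -
  obtain m n where "\<forall>w. s w \<noteq> 0 \<longrightarrow> length w \<le> m" "\<forall>w. t w \<noteq> 0 \<longrightarrow> length w \<le> n"
    using assms finite_support_bound by metis
  then have "\<forall>w. (s \<odot>\<odot> t) w \<noteq> 0 \<longrightarrow> length w \<le> m + n"
    using tensor_mult_length_le[of s t _ m n] by blast
  then show ?thesis unfolding finite_support_bound by blast
qed

lemma tensor_action_length:
  assumes "tensor_action M t u \<noteq> 0"
  obtains w where "length w = length u" "t w \<noteq> 0"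
proof -
  have "\<exists>w\<in>{w. length w = length u}. word_coeff M u w * t w \<noteq> 0"
    using assms unfolding tensor_action_eq by (meson sum.not_neutral_contains_not_neutral)
  then show thesis using that by auto
qed

lemma finite_support_action [intro]:
  fixes t :: "'n::finite list \<Rightarrow> complex"
  assumes "finite_support t"
  shows "finite_support (tensor_action M t)"
proof -
  obtain m where "\<forall>w. t w \<noteq> 0 \<longrightarrow> length w \<le> m"
    using assms finite_support_bound by metis
  then have "\<forall>w. tensor_action M t w \<noteq> 0 \<longrightarrow> length w \<le> m"
    by (auto elim!: tensor_action_length)
  then show ?thesis unfolding finite_support_bound by blast
qed

lemma ring_tensor_algebra: "ring (tensor_algebra :: (complex, 'n::finite list \<Rightarrow> complex) module)"
proof (rule ringI)
  show "abelian_group (tensor_algebra :: (complex, 'n list \<Rightarrow> complex) module)"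
  proof (rule abelian_groupI)
    fix x :: "'n list \<Rightarrow> complex"
    assume "x \<in> carrier tensor_algebra"
    then show "\<exists>y\<in>carrier tensor_algebra. y \<oplus>\<^bsub>tensor_algebra\<^esub> x = \<zero>\<^bsub>tensor_algebra\<^esub>"
      by (intro bexI[of _ "- x"]) auto
  qed (auto simp: add_ac)
  show "Group.monoid (tensor_algebra :: (complex, 'n list \<Rightarrow> complex) module)"
    by (rule Group.monoidI) (auto simp: tensor_mult_assoc)
qed (auto simp: tensor_mult_add_left tensor_mult_add_right)

interpretation tensor: ring "tensor_algebra :: (complex, 'n::finite list \<Rightarrow> complex) module"
  by (rule ring_tensor_algebra)

lemma tensor_finsum:
  fixes f :: "'i \<Rightarrow> 'n::finite list \<Rightarrow> complex"
  assumes "\<And>i. i \<in> I \<Longrightarrow> finite_support (f i)"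
  shows "finsum tensor_algebra f I = (\<Sum>i\<in>I. f i)"
  using assms
proof (induction I rule: infinite_finite_induct)
  case (insert x F)
  then show ?case
    by (subst tensor.finsum_insert) (auto simp: Pi_def)
qed (simp_all add: tensor.finsum_infinite)

lemma tensor_a_inv:
  fixes t :: "'n::finite list \<Rightarrow> complex"
  assumes "finite_support t"
  shows "\<ominus>\<^bsub>tensor_algebra\<^esub> t = - t"
  by (rule tensor.minus_equality) (use assms in auto)

lemma tensor_a_minus:
  fixes s t :: "'n::finite list \<Rightarrow> complex"
  assumes "finite_support t"
  shows "s \<ominus>\<^bsub>tensor_algebra\<^esub> t = s - t"
  using assms by (simp add: a_minus_def tensor_a_inv)

lemma tensor_expand:
  fixes t :: "'n list \<Rightarrow> complex"
  assumes "finite_support t"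
  shows "t = (\<Sum>w | t w \<noteq> 0. tensor_scale (t w) (word_tensor w))"
proof
  fix v
  have "(\<Sum>w | t w \<noteq> 0. tensor_scale (t w) (word_tensor w) v) =
        (\<Sum>w | t w \<noteq> 0. if w = v then t v else 0)"
    by (rule sum.cong) (auto simp: tensor_scale_def word_tensor_def)
  also have "\<dots> = t v"
    using assms by (simp add: finite_support_def)
  finally show "t v = (\<Sum>w | t w \<noteq> 0. tensor_scale (t w) (word_tensor w)) v"
    by (simp add: sum_fun_apply)
qed

lemma tensor_induct [consumes 1, case_names zero word add]:
  fixes t :: "'n list \<Rightarrow> complex"
  assumes "finite_support t"
    and "P 0"
    and "\<And>c w. P (tensor_scale c (word_tensor w))"
    and "\<And>s t. finite_support s \<Longrightarrow> finite_support t \<Longrightarrow> P s \<Longrightarrow> P t \<Longrightarrow> P (s + t)"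
  shows "P t"
proof -
  define g where "g w = tensor_scale (t w) (word_tensor w)" for w
  have fin: "finite_support (g w)" and g: "P (g w)" for w
    unfolding g_def using assms(3) by auto
  have *: "P (sum g W)" if "finite W" for W
    using that
  proof (rule finite_induct)
    fix x F
    assume "finite F" "x \<notin> F" "P (sum g F)"
    moreover have "sum g (insert x F) = g x + sum g F"
      using \<open>finite F\<close> \<open>x \<notin> F\<close> by (rule sum.insert)
    ultimately show "P (sum g (insert x F))"
      using assms(4) fin g by (metis finite_support_sum)
  next
    have "sum g {} = 0" by (rule sum.empty)
    then show "P (sum g {})" using assms(2) by metis
  qed
  have "P (sum g {w. t w \<noteq> 0})"
    using assms(1) by (intro *) (simp add: finite_support_def)
  moreover have "sum g {w. t w \<noteq> 0} = t"
    unfolding g_def by (rule tensor_expand[OF assms(1), symmetric])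
  ultimately show ?thesis
    by simp
qed

lemma tensor_scale_zero [simp]: "tensor_scale c 0 = 0"
  by (simp add: tensor_scale_def fun_eq_iff)

section \<open>The skew group algebra of the tensor algebra\<close>

text \<open>The kernel of \<open>L\<close> need not be an ideal; the proof uses the largest ideal inside it.\<close>

lemma (in ring) genideal_kernel:
  fixes L :: "'a \<Rightarrow> complex"
  assumes L_add: "\<And>x y. x \<in> carrier R \<Longrightarrow> y \<in> carrier R \<Longrightarrow> L (x \<oplus> y) = L x + L y"
    and rel: "\<And>p r q. p \<in> carrier R \<Longrightarrow> r \<in> S \<Longrightarrow> q \<in> carrier R \<Longrightarrow> L (p \<otimes> r \<otimes> q) = 0"
    and S: "S \<subseteq> carrier R" and x: "x \<in> Idl S"
  shows "L x = 0"
proof -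
  define K where "K = {x \<in> carrier R. \<forall>p\<in>carrier R. \<forall>q\<in>carrier R. L (p \<otimes> x \<otimes> q) = 0}"
  have L_zero: "L \<zero> = 0"
    using L_add[of \<zero> \<zero>] by simp
  have L_neg: "L (\<ominus> x) = - L x" if "x \<in> carrier R" for x
    using L_add[of "\<ominus> x" x] that L_zero by (simp add: l_neg eq_neg_iff_add_eq_0)
  have "ideal K R"
  proof (rule idealI[OF ring_axioms])
    show "subgroup K (add_monoid R)"
    proof (rule add.subgroupI)
      have "\<zero> \<in> K" by (auto simp: K_def L_zero)
      then show "K \<noteq> {}" by blast
    qed (auto simp: K_def r_minus l_minus L_neg r_distr l_distr L_add a_inv_def[symmetric])
    show "x \<otimes> k \<in> K" if "k \<in> K" "x \<in> carrier R" for k x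
      using that by (auto simp: K_def simp flip: m_assoc)
    show "k \<otimes> x \<in> K" if "k \<in> K" "x \<in> carrier R" for k x
    proof -
      have "p \<otimes> (k \<otimes> x) \<otimes> q = p \<otimes> k \<otimes> (x \<otimes> q)"
        if "p \<in> carrier R" "q \<in> carrier R" for p q
        using that \<open>k \<in> K\<close> \<open>x \<in> carrier R\<close> by (simp add: K_def m_assoc)
      then show ?thesis using that by (auto simp: K_def)
    qed
  qed
  moreover have "S \<subseteq> K"
    using S rel by (auto simp: K_def)
  ultimately have "Idl S \<subseteq> K"
    by (rule genideal_minimal)
  then have "x \<in> carrier R" and "L (\<one> \<otimes> x \<otimes> \<one>) = 0"
    using x unfolding K_def by blast+
  then show ?thesis by simp
qed

section \<open>The ring T(V) # G\<close>

locale finite_group_rep = group G for G :: "('g, 'm) monoid_scheme" (structure) +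
  fixes \<rho> :: "'g \<Rightarrow> complex^'n::finite^'n"
  assumes finite_G: "finite (carrier G)"
    and rep: "matrix_representation G \<rho>"
begin

abbreviation T where "T \<equiv> tensor_skew G \<rho>"

abbreviation elem :: "('n list \<Rightarrow> complex) \<Rightarrow> 'g \<Rightarrow> 'g \<Rightarrow> 'n list \<Rightarrow> complex" where
  "elem \<equiv> skew_elem G tensor_algebra"

lemma rho_one: "\<rho> \<one> = mat 1"
  using rep by (simp add: matrix_representation_def)

lemma rho_mult: "g \<in> carrier G \<Longrightarrow> h \<in> carrier G \<Longrightarrow> \<rho> (g \<otimes> h) = \<rho> g ** \<rho> h"
  using rep by (simp add: matrix_representation_def)

lemma rho_mult_vec: "g \<in> carrier G \<Longrightarrow> h \<in> carrier G \<Longrightarrow> \<rho> (g \<otimes> h) *v v = \<rho> g *v (\<rho> h *v v)"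
  by (simp add: rho_mult matrix_vector_mul_assoc)

lemma rho_one_vec [simp]: "\<rho> \<one> *v v = v"
  by (simp add: rho_one)

lemma rho_inv_vec [simp]:
  "g \<in> carrier G \<Longrightarrow> \<rho> (inv g) *v (\<rho> g *v v) = v"
  "g \<in> carrier G \<Longrightarrow> \<rho> g *v (\<rho> (inv g) *v v) = v"
  by (simp_all flip: rho_mult_vec)

abbreviation act :: "'g \<Rightarrow> ('n list \<Rightarrow> complex) \<Rightarrow> 'n list \<Rightarrow> complex" where
  "act g \<equiv> tensor_action (\<rho> g)"

lemma act_one: "act \<one> t = t"
  by (simp add: rho_one tensor_action_mat_1)

lemma act_mult: "g \<in> carrier G \<Longrightarrow> h \<in> carrier G \<Longrightarrow> act (g \<otimes> h) t = act g (act h t)"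
  by (simp add: rho_mult tensor_action_comp)

lemma carrier_T: "x \<in> carrier T \<longleftrightarrow>
    x \<in> extensional (carrier G) \<and> (\<forall>g\<in>carrier G. finite_support (x g))"
  by (auto simp: tensor_skew_def skew_group_algebra_def PiE_def Pi_def)

lemma T_ext: "x \<in> carrier T \<Longrightarrow> y \<in> carrier T \<Longrightarrow> (\<And>g. g \<in> carrier G \<Longrightarrow> x g = y g) \<Longrightarrow> x = y"
  using carrier_T extensionalityI by metis

lemma carrier_T_support: "x \<in> carrier T \<Longrightarrow> g \<in> carrier G \<Longrightarrow> finite_support (x g)"
  by (simp add: carrier_T)

lemma T_add: "x \<oplus>\<^bsub>T\<^esub> y = (\<lambda>k\<in>carrier G. x k + y k)"
  by (simp add: tensor_skew_def skew_group_algebra_def)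

lemma T_zero: "\<zero>\<^bsub>T\<^esub> = (\<lambda>k\<in>carrier G. 0)"
  by (simp add: tensor_skew_def skew_group_algebra_def)

lemma T_one: "\<one>\<^bsub>T\<^esub> = elem (word_tensor []) \<one>"
  by (simp add: tensor_skew_def skew_group_algebra_def skew_elem_def cong: if_cong)

lemma T_smult: "c \<odot>\<^bsub>T\<^esub> x = (\<lambda>k\<in>carrier G. tensor_scale c (x k))"
  by (simp add: tensor_skew_def skew_group_algebra_def)

lemma T_mult:
  assumes "x \<in> carrier T" "y \<in> carrier T"
  shows "x \<otimes>\<^bsub>T\<^esub> y = (\<lambda>k\<in>carrier G. \<Sum>g\<in>carrier G. x g \<odot>\<odot> act g (y (inv g \<otimes> k)))"
proof
  fix k
  show "(x \<otimes>\<^bsub>T\<^esub> y) k = (\<lambda>k\<in>carrier G. \<Sum>g\<in>carrier G. x g \<odot>\<odot> act g (y (inv g \<otimes> k))) k"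
    using assms
    by (simp add: tensor_skew_def skew_group_algebra_def restrict_def)
      (auto intro!: tensor_finsum finite_support_mult finite_support_action
        simp: carrier_T_support[unfolded tensor_skew_def skew_group_algebra_def, simplified])
qed

lemma T_mult_apply:
  assumes "x \<in> carrier T" "y \<in> carrier T" "k \<in> carrier G"
  shows "(x \<otimes>\<^bsub>T\<^esub> y) k = (\<Sum>g\<in>carrier G. x g \<odot>\<odot> act g (y (inv g \<otimes> k)))"
  using assms by (simp add: T_mult)

lemma T_closed:
  assumes "x \<in> carrier T" "y \<in> carrier T"
  shows "x \<otimes>\<^bsub>T\<^esub> y \<in> carrier T" "x \<oplus>\<^bsub>T\<^esub> y \<in> carrier T"
  using assms
  by (auto simp: T_mult carrier_T_support T_add carrier_T[of "restrict _ _"]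
      intro!: finite_support_sum finite_support_mult finite_support_action)

lemma T_smult_closed: "x \<in> carrier T \<Longrightarrow> c \<odot>\<^bsub>T\<^esub> x \<in> carrier T"
  by (auto simp: carrier_T_support T_smult carrier_T[of "restrict _ _"])

lemma T_smult_apply: "k \<in> carrier G \<Longrightarrow> (c \<odot>\<^bsub>T\<^esub> x) k = tensor_scale c (x k)"
  by (simp add: T_smult)

lemma T_zero_closed: "\<zero>\<^bsub>T\<^esub> \<in> carrier T"
  by (simp add: T_zero carrier_T)

lemma elem_closed: "finite_support t \<Longrightarrow> elem t g \<in> carrier T"
  by (auto simp: skew_elem_def carrier_T)

lemma elem_apply: "k \<in> carrier G \<Longrightarrow> elem t g k = (if k = g then t else 0)"
  by (simp add: skew_elem_def)

lemma inv_mult_eq_iff: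
  "g \<in> carrier G \<Longrightarrow> k \<in> carrier G \<Longrightarrow> h \<in> carrier G \<Longrightarrow> inv g \<otimes> k = h \<longleftrightarrow> k = g \<otimes> h"
  using inv_solve_left by metis

lemma elem_mult:
  assumes "g \<in> carrier G" "h \<in> carrier G" "finite_support s" "finite_support t"
  shows "elem s g \<otimes>\<^bsub>T\<^esub> elem t h = elem (s \<odot>\<odot> act g t) (g \<otimes> h)"
proof (rule T_ext)
  fix k assume k: "k \<in> carrier G"
  have "(elem s g \<otimes>\<^bsub>T\<^esub> elem t h) k =
      (\<Sum>g'\<in>carrier G. elem s g g' \<odot>\<odot> act g' (elem t h (inv g' \<otimes> k)))"
    using assms k by (simp add: T_mult_apply elem_closed)
  also have "\<dots> = (\<Sum>g'\<in>carrier G. if g = g' then s \<odot>\<odot> act g (elem t h (inv g \<otimes> k)) else 0)"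
    by (rule sum.cong) (auto simp: elem_apply)
  also have "\<dots> = s \<odot>\<odot> act g (elem t h (inv g \<otimes> k))"
    using assms finite_G by simp
  also have "\<dots> = elem (s \<odot>\<odot> act g t) (g \<otimes> h) k"
    using assms k by (auto simp: elem_apply inv_mult_eq_iff)
  finally show "(elem s g \<otimes>\<^bsub>T\<^esub> elem t h) k = elem (s \<odot>\<odot> act g t) (g \<otimes> h) k" .
qed (use assms in \<open>auto intro!: T_closed elem_closed finite_support_mult finite_support_action\<close>)

lemma T_mult_assoc:
  assumes "x \<in> carrier T" "y \<in> carrier T" "z \<in> carrier T"
  shows "(x \<otimes>\<^bsub>T\<^esub> y) \<otimes>\<^bsub>T\<^esub> z = x \<otimes>\<^bsub>T\<^esub> (y \<otimes>\<^bsub>T\<^esub> z)"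
proof (rule T_ext)
  fix k assume k: "k \<in> carrier G"
  let ?s = "\<lambda>g l. x g \<odot>\<odot> (act g (y (inv g \<otimes> l)) \<odot>\<odot> act l (z (inv l \<otimes> k)))"
  have "((x \<otimes>\<^bsub>T\<^esub> y) \<otimes>\<^bsub>T\<^esub> z) k =
      (\<Sum>l\<in>carrier G. \<Sum>g\<in>carrier G. ?s g l)"
    using assms k
    by (subst T_mult_apply)
      (auto simp: T_closed T_mult_apply tensor_mult_sum_left tensor_mult_assoc)
  also have "\<dots> = (\<Sum>g\<in>carrier G. \<Sum>l\<in>carrier G. ?s g l)"
    by (rule sum.swap)
  also have "\<dots> = (\<Sum>g\<in>carrier G. x g \<odot>\<odot> act g ((y \<otimes>\<^bsub>T\<^esub> z) (inv g \<otimes> k)))"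
  proof (rule sum.cong[OF refl])
    fix g assume g: "g \<in> carrier G"
    \<comment> \<open>The substitution l = g h turns the sum over partial products into the
      convolution that gives the product of \<open>y\<close> and \<open>z\<close> at
      \<open>inv g\<close> times \<open>k\<close>.\<close>
    have "(\<Sum>l\<in>carrier G. ?s g l) = (\<Sum>h\<in>carrier G. ?s g (g \<otimes> h))"
      using g by (intro sum.reindex_bij_witness[of _ "\<lambda>h. g \<otimes> h" "\<lambda>l. inv g \<otimes> l"])
        (auto simp flip: m_assoc)
    also have "\<dots> = (\<Sum>h\<in>carrier G. x g \<odot>\<odot> act g (y h \<odot>\<odot> act h (z (inv h \<otimes> (inv g \<otimes> k)))))"
    proof (rule sum.cong[OF refl])
      fix h assume h: "h \<in> carrier G"
      have "inv g \<otimes> (g \<otimes> h) = h" "inv (g \<otimes> h) \<otimes> k = inv h \<otimes> (inv g \<otimes> k)"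
        using g h k by (simp_all flip: m_assoc add: inv_mult_group)
      then show "?s g (g \<otimes> h) = x g \<odot>\<odot> act g (y h \<odot>\<odot> act h (z (inv h \<otimes> (inv g \<otimes> k))))"
        using g h by (simp add: act_mult tensor_action_mult)
    qed
    also have "\<dots> = x g \<odot>\<odot> act g ((y \<otimes>\<^bsub>T\<^esub> z) (inv g \<otimes> k))"
      using assms g k by (simp add: T_mult_apply tensor_action_sum tensor_mult_sum_right)
    finally show "(\<Sum>l\<in>carrier G. ?s g l) = x g \<odot>\<odot> act g ((y \<otimes>\<^bsub>T\<^esub> z) (inv g \<otimes> k))" .
  qed
  also have "\<dots> = (x \<otimes>\<^bsub>T\<^esub> (y \<otimes>\<^bsub>T\<^esub> z)) k"
    using assms k by (simp add: T_closed T_mult_apply)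
  finally show "((x \<otimes>\<^bsub>T\<^esub> y) \<otimes>\<^bsub>T\<^esub> z) k = (x \<otimes>\<^bsub>T\<^esub> (y \<otimes>\<^bsub>T\<^esub> z)) k" .
qed (use assms in \<open>auto intro!: T_closed\<close>)

lemma T_add_apply: "k \<in> carrier G \<Longrightarrow> (x \<oplus>\<^bsub>T\<^esub> y) k = x k + y k"
  by (simp add: T_add)

lemma ring_T: "ring T"
proof (rule ringI)
  show "abelian_group T"
  proof (rule abelian_groupI)
    fix x assume x: "x \<in> carrier T"
    then show "\<exists>y\<in>carrier T. y \<oplus>\<^bsub>T\<^esub> x = \<zero>\<^bsub>T\<^esub>"
      by (intro bexI[of _ "\<lambda>k\<in>carrier G. - x k"])
        (auto simp: T_add T_zero carrier_T fun_eq_iff)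
    show "\<zero>\<^bsub>T\<^esub> \<oplus>\<^bsub>T\<^esub> x = x"
      using x by (intro T_ext) (simp_all add: T_closed T_zero_closed T_add_apply, simp add: T_zero)
  qed (auto simp: T_closed T_zero_closed, auto simp: T_add restrict_def fun_eq_iff add_ac)
  show "Group.monoid T"
  proof (rule Group.monoidI)
    show one: "\<one>\<^bsub>T\<^esub> \<in> carrier T" by (simp add: T_one elem_closed)
    fix x assume x: "x \<in> carrier T"
    show "\<one>\<^bsub>T\<^esub> \<otimes>\<^bsub>T\<^esub> x = x"
    proof (rule T_ext)
      fix k assume k: "k \<in> carrier G"
      have "(\<one>\<^bsub>T\<^esub> \<otimes>\<^bsub>T\<^esub> x) k = (\<Sum>g\<in>carrier G. elem (word_tensor []) \<one> g \<odot>\<odot> act g (x (inv g \<otimes> k)))"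
        using k x one by (simp add: T_mult_apply) (simp add: T_one)
      also have "\<dots> = (\<Sum>g\<in>carrier G. if \<one> = g then x k else 0)"
        using k by (intro sum.cong) (auto simp: elem_apply act_one)
      also have "\<dots> = x k" using finite_G by simp
      finally show "(\<one>\<^bsub>T\<^esub> \<otimes>\<^bsub>T\<^esub> x) k = x k" .
    qed (use x one T_closed in auto)
    show "x \<otimes>\<^bsub>T\<^esub> \<one>\<^bsub>T\<^esub> = x"
    proof (rule T_ext)
      fix k assume k: "k \<in> carrier G"
      have "(x \<otimes>\<^bsub>T\<^esub> \<one>\<^bsub>T\<^esub>) k = (\<Sum>g\<in>carrier G. x g \<odot>\<odot> act g (elem (word_tensor []) \<one> (inv g \<otimes> k)))"
        using k x one by (simp add: T_mult_apply) (simp add: T_one)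
      also have "\<dots> = (\<Sum>g\<in>carrier G. if k = g then x k else 0)"
        using k
        by (intro sum.cong) (auto simp: elem_apply tensor_action_one inv_mult_eq_iff)
      also have "\<dots> = x k" using finite_G k by simp
      finally show "(x \<otimes>\<^bsub>T\<^esub> \<one>\<^bsub>T\<^esub>) k = x k" .
    qed (use x one T_closed in auto)
  qed (auto simp: T_closed T_mult_assoc)
  fix x y z assume xyz: "x \<in> carrier T" "y \<in> carrier T" "z \<in> carrier T"
  show "(x \<oplus>\<^bsub>T\<^esub> y) \<otimes>\<^bsub>T\<^esub> z = x \<otimes>\<^bsub>T\<^esub> z \<oplus>\<^bsub>T\<^esub> y \<otimes>\<^bsub>T\<^esub> z"
    using xyz
    by (intro T_ext) (simp_all add: T_closed T_mult_apply T_add_apply tensor_mult_add_left sum.distrib)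
  show "z \<otimes>\<^bsub>T\<^esub> (x \<oplus>\<^bsub>T\<^esub> y) = z \<otimes>\<^bsub>T\<^esub> x \<oplus>\<^bsub>T\<^esub> z \<otimes>\<^bsub>T\<^esub> y"
    using xyz
    by (intro T_ext) (simp_all add: T_closed T_mult_apply T_add_apply tensor_action_add
        tensor_mult_add_right sum.distrib)
qed

end

sublocale finite_group_rep \<subseteq> T: ring "tensor_skew G \<rho>"
  by (rule ring_T)

section \<open>Induction principles for T(V) # G and the Hecke ideal\<close>

context finite_group_rep
begin

lemma T_finsum:
  assumes "\<And>i. i \<in> I \<Longrightarrow> f i \<in> carrier T" "k \<in> carrier G"
  shows "finsum T f I k = (\<Sum>i\<in>I. f i k)"
  using assms
proof (induction I rule: infinite_finite_induct)
  case (insert i I)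
  then show ?case
    by (subst T.finsum_insert) (auto simp: T_add_apply Pi_def)
qed (simp_all add: T.finsum_infinite T_zero)

lemma T_a_inv_apply:
  assumes "x \<in> carrier T" "k \<in> carrier G"
  shows "(\<ominus>\<^bsub>T\<^esub> x) k = - x k"
proof -
  have "(\<ominus>\<^bsub>T\<^esub> x \<oplus>\<^bsub>T\<^esub> x) k = 0"
    using assms by (simp add: T.l_neg) (simp add: T_zero)
  then show ?thesis using assms by (simp add: T_add_apply eq_neg_iff_add_eq_0)
qed

lemma T_minus_apply:
  assumes "x \<in> carrier T" "y \<in> carrier T" "k \<in> carrier G"
  shows "(x \<ominus>\<^bsub>T\<^esub> y) k = x k - y k"
  using assms by (simp add: a_minus_def T_add_apply T_a_inv_apply)

lemma elem_add: "elem (s + t) g = elem s g \<oplus>\<^bsub>T\<^esub> elem t g"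
  by (auto simp: skew_elem_def T_add fun_eq_iff)

lemma elem_zero: "elem 0 g = \<zero>\<^bsub>T\<^esub>"
  by (auto simp: skew_elem_def T_zero fun_eq_iff)

lemma elem_scale: "elem (tensor_scale c t) g = c \<odot>\<^bsub>T\<^esub> elem t g"
  by (auto simp: skew_elem_def T_smult fun_eq_iff tensor_scale_def)

text \<open>Scalars act as left multiplication by multiples of the unit, so every ideal of the ring
  is closed under scalar multiplication.\<close>

lemma smult_eq_mult:
  assumes "x \<in> carrier T"
  shows "c \<odot>\<^bsub>T\<^esub> x = elem (tensor_scale c (word_tensor [])) \<one> \<otimes>\<^bsub>T\<^esub> x"
proof (rule T_ext)
  let ?e = "elem (tensor_scale c (word_tensor [])) \<one>"
  fix k assume k: "k \<in> carrier G"
  have "(?e \<otimes>\<^bsub>T\<^esub> x) k = (\<Sum>g\<in>carrier G. if \<one> = g then tensor_scale c (x k) else 0)"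
    using k assms
    by (subst T_mult_apply) (auto intro!: sum.cong elem_closed finite_support_scale
        simp: elem_apply act_one tensor_mult_scale_left)
  also have "\<dots> = tensor_scale c (x k)" using finite_G by simp
  finally show "(c \<odot>\<^bsub>T\<^esub> x) k = (?e \<otimes>\<^bsub>T\<^esub> x) k" using k by (simp add: T_smult)
qed (use assms in \<open>auto intro!: T_closed T_smult_closed elem_closed finite_support_scale\<close>)

text \<open>Only the components of the given \<open>x\<close> have to be treated, so properties of
  \<open>x\<close> such as homogeneity remain available in the case \<open>elem\<close>.\<close>

lemma T_components_induct:
  assumes x: "x \<in> carrier T"
    and zero: "P \<zero>\<^bsub>T\<^esub>"
    and elem: "\<And>g. g \<in> carrier G \<Longrightarrow> P (elem (x g) g)"
    and add: "\<And>x y. x \<in> carrier T \<Longrightarrow> y \<in> carrier T \<Longrightarrow> P x \<Longrightarrow> P y \<Longrightarrow> P (x \<oplus>\<^bsub>T\<^esub> y)"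
  shows "P x"
proof -
  define y where "y K = (\<lambda>g\<in>carrier G. if g \<in> K then x g else 0)" for K
  have "finite K \<Longrightarrow> K \<subseteq> carrier G \<Longrightarrow> P (y K)" for K
  proof (induction K rule: finite_induct)
    case empty
    have "y {} = \<zero>\<^bsub>T\<^esub>" by (auto simp: y_def T_zero fun_eq_iff restrict_def)
    then show ?case using zero by simp
  next
    case (insert g K)
    have "y (insert g K) = y K \<oplus>\<^bsub>T\<^esub> elem (x g) g"
      using insert.hyps by (auto simp: y_def T_add elem_apply restrict_def fun_eq_iff)
    moreover have "y K \<in> carrier T" "finite_support (x g)"
      using x insert.prems by (auto simp: y_def carrier_T)
    ultimately show ?case
      using insert assms(3) add elem_closed by auto
  qed
  from this[OF finite_G] have "P (y (carrier G))" by simp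
  moreover have "y (carrier G) = x"
    using x by (auto simp: y_def carrier_T restrict_def fun_eq_iff extensional_def)
  ultimately show ?thesis by simp
qed

lemma T_induct [consumes 1, case_names zero elem add]:
  assumes x: "x \<in> carrier T"
    and zero: "P \<zero>\<^bsub>T\<^esub>"
    and elem: "\<And>c w g. g \<in> carrier G \<Longrightarrow> P (elem (tensor_scale c (word_tensor w)) g)"
    and add: "\<And>x y. x \<in> carrier T \<Longrightarrow> y \<in> carrier T \<Longrightarrow> P x \<Longrightarrow> P y \<Longrightarrow> P (x \<oplus>\<^bsub>T\<^esub> y)"
  shows "P x"
  using x zero _ add
proof (rule T_components_induct)
  fix g assume g: "g \<in> carrier G"
  have "finite_support (x g)" using x g by (rule carrier_T_support)
  then show "P (local.elem (x g) g)"
  proof (induction rule: tensor_induct)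
    case zero
    then show ?case using assms(2) by (metis elem_zero)
  next
    case (word c w)
    then show ?case using elem g by blast
  next
    case (add s t)
    then show ?case using assms(4) elem_closed elem_add by metis
  qed
qed

lemma hecke_relation_eq:
  "hecke_relation G \<rho> a v w =
     (\<lambda>k\<in>carrier G. (if k = \<one> then tensor_of_vectors [v, w] - tensor_of_vectors [w, v] else 0)
        - tensor_scale (a k v w) (word_tensor []))"
proof (rule T_ext)
  have vec: "hecke_vec G v \<otimes>\<^bsub>T\<^esub> hecke_vec G w = elem (tensor_of_vectors [v, w]) \<one>" for v w
    by (simp add: hecke_vec_def elem_mult act_one)
      (simp add: tensor_incl_eq elem_mult act_one flip: tensor_of_vectors_append)
  have sm: "a g v w \<odot>\<^bsub>T\<^esub> hecke_grp G g \<in> carrier T" for g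
    by (simp add: hecke_grp_def T_smult_closed elem_closed)
  show "hecke_relation G \<rho> a v w \<in> carrier T"
    by (simp add: hecke_relation_def Let_def vec elem_closed sm T.finsum_closed)
  show "(\<lambda>k\<in>carrier G. (if k = \<one> then tensor_of_vectors [v, w] - tensor_of_vectors [w, v] else 0)
        - tensor_scale (a k v w) (word_tensor [])) \<in> carrier T"
    unfolding carrier_T by (auto intro!: finite_support_diff finite_support_uminus finite_support_scale)
  fix k assume k: "k \<in> carrier G"
  have "(\<Oplus>\<^bsub>T\<^esub>g\<in>carrier G. a g v w \<odot>\<^bsub>T\<^esub> hecke_grp G g) k =
      (\<Sum>g\<in>carrier G. if k = g then tensor_scale (a k v w) (word_tensor []) else 0)"
    using k sm by (subst T_finsum)
      (auto intro!: sum.cong simp: hecke_grp_def T_smult_apply elem_apply tensor_scale_zero)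
  also have "\<dots> = tensor_scale (a k v w) (word_tensor [])"
    using finite_G k by simp
  finally show "hecke_relation G \<rho> a v w k = (\<lambda>k\<in>carrier G.
      (if k = \<one> then tensor_of_vectors [v, w] - tensor_of_vectors [w, v] else 0)
        - tensor_scale (a k v w) (word_tensor [])) k"
    using k by (simp add: hecke_relation_def Let_def vec elem_closed sm T.finsum_closed T_minus_apply elem_apply)
qed

lemma hecke_relation_closed: "hecke_relation G \<rho> a v w \<in> carrier T"
  unfolding hecke_relation_eq carrier_T
  by (auto intro!: finite_support_diff finite_support_uminus finite_support_scale)

lemma hecke_ideal: "ideal (hecke_ideal G \<rho> a) T"
  unfolding hecke_ideal_def using hecke_relation_closed by (intro T.genideal_ideal) blast

lemma hecke_relation_in_ideal: "hecke_relation G \<rho> a v w \<in> hecke_ideal G \<rho> a"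
  unfolding hecke_ideal_def using hecke_relation_closed
  by (intro set_mp[OF T.genideal_self]) auto

text \<open>Words with scalar coefficients generate the skew group algebra additively, so
  \<open>L\<close> has to be tested only on relations placed between two of them. The scalars
  \<open>c\<close> and \<open>d\<close> are kept in the test elements, which is why additivity of
  \<open>L\<close> suffices.\<close>

lemma hecke_ideal_kernel:
  fixes L :: "('g \<Rightarrow> 'n list \<Rightarrow> complex) \<Rightarrow> complex"
  assumes L_add: "\<And>x y. x \<in> carrier T \<Longrightarrow> y \<in> carrier T \<Longrightarrow> L (x \<oplus>\<^bsub>T\<^esub> y) = L x + L y"
    and rel: "\<And>c d v w s g t h. g \<in> carrier G \<Longrightarrow> h \<in> carrier G \<Longrightarrow>
      L (elem (tensor_scale c (word_tensor s)) g \<otimes>\<^bsub>T\<^esub> hecke_relation G \<rho> a v w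
         \<otimes>\<^bsub>T\<^esub> elem (tensor_scale d (word_tensor t)) h) = 0"
    and x: "x \<in> hecke_ideal G \<rho> a"
  shows "L x = 0"
proof (rule T.genideal_kernel[OF L_add _ _ x[unfolded hecke_ideal_def]])
  have L_zero: "L \<zero>\<^bsub>T\<^esub> = 0"
    using L_add[of "\<zero>\<^bsub>T\<^esub>" "\<zero>\<^bsub>T\<^esub>"] by simp
  fix p r q assume p: "p \<in> carrier T" and q: "q \<in> carrier T"
    and "r \<in> {hecke_relation G \<rho> a v w | v w. True}"
  then obtain v w where r: "r = hecke_relation G \<rho> a v w" by blast
  have r_closed: "r \<in> carrier T" by (simp add: r hecke_relation_closed)
  show "L (p \<otimes>\<^bsub>T\<^esub> r \<otimes>\<^bsub>T\<^esub> q) = 0"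
    using p
  proof (induction p rule: T_induct)
    case (elem c s g)
    have e: "local.elem (tensor_scale c (word_tensor s)) g \<in> carrier T" for c s g
      by (auto intro!: elem_closed finite_support_scale)
    show ?case
      using q
    proof (induction q rule: T_induct)
      case (elem d t h)
      then show ?case using rel \<open>g \<in> carrier G\<close> by (simp add: r)
    qed (simp_all add: L_zero T.r_distr L_add r_closed e)
  qed (simp_all add: L_zero T.l_distr L_add r_closed q)
qed (use hecke_relation_closed in auto)

end

section \<open>The symmetric algebra relations\<close>

lemmas fun_apply_simps = zero_fun_apply plus_fun_apply minus_apply uminus_apply

lemma tensor_mult_diff_left: "(s - s') \<odot>\<odot> t = s \<odot>\<odot> t - s' \<odot>\<odot> t"
  by (simp add: tensor_mult_def fun_eq_iff left_diff_distrib sum_subtractf)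

lemma tensor_mult_diff_right: "s \<odot>\<odot> (t - t') = s \<odot>\<odot> t - s \<odot>\<odot> t'"
  by (simp add: tensor_mult_def fun_eq_iff right_diff_distrib sum_subtractf)

text \<open>Induction over tensors that keeps a property of the supporting words, typically their
  length. In a sum the supports of the summands are not controlled by that of the sum, so plain
  induction would lose the property.\<close>

lemma tensor_induct_on [consumes 2, case_names zero word add]:
  fixes t :: "'n list \<Rightarrow> complex"
  assumes t: "finite_support t" and S: "\<forall>w. t w \<noteq> 0 \<longrightarrow> S w"
    and zero: "P 0"
    and word: "\<And>c w. S w \<Longrightarrow> P (tensor_scale c (word_tensor w))"
    and add: "\<And>s t. finite_support s \<Longrightarrow> finite_support t \<Longrightarrow> P s \<Longrightarrow> P t \<Longrightarrow> P (s + t)"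
  shows "P t"
proof -
  \<comment> \<open>Truncation to the words in \<open>S\<close> is additive and fixes
    \<open>t\<close>, so the unrestricted induction can be run for \<open>P\<close> of the truncated
    tensor.\<close>
  define res :: "('n list \<Rightarrow> complex) \<Rightarrow> 'n list \<Rightarrow> complex" where "res t = (\<lambda>w. if S w then t w else 0)" for t
  have res_add: "res (s + t) = res s + res t" for s t
    by (auto simp: res_def fun_eq_iff)
  have res_fin: "finite_support (res t)" if "finite_support t" for t
    using that unfolding finite_support_def res_def by (rule rev_finite_subset) auto
  have "P (res t)"
    using t
  proof (induction t rule: tensor_induct)
    case zero
    then show ?case using assms(3) by (simp add: res_def zero_fun_def)
  next
    case (word c w)
    have "res (tensor_scale c (word_tensor w)) = (if S w then tensor_scale c (word_tensor w) else 0)"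
      by (auto simp: res_def tensor_scale_def word_tensor_def fun_eq_iff)
    then show ?case using assms(3,4) by simp
  next
    case (add s t)
    then show ?case using assms(5) by (simp only: res_add res_fin)
  qed
  moreover have "res t = t" using S by (auto simp: res_def fun_eq_iff)
  ultimately show ?thesis by simp
qed

text \<open>\<open>Q\<close> is the side condition under which \<open>P\<close> is known to be
  additive; it is instantiated with finite support.\<close>

lemma sum_closed_induct:
  assumes "finite I" "P 0" "\<And>i. i \<in> I \<Longrightarrow> Q (f i) \<and> P (f i)"
    and "\<And>s t. Q s \<Longrightarrow> Q t \<Longrightarrow> P s \<Longrightarrow> P t \<Longrightarrow> P (s + t)" "\<And>s t. Q s \<Longrightarrow> Q t \<Longrightarrow> Q (s + t)" "Q 0"
  shows "P (sum f I)"
proof -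
  have "J \<subseteq> I \<longrightarrow> Q (sum f J) \<and> P (sum f J)" if "finite J" for J
    using that
  proof (rule finite_induct)
    show "{} \<subseteq> I \<longrightarrow> Q (sum f {}) \<and> P (sum f {})"
      using assms by (metis sum.empty)
    fix i J
    assume "finite J" "i \<notin> J" and IH: "J \<subseteq> I \<longrightarrow> Q (sum f J) \<and> P (sum f J)"
    have "sum f (insert i J) = f i + sum f J"
      using \<open>finite J\<close> \<open>i \<notin> J\<close> by (rule sum.insert)
    then show "insert i J \<subseteq> I \<longrightarrow> Q (sum f (insert i J)) \<and> P (sum f (insert i J))"
      using IH assms by (metis insert_subset)
  qed
  then show ?thesis using assms(1) by blast
qed

text \<open>Exchanges of neighbours connect any two arrangements of a multiset: the first letter of
  \<open>w\<close> is moved to its place in the other word, and the rest is treated behind a growing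
  prefix \<open>u\<close>.\<close>

lemma swap_connected:
  assumes refl: "\<And>w. R w w" and trans: "\<And>u v w. R u v \<Longrightarrow> R v w \<Longrightarrow> R u w"
    and swap: "\<And>u x y v. R (u @ [x, y] @ v) (u @ [y, x] @ v)"
    and "mset w = mset w'"
  shows "R w w'"
proof -
  have move: "R (u @ x # p @ q) (u @ p @ x # q)" for u x p q
  proof (induction p arbitrary: u)
    case Nil
    then show ?case by (simp add: refl)
  next
    case (Cons y p)
    have "R (u @ x # y # p @ q) (u @ y # x # p @ q)"
      using swap[of u x y "p @ q"] by simp
    moreover have "R ((u @ [y]) @ x # p @ q) ((u @ [y]) @ p @ x # q)"
      by (rule Cons.IH)
    ultimately show ?case using trans by simp
  qed
  have "R (u @ w) (u @ w')" for u
    using \<open>mset w = mset w'\<close>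
  proof (induction w arbitrary: u w')
    case Nil
    then show ?case by (simp add: refl)
  next
    case (Cons x w)
    then have "x \<in> set w'" by (metis list.set_intros(1) set_mset_mset)
    then obtain p q where w': "w' = p @ x # q" by (meson split_list)
    then have "mset w = mset (p @ q)" using Cons.prems by simp
    then have "R ((u @ [x]) @ w) ((u @ [x]) @ p @ q)" by (rule Cons.IH)
    then show ?case using trans[OF _ move[of u x p q]] w' by simp
  qed
  from this[of "[]"] show ?thesis by simp
qed

text \<open>The sum over all arrangements of \<open>M\<close> is the coefficient of the monomial
  \<open>M\<close> in the image of the tensor in the polynomial ring S(V).\<close>

definition mset_content :: "('n list \<Rightarrow> complex) \<Rightarrow> 'n multiset \<Rightarrow> complex" where
  "mset_content t M = (\<Sum>w | mset w = M. t w)"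

lemma finite_words_of_mset: "finite {w :: 'n::finite list. mset w = M}"
  by (rule finite_subset[OF _ finite_words_of_length[of "size M"]]) auto

lemma content_add: "mset_content (s + t) M = mset_content s M + mset_content t M"
  by (simp add: mset_content_def sum.distrib)

lemma content_scale: "mset_content (tensor_scale c t) M = c * mset_content t M"
  by (simp add: mset_content_def tensor_scale_def sum_distrib_left)

lemma content_word:
  "mset_content (word_tensor w :: 'n::finite list \<Rightarrow> complex) M = (if mset w = M then 1 else 0)"
  by (simp add: mset_content_def word_tensor_def finite_words_of_mset)

text \<open>A tensor with zero contents is a combination of differences of rearranged words: a
  representative of its arrangement class is subtracted from each word, and the subtracted terms
  cancel. The words \<open>w\<close> in the last assumption come from the support of
  \<open>t\<close>, so their length is under control.\<close>

lemma content_zero_induct: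
  fixes t :: "'n::finite list \<Rightarrow> complex"
  assumes t: "finite_support t" and mset_content: "\<And>M. mset_content t M = 0"
    and zero: "N 0" and add: "\<And>s t. finite_support s \<Longrightarrow> finite_support t \<Longrightarrow> N s \<Longrightarrow> N t \<Longrightarrow> N (s + t)"
    and scale: "\<And>c t. finite_support t \<Longrightarrow> N t \<Longrightarrow> N (tensor_scale c t)"
    and word: "\<And>w w'. t w \<noteq> 0 \<Longrightarrow> mset w = mset w' \<Longrightarrow> N (word_tensor w - word_tensor w')"
  shows "N t"
proof -
  define r :: "'n list \<Rightarrow> 'n list" where "r w = (SOME w'. mset w' = mset w)" for w
  have r: "mset (r w) = mset w" for w
    unfolding r_def by (rule someI[of _ w]) simp
  have r_eq: "r w = r w' \<longleftrightarrow> mset w = mset w'" for w w'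
    using r by (metis r_def)
  define f where "f w = tensor_scale (t w) (word_tensor w - word_tensor (r w))" for w
  let ?W = "{w. t w \<noteq> 0}"
  have fin: "finite ?W" using t by (simp add: finite_support_def)
  have "N (sum f ?W)"
  proof (rule sum_closed_induct[where Q = finite_support])
    fix w assume "w \<in> ?W"
    have "finite_support (word_tensor w - word_tensor (r w))"
      by (auto intro!: finite_support_diff)
    moreover have "N (word_tensor w - word_tensor (r w))"
      using word \<open>w \<in> ?W\<close> r by auto
    ultimately show "finite_support (f w) \<and> N (f w)"
      unfolding f_def using scale by (simp add: finite_support_scale)
  next
    show "N (s + t)" if "finite_support s" "finite_support t" "N s" "N t" for s t
      using that by (rule add)
    show "finite_support (s + t)" if "finite_support s" "finite_support t" for s t :: "'n list \<Rightarrow> complex"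
      using that by (rule finite_support_add)
  qed (fact fin zero finite_support_zero)+
  moreover have "sum f ?W = t"
  proof
    fix z
    have "sum f ?W z = (\<Sum>w\<in>?W. tensor_scale (t w) (word_tensor w) z) - (\<Sum>w\<in>?W. t w * word_tensor (r w) z)"
      by (simp add: sum_fun_apply f_def tensor_scale_def right_diff_distrib sum_subtractf)
    also have "(\<Sum>w\<in>?W. tensor_scale (t w) (word_tensor w) z) = t z"
      by (rule trans[OF sum_fun_apply[symmetric] fun_cong[OF tensor_expand[OF t], symmetric]])
    \<comment> \<open>At a representative the subtracted terms add up to the content of its class,
      which vanishes; at any other word there are none.\<close>
    also have "(\<Sum>w\<in>?W. t w * word_tensor (r w) z) = 0"
    proof (cases "z = r z")
      case True
      have "(\<Sum>w\<in>?W. t w * word_tensor (r w) z) = (\<Sum>w\<in>?W. if mset w = mset z then t w else 0)"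
      proof (rule sum.cong)
        fix w
        have "z = r w \<longleftrightarrow> mset w = mset z" using True r_eq[of z w] by metis
        then show "t w * word_tensor (r w) z = (if mset w = mset z then t w else 0)"
          by (simp add: word_tensor_def)
      qed simp
      also have "\<dots> = (\<Sum>w\<in>?W \<inter> {w. mset w = mset z}. t w)"
        using fin by (simp add: sum.inter_restrict)
      also have "\<dots> = mset_content t (mset z)"
        unfolding mset_content_def by (rule sum.mono_neutral_left) (auto simp: finite_words_of_mset)
      finally show ?thesis using mset_content by simp
    next
      case False
      then have "z \<noteq> r w" for w using r r_eq by metis
      then show ?thesis by (auto simp: word_tensor_def intro!: sum.neutral)
    qed
    finally show "sum f ?W z = t z" by simp
  qed
  ultimately show ?thesis by simp
qed

text \<open>Linearity is asked only on finitely supported tensors: a functional given by a sum over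
  the support takes the default value 0 on the others and is not additive there.\<close>

definition linear_functional :: "(('n list \<Rightarrow> complex) \<Rightarrow> complex) \<Rightarrow> bool" where
  "linear_functional F \<longleftrightarrow>
     (\<forall>s t. finite_support s \<longrightarrow> finite_support t \<longrightarrow> F (s + t) = F s + F t) \<and>
     (\<forall>c t. finite_support t \<longrightarrow> F (tensor_scale c t) = c * F t)"

lemma linear_functional_zero: "linear_functional F \<Longrightarrow> F 0 = 0"
  using finite_support_zero unfolding linear_functional_def
  by (metis add_cancel_right_right add.right_neutral)

lemma linear_functional_diff:
  assumes "linear_functional F" "finite_support s" "finite_support t"
  shows "F (s - t) = F s - F t"
proof -
  have "F ((s - t) + t) = F (s - t) + F t"
    using assms finite_support_diff unfolding linear_functional_def by blast
  then show ?thesis by simp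
qed

lemma linear_functional_sum:
  assumes F: "linear_functional F" and "\<And>i. i \<in> I \<Longrightarrow> finite_support (f i)"
  shows "F (sum f I) = (\<Sum>i\<in>I. F (f i))"
proof (cases "finite I")
  case True
  have "J \<subseteq> I \<longrightarrow> F (sum f J) = (\<Sum>i\<in>J. F (f i))" if "finite J" for J
    using that
  proof (rule finite_induct)
    show "{} \<subseteq> I \<longrightarrow> F (sum f {}) = (\<Sum>i\<in>{}. F (f i))"
      using linear_functional_zero[OF F] by (metis sum.empty)
    fix i J
    assume J: "finite J" "i \<notin> J" and IH: "J \<subseteq> I \<longrightarrow> F (sum f J) = (\<Sum>i\<in>J. F (f i))"
    have eq: "sum f (insert i J) = f i + sum f J" using J by (rule sum.insert)
    show "insert i J \<subseteq> I \<longrightarrow> F (sum f (insert i J)) = (\<Sum>i\<in>insert i J. F (f i))"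
    proof
      assume sub: "insert i J \<subseteq> I"
      then have "finite_support (f i)" "finite_support (sum f J)"
        using assms(2) by (auto intro!: finite_support_sum)
      then have "F (sum f (insert i J)) = F (f i) + F (sum f J)"
        unfolding eq using F by (simp add: linear_functional_def)
      then show "F (sum f (insert i J)) = (\<Sum>i\<in>insert i J. F (f i))"
        using IH sub J by simp
    qed
  qed
  then show ?thesis using True by blast
next
  case False
  then have "sum f I = 0" by (rule sum.infinite)
  then show ?thesis using False linear_functional_zero[OF F] by simp
qed

lemma tensor_pair_expand:
  fixes v w :: "complex^'n::finite"
  shows "tensor_of_vectors [v, w] =
    (\<Sum>p\<in>UNIV. tensor_scale (v $ fst p * w $ snd p) (word_tensor [fst p, snd p]))"
proof
  fix z
  have "(\<Sum>p\<in>UNIV. tensor_scale (v $ fst p * w $ snd p) (word_tensor [fst p, snd p])) z =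
      (\<Sum>p\<in>UNIV. if z = [fst p, snd p] then v $ fst p * w $ snd p else 0)"
    by (auto simp: sum_fun_apply tensor_scale_def word_tensor_def intro!: sum.cong)
  also have "\<dots> = tensor_of_vectors [v, w] z"
  proof (cases "length z = 2")
    case True
    then obtain i j where z: "z = [i, j]" by (auto simp: length_Suc_conv eval_nat_numeral)
    have "(\<Sum>p\<in>UNIV. if z = [fst p, snd p] then v $ fst p * w $ snd p else 0) =
        (\<Sum>p\<in>UNIV. if p = (i, j) then v $ i * w $ j else 0)"
      by (rule sum.cong) (auto simp: z)
    then show ?thesis by (simp add: z)
  next
    case False
    then show ?thesis by (auto simp: tensor_of_vectors_length intro!: sum.neutral)
  qed
  finally show "tensor_of_vectors [v, w] z =
    (\<Sum>p\<in>UNIV. tensor_scale (v $ fst p * w $ snd p) (word_tensor [fst p, snd p])) z" by simp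
qed

lemma linear_functional_pair:
  fixes v w :: "complex^'n::finite"
  assumes F: "linear_functional F"
  shows "F (tensor_of_vectors [v, w]) =
    (\<Sum>p\<in>UNIV. v $ fst p * w $ snd p * F (word_tensor [fst p, snd p]))"
  unfolding tensor_pair_expand
  by (subst linear_functional_sum[OF F]) (use F in \<open>auto simp: linear_functional_def\<close>)

lemma sum_swap_pair: "(\<Sum>p\<in>UNIV. f (snd p) (fst p)) = (\<Sum>p\<in>UNIV. f (fst p) (snd p))"
  by (rule sum.reindex_bij_witness[of _ prod.swap prod.swap]) auto

lemma linear_functional_content_mult:
  fixes s t :: "'n::finite list \<Rightarrow> complex"
  assumes "finite_support s" "finite_support t"
  shows "linear_functional (\<lambda>x. mset_content (s \<odot>\<odot> x \<odot>\<odot> t) M)"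
  unfolding linear_functional_def
  by (simp add: tensor_mult_add_left tensor_mult_add_right content_add tensor_mult_scale_left
      tensor_mult_scale_right content_scale)

text \<open>Expanding both vectors in the standard basis and renaming the indices reduces symmetry
  in two vectors to symmetry in two letters.\<close>

lemma linear_functional_antisym:
  fixes v w :: "complex^'n::finite"
  assumes F: "linear_functional F" and "\<And>i j. F (word_tensor [i, j]) = F (word_tensor [j, i])"
  shows "F (tensor_of_vectors [v, w]) = F (tensor_of_vectors [w, v])"
proof -
  have "F (tensor_of_vectors [v, w]) =
      (\<Sum>p\<in>UNIV. v $ fst p * w $ snd p * F (word_tensor [fst p, snd p]))"
    by (rule linear_functional_pair[OF F])
  also have "\<dots> = (\<Sum>p\<in>UNIV. v $ snd p * w $ fst p * F (word_tensor [snd p, fst p]))"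
    by (rule sum_swap_pair[symmetric])
  also have "\<dots> = (\<Sum>p\<in>UNIV. w $ fst p * v $ snd p * F (word_tensor [fst p, snd p]))"
    using assms(2) by (metis (no_types, lifting) mult.commute)
  also have "\<dots> = F (tensor_of_vectors [w, v])"
    by (rule linear_functional_pair[OF F, symmetric])
  finally show ?thesis .
qed

lemma sym_generator_eq:
  fixes v w :: "complex^'n::finite"
  shows "tensor_incl v \<otimes>\<^bsub>tensor_algebra\<^esub> tensor_incl w
      \<ominus>\<^bsub>tensor_algebra\<^esub> tensor_incl w \<otimes>\<^bsub>tensor_algebra\<^esub> tensor_incl v
    = tensor_of_vectors [v, w] - tensor_of_vectors [w, v]"
proof -
  have *: "tensor_incl v \<odot>\<odot> tensor_incl w = tensor_of_vectors [v, w]" for v w :: "complex^'n"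
    using tensor_of_vectors_append[of "[v]" "[w]"] by (simp add: tensor_incl_eq)
  show ?thesis by (simp add: * tensor_a_minus)
qed

lemma sym_ideal_alt:
  "sym_ideal = Idl\<^bsub>tensor_algebra\<^esub>
     {tensor_of_vectors [v, w] - tensor_of_vectors [w, v] | v w :: complex^'n::finite. True}"
  unfolding sym_ideal_def sym_generator_eq ..

lemma sym_generators_closed:
  "{tensor_of_vectors [v, w] - tensor_of_vectors [w, v] | v w :: complex^'n::finite. True}
    \<subseteq> carrier tensor_algebra"
  by (auto intro!: finite_support_diff)

lemma sym_ideal: "ideal (sym_ideal :: ('n::finite list \<Rightarrow> complex) set) tensor_algebra"
  unfolding sym_ideal_alt by (rule tensor.genideal_ideal[OF sym_generators_closed])

text \<open>The content of a word does not see the exchange of two neighbours, whatever stands to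
  the left and right of them; so it vanishes on all multiples of the generators.\<close>

lemma sym_ideal_content:
  fixes t :: "'n::finite list \<Rightarrow> complex"
  assumes t: "t \<in> sym_ideal"
  shows "mset_content t M = 0"
proof (rule tensor.genideal_kernel[OF _ _ sym_generators_closed t[unfolded sym_ideal_alt]])
  show "mset_content (x \<oplus>\<^bsub>tensor_algebra\<^esub> y) M = mset_content x M + mset_content y M" for x y :: "'n list \<Rightarrow> complex"
    by (simp add: content_add)
  fix p r q :: "'n list \<Rightarrow> complex"
  assume "p \<in> carrier tensor_algebra" "q \<in> carrier tensor_algebra"
    and "r \<in> {tensor_of_vectors [v, w] - tensor_of_vectors [w, v] | v w :: complex^'n. True}"
  then obtain v w where p: "finite_support p" and q: "finite_support q"
    and r: "r = tensor_of_vectors [v, w] - tensor_of_vectors [w, v]"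
    by auto
  let ?F = "\<lambda>x. mset_content (p \<odot>\<odot> x \<odot>\<odot> q) M"
  have F: "linear_functional ?F" by (rule linear_functional_content_mult[OF p q])
  have *: "?F (word_tensor [i, j]) = ?F (word_tensor [j, i])" for i j
    using p
  proof (induction p rule: tensor_induct)
    case (word c u)
    show ?case
      using q
    proof (induction q rule: tensor_induct)
      case (word d v)
      then show ?case
        by (simp add: tensor_mult_scale_left tensor_mult_scale_right content_scale word_tensor_mult
            content_word add_mset_commute)
    qed (simp_all add: tensor_mult_add_right content_add del: fun_apply_simps)
  qed (simp_all add: tensor_mult_add_left content_add del: fun_apply_simps)
  show "mset_content (p \<otimes>\<^bsub>tensor_algebra\<^esub> r \<otimes>\<^bsub>tensor_algebra\<^esub> q) M = 0"
    using linear_functional_antisym[OF F *, of v w]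
      linear_functional_diff[OF F, of "tensor_of_vectors [v, w]" "tensor_of_vectors [w, v]"]
    by (simp add: r)
qed

lemma sym_ideal_add: "s \<in> sym_ideal \<Longrightarrow> t \<in> sym_ideal \<Longrightarrow> s + t \<in> sym_ideal"
  using additive_subgroup.a_closed[OF ideal.axioms(1)[OF sym_ideal]] by fastforce

lemma sym_ideal_zero: "0 \<in> sym_ideal"
  using additive_subgroup.zero_closed[OF ideal.axioms(1)[OF sym_ideal]] by simp

lemma sym_ideal_mult:
  "finite_support s \<Longrightarrow> t \<in> sym_ideal \<Longrightarrow> s \<odot>\<odot> t \<in> sym_ideal"
  "finite_support s \<Longrightarrow> t \<in> sym_ideal \<Longrightarrow> t \<odot>\<odot> s \<in> sym_ideal"
  using ideal.I_l_closed[OF sym_ideal] ideal.I_r_closed[OF sym_ideal] by fastforce+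

lemma sym_ideal_scale:
  fixes t :: "'n::finite list \<Rightarrow> complex"
  assumes "t \<in> sym_ideal"
  shows "tensor_scale c t \<in> sym_ideal"
  using sym_ideal_mult(1)[of "tensor_scale c (word_tensor [])" t] assms
  by (simp add: tensor_mult_scale_left finite_support_scale)

lemma sym_ideal_finite_support: "t \<in> sym_ideal \<Longrightarrow> finite_support t"
  using ideal.Icarr[OF sym_ideal] by fastforce

text \<open>An exchange of neighbours is the commutator of two basis vectors multiplied by words on
  both sides.\<close>

lemma sym_ideal_words:
  assumes "mset w = mset w'"
  shows "word_tensor w - word_tensor w' \<in> sym_ideal"
proof (rule swap_connected[where R = "\<lambda>w w'. word_tensor w - word_tensor w' \<in> sym_ideal", OF _ _ _ assms])
  fix u v w :: "'a list"
  have "word_tensor w - word_tensor w = (0 :: 'a list \<Rightarrow> complex)" by (rule diff_self)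
  then show "word_tensor w - word_tensor w \<in> sym_ideal" using sym_ideal_zero by metis
  assume "word_tensor u - word_tensor v \<in> sym_ideal" "word_tensor v - word_tensor w \<in> sym_ideal"
  then have "(word_tensor u - word_tensor v) + (word_tensor v - word_tensor w) \<in> sym_ideal"
    by (rule sym_ideal_add)
  then show "word_tensor u - word_tensor w \<in> sym_ideal" by (simp only: add_diff_eq diff_add_cancel)
next
  fix u v :: "'a list" and x y :: 'a
  have "tensor_of_vectors [axis x 1, axis y 1] - tensor_of_vectors [axis y 1, axis x 1] \<in> sym_ideal"
    unfolding sym_ideal_alt by (rule set_mp[OF tensor.genideal_self[OF sym_generators_closed]]) blast
  then have "word_tensor u \<odot>\<odot> (word_tensor [x, y] - word_tensor [y, x]) \<odot>\<odot> word_tensor v \<in> sym_ideal"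
    using tensor_of_axes[of "[x, y]"] tensor_of_axes[of "[y, x]"] by (simp add: sym_ideal_mult)
  moreover have "word_tensor u \<odot>\<odot> (word_tensor [x, y] - word_tensor [y, x]) \<odot>\<odot> word_tensor v =
      word_tensor (u @ [x, y] @ v) - word_tensor (u @ [y, x] @ v)"
    by (simp add: tensor_mult_diff_left tensor_mult_diff_right word_tensor_mult del: fun_apply_simps)
  ultimately show "word_tensor (u @ [x, y] @ v) - word_tensor (u @ [y, x] @ v) \<in> sym_ideal"
    by (simp only:)
qed

text \<open>Membership in the ideal becomes a test on coefficients, one for each monomial. The
  leading term argument uses it in this form, since functionals can only detect
  coefficients.\<close>

theorem sym_ideal_iff:
  fixes t :: "'n::finite list \<Rightarrow> complex"
  shows "t \<in> sym_ideal \<longleftrightarrow> finite_support t \<and> (\<forall>M. mset_content t M = 0)"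
proof
  assume "t \<in> sym_ideal"
  then show "finite_support t \<and> (\<forall>M. mset_content t M = 0)"
    by (simp add: sym_ideal_content sym_ideal_finite_support)
next
  assume "finite_support t \<and> (\<forall>M. mset_content t M = 0)"
  then have "finite_support t" and "\<And>M. mset_content t M = 0" by auto
  then show "t \<in> sym_ideal"
  proof (rule content_zero_induct)
    show "word_tensor w - word_tensor w' \<in> sym_ideal" if "mset w = mset w'" for w w' :: "'n list"
      using that by (rule sym_ideal_words)
    show "0 \<in> (sym_ideal :: ('n list \<Rightarrow> complex) set)" by (rule sym_ideal_zero)
    show "tensor_scale c t \<in> sym_ideal" if "t \<in> sym_ideal" for c and t :: "'n list \<Rightarrow> complex"
      using that by (rule sym_ideal_scale)
    show "s + t \<in> sym_ideal" if "s \<in> sym_ideal" "t \<in> sym_ideal" for s t :: "'n list \<Rightarrow> complex"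
      using that by (rule sym_ideal_add)
  qed
qed

section \<open>A normal form functional\<close>

definition tensor_lin :: "('n list \<Rightarrow> complex) \<Rightarrow> ('n list \<Rightarrow> complex) \<Rightarrow> complex" where
  "tensor_lin F t = (\<Sum>w | t w \<noteq> 0. t w * F w)"

lemma tensor_lin_superset:
  assumes "finite W" "\<And>w. t w \<noteq> 0 \<Longrightarrow> w \<in> W"
  shows "tensor_lin F t = (\<Sum>w\<in>W. t w * F w)"
  unfolding tensor_lin_def using assms by (intro sum.mono_neutral_left) auto

lemma linear_functional_tensor_lin: "linear_functional (tensor_lin F)"
  unfolding linear_functional_def
proof (intro conjI allI impI)
  fix s t :: "'a list \<Rightarrow> complex"
  assume "finite_support s" "finite_support t"
  then have fin: "finite ({w. s w \<noteq> 0} \<union> {w. t w \<noteq> 0})" by (simp add: finite_support_def)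
  have "tensor_lin F (s + t) = (\<Sum>w\<in>{w. s w \<noteq> 0} \<union> {w. t w \<noteq> 0}. (s + t) w * F w)"
    by (rule tensor_lin_superset[OF fin]) auto
  also have "\<dots> = (\<Sum>w\<in>{w. s w \<noteq> 0} \<union> {w. t w \<noteq> 0}. s w * F w) +
      (\<Sum>w\<in>{w. s w \<noteq> 0} \<union> {w. t w \<noteq> 0}. t w * F w)"
    by (simp add: distrib_right sum.distrib)
  also have "(\<Sum>w\<in>{w. s w \<noteq> 0} \<union> {w. t w \<noteq> 0}. s w * F w) = tensor_lin F s"
    by (rule tensor_lin_superset[OF fin, symmetric]) auto
  also have "(\<Sum>w\<in>{w. s w \<noteq> 0} \<union> {w. t w \<noteq> 0}. t w * F w) = tensor_lin F t"
    by (rule tensor_lin_superset[OF fin, symmetric]) auto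
  finally show "tensor_lin F (s + t) = tensor_lin F s + tensor_lin F t" .
next
  fix c and t :: "'a list \<Rightarrow> complex"
  assume "finite_support t"
  then have "tensor_lin F (tensor_scale c t) = (\<Sum>w | t w \<noteq> 0. tensor_scale c t w * F w)"
    by (intro tensor_lin_superset) (auto simp: finite_support_def tensor_scale_def)
  then show "tensor_lin F (tensor_scale c t) = c * tensor_lin F t"
    by (simp add: tensor_lin_def tensor_scale_def sum_distrib_left mult.assoc)
qed

lemma tensor_lin_word: "tensor_lin F (word_tensor w) = F w"
proof -
  have "tensor_lin F (word_tensor w) = (\<Sum>v\<in>{w}. word_tensor w v * F v)"
    by (rule tensor_lin_superset) (auto simp: word_tensor_def split: if_splits)
  then show ?thesis by (simp add: word_tensor_def)
qed

lemmas tensor_lin_scale = linear_functional_tensor_lin[unfolded linear_functional_def, THEN conjunct2, rule_format]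
lemmas tensor_lin_sum = linear_functional_sum[OF linear_functional_tensor_lin]

text \<open>An arbitrary injection into the naturals orders the letters, as the index type carries
  no order of its own.\<close>

definition key :: "'n::finite \<Rightarrow> nat" where
  "key = (SOME f. inj f)"

lemma inj_key: "inj (key :: 'n::finite \<Rightarrow> nat)"
proof -
  obtain f :: "'n \<Rightarrow> nat" where "inj f"
    using finite_imp_inj_to_nat_seg[of "UNIV :: 'n set"] by auto
  then show ?thesis unfolding key_def by (rule someI[where P = inj])
qed

text \<open>Exchanging two adjacent letters that are in the wrong order decreases this weight.\<close>

fun word_weight :: "'n::finite list \<Rightarrow> nat" where
  "word_weight [] = 0"
| "word_weight (i # w) = key i * Suc (length w) + word_weight w"

lemma word_weight_append:
  "length v = length v' \<Longrightarrow> word_weight v < word_weight v' \<Longrightarrow> word_weight (u @ v) < word_weight (u @ v')"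
  by (induction u) auto

lemma word_weight_swap:
  assumes "key y < key x"
  shows "word_weight (u @ [y, x] @ v) < word_weight (u @ [x, y] @ v)"
proof (rule word_weight_append)
  obtain d where "key x = key y + Suc d" using assms less_iff_Suc_add by auto
  then show "word_weight ([y, x] @ v) < word_weight ([x, y] @ v)" by (simp add: algebra_simps)
qed simp

definition has_descent :: "'n::finite list \<Rightarrow> bool" where
  "has_descent w \<longleftrightarrow> (\<exists>u x y v. w = u @ [x, y] @ v \<and> key y < key x)"

text \<open>Which descent is taken is left open. That the value computed along it does not depend on
  the choice is the content of \<open>rel_holds_all\<close>.\<close>

definition some_descent :: "'n::finite list \<Rightarrow> 'n list \<times> 'n \<times> 'n \<times> 'n list" where
  "some_descent w = (SOME (u, x, y, v). w = u @ [x, y] @ v \<and> key y < key x)"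

lemma some_descent:
  assumes "has_descent w" "some_descent w = (u, x, y, v)"
  shows "w = u @ [x, y] @ v" "key y < key x"
proof -
  have "\<exists>p. case p of (u, x, y, v) \<Rightarrow> w = u @ [x, y] @ v \<and> key y < key x"
    using assms(1) by (auto simp: has_descent_def)
  from someI_ex[OF this] show "w = u @ [x, y] @ v" "key y < key x"
    using assms(2) unfolding some_descent_def[symmetric] by auto
qed

text \<open>Prepared for the termination of \<open>nf_value\<close>, with the tuple on the left as
  the case distinction delivers it.\<close>

lemma some_descent_decreasing:
  assumes "has_descent w" "(u, x, y, v) = some_descent w"
  shows "length w = length u + length v + 2 \<and> word_weight (u @ y # x # v) < word_weight w"
  using some_descent[OF assms(1) assms(2)[symmetric]] word_weight_swap[of y x u v] by simp

section \<open>Recursion along descents\<close>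

context finite_group_rep
begin

text \<open>
  The value at \<open>w \<otimes> g\<close> of a functional that is compatible with the relations
  \<open>xy - yx = \<Sum>\<^sub>h a\<^sub>h(x, y) h\<close> and equals \<open>\<beta>\<close> on words without a descent.
\<close>

function nf_value ::
  "('g \<Rightarrow> complex^'n \<Rightarrow> complex^'n \<Rightarrow> complex) \<Rightarrow> ('n list \<Rightarrow> 'g \<Rightarrow> complex) \<Rightarrow> 'n list \<Rightarrow> 'g \<Rightarrow> complex"
  where
  "nf_value a \<beta> w g = (if has_descent w then
     (case some_descent w of (u, x, y, v) \<Rightarrow>
        nf_value a \<beta> (u @ [y, x] @ v) g +
        (\<Sum>h\<in>carrier G. a h (axis x 1) (axis y 1) *
           (\<Sum>v' | length v' = length v. word_coeff (\<rho> h) v' v * nf_value a \<beta> (u @ v') (h \<otimes> g))))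
     else \<beta> w g)"
  by auto
termination
  \<comment> \<open>Length first, then weight: the exchanged word keeps its length and loses weight,
    and the words in the correction sum are two letters shorter but may have any weight.\<close>
  by (relation "measures [\<lambda>(a, \<beta>, w, g). length w, \<lambda>(a, \<beta>, w, g). word_weight w]")
    (auto dest!: some_descent_decreasing)

declare nf_value.simps [simp del]

definition nf_functional where
  "nf_functional a \<beta> g t = tensor_lin (\<lambda>w. nf_value a \<beta> w g) t"

text \<open>The value that the relation forces on the tensor s (x y - y x) t at \<open>g\<close>:
  the commutator becomes the sum of the a_h(x, y) h, and moving \<open>h\<close> to the right past
  \<open>t\<close> gives s h(t) at the group element h g.\<close>

definition commutator_term where
  "commutator_term a \<beta> s x y t g =
     (\<Sum>h\<in>carrier G. a h x y * nf_functional a \<beta> (h \<otimes> g) (s \<odot>\<odot> act h t))"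

lemma act_word: "act h (word_tensor v) =
    (\<Sum>v' | length v' = length v. tensor_scale (word_coeff (\<rho> h) v' v) (word_tensor v'))"
proof
  fix z
  have "act h (word_tensor v) z = (\<Sum>w | length w = length z. if w = v then word_coeff (\<rho> h) z v else 0)"
    unfolding tensor_action_eq by (rule sum.cong) (auto simp: word_tensor_def)
  also have "\<dots> = (if length z = length v then word_coeff (\<rho> h) z v else 0)"
    by (auto simp: finite_words_of_length)
  also have "\<dots> = (\<Sum>v' | length v' = length v. if z = v' then word_coeff (\<rho> h) z v else 0)"
    by (simp add: finite_words_of_length)
  also have "\<dots> = (\<Sum>v' | length v' = length v. tensor_scale (word_coeff (\<rho> h) v' v) (word_tensor v') z)"
    by (rule sum.cong) (auto simp: word_tensor_def tensor_scale_def)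
  finally show "act h (word_tensor v) z =
    (\<Sum>v' | length v' = length v. tensor_scale (word_coeff (\<rho> h) v' v) (word_tensor v')) z"
    by (simp add: sum_fun_apply)
qed

lemma nf_functional_word: "nf_functional a \<beta> g (word_tensor w) = nf_value a \<beta> w g"
  by (simp add: nf_functional_def tensor_lin_word)

lemma nf_functional_act_word:
  "nf_functional a \<beta> g (word_tensor u \<odot>\<odot> act h (word_tensor v)) =
     (\<Sum>v' | length v' = length v. word_coeff (\<rho> h) v' v * nf_value a \<beta> (u @ v') g)"
  unfolding act_word tensor_mult_sum_right nf_functional_def
  by (subst tensor_lin_sum)
    (auto simp: tensor_mult_scale_right word_tensor_mult tensor_lin_scale tensor_lin_word
      intro!: finite_support_scale)

lemma nf_value_descent:
  assumes "has_descent w" "some_descent w = (u, x, y, v)"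
  shows "nf_value a \<beta> w g = nf_value a \<beta> (u @ [y, x] @ v) g +
    commutator_term a \<beta> (word_tensor u) (axis x 1) (axis y 1) (word_tensor v) g"
  using assms by (subst nf_value.simps)
    (simp add: commutator_term_def nf_functional_act_word)

lemma nf_functional_linear: "linear_functional (nf_functional a \<beta> g)"
  unfolding nf_functional_def by (rule linear_functional_tensor_lin)

lemmas nf_functional_add = nf_functional_linear[unfolded linear_functional_def, THEN conjunct1, rule_format]
lemmas nf_functional_scale = nf_functional_linear[unfolded linear_functional_def, THEN conjunct2, rule_format]
lemmas nf_functional_diff = linear_functional_diff[OF nf_functional_linear]
lemmas nf_functional_zero = linear_functional_zero[OF nf_functional_linear]

definition hecke_invariant where
  "hecke_invariant a \<longleftrightarrow> (\<forall>g\<in>carrier G. \<forall>h\<in>carrier G. \<forall>v w.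
     a (inv h \<otimes> g \<otimes> h) v w = a g (\<rho> h *v v) (\<rho> h *v w))"

definition hecke_jacobi :: "('g \<Rightarrow> complex^'n \<Rightarrow> complex^'n \<Rightarrow> complex) \<Rightarrow> bool" where
  "hecke_jacobi a \<longleftrightarrow> (\<forall>g\<in>carrier G. \<forall>u v w.
     a g u v *s (\<rho> g *v w - w) + a g v w *s (\<rho> g *v u - u) + a g w u *s (\<rho> g *v v - v) = 0)"

end

lemma skew_formD:
  assumes "skew_bilinear_form b"
  shows "b (u + v) w = b u w + b v w" "b (c *s v) w = c * b v w"
    "b u (v + w) = b u v + b u w" "b v (c *s w) = c * b v w" "b w v = - b v w"
  using assms unfolding skew_bilinear_form_def by blast+

lemma skew_form_zero:
  fixes b :: "complex^'n \<Rightarrow> complex^'n \<Rightarrow> complex"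
  assumes b: "skew_bilinear_form b"
  shows "b 0 v = 0" "b v 0 = 0"
  using skew_formD(2)[OF b, of 0 0 v] skew_formD(4)[OF b, of v 0 0] by simp_all

lemma skew_form_self: "skew_bilinear_form b \<Longrightarrow> b v v = 0"
  using skew_formD(5)[of b v v] by simp

lemma skew_form_expand:
  fixes b :: "complex^'n::finite \<Rightarrow> complex^'n \<Rightarrow> complex"
  assumes b: "skew_bilinear_form b"
  shows "b v w = (\<Sum>p\<in>UNIV. v $ fst p * w $ snd p * b (axis (fst p) 1) (axis (snd p) 1))"
proof -
  have l: "b (sum f S) w = (\<Sum>i\<in>S. b (f i) w)" for f :: "'n \<Rightarrow> _" and S w
    by (induction S rule: infinite_finite_induct) (simp_all add: skew_form_zero[OF b] skew_formD(1)[OF b])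
  have r: "b v (sum f S) = (\<Sum>i\<in>S. b v (f i))" for f :: "'n \<Rightarrow> _" and S v
    by (induction S rule: infinite_finite_induct) (simp_all add: skew_form_zero[OF b] skew_formD(3)[OF b])
  have "b v w = b (\<Sum>i\<in>UNIV. v $ i *s axis i 1) (\<Sum>j\<in>UNIV. w $ j *s axis j 1)"
    by (simp add: basis_expansion)
  also have "\<dots> = (\<Sum>i\<in>UNIV. \<Sum>j\<in>UNIV. v $ i * w $ j * b (axis i 1) (axis j 1))"
    unfolding l r by (subst sum.swap) (simp add: skew_formD(1-4)[OF b] sum_distrib_left mult_ac)
  also have "\<dots> = (\<Sum>p\<in>UNIV. v $ fst p * w $ snd p * b (axis (fst p) 1) (axis (snd p) 1))"
    unfolding sum.cartesian_product UNIV_Times_UNIV by (rule sum.cong) auto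
  finally show ?thesis .
qed

section \<open>Compatibility of the functional with the relations\<close>

locale hecke_data = finite_group_rep +
  fixes a :: "'a \<Rightarrow> complex^'c \<Rightarrow> complex^'c \<Rightarrow> complex"
    and \<beta> :: "'c list \<Rightarrow> 'a \<Rightarrow> complex"
  assumes forms: "form_family G a"
begin

abbreviation L where "L \<equiv> nf_functional a \<beta>"
abbreviation "ct \<equiv> commutator_term a \<beta>"

lemma skew_form: "g \<in> carrier G \<Longrightarrow> skew_bilinear_form (a g)"
  using forms by (simp add: form_family_def)

lemmas form = skew_formD(1-4)[OF skew_form]
lemmas form_skew = skew_formD(5)[OF skew_form]
lemmas form_self = skew_form_self[OF skew_form]
lemmas form_expand = skew_form_expand[OF skew_form]

text \<open>\<open>k\<close> counts all letters, the exchanged pair included. The identity is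
  demanded at every position, whereas the recursion grants it only at the selected descent.\<close>

definition rel_holds :: "nat \<Rightarrow> bool" where
  "rel_holds k \<longleftrightarrow> (\<forall>u x y v g. length u + length v + 2 = k \<longrightarrow> g \<in> carrier G \<longrightarrow>
     L g (word_tensor (u @ [x, y] @ v)) - L g (word_tensor (u @ [y, x] @ v)) =
     ct (word_tensor u) (axis x 1) (axis y 1) (word_tensor v) g)"

lemma ct_pair:
  assumes "finite_support s" "finite_support t"
  shows "ct s v w t g = (\<Sum>p\<in>UNIV. v $ fst p * w $ snd p * ct s (axis (fst p) 1) (axis (snd p) 1) t g)"
proof -
  have "ct s v w t g = (\<Sum>h\<in>carrier G. (\<Sum>p\<in>UNIV. v $ fst p * w $ snd p *
      a h (axis (fst p) 1) (axis (snd p) 1)) * L (h \<otimes> g) (s \<odot>\<odot> act h t))"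
    unfolding commutator_term_def by (rule sum.cong) (simp_all flip: form_expand)
  also have "\<dots> = (\<Sum>p\<in>UNIV. v $ fst p * w $ snd p * ct s (axis (fst p) 1) (axis (snd p) 1) t g)"
    unfolding commutator_term_def sum_distrib_left sum_distrib_right
    by (subst sum.swap) (simp add: mult.assoc)
  finally show ?thesis .
qed

text \<open>Multilinear extension from basis letters to vectors and from words to homogeneous
  tensors. It is needed as soon as a group element passes over letters and turns them into vectors;
  homogeneity of \<open>s\<close> and \<open>t\<close> keeps the total length at
  \<open>k\<close>.\<close>

lemma rel_holds_tensor:
  assumes k: "rel_holds k" "i + j + 2 = k" and g: "g \<in> carrier G"
    and s: "finite_support s" "\<forall>w. s w \<noteq> 0 \<longrightarrow> length w = i"
    and t: "finite_support t" "\<forall>w. t w \<noteq> 0 \<longrightarrow> length w = j"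
  shows "L g (s \<odot>\<odot> (tensor_of_vectors [x, y] - tensor_of_vectors [y, x]) \<odot>\<odot> t) = ct s x y t g"
proof -
  define b where "b p = word_tensor [fst p, snd p] - (word_tensor [snd p, fst p] :: 'c list \<Rightarrow> complex)" for p
  have b_fin: "finite_support (b p)" for p unfolding b_def by (intro finite_support_diff) simp_all
  have word: "L g (s \<odot>\<odot> b p \<odot>\<odot> t) = ct s (axis (fst p) 1) (axis (snd p) 1) t g" for p
    using s
  proof (induction s rule: tensor_induct_on)
    case zero
    show ?case by (simp add: nf_functional_zero commutator_term_def del: fun_apply_simps)
  next
    case (add s s')
    then show ?case
      using t b_fin
      by (simp add: tensor_mult_add_left nf_functional_add finite_support_mult finite_support_action
          commutator_term_def distrib_left sum.distrib del: fun_apply_simps)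
  next
    case (word c u)
    show ?case
      using t
    proof (induction t rule: tensor_induct_on)
      case zero
      show ?case by (simp add: nf_functional_zero commutator_term_def del: fun_apply_simps)
    next
      case (add t t')
      then show ?case
        using b_fin
        by (simp add: tensor_mult_add_right tensor_action_add nf_functional_add finite_support_mult finite_support_action
            finite_support_scale commutator_term_def distrib_left sum.distrib del: fun_apply_simps)
    next
      case (word d v)
      have "word_tensor u \<odot>\<odot> b p \<odot>\<odot> word_tensor v =
          word_tensor (u @ [fst p, snd p] @ v) - word_tensor (u @ [snd p, fst p] @ v)"
        unfolding b_def
        by (simp add: tensor_mult_diff_left tensor_mult_diff_right word_tensor_mult del: fun_apply_simps)
      then have "L g (word_tensor u \<odot>\<odot> b p \<odot>\<odot> word_tensor v) =
          ct (word_tensor u) (axis (fst p) 1) (axis (snd p) 1) (word_tensor v) g"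
        using k g \<open>length u = i\<close> \<open>length v = j\<close>
        by (simp add: rel_holds_def nf_functional_diff del: fun_apply_simps append_Cons append_Nil)
      then show ?case
        using b_fin
        by (simp add: tensor_mult_scale_left tensor_mult_scale_right nf_functional_scale tensor_action_scale
            finite_support_mult finite_support_action finite_support_scale commutator_term_def
            sum_distrib_left mult_ac del: fun_apply_simps)
    qed
  qed
  have F: "linear_functional (\<lambda>z. L g (s \<odot>\<odot> z \<odot>\<odot> t))"
    unfolding linear_functional_def using s t
    by (simp add: tensor_mult_add_right tensor_mult_add_left tensor_mult_scale_left
        tensor_mult_scale_right nf_functional_add nf_functional_scale finite_support_mult)
  have "L g (s \<odot>\<odot> (tensor_of_vectors [x, y] - tensor_of_vectors [y, x]) \<odot>\<odot> t) =
      (\<Sum>p\<in>UNIV. x $ fst p * y $ snd p * L g (s \<odot>\<odot> word_tensor [fst p, snd p] \<odot>\<odot> t)) -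
      (\<Sum>p\<in>UNIV. x $ fst p * y $ snd p * L g (s \<odot>\<odot> word_tensor [snd p, fst p] \<odot>\<odot> t))"
    unfolding linear_functional_diff[OF F finite_support_vectors finite_support_vectors]
      linear_functional_pair[OF F]
    by (subst (2) sum_swap_pair[symmetric]) (simp add: mult_ac)
  also have "\<dots> = (\<Sum>p\<in>UNIV. x $ fst p * y $ snd p * L g (s \<odot>\<odot> b p \<odot>\<odot> t))"
    unfolding b_def linear_functional_diff[OF F finite_support_word finite_support_word]
    by (simp add: right_diff_distrib sum_subtractf)
  also have "\<dots> = ct s x y t g"
    unfolding word by (rule ct_pair[OF s(1) t(1), symmetric])
  finally show ?thesis .
qed

end

lemma tensor_action_diff: "tensor_action M (s - t) = tensor_action M s - tensor_action M t"
  by (simp add: tensor_action_eq fun_eq_iff right_diff_distrib sum_subtractf)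

section \<open>Conjugation and two-sided products\<close>

context finite_group_rep
begin

lemma hecke_invariant_conj:
  assumes "hecke_invariant a" "h \<in> carrier G" "l \<in> carrier G"
  shows "a (h \<otimes> l \<otimes> inv h) (\<rho> h *v v) (\<rho> h *v w) = a l v w"
proof -
  have "a (inv h \<otimes> (h \<otimes> l \<otimes> inv h) \<otimes> h) v w = a (h \<otimes> l \<otimes> inv h) (\<rho> h *v v) (\<rho> h *v w)"
    using assms unfolding hecke_invariant_def by simp
  moreover have "inv h \<otimes> (h \<otimes> l \<otimes> inv h) \<otimes> h = inv h \<otimes> h \<otimes> l \<otimes> (inv h \<otimes> h)"
    using assms(2,3) by (simp only: m_assoc m_closed inv_closed)
  ultimately show ?thesis using assms(2,3) by simp
qed

lemma conj_reindex:
  assumes h: "h \<in> carrier G"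
  shows "(\<Sum>k\<in>carrier G. f k) = (\<Sum>l\<in>carrier G. f (h \<otimes> l \<otimes> inv h))"
proof (rule sum.reindex_bij_witness[of _ "\<lambda>l. h \<otimes> l \<otimes> inv h" "\<lambda>k. inv h \<otimes> k \<otimes> h"])
  fix k assume k: "k \<in> carrier G"
  have "h \<otimes> (inv h \<otimes> k \<otimes> h) \<otimes> inv h = h \<otimes> inv h \<otimes> k \<otimes> (h \<otimes> inv h)"
    using h k by (simp only: m_assoc m_closed inv_closed)
  then show *: "h \<otimes> (inv h \<otimes> k \<otimes> h) \<otimes> inv h = k" using h k by simp
  then show "f (h \<otimes> (inv h \<otimes> k \<otimes> h) \<otimes> inv h) = f k" by simp
  have "inv h \<otimes> (h \<otimes> k \<otimes> inv h) \<otimes> h = inv h \<otimes> h \<otimes> k \<otimes> (inv h \<otimes> h)"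
    using h k by (simp only: m_assoc m_closed inv_closed)
  then show "inv h \<otimes> (h \<otimes> k \<otimes> inv h) \<otimes> h = k" using h k by simp
qed (use h in simp_all)

lemma elem_mult_left:
  assumes "g \<in> carrier G" "k \<in> carrier G" "finite_support s" "x \<in> carrier T"
  shows "(elem s g \<otimes>\<^bsub>T\<^esub> x) k = s \<odot>\<odot> act g (x (inv g \<otimes> k))"
proof -
  have "(elem s g \<otimes>\<^bsub>T\<^esub> x) k =
      (\<Sum>g'\<in>carrier G. if g = g' then s \<odot>\<odot> act g (x (inv g \<otimes> k)) else 0)"
    using assms by (subst T_mult_apply) (auto simp: elem_closed elem_apply intro!: sum.cong)
  also have "\<dots> = s \<odot>\<odot> act g (x (inv g \<otimes> k))"
    using assms finite_G by simp
  finally show ?thesis .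
qed

lemma elem_mult_right:
  assumes "h \<in> carrier G" "k \<in> carrier G" "finite_support t" "x \<in> carrier T"
  shows "(x \<otimes>\<^bsub>T\<^esub> elem t h) k = x (k \<otimes> inv h) \<odot>\<odot> act (k \<otimes> inv h) t"
proof -
  have "(x \<otimes>\<^bsub>T\<^esub> elem t h) k =
      (\<Sum>g'\<in>carrier G. if k \<otimes> inv h = g' then x (k \<otimes> inv h) \<odot>\<odot> act (k \<otimes> inv h) t else 0)"
  proof (subst T_mult_apply)
    have eq: "inv g' \<otimes> k = h \<longleftrightarrow> k \<otimes> inv h = g'" if "g' \<in> carrier G" for g'
      using assms(1,2) that by (metis inv_mult_eq_iff inv_solve_right)
    show "(\<Sum>g\<in>carrier G. x g \<odot>\<odot> act g (local.elem t h (inv g \<otimes> k))) =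
      (\<Sum>g'\<in>carrier G. if k \<otimes> inv h = g' then x (k \<otimes> inv h) \<odot>\<odot> act (k \<otimes> inv h) t else 0)"
      using assms eq by (intro sum.cong) (auto simp: elem_apply)
  qed (use assms in \<open>auto simp: elem_closed\<close>)
  also have "\<dots> = x (k \<otimes> inv h) \<odot>\<odot> act (k \<otimes> inv h) t"
    using assms finite_G by simp
  finally show ?thesis .
qed

text \<open>Every group element is \<open>g1\<close> l \<open>g2\<close> for exactly one l, and at
  that place the two-sided product sees only the component of \<open>x\<close> at l.\<close>

lemma sandwich_apply:
  assumes "g1 \<in> carrier G" "g2 \<in> carrier G" "l \<in> carrier G"
    "finite_support s" "finite_support t" "x \<in> carrier T"
  shows "(elem s g1 \<otimes>\<^bsub>T\<^esub> x \<otimes>\<^bsub>T\<^esub> elem t g2) (g1 \<otimes> l \<otimes> g2) =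
    s \<odot>\<odot> act g1 (x l) \<odot>\<odot> act (g1 \<otimes> l) t"
proof -
  have "g1 \<otimes> l \<otimes> g2 \<otimes> inv g2 = g1 \<otimes> l" and "inv g1 \<otimes> (g1 \<otimes> l) = l"
    using assms by (simp_all add: inv_mult_eq_iff) (simp add: m_assoc)
  then show ?thesis
    using assms by (simp add: elem_mult_right elem_mult_left T_closed elem_closed)
qed

end

section \<open>Resolving disjoint and overlapping descents\<close>

context hecke_data
begin

lemma ct_diff_right:
  assumes "finite_support s" "finite_support t" "finite_support t'"
  shows "ct s x y (t - t') g = ct s x y t g - ct s x y t' g"
  using assms unfolding commutator_term_def
  by (simp add: tensor_action_diff tensor_mult_diff_right nf_functional_diff finite_support_mult
      finite_support_action right_diff_distrib sum_subtractf del: fun_apply_simps)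

lemma ct_diff_left:
  assumes "finite_support s" "finite_support s'" "finite_support t"
  shows "ct (s - s') x y t g = ct s x y t g - ct s' x y t g"
  using assms unfolding commutator_term_def
  by (simp add: tensor_mult_diff_left nf_functional_diff finite_support_mult
      finite_support_action right_diff_distrib sum_subtractf del: fun_apply_simps)

lemma ct_skew: "ct s y x t g = - ct s x y t g"
  unfolding commutator_term_def sum_negf[symmetric]
  by (rule sum.cong) (simp_all add: form_skew[of _ y x])

text \<open>Two commutators at disjoint places can be replaced by group elements in either order.
  Both sides become the double sum of a_h(x, y) a_l(x', y') over h and l, taken at the group element
  h l g. If h is produced first, it passes over x' and y', and invariance restores the factor
  a_l(x', y').\<close>

lemma ct_commute:
  assumes inv: "hecke_invariant a" and k: "rel_holds k" "length u + length m + length v + 2 = k"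
    and g: "g \<in> carrier G"
  shows "ct (word_tensor u) x y
      (word_tensor m \<odot>\<odot> (tensor_of_vectors [x', y'] - tensor_of_vectors [y', x']) \<odot>\<odot> word_tensor v) g =
    ct (word_tensor u \<odot>\<odot> (tensor_of_vectors [x, y] - tensor_of_vectors [y, x]) \<odot>\<odot> word_tensor m) x' y'
      (word_tensor v) g"
proof -
  define s t r where "s = (word_tensor u :: 'c list \<Rightarrow> complex)"
    and "t = (word_tensor v :: 'c list \<Rightarrow> complex)" and "r = (word_tensor m :: 'c list \<Rightarrow> complex)"
  have fin: "finite_support s" "finite_support t" "finite_support r"
    by (simp_all add: s_def t_def r_def)
  have len: "s w \<noteq> 0 \<Longrightarrow> length w = length u" "t w \<noteq> 0 \<Longrightarrow> length w = length v"
    "r w \<noteq> 0 \<Longrightarrow> length w = length m" for w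
    by (auto simp: s_def t_def r_def word_tensor_def split: if_splits)
  have mult_len: "(p \<odot>\<odot> q) w \<noteq> 0 \<Longrightarrow> length w = i + j"
    if "\<And>w. p w \<noteq> 0 \<Longrightarrow> length w = i" "\<And>w. q w \<noteq> 0 \<Longrightarrow> length w = j"
    for p q :: "'c list \<Rightarrow> complex" and w i j
  proof -
    assume "(p \<odot>\<odot> q) w \<noteq> 0"
    then obtain n where n: "n \<in> {..length w}" "p (take n w) * q (drop n w) \<noteq> 0"
      unfolding tensor_mult_def by (rule sum.not_neutral_contains_not_neutral)
    then show "length w = i + j" using that(1)[of "take n w"] that(2)[of "drop n w"] by auto
  qed
  have act_len: "act h p w \<noteq> 0 \<Longrightarrow> length w = i"
    if "\<And>w. p w \<noteq> 0 \<Longrightarrow> length w = i" for p :: "'c list \<Rightarrow> complex" and w i h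
    by (erule tensor_action_length) (use that in force)
  have lhs: "ct s x y (r \<odot>\<odot> (tensor_of_vectors [x', y'] - tensor_of_vectors [y', x']) \<odot>\<odot> t) g =
    (\<Sum>h\<in>carrier G. \<Sum>l\<in>carrier G. a h x y * (a l x' y' *
      L (h \<otimes> l \<otimes> g) (s \<odot>\<odot> act h r \<odot>\<odot> act (h \<otimes> l) t)))"
    unfolding commutator_term_def[of a \<beta> s x y]
  proof (rule sum.cong[OF refl])
    fix h assume h: "h \<in> carrier G"
    have "L (h \<otimes> g) (s \<odot>\<odot> act h (r \<odot>\<odot> (tensor_of_vectors [x', y'] - tensor_of_vectors [y', x']) \<odot>\<odot> t)) =
        L (h \<otimes> g) ((s \<odot>\<odot> act h r) \<odot>\<odot> (tensor_of_vectors [\<rho> h *v x', \<rho> h *v y']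
           - tensor_of_vectors [\<rho> h *v y', \<rho> h *v x']) \<odot>\<odot> act h t)"
      by (simp add: tensor_action_mult tensor_action_diff tensor_action_vectors tensor_mult_assoc
          del: fun_apply_simps)
    also have "\<dots> = ct (s \<odot>\<odot> act h r) (\<rho> h *v x') (\<rho> h *v y') (act h t) (h \<otimes> g)"
    proof (rule rel_holds_tensor[OF k(1), of "length u + length m" "length v"])
      show "\<forall>w. (s \<odot>\<odot> act h r) w \<noteq> 0 \<longrightarrow> length w = length u + length m"
        by (intro allI impI) (rule mult_len[OF len(1) act_len[OF len(3)]])
      show "\<forall>w. act h t w \<noteq> 0 \<longrightarrow> length w = length v"
        by (intro allI impI) (rule act_len[OF len(2)])
    qed (use fin k g h in \<open>auto intro!: finite_support_mult finite_support_action\<close>)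
    also have "\<dots> = (\<Sum>k\<in>carrier G. a k (\<rho> h *v x') (\<rho> h *v y') *
        L (k \<otimes> (h \<otimes> g)) (s \<odot>\<odot> act h r \<odot>\<odot> act k (act h t)))"
      by (simp add: commutator_term_def)
    also have "\<dots> = (\<Sum>l\<in>carrier G. a l x' y' * L (h \<otimes> l \<otimes> g) (s \<odot>\<odot> act h r \<odot>\<odot> act (h \<otimes> l) t))"
    \<comment> \<open>Summation over the conjugates k = h l h^-1, for which k h = h l.\<close>
    proof (subst conj_reindex[OF h], rule sum.cong[OF refl])
      fix l assume l: "l \<in> carrier G"
      have "h \<otimes> l \<otimes> inv h \<otimes> (h \<otimes> g) = h \<otimes> l \<otimes> (inv h \<otimes> h) \<otimes> g" and "h \<otimes> l \<otimes> inv h \<otimes> h = h \<otimes> l \<otimes> (inv h \<otimes> h)"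
        using h l g by (simp_all only: m_assoc m_closed inv_closed)
      then have "h \<otimes> l \<otimes> inv h \<otimes> (h \<otimes> g) = h \<otimes> l \<otimes> g" and "h \<otimes> l \<otimes> inv h \<otimes> h = h \<otimes> l"
        using h l by simp_all
      then show "a (h \<otimes> l \<otimes> inv h) (\<rho> h *v x') (\<rho> h *v y') * L (h \<otimes> l \<otimes> inv h \<otimes> (h \<otimes> g))
          (s \<odot>\<odot> act h r \<odot>\<odot> act (h \<otimes> l \<otimes> inv h) (act h t)) =
        a l x' y' * L (h \<otimes> l \<otimes> g) (s \<odot>\<odot> act h r \<odot>\<odot> act (h \<otimes> l) t)"
        using h l by (simp add: hecke_invariant_conj[OF inv] flip: act_mult)
    qed
    finally show "a h x y * L (h \<otimes> g) (s \<odot>\<odot> act h (r \<odot>\<odot> (tensor_of_vectors [x', y'] - tensor_of_vectors [y', x']) \<odot>\<odot> t)) =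
        (\<Sum>l\<in>carrier G. a h x y * (a l x' y' * L (h \<otimes> l \<otimes> g) (s \<odot>\<odot> act h r \<odot>\<odot> act (h \<otimes> l) t)))"
      by (simp add: sum_distrib_left)
  qed
  have "ct (s \<odot>\<odot> (tensor_of_vectors [x, y] - tensor_of_vectors [y, x]) \<odot>\<odot> r) x' y' t g =
    (\<Sum>l\<in>carrier G. \<Sum>h\<in>carrier G. a h x y * (a l x' y' *
      L (h \<otimes> l \<otimes> g) (s \<odot>\<odot> act h r \<odot>\<odot> act (h \<otimes> l) t)))"
    unfolding commutator_term_def[of a \<beta> _ x' y']
  proof (rule sum.cong[OF refl])
    fix l assume l: "l \<in> carrier G"
    have "L (l \<otimes> g) (s \<odot>\<odot> (tensor_of_vectors [x, y] - tensor_of_vectors [y, x]) \<odot>\<odot> r \<odot>\<odot> act l t) =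
        L (l \<otimes> g) (s \<odot>\<odot> (tensor_of_vectors [x, y] - tensor_of_vectors [y, x]) \<odot>\<odot> (r \<odot>\<odot> act l t))"
      by (simp add: tensor_mult_assoc)
    also have "\<dots> = ct s x y (r \<odot>\<odot> act l t) (l \<otimes> g)"
    proof (rule rel_holds_tensor[OF k(1), of "length u" "length m + length v"])
      show "\<forall>w. (r \<odot>\<odot> act l t) w \<noteq> 0 \<longrightarrow> length w = length m + length v"
        by (intro allI impI) (rule mult_len[OF len(3) act_len[OF len(2)]])
      show "\<forall>w. s w \<noteq> 0 \<longrightarrow> length w = length u"
        using len(1) by blast
    qed (use fin k g l in \<open>auto intro!: finite_support_mult finite_support_action\<close>)
    also have "\<dots> = (\<Sum>h\<in>carrier G. a h x y * L (h \<otimes> l \<otimes> g) (s \<odot>\<odot> act h r \<odot>\<odot> act (h \<otimes> l) t))"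
      unfolding commutator_term_def
      by (rule sum.cong) (use g l in \<open>simp_all add: tensor_action_mult act_mult tensor_mult_assoc m_assoc\<close>)
    finally show "a l x' y' * L (l \<otimes> g) (s \<odot>\<odot> (tensor_of_vectors [x, y] - tensor_of_vectors [y, x]) \<odot>\<odot> r \<odot>\<odot> act l t) =
      (\<Sum>h\<in>carrier G. a h x y * (a l x' y' * L (h \<otimes> l \<otimes> g) (s \<odot>\<odot> act h r \<odot>\<odot> act (h \<otimes> l) t)))"
      by (simp add: sum_distrib_left mult.left_commute)
  qed
  then show ?thesis
    using lhs sum.swap unfolding s_def t_def r_def by simp
qed

abbreviation "e \<equiv> (\<lambda>i. axis i 1 :: complex^'c)"

text \<open>The value that rewriting at this particular place would produce; the recursion itself
  uses only one such place of each word.\<close>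

definition resolve where
  "resolve u x y v g = nf_value a \<beta> (u @ [y, x] @ v) g +
     ct (word_tensor u) (e x) (e y) (word_tensor v) g"

lemma word_commutator:
  "word_tensor u \<odot>\<odot> (tensor_of_vectors [e x, e y] - tensor_of_vectors [e y, e x]) \<odot>\<odot> word_tensor v =
    word_tensor (u @ [x, y] @ v) - word_tensor (u @ [y, x] @ v)"
  using tensor_of_axes[of "[x, y]"] tensor_of_axes[of "[y, x]"]
  by (simp add: tensor_mult_diff_left tensor_mult_diff_right word_tensor_mult del: fun_apply_simps)

text \<open>Both ways lead to the word with both pairs exchanged, and the corrections collected on
  the two ways have equal sums by \<open>ct_commute\<close>. The length in \<open>rel_holds\<close>
  is that of the word after one of the two pairs has been replaced by a group element.\<close>

lemma resolve_disjoint: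
  assumes "hecke_invariant a" "rel_holds (length u + length m + length v + 2)" "g \<in> carrier G"
    and IH1: "nf_value a \<beta> (u @ [y, x] @ m @ [x', y'] @ v) g = resolve (u @ [y, x] @ m) x' y' v g"
    and IH2: "nf_value a \<beta> (u @ [x, y] @ m @ [y', x'] @ v) g = resolve u x y (m @ [y', x'] @ v) g"
  shows "resolve u x y (m @ [x', y'] @ v) g = resolve (u @ [x, y] @ m) x' y' v g"
proof -
  have "ct (word_tensor u) (e x) (e y) (word_tensor (m @ [x', y'] @ v)) g
      - ct (word_tensor u) (e x) (e y) (word_tensor (m @ [y', x'] @ v)) g =
    ct (word_tensor (u @ [x, y] @ m)) (e x') (e y') (word_tensor v) g
      - ct (word_tensor (u @ [y, x] @ m)) (e x') (e y') (word_tensor v) g"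
    using ct_commute[OF assms(1,2) refl assms(3), of "e x" "e y" "e x'" "e y'"]
    unfolding word_commutator
    by (simp add: ct_diff_left ct_diff_right del: append_Cons append_Nil append_assoc fun_apply_simps)
  moreover have "s1 + p1 = s2 + q1" if "p1 - p2 = q1 - q2" "s1 = r + q2" "s2 = r + p2"
    for p1 p2 q1 q2 r s1 s2 :: complex
    using that by (simp add: diff_eq_eq)
  ultimately show ?thesis
    using IH1 IH2 unfolding resolve_def append_assoc append_Cons append_Nil by blast
qed

text \<open>The six corrections pair up by the two letters that are commuted. Each pair contributes,
  for every h, the difference of the third letter moved by h and the letter itself, so the Jacobi
  identity makes the sum vanish for each h separately.\<close>

lemma jacobi_ct:
  assumes jac: "hecke_jacobi a" and g: "g \<in> carrier G"
  shows "ct (word_tensor u) (e x) (e y) (word_tensor (z # v)) g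
       - ct (word_tensor (u @ [z])) (e x) (e y) (word_tensor v) g
       - ct (word_tensor u) (e x) (e z) (word_tensor (y # v)) g
       + ct (word_tensor (u @ [y])) (e x) (e z) (word_tensor v) g
       + ct (word_tensor u) (e y) (e z) (word_tensor (x # v)) g
       - ct (word_tensor (u @ [x])) (e y) (e z) (word_tensor v) g = 0"
proof -
  \<comment> \<open>\<open>F h p\<close> puts a vector \<open>p\<close> in the place of the third
    letter. A letter to the right of the commutator is met by \<open>h\<close> and enters as its
    image under \<open>h\<close>; a letter to the left enters unchanged.\<close>
  define F where "F h p = L (h \<otimes> g) (word_tensor u \<odot>\<odot> tensor_of_vectors [p] \<odot>\<odot> act h (word_tensor v))" for h p
  have vec_add: "tensor_of_vectors [p + q] = tensor_of_vectors [p] + tensor_of_vectors [q]"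
    and vec_scale: "tensor_of_vectors [c *s p] = tensor_scale c (tensor_of_vectors [p])"
    for p q :: "complex^'c" and c
    by (simp_all add: tensor_incl_def tensor_scale_def fun_eq_iff flip: tensor_incl_eq)
  have fin: "finite_support (act h (word_tensor v))" for h
    by (auto intro: finite_support_action)
  have F_add: "F h (p + q) = F h p + F h q" and F_scale: "F h (c *s p) = c * F h p" for h p q c
    by (simp_all add: F_def vec_add vec_scale tensor_mult_add_left tensor_mult_add_right tensor_mult_scale_left
        tensor_mult_scale_right nf_functional_add nf_functional_scale finite_support_mult fin
        del: fun_apply_simps)
  have F_diff: "F h (p - q) = F h p - F h q" for h p q
    using F_add[of h "p - q" q] by simp
  have F_zero: "F h 0 = 0" for h using F_scale[of h 0 0] by simp
  have r: "ct (word_tensor u) p q (word_tensor (z # v)) g = (\<Sum>h\<in>carrier G. a h p q * F h (\<rho> h *v e z))" for p q z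
  proof -
    have zv: "word_tensor (z # v) = tensor_of_vectors [e z] \<odot>\<odot> word_tensor v"
      using word_tensor_mult[of "[z]" v] tensor_of_axes[of "[z]"] by simp
    show ?thesis
      unfolding commutator_term_def F_def zv
      by (simp only: tensor_action_mult tensor_action_vectors tensor_mult_assoc list.map)
  qed
  have l: "ct (word_tensor (u @ [z])) p q (word_tensor v) g = (\<Sum>h\<in>carrier G. a h p q * F h (e z))" for p q z
    unfolding commutator_term_def F_def
    using word_tensor_mult[of u "[z]"] tensor_of_axes[of "[z]"]
    by (intro sum.cong) simp_all
  have "(\<Sum>h\<in>carrier G. a h (e x) (e y) * F h (\<rho> h *v e z) - a h (e x) (e y) * F h (e z)
      - a h (e x) (e z) * F h (\<rho> h *v e y) + a h (e x) (e z) * F h (e y)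
      + a h (e y) (e z) * F h (\<rho> h *v e x) - a h (e y) (e z) * F h (e x)) = 0"
  proof (rule sum.neutral, rule ballI)
    fix h assume h: "h \<in> carrier G"
    have "F h (a h (e x) (e y) *s (\<rho> h *v e z - e z) + a h (e y) (e z) *s (\<rho> h *v e x - e x)
       + a h (e z) (e x) *s (\<rho> h *v e y - e y)) = 0"
      using jac h F_zero unfolding hecke_jacobi_def by simp
    then show "a h (e x) (e y) * F h (\<rho> h *v e z) - a h (e x) (e y) * F h (e z)
      - a h (e x) (e z) * F h (\<rho> h *v e y) + a h (e x) (e z) * F h (e y)
      + a h (e y) (e z) * F h (\<rho> h *v e x) - a h (e y) (e z) * F h (e x) = 0"
      unfolding F_add F_scale F_diff form_skew[OF h, of "e z" "e x"]
      by (simp add: algebra_simps)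
  qed
  then show ?thesis
    unfolding r l by (simp add: sum.distrib sum_subtractf)
qed

text \<open>Two ways lead from x y z to z y x: one through y x z and y z x, the other through x z y
  and z x y. The corrections along them are the six terms of \<open>jacobi_ct\<close>.\<close>

lemma resolve_overlap:
  assumes "hecke_jacobi a" "g \<in> carrier G"
    and "nf_value a \<beta> (u @ [y, x, z] @ v) g = resolve (u @ [y]) x z v g"
    and "nf_value a \<beta> (u @ [y, z, x] @ v) g = resolve u y z (x # v) g"
    and "nf_value a \<beta> (u @ [x, z, y] @ v) g = resolve u x z (y # v) g"
    and "nf_value a \<beta> (u @ [z, x, y] @ v) g = resolve (u @ [z]) x y v g"
  shows "resolve u x y (z # v) g = resolve (u @ [x]) y z v g"
  using jacobi_ct[OF assms(1,2), of u x y z v] assms(3-6)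
  by (simp add: resolve_def algebra_simps)

text \<open>Compares two descents of one word, the first not to the right of the second. Every
  intermediate word arises by sorting steps, so it has the same length and smaller weight, and
  \<open>IH\<close> allows it to be rewritten at whichever descent is wanted.\<close>

lemma resolve_unique:
  assumes inv: "hecke_invariant a" and jac: "hecke_jacobi a" and k: "rel_holds (k - 2)"
    and g: "g \<in> carrier G"
    and IH: "\<And>u x y v. word_weight (u @ [x, y] @ v) < N \<Longrightarrow> length (u @ [x, y] @ v) = k \<Longrightarrow> key y < key x \<Longrightarrow>
      nf_value a \<beta> (u @ [x, y] @ v) g = resolve u x y v g"
    and w: "u @ [x, y] @ v = u' @ [x', y'] @ v'" "length (u @ [x, y] @ v) = k" "word_weight (u @ [x, y] @ v) = N"
    and desc: "key y < key x" "key y' < key x'" and le: "length u \<le> length u'"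
  shows "resolve u x y v g = resolve u' x' y' v' g"
proof -
  obtain m0 where m0: "u' = u @ m0" "x # y # v = m0 @ x' # y' # v'"
  proof
    show "u' = u @ drop (length u) u'"
      using w(1) le by (metis append_eq_append_conv_if append_take_drop_id append_Cons)
    then show "x # y # v = drop (length u) u' @ x' # y' # v'"
      using w(1) by (metis append.assoc append_Cons append_Nil same_append_eq)
  qed
  have less: "word_weight (p @ [i, j] @ q) < word_weight (p @ [j, i] @ q)" if "key i < key j" for p i j q
    using word_weight_swap[OF that] .
  show ?thesis
  \<comment> \<open>The rule only serves to split \<open>m0\<close> into no letter, one letter, and
    at least two letters: equal, overlapping and disjoint places.\<close>
  proof (cases m0 rule: remdups_adj.cases)
    case 1
    then show ?thesis using m0 by simp
  next
    case (2 c)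
    then have eq: "u' = u @ [x]" "x' = y" "v = y' # v'" using m0 by auto
    define z where "z = y'"
    have z: "key z < key y" "key z < key x" using desc eq z_def by auto
    have N: "word_weight (u @ [x, y, z] @ v') = N" and len: "length u + length v' + 3 = k"
      using w eq by (auto simp: z_def)
    have w1: "word_weight (u @ [y, x, z] @ v') < N" using less[OF desc(1), of u "z # v'"] N by simp
    have w2: "word_weight (u @ [y, z, x] @ v') < N" using less[OF z(2), of "u @ [y]" "v'"] w1 by simp
    have w3: "word_weight (u @ [x, z, y] @ v') < N" using less[OF z(1), of "u @ [x]" "v'"] N by simp
    have w4: "word_weight (u @ [z, x, y] @ v') < N" using less[OF z(2), of u "y # v'"] w3 by simp
    have "resolve u x y (z # v') g = resolve (u @ [x]) y z v' g"
    proof (rule resolve_overlap[OF jac g])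
      show "nf_value a \<beta> (u @ [y, x, z] @ v') g = resolve (u @ [y]) x z v' g"
        using IH[of "u @ [y]" x z v'] w1 z len by simp
      show "nf_value a \<beta> (u @ [y, z, x] @ v') g = resolve u y z (x # v') g"
        using IH[of u y z "x # v'"] w2 z len by simp
      show "nf_value a \<beta> (u @ [x, z, y] @ v') g = resolve u x z (y # v') g"
        using IH[of u x z "y # v'"] w3 z len by simp
      show "nf_value a \<beta> (u @ [z, x, y] @ v') g = resolve (u @ [z]) x y v' g"
        using IH[of "u @ [z]" x y v'] w4 desc len by simp
    qed
    then show ?thesis using eq by (simp add: z_def)
  next
    case (3 c d m)
    then have eq: "u' = u @ [x, y] @ m" "v = m @ [x', y'] @ v'" using m0 by auto
    have "resolve u x y (m @ [x', y'] @ v') g = resolve (u @ [x, y] @ m) x' y' v' g"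
    proof (rule resolve_disjoint[OF inv _ g])
      show "rel_holds (length u + length m + length v' + 2)"
      proof -
        have "k - 2 = length u + length m + length v' + 2" using w(2) eq by simp
        then show ?thesis using k by (simp only:)
      qed
      show "nf_value a \<beta> (u @ [y, x] @ m @ [x', y'] @ v') g = resolve (u @ [y, x] @ m) x' y' v' g"
        using IH[of "u @ [y, x] @ m" x' y' v'] less[OF desc(1), of u v] w desc eq by simp
      show "nf_value a \<beta> (u @ [x, y] @ m @ [y', x'] @ v') g = resolve u x y (m @ [y', x'] @ v') g"
        using IH[of u x y "m @ [y', x'] @ v'"] less[OF desc(2), of "u @ [x, y] @ m" v'] w desc eq by simp
    qed
    then show ?thesis using eq by simp
  qed
qed

text \<open>The outer induction is on the length, since a correction is two letters shorter; the
  inner one is on the weight, since an exchange keeps the length. The inner step compares the given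
  descent with the selected one by \<open>resolve_unique\<close>.\<close>

theorem rel_holds_all:
  assumes inv: "hecke_invariant a" and jac: "hecke_jacobi a"
  shows "rel_holds k"
proof (induction k rule: less_induct)
  case (less k)
  show ?case
  proof (cases "k < 2")
    case True
    then show ?thesis by (simp add: rel_holds_def)
  next
    case False
    then have k: "rel_holds (k - 2)" using less by simp
    have step: "nf_value a \<beta> (u @ [x, y] @ v) g = resolve u x y v g"
      if "length (u @ [x, y] @ v) = k" "key y < key x" "g \<in> carrier G" for u v :: "'c list" and x y g
      using that
    proof (induction "word_weight (u @ [x, y] @ v)" arbitrary: u x y v rule: less_induct)
      case less
      let ?w = "u @ [x, y] @ v"
      have desc: "has_descent ?w" using less.prems by (auto simp: has_descent_def)
      obtain u' x' y' v' where some: "some_descent ?w = (u', x', y', v')" by (metis prod_cases4)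
      have w: "?w = u' @ [x', y'] @ v'" and key': "key y' < key x'"
        using some_descent[OF desc some] by auto
      have IH: "nf_value a \<beta> (p @ [i, j] @ q) g = resolve p i j q g"
        if "word_weight (p @ [i, j] @ q) < word_weight ?w" "length (p @ [i, j] @ q) = k" "key j < key i" for p q :: "'c list" and i j
        using less.hyps[OF that \<open>g \<in> carrier G\<close>] .
      have "resolve u' x' y' v' g = resolve u x y v g"
      proof (cases "length u \<le> length u'")
        case True
        show ?thesis
          by (rule resolve_unique[OF inv jac k less.prems(3) IH w less.prems(1) refl less.prems(2) key' True, symmetric])
      next
        case False
        then have "length u' \<le> length u" by simp
        show ?thesis
          by (rule resolve_unique[OF inv jac k less.prems(3) IH w[symmetric] _ _ key' less.prems(2) \<open>length u' \<le> length u\<close>])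
            (use w less.prems(1) in simp_all)
      qed
      moreover have "nf_value a \<beta> ?w g = resolve u' x' y' v' g"
        unfolding resolve_def by (rule nf_value_descent[OF desc some])
      ultimately show ?case by simp
    qed
    show ?thesis
      unfolding rel_holds_def
    proof (intro allI impI)
      fix u v :: "'c list" and x y :: 'c and g
      assume len: "length u + length v + 2 = k" and g: "g \<in> carrier G"
      \<comment> \<open>\<open>step\<close> covers a descent. For an ascent the exchanged word has
        the descent, and skewness supplies the sign; for equal letters both sides are 0.\<close>
      consider "key y < key x" | "key x < key y" | "x = y"
        using inj_key by (metis injD linorder_neqE_nat)
      then show "L g (word_tensor (u @ [x, y] @ v)) - L g (word_tensor (u @ [y, x] @ v)) =
          ct (word_tensor u) (e x) (e y) (word_tensor v) g"
      proof cases
        case 1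
        then show ?thesis
          using step[of u x y v g] len g by (simp add: nf_functional_word resolve_def)
      next
        case 2
        then show ?thesis
          using step[of u y x v g] len g ct_skew[of "word_tensor u" "e y" "e x" "word_tensor v" g]
          by (simp add: nf_functional_word resolve_def)
      next
        case 3
        then show ?thesis by (simp add: commutator_term_def form_self)
      qed
    qed
  qed
qed

end

section \<open>The Poincare-Birkhoff-Witt property\<close>

context hecke_data
begin

definition nf_total where
  "nf_total x = (\<Sum>g\<in>carrier G. L g (x g))"

lemma word_scale_length:
  "tensor_scale c (word_tensor u) w \<noteq> 0 \<Longrightarrow> length w = length u"
  by (auto simp: tensor_scale_def word_tensor_def split: if_splits)

text \<open>In the product s g1 R t g2 the component at g1 l g2 carries the term with a_l, and for l
  = 1 also the commutator of g1 v and g1 w. By \<open>rel_holds_all\<close> the value on that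
  commutator is a sum over the conjugates g1 l g1^-1; invariance turns it into the sum of the a_l
  terms, and the two cancel.\<close>

lemma nf_total_ideal:
  assumes inv: "hecke_invariant a" and jac: "hecke_jacobi a" and x: "x \<in> hecke_ideal G \<rho> a"
  shows "nf_total x = 0"
proof (rule hecke_ideal_kernel[OF _ _ x])
  show "nf_total (x \<oplus>\<^bsub>T\<^esub> y) = nf_total x + nf_total y" if "x \<in> carrier T" "y \<in> carrier T" for x y
    using that unfolding nf_total_def
    by (simp add: T_add_apply nf_functional_add carrier_T_support sum.distrib)
next
  fix c d v w u r g1 g2
  assume g1: "g1 \<in> carrier G" and g2: "g2 \<in> carrier G"
  define s t where "s = tensor_scale c (word_tensor (u :: 'c list))" and "t = tensor_scale d (word_tensor (r :: 'c list))"
  define D where "D = tensor_of_vectors [\<rho> g1 *v v, \<rho> g1 *v w] - tensor_of_vectors [\<rho> g1 *v w, \<rho> g1 *v v]"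
  have fin: "finite_support s" "finite_support t" "finite_support D"
    unfolding s_def t_def D_def by (auto intro!: finite_support_scale finite_support_diff)
  have len: "s z \<noteq> 0 \<Longrightarrow> length z = length u" "t z \<noteq> 0 \<Longrightarrow> length z = length r" for z
    unfolding s_def t_def by (auto dest: word_scale_length)
  let ?R = "hecke_relation G \<rho> a v w"
  let ?S = "elem s g1 \<otimes>\<^bsub>T\<^esub> ?R \<otimes>\<^bsub>T\<^esub> elem t g2"
  have rel: "?R l = (if l = \<one> then tensor_of_vectors [v, w] - tensor_of_vectors [w, v] else 0)
      - tensor_scale (a l v w) (word_tensor [])" if "l \<in> carrier G" for l
    using that by (simp add: hecke_relation_eq)
  have "nf_total ?S = (\<Sum>l\<in>carrier G. L (g1 \<otimes> l \<otimes> g2) (?S (g1 \<otimes> l \<otimes> g2)))"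
    unfolding nf_total_def
  proof (rule sum.reindex_bij_witness[of _ "\<lambda>l. g1 \<otimes> l \<otimes> g2" "\<lambda>k. inv g1 \<otimes> k \<otimes> inv g2"])
    fix k assume k: "k \<in> carrier G"
    have "g1 \<otimes> (inv g1 \<otimes> k \<otimes> inv g2) \<otimes> g2 = g1 \<otimes> inv g1 \<otimes> k \<otimes> (inv g2 \<otimes> g2)"
      using g1 g2 k by (simp only: m_assoc m_closed inv_closed)
    then show "g1 \<otimes> (inv g1 \<otimes> k \<otimes> inv g2) \<otimes> g2 = k" using g1 g2 k by simp
    then show "L (g1 \<otimes> (inv g1 \<otimes> k \<otimes> inv g2) \<otimes> g2) (?S (g1 \<otimes> (inv g1 \<otimes> k \<otimes> inv g2) \<otimes> g2)) = L k (?S k)"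
      by simp
    have "inv g1 \<otimes> (g1 \<otimes> k \<otimes> g2) \<otimes> inv g2 = inv g1 \<otimes> g1 \<otimes> k \<otimes> (g2 \<otimes> inv g2)"
      using g1 g2 k by (simp only: m_assoc m_closed inv_closed)
    then show "inv g1 \<otimes> (g1 \<otimes> k \<otimes> g2) \<otimes> inv g2 = k" using g1 g2 k by simp
  qed (use g1 g2 in simp_all)
  also have "\<dots> = (\<Sum>l\<in>carrier G. (if l = \<one> then L (g1 \<otimes> g2) (s \<odot>\<odot> D \<odot>\<odot> act g1 t) else 0)
      - a l v w * L (g1 \<otimes> l \<otimes> g2) (s \<odot>\<odot> act (g1 \<otimes> l) t))"
  proof (rule sum.cong[OF refl])
    fix l assume l: "l \<in> carrier G"
    have "?S (g1 \<otimes> l \<otimes> g2) = s \<odot>\<odot> act g1 (?R l) \<odot>\<odot> act (g1 \<otimes> l) t"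
      using g1 g2 l fin by (simp add: sandwich_apply hecke_relation_closed)
    also have "act g1 (?R l) = (if l = \<one> then D else 0) - tensor_scale (a l v w) (word_tensor [])"
      using l by (simp add: rel D_def tensor_action_diff tensor_action_scale tensor_action_one
          tensor_action_vectors del: fun_apply_simps)
    also have "s \<odot>\<odot> ((if l = \<one> then D else 0) - tensor_scale (a l v w) (word_tensor [])) \<odot>\<odot> act (g1 \<otimes> l) t =
        (if l = \<one> then s \<odot>\<odot> D \<odot>\<odot> act (g1 \<otimes> l) t else 0) - tensor_scale (a l v w) (s \<odot>\<odot> act (g1 \<otimes> l) t)"
      by (simp add: tensor_mult_diff_left tensor_mult_diff_right tensor_mult_scale_left tensor_mult_scale_right
          del: fun_apply_simps)
    finally have eq: "?S (g1 \<otimes> l \<otimes> g2) =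
      (if l = \<one> then s \<odot>\<odot> D \<odot>\<odot> act (g1 \<otimes> l) t else 0) - tensor_scale (a l v w) (s \<odot>\<odot> act (g1 \<otimes> l) t)" .
    have fin': "finite_support (s \<odot>\<odot> D \<odot>\<odot> act h t)" "finite_support (s \<odot>\<odot> act h t)" for h
      using fin by (auto intro!: finite_support_mult finite_support_action)
    show "L (g1 \<otimes> l \<otimes> g2) (?S (g1 \<otimes> l \<otimes> g2)) =
      (if l = \<one> then L (g1 \<otimes> g2) (s \<odot>\<odot> D \<odot>\<odot> act g1 t) else 0)
      - a l v w * L (g1 \<otimes> l \<otimes> g2) (s \<odot>\<odot> act (g1 \<otimes> l) t)"
      unfolding eq using g1 fin'
      by (simp add: nf_functional_diff nf_functional_scale nf_functional_zero finite_support_scale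
          del: fun_apply_simps)
  qed
  also have "\<dots> = L (g1 \<otimes> g2) (s \<odot>\<odot> D \<odot>\<odot> act g1 t)
      - (\<Sum>l\<in>carrier G. a l v w * L (g1 \<otimes> l \<otimes> g2) (s \<odot>\<odot> act (g1 \<otimes> l) t))"
    using finite_G by (simp add: sum_subtractf)
  also have "L (g1 \<otimes> g2) (s \<odot>\<odot> D \<odot>\<odot> act g1 t) = ct s (\<rho> g1 *v v) (\<rho> g1 *v w) (act g1 t) (g1 \<otimes> g2)"
    unfolding D_def
  proof (rule rel_holds_tensor[where i = "length u" and j = "length r", OF rel_holds_all[OF inv jac] refl])
    show "\<forall>w. s w \<noteq> 0 \<longrightarrow> length w = length u" using len(1) by blast
    show "\<forall>w. act g1 t w \<noteq> 0 \<longrightarrow> length w = length r"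
      by (intro allI impI, erule tensor_action_length) (use len(2) in force)
  qed (use g1 g2 fin in \<open>auto intro: finite_support_action\<close>)
  also have "\<dots> = (\<Sum>l\<in>carrier G. a l v w * L (g1 \<otimes> l \<otimes> g2) (s \<odot>\<odot> act (g1 \<otimes> l) t))"
    unfolding commutator_term_def
  proof (subst conj_reindex[OF g1], rule sum.cong[OF refl])
    fix l assume l: "l \<in> carrier G"
    have "g1 \<otimes> l \<otimes> inv g1 \<otimes> (g1 \<otimes> g2) = g1 \<otimes> l \<otimes> (inv g1 \<otimes> g1) \<otimes> g2"
      and "g1 \<otimes> l \<otimes> inv g1 \<otimes> g1 = g1 \<otimes> l \<otimes> (inv g1 \<otimes> g1)"
      using g1 g2 l by (simp_all only: m_assoc m_closed inv_closed)
    then have "g1 \<otimes> l \<otimes> inv g1 \<otimes> (g1 \<otimes> g2) = g1 \<otimes> l \<otimes> g2" and "g1 \<otimes> l \<otimes> inv g1 \<otimes> g1 = g1 \<otimes> l"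
      using g1 g2 l by simp_all
    then show "a (g1 \<otimes> l \<otimes> inv g1) (\<rho> g1 *v v) (\<rho> g1 *v w) *
        L (g1 \<otimes> l \<otimes> inv g1 \<otimes> (g1 \<otimes> g2)) (s \<odot>\<odot> act (g1 \<otimes> l \<otimes> inv g1) (act g1 t)) =
      a l v w * L (g1 \<otimes> l \<otimes> g2) (s \<odot>\<odot> act (g1 \<otimes> l) t)"
      using g1 l by (simp add: hecke_invariant_conj[OF inv] flip: act_mult)
  qed
  finally show "nf_total ?S = 0" by simp
qed

text \<open>A recursion step passes to a rearrangement, on which \<beta> agrees, and to words two
  letters shorter, on which \<beta> is 0 as long as the start has at most \<open>k\<close> letters.
  So up to length \<open>k\<close> nothing is added to the initial values.\<close>

lemma nf_value_top:
  assumes \<beta>: "\<And>w g. length w < k \<Longrightarrow> \<beta> w g = 0"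
    "\<And>w w' g. mset w = mset w' \<Longrightarrow> \<beta> w g = \<beta> w' g"
  shows "length w \<le> k \<Longrightarrow> nf_value a \<beta> w g = \<beta> w g"
proof (induction "length w" arbitrary: w g rule: less_induct)
  case outer: less
  then show ?case
  proof (induction "word_weight w" arbitrary: w rule: less_induct)
    case less
    show ?case
    proof (cases "has_descent w")
      case False
      then show ?thesis by (simp add: nf_value.simps)
    next
      case True
      obtain u x y v where some: "some_descent w = (u, x, y, v)" by (metis prod_cases4)
      then have w: "w = u @ [x, y] @ v" and desc: "key y < key x"
        using some_descent[OF True] by auto
      have len: "length w = length u + length v + 2" using w by simp
      have "nf_value a \<beta> (u @ [y, x] @ v) g = \<beta> (u @ [y, x] @ v) g"
      proof (rule less.hyps)
        show "word_weight (u @ [y, x] @ v) < word_weight w" unfolding w by (rule word_weight_swap[OF desc])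
        show "length (u @ [y, x] @ v) \<le> k" using less.prems len by simp
        fix w' :: "'c list" and g
        assume "length w' < length (u @ [y, x] @ v)" "length w' \<le> k"
        then show "nf_value a \<beta> w' g = \<beta> w' g" using less.prems(1)[of w' g] len by simp
      qed
      also have "\<dots> = \<beta> w g" by (rule \<beta>(2)) (simp add: w)
      finally have 1: "nf_value a \<beta> (u @ [y, x] @ v) g = \<beta> w g" .
      have 2: "nf_value a \<beta> (u @ v') h = 0" if "length v' = length v" for v' h
        using less.prems(1)[of "u @ v'" h] less.prems(2) \<beta>(1)[of "u @ v'" h] that len by simp
      show ?thesis
        using nf_value_descent[OF True some, of a \<beta> g] 1
        unfolding commutator_term_def nf_functional_act_word by (simp add: 2)
    qed
  qed
qed

end

section \<open>Degrees and leading terms of the Hecke ideal\<close>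

context finite_group_rep
begin

text \<open>The strict bound makes \<open>low k\<close> the lift of F_{k-1} for every
  \<open>k\<close>; in particular \<open>low 0\<close> is zero, in accordance with F_{-1} =
  0.\<close>

definition low :: "nat \<Rightarrow> ('g \<Rightarrow> 'n list \<Rightarrow> complex) set" where
  "low k = {x \<in> carrier T. \<forall>g\<in>carrier G. \<forall>w. x g w \<noteq> 0 \<longrightarrow> length w < k}"

definition part :: "nat \<Rightarrow> ('g \<Rightarrow> 'n list \<Rightarrow> complex) \<Rightarrow> 'g \<Rightarrow> 'n list \<Rightarrow> complex" where
  "part k x = (\<lambda>g\<in>carrier G. \<lambda>w. if length w = k then x g w else 0)"

lemma low_closed: "x \<in> low k \<Longrightarrow> x \<in> carrier T"
  by (simp add: low_def)

lemma low_zero: "\<zero>\<^bsub>T\<^esub> \<in> low k"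
  unfolding low_def by (auto simp: T_zero_closed) (simp add: T_zero)

lemma low_add:
  assumes "x \<in> low k" "y \<in> low k"
  shows "x \<oplus>\<^bsub>T\<^esub> y \<in> low k"
  using assms unfolding low_def
  by (auto simp: T_closed T_add_apply) (metis add.right_neutral)

lemma low_smult: "x \<in> low k \<Longrightarrow> c \<odot>\<^bsub>T\<^esub> x \<in> low k"
  unfolding low_def by (auto simp: T_smult_closed T_smult_apply tensor_scale_def)

lemma low_a_inv: "x \<in> low k \<Longrightarrow> \<ominus>\<^bsub>T\<^esub> x \<in> low k"
  unfolding low_def by (auto simp: T_a_inv_apply)

lemma low_mono: "j \<le> k \<Longrightarrow> low j \<subseteq> low k"
  unfolding low_def by fastforce

lemma low_0: "low 0 = {\<zero>\<^bsub>T\<^esub>}"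
proof -
  have "x = \<zero>\<^bsub>T\<^esub>" if "x \<in> low 0" for x
    using that by (intro T_ext) (auto simp: low_def T_zero_closed, auto simp: T_zero fun_eq_iff)
  then show ?thesis using low_zero by blast
qed

text \<open>Each of the finitely many components has words of bounded length, and degrees of sums
  are bounded by the maximum.\<close>

lemma low_exists:
  assumes x: "x \<in> carrier T"
  shows "\<exists>k. x \<in> low k"
  using x
proof (rule T_components_induct[where P = "\<lambda>x. \<exists>k. x \<in> low k"])
  show "\<exists>k. \<zero>\<^bsub>T\<^esub> \<in> low k" using low_zero by blast
  fix g assume g: "g \<in> carrier G"
  obtain N where "\<forall>w. x g w \<noteq> 0 \<longrightarrow> length w \<le> N"
    using carrier_T_support[OF x g] finite_support_bound by blast
  then have "elem (x g) g \<in> low (Suc N)"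
    using carrier_T_support[OF x g] by (auto simp: low_def elem_closed elem_apply less_Suc_eq_le)
  then show "\<exists>k. elem (x g) g \<in> low k" ..
next
  fix x y assume "\<exists>k. x \<in> low k" "\<exists>k. y \<in> low k"
  then obtain i j where "x \<in> low i" "y \<in> low j" by blast
  then have "x \<in> low (max i j)" "y \<in> low (max i j)"
    using low_mono[of i "max i j"] low_mono[of j "max i j"] by auto
  then show "\<exists>k. x \<oplus>\<^bsub>T\<^esub> y \<in> low k" using low_add by blast
qed

text \<open>A coefficient of S(V) # G in degree \<open>k\<close>, given by a multiset M and the
  group element \<open>g\<close>, is read off by the functional whose initial values are the
  indicator of M and \<open>g\<close>. This functional vanishes on the ideal, so the leading part
  has no nonzero coefficient in S(V) # G.\<close>

theorem pbw:
  assumes forms: "form_family G a" and inv: "hecke_invariant a" and jac: "hecke_jacobi a"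
    and x: "x \<in> hecke_ideal G \<rho> a" "x \<in> low (Suc k)" and g: "g \<in> carrier G"
  shows "part k x g \<in> sym_ideal"
proof -
  have xT: "x \<in> carrier T" using x(2) by (rule low_closed)
  have fin: "finite_support (part k x g)"
    using carrier_T_support[OF xT g] g unfolding part_def finite_support_def
    by (auto elim: rev_finite_subset)
  have "mset_content (part k x g) M = 0" for M
  proof (cases "size M = k")
    case False
    then show ?thesis
      using g unfolding mset_content_def part_def by (auto intro!: sum.neutral)
  next
    case True
    \<comment> \<open>It depends on the multiset only and is 0 on words with fewer than
      \<open>k\<close> letters, as \<open>nf_value_top\<close> demands.\<close>
    define \<beta> where "\<beta> w h = (if mset w = M \<and> h = g then 1 else 0 :: complex)" for w :: "'n list" and h
    interpret hecke_data G \<rho> a \<beta>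
      by unfold_locales (rule forms)
    have top: "nf_value a \<beta> w h = \<beta> w h" if "length w \<le> k" for w h
      using that by (rule nf_value_top[rotated 2]) (use True in \<open>auto simp: \<beta>_def\<close>)
    have L_eq: "L h (x h) = (if h = g then mset_content (part k x g) M else 0)" if h: "h \<in> carrier G" for h
    proof -
      have "L h (x h) = (\<Sum>w | x h w \<noteq> 0. x h w * \<beta> w h)"
        unfolding nf_functional_def tensor_lin_def
        using x(2) h by (intro sum.cong) (auto simp: top low_def less_Suc_eq_le)
      also have "\<dots> = (if h = g then \<Sum>w | x g w \<noteq> 0. if mset w = M then x g w else 0 else 0)"
        by (auto simp: \<beta>_def intro!: sum.cong)
      also have "(\<Sum>w | x g w \<noteq> 0. if mset w = M then x g w else 0) = mset_content (part k x g) M"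
      proof -
        have finx: "finite {w. x g w \<noteq> 0}"
          using carrier_T_support[OF xT g] by (simp add: finite_support_def)
        then have "(\<Sum>w | x g w \<noteq> 0. if mset w = M then x g w else 0) = sum (x g) ({w. x g w \<noteq> 0} \<inter> {w. mset w = M})"
          by (simp add: sum.inter_restrict)
        also have "\<dots> = (\<Sum>w | mset w = M. x g w)"
          by (rule sum.mono_neutral_left) (auto simp: finite_words_of_mset)
        also have "\<dots> = mset_content (part k x g) M"
          unfolding mset_content_def part_def using g True by (auto intro!: sum.cong)
        finally show ?thesis .
      qed
      finally show ?thesis .
    qed
    have "0 = nf_total x" using nf_total_ideal[OF inv jac x(1)] by simp
    also have "\<dots> = (\<Sum>h\<in>carrier G. if h = g then mset_content (part k x g) M else 0)"
      unfolding nf_total_def using L_eq by (rule sum.cong[OF refl])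
    also have "\<dots> = mset_content (part k x g) M"
      using finite_G g by simp
    finally show ?thesis by simp
  qed
  then show ?thesis using fin by (simp add: sym_ideal_iff)
qed

lemma hecke_ideal_closed: "x \<in> hecke_ideal G \<rho> a \<Longrightarrow> x \<in> carrier T"
  using ideal.Icarr[OF hecke_ideal] .

lemma hecke_ideal_add:
  "x \<in> hecke_ideal G \<rho> a \<Longrightarrow> y \<in> hecke_ideal G \<rho> a \<Longrightarrow> x \<oplus>\<^bsub>T\<^esub> y \<in> hecke_ideal G \<rho> a"
  using additive_subgroup.a_closed[OF ideal.axioms(1)[OF hecke_ideal]] .

lemma hecke_ideal_a_inv: "x \<in> hecke_ideal G \<rho> a \<Longrightarrow> \<ominus>\<^bsub>T\<^esub> x \<in> hecke_ideal G \<rho> a"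
  using additive_subgroup.a_inv_closed[OF ideal.axioms(1)[OF hecke_ideal]] .

lemma hecke_ideal_zero: "\<zero>\<^bsub>T\<^esub> \<in> hecke_ideal G \<rho> a"
  using additive_subgroup.zero_closed[OF ideal.axioms(1)[OF hecke_ideal]] .

lemma hecke_ideal_minus:
  "x \<in> hecke_ideal G \<rho> a \<Longrightarrow> y \<in> hecke_ideal G \<rho> a \<Longrightarrow> x \<ominus>\<^bsub>T\<^esub> y \<in> hecke_ideal G \<rho> a"
  unfolding a_minus_def by (intro hecke_ideal_add hecke_ideal_a_inv)

lemma hecke_ideal_mult:
  assumes "x \<in> hecke_ideal G \<rho> a" "y \<in> carrier T"
  shows "x \<otimes>\<^bsub>T\<^esub> y \<in> hecke_ideal G \<rho> a" "y \<otimes>\<^bsub>T\<^esub> x \<in> hecke_ideal G \<rho> a"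
  using ideal.I_r_closed[OF hecke_ideal] ideal.I_l_closed[OF hecke_ideal] assms by blast+

lemma hecke_ideal_smult: "x \<in> hecke_ideal G \<rho> a \<Longrightarrow> c \<odot>\<^bsub>T\<^esub> x \<in> hecke_ideal G \<rho> a"
  using hecke_ideal_closed smult_eq_mult hecke_ideal_mult(2) elem_closed finite_support_scale finite_support_word
  by metis

text \<open>Congruence modulo the ideal to an element of degree below \<open>k\<close>. For
  \<open>x\<close> of degree at most \<open>k\<close> this says that its class in F_k / F_{k-1} is
  zero.\<close>

definition reducible where
  "reducible a k x \<longleftrightarrow> (\<exists>y\<in>low k. x \<ominus>\<^bsub>T\<^esub> y \<in> hecke_ideal G \<rho> a)"

lemma reducible_zero: "reducible a k \<zero>\<^bsub>T\<^esub>"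
  unfolding reducible_def using low_zero hecke_ideal_zero T_zero_closed
  by (intro bexI[of _ "\<zero>\<^bsub>T\<^esub>"]) (auto simp: a_minus_def)

lemma reducible_add:
  assumes "reducible a k x" "reducible a k x'" "x \<in> carrier T" "x' \<in> carrier T"
  shows "reducible a k (x \<oplus>\<^bsub>T\<^esub> x')"
proof -
  obtain y y' where y: "y \<in> low k" "x \<ominus>\<^bsub>T\<^esub> y \<in> hecke_ideal G \<rho> a"
    "y' \<in> low k" "x' \<ominus>\<^bsub>T\<^esub> y' \<in> hecke_ideal G \<rho> a"
    using assms unfolding reducible_def by blast
  have yT: "y \<in> carrier T" "y' \<in> carrier T" using y low_closed by auto
  have "(x \<oplus>\<^bsub>T\<^esub> x') \<ominus>\<^bsub>T\<^esub> (y \<oplus>\<^bsub>T\<^esub> y') = (x \<ominus>\<^bsub>T\<^esub> y) \<oplus>\<^bsub>T\<^esub> (x' \<ominus>\<^bsub>T\<^esub> y')"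
    by (rule T_ext) (use assms yT in \<open>simp_all add: T_minus_apply T_add_apply T_closed\<close>)
  then show ?thesis
    unfolding reducible_def using y low_add hecke_ideal_add by metis
qed

lemma reducible_smult:
  assumes "reducible a k x" "x \<in> carrier T"
  shows "reducible a k (c \<odot>\<^bsub>T\<^esub> x)"
proof -
  obtain y where y: "y \<in> low k" "x \<ominus>\<^bsub>T\<^esub> y \<in> hecke_ideal G \<rho> a"
    using assms unfolding reducible_def by blast
  have "c \<odot>\<^bsub>T\<^esub> x \<ominus>\<^bsub>T\<^esub> c \<odot>\<^bsub>T\<^esub> y = c \<odot>\<^bsub>T\<^esub> (x \<ominus>\<^bsub>T\<^esub> y)"
    by (rule T_ext) (use assms y low_closed in \<open>simp_all add: T_minus_apply T_smult_apply T_smult_closed,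
      simp add: tensor_scale_def fun_eq_iff right_diff_distrib\<close>)
  then show ?thesis
    unfolding reducible_def using y low_smult hecke_ideal_smult by metis
qed

text \<open>Multiplying the relation by \<open>u\<close> on the left and by \<open>v\<close> and
  \<open>g\<close> on the right gives the exchange of two neighbours together with terms u h(v),
  which have two letters fewer. The product \<open>P\<close> lies in the ideal, so x - P is the
  wanted element of lower degree.\<close>

lemma reducible_swap:
  assumes g: "g \<in> carrier G"
  shows "reducible a (length u + length v + 2)
    (elem (word_tensor (u @ [i, j] @ v) - word_tensor (u @ [j, i] @ v)) g)"
proof -
  define s t where "s = (word_tensor u :: 'n list \<Rightarrow> complex)" and "t = (word_tensor v :: 'n list \<Rightarrow> complex)"
  define D where "D = tensor_of_vectors [axis i 1, axis j 1] - (tensor_of_vectors [axis j 1, axis i 1] :: 'n list \<Rightarrow> complex)"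
  define R where "R = hecke_relation G \<rho> a (axis i 1) (axis j 1)"
  define P where "P = elem s \<one> \<otimes>\<^bsub>T\<^esub> R \<otimes>\<^bsub>T\<^esub> elem t g"
  have sDt: "s \<odot>\<odot> D \<odot>\<odot> t = word_tensor (u @ [i, j] @ v) - word_tensor (u @ [j, i] @ v)"
    using tensor_of_axes[of "[i, j]"] tensor_of_axes[of "[j, i]"] unfolding s_def t_def D_def
    by (simp add: tensor_mult_diff_left tensor_mult_diff_right word_tensor_mult del: fun_apply_simps)
  define x where "x = elem (s \<odot>\<odot> D \<odot>\<odot> t) g"
  have fin: "finite_support s" "finite_support t" "finite_support D" "finite_support (s \<odot>\<odot> D \<odot>\<odot> t)"
    unfolding s_def t_def D_def by (auto intro!: finite_support_diff finite_support_mult)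
  have R: "R \<in> carrier T" "R \<in> hecke_ideal G \<rho> a"
    unfolding R_def by (simp_all add: hecke_relation_closed hecke_relation_in_ideal)
  have PI: "P \<in> hecke_ideal G \<rho> a"
    unfolding P_def using R fin by (intro hecke_ideal_mult elem_closed)
  have PT: "P \<in> carrier T" using PI by (rule hecke_ideal_closed)
  have xT: "x \<in> carrier T" unfolding x_def using fin by (intro elem_closed)
  have "x \<ominus>\<^bsub>T\<^esub> P \<in> low (length u + length v + 2)"
    unfolding low_def
  proof (intro CollectI conjI ballI allI impI)
    show "x \<ominus>\<^bsub>T\<^esub> P \<in> carrier T" using xT PT by simp
    fix k w assume k: "k \<in> carrier G" and "(x \<ominus>\<^bsub>T\<^esub> P) k w \<noteq> 0"
    define l where "l = k \<otimes> inv g"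
    have l: "l \<in> carrier G" "k = \<one> \<otimes> l \<otimes> g" using k g by (simp_all add: l_def m_assoc)
    have "P k = s \<odot>\<odot> R l \<odot>\<odot> act l t"
      unfolding P_def l(2) using sandwich_apply[OF one_closed g l(1) fin(1,2) R(1)] l(1) by (simp add: act_one)
    also have "R l = (if l = \<one> then D else 0) - tensor_scale (a l (axis i 1) (axis j 1)) (word_tensor [])"
      unfolding R_def D_def using l by (simp add: hecke_relation_eq)
    also have "s \<odot>\<odot> ((if l = \<one> then D else 0) - tensor_scale (a l (axis i 1) (axis j 1)) (word_tensor [])) \<odot>\<odot> act l t
       = (if l = \<one> then s \<odot>\<odot> D \<odot>\<odot> t else 0) - tensor_scale (a l (axis i 1) (axis j 1)) (s \<odot>\<odot> act l t)"
      by (simp add: tensor_mult_diff_left tensor_mult_diff_right tensor_mult_scale_left tensor_mult_scale_right act_one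
          del: fun_apply_simps)
    finally have "P k = (if l = \<one> then s \<odot>\<odot> D \<odot>\<odot> t else 0)
        - tensor_scale (a l (axis i 1) (axis j 1)) (s \<odot>\<odot> act l t)" .
    moreover have "x k = (if l = \<one> then s \<odot>\<odot> D \<odot>\<odot> t else 0)"
    proof -
      have "k = g \<longleftrightarrow> l = \<one>" using l g by (metis l_one l_def r_inv)
      then show ?thesis using k by (simp add: x_def elem_apply)
    qed
    ultimately have "(x \<ominus>\<^bsub>T\<^esub> P) k = tensor_scale (a l (axis i 1) (axis j 1)) (s \<odot>\<odot> act l t)"
      using T_minus_apply[OF xT PT k] by simp
    then have "(s \<odot>\<odot> act l t) w \<noteq> 0"
      using \<open>(x \<ominus>\<^bsub>T\<^esub> P) k w \<noteq> 0\<close> by (auto simp: tensor_scale_def)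
    then have "length w \<le> length u + length v"
    proof (rule tensor_mult_length_le)
      show "s w \<noteq> 0 \<Longrightarrow> length w \<le> length u" for w
        by (auto simp: s_def word_tensor_def split: if_splits)
      show "length w \<le> length v" if "act l t w \<noteq> 0" for w
        using that by (rule tensor_action_length) (auto simp: t_def word_tensor_def split: if_splits)
    qed
    then show "length w < length u + length v + 2" by simp
  qed
  moreover have "x \<ominus>\<^bsub>T\<^esub> (x \<ominus>\<^bsub>T\<^esub> P) = P"
    by (rule T_ext) (use xT PT in \<open>simp_all add: T_minus_apply\<close>)
  ultimately have "reducible a (length u + length v + 2) x"
    unfolding reducible_def using PI by metis
  then show ?thesis by (simp add: x_def sDt)
qed

text \<open>Sorting changes a homogeneous element only by lower terms, so symmetric relations die in
  gr A; this makes the canonical map from S(V) # G to gr A well defined. Each component is a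
  combination of differences of rearranged words, and each of these is a chain of exchanges of
  neighbours.\<close>

theorem sym_ideal_reducible:
  assumes x: "x \<in> carrier T" and hom: "\<And>g w. g \<in> carrier G \<Longrightarrow> x g w \<noteq> 0 \<Longrightarrow> length w = k"
    and sym: "\<And>g. g \<in> carrier G \<Longrightarrow> x g \<in> sym_ideal"
  shows "reducible a k x"
  using x
proof (rule T_components_induct)
  show "reducible a k \<zero>\<^bsub>T\<^esub>" by (rule reducible_zero)
  show "reducible a k (x \<oplus>\<^bsub>T\<^esub> y)"
    if "x \<in> carrier T" "y \<in> carrier T" "reducible a k x" "reducible a k y" for x y
    using that by (intro reducible_add)
  fix g assume g: "g \<in> carrier G"
  have words: "length w = k \<longrightarrow> reducible a k (elem (word_tensor w - word_tensor w') g)"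
    if "mset w = mset w'" for w w'
  proof -
    have "length w = length w' \<and> (length w = k \<longrightarrow> reducible a k (elem (word_tensor w - word_tensor w') g))"
      using that
    proof (rule swap_connected[rotated 3])
      fix w :: "'n list"
      have "word_tensor w - word_tensor w = (0 :: 'n list \<Rightarrow> complex)" by (rule diff_self)
      then have "elem (word_tensor w - word_tensor w) g = \<zero>\<^bsub>T\<^esub>" by (metis elem_zero)
      then show "length w = length w \<and> (length w = k \<longrightarrow> reducible a k (elem (word_tensor w - word_tensor w) g))"
        by (simp add: reducible_zero del: fun_apply_simps)
    next
      fix u v w :: "'n list"
      assume 1: "length u = length v \<and> (length u = k \<longrightarrow> reducible a k (elem (word_tensor u - word_tensor v) g))"
        and 2: "length v = length w \<and> (length v = k \<longrightarrow> reducible a k (elem (word_tensor v - word_tensor w) g))"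
      have "elem (word_tensor u - word_tensor w) g =
          elem (word_tensor u - word_tensor v) g \<oplus>\<^bsub>T\<^esub> elem (word_tensor v - word_tensor w) g"
        unfolding elem_add[symmetric] by (simp only: add_diff_eq diff_add_cancel)
      moreover have "elem (word_tensor u - word_tensor v) g \<in> carrier T" for u v
        by (intro elem_closed finite_support_diff finite_support_word)
      ultimately show "length u = length w \<and> (length u = k \<longrightarrow> reducible a k (elem (word_tensor u - word_tensor w) g))"
        using 1 2 reducible_add by auto
    next
      fix u v :: "'n list" and i j
      show "length (u @ [i, j] @ v) = length (u @ [j, i] @ v) \<and> (length (u @ [i, j] @ v) = k \<longrightarrow>
          reducible a k (elem (word_tensor (u @ [i, j] @ v) - word_tensor (u @ [j, i] @ v)) g))"
        using reducible_swap[OF g, of a u v i j] by auto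
    qed
    then show ?thesis by blast
  qed
  show "reducible a k (elem (x g) g)"
  proof (rule content_zero_induct[where N = "\<lambda>t. reducible a k (elem t g)"])
    show "finite_support (x g)" using x g by (rule carrier_T_support)
    show "mset_content (x g) M = 0" for M using sym[OF g] by (rule sym_ideal_content)
    show "reducible a k (elem 0 g)" by (simp only: elem_zero reducible_zero)
    show "reducible a k (elem (s + t) g)"
      if "finite_support s" "finite_support t" "reducible a k (elem s g)" "reducible a k (elem t g)" for s t
      using that by (simp only: elem_add reducible_add elem_closed)
    show "reducible a k (elem (tensor_scale c t) g)" if "finite_support t" "reducible a k (elem t g)" for c t
      using that by (simp only: elem_scale reducible_smult elem_closed)
    show "reducible a k (elem (word_tensor w - word_tensor w') g)" if "x g w \<noteq> 0" "mset w = mset w'" for w w'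
      using words[OF that(2)] hom[OF g that(1)] by blast
  qed
qed

section \<open>Necessity of invariance and of the Jacobi identity\<close>

lemma tensor_of_vectors_single_add:
  "tensor_of_vectors [p + q] = tensor_of_vectors [p] + (tensor_of_vectors [q] :: 'n list \<Rightarrow> complex)"
  by (simp add: tensor_incl_def fun_eq_iff flip: tensor_incl_eq)

lemma tensor_of_vectors_single_scale:
  "tensor_of_vectors [c *s p] = tensor_scale c (tensor_of_vectors [p] :: 'n list \<Rightarrow> complex)"
  by (simp add: tensor_incl_def tensor_scale_def fun_eq_iff flip: tensor_incl_eq)

lemma tensor_of_vectors_single_diff:
  "tensor_of_vectors [p - q] = tensor_of_vectors [p] - (tensor_of_vectors [q] :: 'n list \<Rightarrow> complex)"
  by (simp add: tensor_incl_def fun_eq_iff flip: tensor_incl_eq)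

lemma tensor_of_vectors_single_zero:
  assumes "tensor_of_vectors [p] = (0 :: 'n list \<Rightarrow> complex)"
  shows "p = 0"
proof -
  have "p $ i = 0" for i
    using fun_cong[OF assms, of "[i]"] by simp
  then show ?thesis by (simp add: vec_eq_iff)
qed

text \<open>The commutator of v and w conjugated by h is the commutator of h v and h w. The
  conjugated relation minus the relation for h v and h w therefore has no quadratic part: it is a
  combination of group elements inside the ideal, hence zero.\<close>

lemma hecke_invariant_necessary:
  assumes faithful: "\<And>x. x \<in> hecke_ideal G \<rho> a \<Longrightarrow> x \<in> low 2 \<Longrightarrow> x = \<zero>\<^bsub>T\<^esub>"
  shows "hecke_invariant a"
  unfolding hecke_invariant_def
proof (intro ballI allI)
  fix g h v w assume g: "g \<in> carrier G" and h: "h \<in> carrier G"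
  define one where "one = (word_tensor [] :: 'n list \<Rightarrow> complex)"
  define R where "R v w = hecke_relation G \<rho> a v w" for v w
  have R: "R v w \<in> hecke_ideal G \<rho> a" "R v w \<in> carrier T" for v w
    unfolding R_def by (simp_all add: hecke_relation_closed hecke_relation_in_ideal)
  define P where "P = elem one h \<otimes>\<^bsub>T\<^esub> R v w \<otimes>\<^bsub>T\<^esub> elem one (inv h)"
  define z where "z = P \<ominus>\<^bsub>T\<^esub> R (\<rho> h *v v) (\<rho> h *v w)"
  have PI: "P \<in> hecke_ideal G \<rho> a"
    unfolding P_def one_def by (intro hecke_ideal_mult elem_closed R) simp_all
  then have zI: "z \<in> hecke_ideal G \<rho> a"
    unfolding z_def using R hecke_ideal_minus by blast
  have z: "z (h \<otimes> l \<otimes> inv h) = tensor_scale (a (h \<otimes> l \<otimes> inv h) (\<rho> h *v v) (\<rho> h *v w) - a l v w) one"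
    if l: "l \<in> carrier G" for l
  proof -
    have "P (h \<otimes> l \<otimes> inv h) = one \<odot>\<odot> act h (R v w l) \<odot>\<odot> act (h \<otimes> l) one"
      unfolding P_def by (rule sandwich_apply) (use h l R in \<open>simp_all add: one_def\<close>)
    also have "\<dots> = act h (R v w l)"
      by (simp add: one_def tensor_action_one)
    also have "\<dots> = (if l = \<one> then tensor_of_vectors [\<rho> h *v v, \<rho> h *v w] - tensor_of_vectors [\<rho> h *v w, \<rho> h *v v] else 0)
        - tensor_scale (a l v w) one"
      using l unfolding R_def hecke_relation_eq one_def
      by (simp add: tensor_action_diff tensor_action_vectors tensor_action_scale tensor_action_one del: fun_apply_simps)
    finally have P: "P (h \<otimes> l \<otimes> inv h) = \<dots>" .
    have one_iff: "h \<otimes> l \<otimes> inv h = \<one> \<longleftrightarrow> l = \<one>"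
      using h l inv_solve_right' by fastforce
    have "z (h \<otimes> l \<otimes> inv h) = P (h \<otimes> l \<otimes> inv h) - R (\<rho> h *v v) (\<rho> h *v w) (h \<otimes> l \<otimes> inv h)"
      unfolding z_def using h l PI hecke_ideal_closed R by (intro T_minus_apply) auto
    also have "\<dots> = tensor_scale (a (h \<otimes> l \<otimes> inv h) (\<rho> h *v v) (\<rho> h *v w)) one - tensor_scale (a l v w) one"
      unfolding P using h l by (simp add: R_def hecke_relation_eq one_iff one_def del: fun_apply_simps)
    finally show ?thesis by (simp add: tensor_scale_def fun_eq_iff left_diff_distrib)
  qed
  have z': "z k = tensor_scale (a k (\<rho> h *v v) (\<rho> h *v w) - a (inv h \<otimes> k \<otimes> h) v w) one"
    if k: "k \<in> carrier G" for k
  proof -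
    have "h \<otimes> (inv h \<otimes> k \<otimes> h) \<otimes> inv h = h \<otimes> inv h \<otimes> k \<otimes> (h \<otimes> inv h)"
      using h k by (simp only: m_assoc m_closed inv_closed)
    then have "h \<otimes> (inv h \<otimes> k \<otimes> h) \<otimes> inv h = k" using h k by simp
    then show ?thesis using z[of "inv h \<otimes> k \<otimes> h"] h k by simp
  qed
  have "z \<in> low 2"
    unfolding low_def using hecke_ideal_closed[OF zI]
    by (auto simp: z' tensor_scale_def one_def word_tensor_def split: if_splits)
  then have "z = \<zero>\<^bsub>T\<^esub>" using faithful zI by blast
  then have "z g [] = 0" using g by (simp add: T_zero)
  then show "a (inv h \<otimes> g \<otimes> h) v w = a g (\<rho> h *v v) (\<rho> h *v w)"
    using z'[OF g] by (simp add: tensor_scale_def one_def word_tensor_def)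
qed

text \<open>\<open>B u v w\<close> is the commutator of u with a relation. In the cyclic sum the
  cubic parts cancel, and the component at k is the single vector \<open>s k\<close>, the left-hand
  side of the Jacobi identity. So an element of degree one lies in the ideal and must
  vanish.\<close>

lemma hecke_jacobi_necessary:
  assumes faithful: "\<And>x. x \<in> hecke_ideal G \<rho> a \<Longrightarrow> x \<in> low 2 \<Longrightarrow> x = \<zero>\<^bsub>T\<^esub>"
  shows "hecke_jacobi a"
  unfolding hecke_jacobi_def
proof (intro ballI allI)
  fix g u v w assume g: "g \<in> carrier G"
  define R where "R v w = hecke_relation G \<rho> a v w" for v w
  define V where "V u = elem (tensor_of_vectors [u]) \<one>" for u
  have R: "R v w \<in> hecke_ideal G \<rho> a" "R v w \<in> carrier T" for v w
    unfolding R_def by (simp_all add: hecke_relation_closed hecke_relation_in_ideal)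
  have V: "V u \<in> carrier T" for u unfolding V_def by (intro elem_closed) simp
  define B where "B u v w = V u \<otimes>\<^bsub>T\<^esub> R v w \<ominus>\<^bsub>T\<^esub> R v w \<otimes>\<^bsub>T\<^esub> V u" for u v w
  have BI: "B u v w \<in> hecke_ideal G \<rho> a" for u v w
    unfolding B_def by (intro hecke_ideal_minus hecke_ideal_mult R V)
  have BT: "B u v w \<in> carrier T" for u v w using BI by (rule hecke_ideal_closed)
  define z where "z = B u v w \<oplus>\<^bsub>T\<^esub> B v w u \<oplus>\<^bsub>T\<^esub> B w u v"
  have zI: "z \<in> hecke_ideal G \<rho> a" unfolding z_def by (intro hecke_ideal_add BI)
  \<comment> \<open>The double commutator [u,[v,w]] written out; its cyclic sum is zero.\<close>
  let ?c = "\<lambda>u v w. tensor_of_vectors [u, v, w] - tensor_of_vectors [u, w, v]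
      - (tensor_of_vectors [v, w, u] - tensor_of_vectors [w, v, u])"
  have B: "B u v w k = (if k = \<one> then ?c u v w else 0) + tensor_of_vectors [a k v w *s (\<rho> k *v u - u)]"
    if k: "k \<in> carrier G" for u v w k
  proof -
    have R_eq: "R v w k = (if k = \<one> then tensor_of_vectors [v, w] - tensor_of_vectors [w, v] else 0)
        - tensor_scale (a k v w) (word_tensor [])"
      using k by (simp add: R_def hecke_relation_eq)
    have app: "tensor_of_vectors [p] \<odot>\<odot> tensor_of_vectors [q, r] = tensor_of_vectors [p, q, r]"
      "tensor_of_vectors [q, r] \<odot>\<odot> tensor_of_vectors [p] = tensor_of_vectors [q, r, p]" for p q r :: "complex^'n"
      using tensor_of_vectors_append[of "[p]" "[q, r]"] tensor_of_vectors_append[of "[q, r]" "[p]"] by simp_all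
    have "(V u \<otimes>\<^bsub>T\<^esub> R v w) k = tensor_of_vectors [u] \<odot>\<odot> R v w k"
      unfolding V_def using elem_mult_left[OF one_closed k _ R(2)] k by (simp add: act_one)
    moreover have "(R v w \<otimes>\<^bsub>T\<^esub> V u) k = R v w k \<odot>\<odot> tensor_of_vectors [\<rho> k *v u]"
      unfolding V_def using elem_mult_right[OF one_closed k _ R(2)] k by (simp add: tensor_action_vectors)
    ultimately have "B u v w k = tensor_of_vectors [u] \<odot>\<odot> R v w k - R v w k \<odot>\<odot> tensor_of_vectors [\<rho> k *v u]"
      unfolding B_def using k V R by (simp add: T_minus_apply T_closed)
    also have "\<dots> = (if k = \<one> then ?c u v w else 0) + tensor_of_vectors [a k v w *s (\<rho> k *v u - u)]"
      unfolding R_eq tensor_of_vectors_single_scale tensor_of_vectors_single_diff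
      by (simp add: tensor_mult_diff_left tensor_mult_diff_right tensor_mult_scale_left tensor_mult_scale_right
          app del: fun_apply_simps)
        (simp add: fun_eq_iff tensor_scale_def algebra_simps)
    finally show ?thesis .
  qed
  define s where "s k = a k u v *s (\<rho> k *v w - w) + a k v w *s (\<rho> k *v u - u) + a k w u *s (\<rho> k *v v - v)" for k
  have z: "z k = tensor_of_vectors [s k]" if k: "k \<in> carrier G" for k
    unfolding z_def s_def tensor_of_vectors_single_add
    using k by (simp add: T_add_apply T_closed BT B del: fun_apply_simps)
  have "z \<in> low 2"
    unfolding low_def
  proof (intro CollectI conjI ballI allI impI)
    show "z \<in> carrier T" using zI by (rule hecke_ideal_closed)
    fix k i assume "k \<in> carrier G" "z k i \<noteq> 0"
    then show "length i < 2"
      using tensor_of_vectors_length[of i "[s k]"] by (cases "length i = 1") (auto simp: z)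
  qed
  then have "z = \<zero>\<^bsub>T\<^esub>" using faithful zI by blast
  then have "tensor_of_vectors [s g] = (0 :: 'n list \<Rightarrow> complex)"
    using z[OF g] g by (simp add: T_zero)
  then have "s g = 0" by (rule tensor_of_vectors_single_zero)
  then show "a g u v *s (\<rho> g *v w - w) + a g v w *s (\<rho> g *v u - u) + a g w u *s (\<rho> g *v v - v) = 0"
    by (simp add: s_def)
qed

end

section \<open>The associated graded algebra\<close>

text \<open>Finite sums in a quotient are images of finite sums upstairs. \<open>S\<close> may be a
  proper part of the carrier of \<open>M\<close>, as for the lift of F_k, and \<open>N\<close> is a
  record whose addition is known only on representatives, so its monoid laws have to be derived
  before \<open>finsum\<close> can be handled.\<close>

lemma abelian_monoid_image:
  assumes M: "abelian_monoid M" and S: "S \<subseteq> carrier M" "\<zero>\<^bsub>M\<^esub> \<in> S"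
    "\<And>x y. x \<in> S \<Longrightarrow> y \<in> S \<Longrightarrow> x \<oplus>\<^bsub>M\<^esub> y \<in> S"
    and N: "carrier N = p ` S" "\<zero>\<^bsub>N\<^esub> = p \<zero>\<^bsub>M\<^esub>"
    "\<And>x y. x \<in> S \<Longrightarrow> y \<in> S \<Longrightarrow> p x \<oplus>\<^bsub>N\<^esub> p y = p (x \<oplus>\<^bsub>M\<^esub> y)"
  shows "abelian_monoid N"
    and "f \<in> I \<rightarrow> S \<Longrightarrow> finsum N (\<lambda>i. p (f i)) I = p (finsum M f I)"
proof -
  interpret M: abelian_monoid M by (rule M)
  have SM: "x \<in> S \<Longrightarrow> x \<in> carrier M" for x using S by blast
  show N_monoid: "abelian_monoid N"
    by (rule abelian_monoidI) (auto simp: N S SM M.a_assoc, simp_all add: SM M.a_comm)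
  then interpret N: abelian_monoid N .
  assume "f \<in> I \<rightarrow> S"
  then show "finsum N (\<lambda>i. p (f i)) I = p (finsum M f I)"
  proof (induction I rule: infinite_finite_induct)
    case (insert i I)
    have "finsum M f J \<in> S" if "finite J" "J \<subseteq> I" for J
      using that
    proof (induction J rule: finite_induct)
      case (insert j J)
      then show ?case using \<open>f \<in> insert i I \<rightarrow> S\<close> SM
        by (subst M.finsum_insert) (auto simp: Pi_def subset_iff intro!: S)
    qed (simp add: S)
    then have "finsum M f I \<in> S" using insert by blast
    then show ?case
    proof -
      assume sum: "finsum M f I \<in> S"
      have "finsum N (\<lambda>i. p (f i)) (insert i I) = p (f i) \<oplus>\<^bsub>N\<^esub> finsum N (\<lambda>i. p (f i)) I"
        using insert.hyps insert.prems by (subst N.finsum_insert) (auto simp: N(1) Pi_def)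
      also have "\<dots> = p (f i \<oplus>\<^bsub>M\<^esub> finsum M f I)"
        using insert sum N(3) by (simp add: Pi_def)
      also have "f i \<oplus>\<^bsub>M\<^esub> finsum M f I = finsum M f (insert i I)"
        using insert.hyps insert.prems SM by (subst M.finsum_insert) (auto simp: Pi_def)
      finally show ?thesis .
    qed
  qed (simp_all add: N M.finsum_infinite N.finsum_infinite)
qed

section \<open>Cosets of the Hecke ideal and the pieces F_k / F_{k-1}\<close>

context finite_group_rep
begin

abbreviation A where "A a \<equiv> hecke_quotient G \<rho> a"
abbreviation I where "I a \<equiv> hecke_ideal G \<rho> a"
abbreviation F where "F a \<equiv> hecke_filtration G \<rho> a"
abbreviation cos where "cos a x \<equiv> I a +>\<^bsub>T\<^esub> x"

lemma A_simps:
  "\<zero>\<^bsub>A a\<^esub> = I a" "\<one>\<^bsub>A a\<^esub> = cos a \<one>\<^bsub>T\<^esub>"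
  "X \<oplus>\<^bsub>A a\<^esub> Y = X <+>\<^bsub>T\<^esub> Y" "X \<otimes>\<^bsub>A a\<^esub> Y = rcoset_mult T (I a) X Y"
  "c \<odot>\<^bsub>A a\<^esub> X = (\<Union>x\<in>X. cos a (c \<odot>\<^bsub>T\<^esub> x))"
  by (simp_all add: hecke_quotient_def quot_alg_def)

lemma cos_add: "x \<in> carrier T \<Longrightarrow> y \<in> carrier T \<Longrightarrow> cos a x \<oplus>\<^bsub>A a\<^esub> cos a y = cos a (x \<oplus>\<^bsub>T\<^esub> y)"
  by (simp add: A_simps ideal.a_rcos_sum[OF hecke_ideal])

lemma cos_mult: "x \<in> carrier T \<Longrightarrow> y \<in> carrier T \<Longrightarrow> cos a x \<otimes>\<^bsub>A a\<^esub> cos a y = cos a (x \<otimes>\<^bsub>T\<^esub> y)"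
  by (simp add: A_simps ideal.rcoset_mult_add[OF hecke_ideal])

lemma cos_eq: "x \<in> carrier T \<Longrightarrow> y \<in> carrier T \<Longrightarrow> cos a x = cos a y \<longleftrightarrow> x \<ominus>\<^bsub>T\<^esub> y \<in> I a"
  using T.quotient_eq_iff_same_a_r_cos[OF hecke_ideal] by blast

lemma cos_zero: "cos a \<zero>\<^bsub>T\<^esub> = I a"
  using ideal.Icarr[OF hecke_ideal] by (intro T.a_coset_add_zero) blast

lemma cos_elem: "y \<in> cos a x \<Longrightarrow> x \<in> carrier T \<Longrightarrow> y \<in> carrier T \<and> cos a y = cos a x"
proof -
  assume "y \<in> cos a x" and x: "x \<in> carrier T"
  then obtain i where i: "i \<in> I a" "y = i \<oplus>\<^bsub>T\<^esub> x" by (auto simp: a_r_coset_def')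
  have iT: "i \<in> carrier T" using i(1) by (rule hecke_ideal_closed)
  have "y \<ominus>\<^bsub>T\<^esub> x = i"
    unfolding i(2) using iT x by (simp add: a_minus_def T.a_assoc T.r_neg)
  then show ?thesis using i iT x cos_eq by simp
qed

lemma cos_self: "x \<in> carrier T \<Longrightarrow> x \<in> cos a x"
  unfolding a_r_coset_def' by (rule UN_I[OF hecke_ideal_zero]) simp

text \<open>Scalar multiplication in the quotient is a union over all members of the coset; it is a
  single coset because the ideal is closed under scalars.\<close>

lemma cos_smult:
  assumes x: "x \<in> carrier T"
  shows "c \<odot>\<^bsub>A a\<^esub> cos a x = cos a (c \<odot>\<^bsub>T\<^esub> x)"
proof -
  have "cos a (c \<odot>\<^bsub>T\<^esub> y) = cos a (c \<odot>\<^bsub>T\<^esub> x)" if "y \<in> cos a x" for y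
  proof -
    have y: "y \<in> carrier T" "y \<ominus>\<^bsub>T\<^esub> x \<in> I a" using cos_elem[OF that x] cos_eq x by auto
    have "c \<odot>\<^bsub>T\<^esub> y \<ominus>\<^bsub>T\<^esub> c \<odot>\<^bsub>T\<^esub> x = c \<odot>\<^bsub>T\<^esub> (y \<ominus>\<^bsub>T\<^esub> x)"
      by (rule T_ext) (use x y in \<open>simp_all add: T_minus_apply T_smult_apply T_smult_closed,
        simp add: tensor_scale_def fun_eq_iff right_diff_distrib\<close>)
    then have "c \<odot>\<^bsub>T\<^esub> y \<ominus>\<^bsub>T\<^esub> c \<odot>\<^bsub>T\<^esub> x \<in> I a" using hecke_ideal_smult[OF y(2)] by simp
    then show ?thesis
      by (simp only: cos_eq[OF T_smult_closed[OF y(1)] T_smult_closed[OF x]])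
  qed
  then have "(\<lambda>y. cos a (c \<odot>\<^bsub>T\<^esub> y)) ` cos a x = {cos a (c \<odot>\<^bsub>T\<^esub> x)}"
    using cos_self[OF x] by blast
  then show ?thesis unfolding A_simps(5) by simp
qed

lemma low_Suc: "low (Suc k) = carrier G \<rightarrow>\<^sub>E tensor_degree_le k"
  by (auto simp: low_def carrier_T PiE_def tensor_degree_le_def less_Suc_eq_le)

lemma filtration_eq: "F a k = cos a ` low (Suc k)"
  unfolding hecke_filtration_def low_Suc by blast

lemma filt_prev_eq: "filt_prev (A a) (F a) k = cos a ` low k"
  by (cases k) (simp_all add: filt_prev_def filtration_eq low_0 cos_zero A_simps)

text \<open>An element of F_k / F_{k-1} is a coset of cosets. Written out, it consists of the cosets
  of all p + x with p of degree below \<open>k\<close>.\<close>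

definition gr_class where
  "gr_class a k x = (\<lambda>p. cos a (p \<oplus>\<^bsub>T\<^esub> x)) ` low k"

lemma gr_class_coset:
  assumes "x \<in> carrier T"
  shows "filt_prev (A a) (F a) k +>\<^bsub>A a\<^esub> cos a x = gr_class a k x"
  unfolding filt_prev_eq a_r_coset_def'[of "A a"] gr_class_def
  using assms low_closed by (auto simp: cos_add)

text \<open>Reduces two successive quotients, by the ideal and then by F_{k-1}, to one condition on
  representatives in T(V) # G.\<close>

lemma gr_class_eq:
  assumes x: "x \<in> carrier T" and y: "y \<in> carrier T"
  shows "gr_class a k x = gr_class a k y \<longleftrightarrow> reducible a k (x \<ominus>\<^bsub>T\<^esub> y)"
proof
  assume eq: "gr_class a k x = gr_class a k y"
  have "cos a (\<zero>\<^bsub>T\<^esub> \<oplus>\<^bsub>T\<^esub> x) \<in> gr_class a k x"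
    unfolding gr_class_def using low_zero by blast
  then have "cos a (\<zero>\<^bsub>T\<^esub> \<oplus>\<^bsub>T\<^esub> x) \<in> gr_class a k y"
    unfolding eq .
  then obtain p where p: "p \<in> low k" "cos a x = cos a (p \<oplus>\<^bsub>T\<^esub> y)"
    using x by (auto simp: gr_class_def)
  then have "x \<ominus>\<^bsub>T\<^esub> (p \<oplus>\<^bsub>T\<^esub> y) \<in> I a" using x y low_closed cos_eq T_closed by metis
  moreover have "x \<ominus>\<^bsub>T\<^esub> (p \<oplus>\<^bsub>T\<^esub> y) = x \<ominus>\<^bsub>T\<^esub> y \<ominus>\<^bsub>T\<^esub> p"
    by (rule T_ext) (use x y low_closed[OF p(1)] in \<open>simp_all add: T_minus_apply T_add_apply T_closed\<close>)
  ultimately show "reducible a k (x \<ominus>\<^bsub>T\<^esub> y)" using p by (auto simp: reducible_def)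
next
  assume "reducible a k (x \<ominus>\<^bsub>T\<^esub> y)"
  then obtain q where q: "q \<in> low k" "x \<ominus>\<^bsub>T\<^esub> y \<ominus>\<^bsub>T\<^esub> q \<in> I a" by (auto simp: reducible_def)
  have qT: "q \<in> carrier T" using q(1) by (rule low_closed)
  have 1: "cos a (p \<oplus>\<^bsub>T\<^esub> x) = cos a ((p \<oplus>\<^bsub>T\<^esub> q) \<oplus>\<^bsub>T\<^esub> y)" if "p \<in> low k" for p
  proof -
    have pT: "p \<in> carrier T" using that by (rule low_closed)
    have "(p \<oplus>\<^bsub>T\<^esub> x) \<ominus>\<^bsub>T\<^esub> ((p \<oplus>\<^bsub>T\<^esub> q) \<oplus>\<^bsub>T\<^esub> y) = x \<ominus>\<^bsub>T\<^esub> y \<ominus>\<^bsub>T\<^esub> q"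
      by (rule T_ext) (use x y pT qT in \<open>simp_all add: T_minus_apply T_add_apply T_closed\<close>)
    then show ?thesis using q x y pT qT by (simp add: cos_eq T_closed)
  qed
  have 2: "cos a (p \<oplus>\<^bsub>T\<^esub> y) = cos a ((p \<ominus>\<^bsub>T\<^esub> q) \<oplus>\<^bsub>T\<^esub> x)" if "p \<in> low k" for p
  proof -
    have pT: "p \<in> carrier T" using that by (rule low_closed)
    have "p \<ominus>\<^bsub>T\<^esub> q \<in> low k" unfolding a_minus_def using that q low_add low_a_inv by blast
    from 1[OF this] have "cos a ((p \<ominus>\<^bsub>T\<^esub> q) \<oplus>\<^bsub>T\<^esub> x) = cos a ((p \<ominus>\<^bsub>T\<^esub> q) \<oplus>\<^bsub>T\<^esub> q \<oplus>\<^bsub>T\<^esub> y)" .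
    moreover have "(p \<ominus>\<^bsub>T\<^esub> q) \<oplus>\<^bsub>T\<^esub> q = p"
      by (rule T_ext) (use pT qT in \<open>simp_all add: T_minus_apply T_add_apply T_closed\<close>)
    ultimately show ?thesis by simp
  qed
  show "gr_class a k x = gr_class a k y"
    unfolding gr_class_def
  proof (intro equalityI image_subsetI)
    fix p assume p: "p \<in> low k"
    show "cos a (p \<oplus>\<^bsub>T\<^esub> x) \<in> (\<lambda>p. cos a (p \<oplus>\<^bsub>T\<^esub> y)) ` low k"
      unfolding 1[OF p] using p q low_add by blast
    have "p \<ominus>\<^bsub>T\<^esub> q \<in> low k" unfolding a_minus_def using p q low_add low_a_inv by blast
    then show "cos a (p \<oplus>\<^bsub>T\<^esub> y) \<in> (\<lambda>p. cos a (p \<oplus>\<^bsub>T\<^esub> x)) ` low k"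
      unfolding 2[OF p] by blast
  qed
qed

lemma gr_class_low:
  assumes "x \<in> carrier T" "p \<in> low k"
  shows "gr_class a k (p \<oplus>\<^bsub>T\<^esub> x) = gr_class a k x"
proof -
  have pT: "p \<in> carrier T" using assms(2) by (rule low_closed)
  have "p \<oplus>\<^bsub>T\<^esub> x \<ominus>\<^bsub>T\<^esub> x \<ominus>\<^bsub>T\<^esub> p = \<zero>\<^bsub>T\<^esub>"
    by (rule T_ext) (use assms pT in \<open>simp_all add: T_minus_apply T_add_apply T_closed, simp add: T_zero\<close>)
  then have "reducible a k (p \<oplus>\<^bsub>T\<^esub> x \<ominus>\<^bsub>T\<^esub> x)"
    unfolding reducible_def using assms hecke_ideal_zero by metis
  then show ?thesis using assms pT by (simp add: gr_class_eq T_closed)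
qed

abbreviation P where "P a k \<equiv> gr_piece (A a) (F a) k"

lemma gr_piece_simps:
  "\<zero>\<^bsub>P a k\<^esub> = filt_prev (A a) (F a) k"
  "X \<oplus>\<^bsub>P a k\<^esub> Y = X <+>\<^bsub>A a\<^esub> Y"
  "c \<odot>\<^bsub>P a k\<^esub> X = (\<Union>x\<in>X. filt_prev (A a) (F a) k +>\<^bsub>A a\<^esub> (c \<odot>\<^bsub>A a\<^esub> x))"
  by (simp_all add: gr_piece_def quot_alg_def set_add_def' a_r_coset_def')

lemma gr_piece_carrier: "carrier (P a k) = gr_class a k ` low (Suc k)"
proof -
  have "carrier (P a k) = (\<lambda>X. filt_prev (A a) (F a) k +>\<^bsub>A a\<^esub> X) ` F a k"
    by (auto simp: gr_piece_def quot_alg_def A_RCOSETS_def' a_r_coset_def')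
  also have "\<dots> = (\<lambda>X. filt_prev (A a) (F a) k +>\<^bsub>A a\<^esub> X) ` (cos a ` low (Suc k))"
    by (rule arg_cong[where f = "image _", OF filtration_eq])
  also have "\<dots> = gr_class a k ` low (Suc k)"
    unfolding image_image by (rule image_cong) (auto simp: gr_class_coset low_closed)
  finally show ?thesis .
qed

lemma gr_piece_zero: "\<zero>\<^bsub>P a k\<^esub> = gr_class a k \<zero>\<^bsub>T\<^esub>"
  unfolding gr_piece_simps filt_prev_eq gr_class_def by (rule image_cong) (auto simp: low_closed)

lemma gr_piece_add:
  assumes x: "x \<in> carrier T" and y: "y \<in> carrier T"
  shows "gr_class a k x \<oplus>\<^bsub>P a k\<^esub> gr_class a k y = gr_class a k (x \<oplus>\<^bsub>T\<^esub> y)"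
proof -
  have 1: "cos a (p \<oplus>\<^bsub>T\<^esub> x) \<oplus>\<^bsub>A a\<^esub> cos a (q \<oplus>\<^bsub>T\<^esub> y) = cos a ((p \<oplus>\<^bsub>T\<^esub> q) \<oplus>\<^bsub>T\<^esub> (x \<oplus>\<^bsub>T\<^esub> y))"
    if "p \<in> low k" "q \<in> low k" for p q
  proof -
    have pT: "p \<in> carrier T" "q \<in> carrier T" using that low_closed by auto
    then have "(p \<oplus>\<^bsub>T\<^esub> x) \<oplus>\<^bsub>T\<^esub> (q \<oplus>\<^bsub>T\<^esub> y) = (p \<oplus>\<^bsub>T\<^esub> q) \<oplus>\<^bsub>T\<^esub> (x \<oplus>\<^bsub>T\<^esub> y)"
      using x y by (simp add: T.add.m_ac T_closed)
    then show ?thesis using pT x y by (simp add: cos_add T_closed)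
  qed
  show ?thesis
    unfolding gr_piece_simps set_add_def'[of "A a"] gr_class_def
  proof (intro equalityI subsetI)
    fix z assume "z \<in> (\<Union>h\<in>(\<lambda>p. cos a (p \<oplus>\<^bsub>T\<^esub> x)) ` low k.
        \<Union>l\<in>(\<lambda>p. cos a (p \<oplus>\<^bsub>T\<^esub> y)) ` low k. {h \<oplus>\<^bsub>A a\<^esub> l})"
    then show "z \<in> (\<lambda>p. cos a (p \<oplus>\<^bsub>T\<^esub> (x \<oplus>\<^bsub>T\<^esub> y))) ` low k"
      using 1 low_add by auto
  next
    fix z assume "z \<in> (\<lambda>p. cos a (p \<oplus>\<^bsub>T\<^esub> (x \<oplus>\<^bsub>T\<^esub> y))) ` low k"
    then obtain p where p: "p \<in> low k" "z = cos a (p \<oplus>\<^bsub>T\<^esub> (x \<oplus>\<^bsub>T\<^esub> y))" by auto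
    then have "z = cos a (p \<oplus>\<^bsub>T\<^esub> x) \<oplus>\<^bsub>A a\<^esub> cos a (\<zero>\<^bsub>T\<^esub> \<oplus>\<^bsub>T\<^esub> y)"
      using 1[OF p(1) low_zero] low_closed by simp
    then show "z \<in> (\<Union>h\<in>(\<lambda>p. cos a (p \<oplus>\<^bsub>T\<^esub> x)) ` low k.
        \<Union>l\<in>(\<lambda>p. cos a (p \<oplus>\<^bsub>T\<^esub> y)) ` low k. {h \<oplus>\<^bsub>A a\<^esub> l})"
      using p(1) low_zero by blast
  qed
qed

lemma gr_piece_smult:
  assumes x: "x \<in> carrier T"
  shows "c \<odot>\<^bsub>P a k\<^esub> gr_class a k x = gr_class a k (c \<odot>\<^bsub>T\<^esub> x)"
proof -
  have "filt_prev (A a) (F a) k +>\<^bsub>A a\<^esub> (c \<odot>\<^bsub>A a\<^esub> cos a (p \<oplus>\<^bsub>T\<^esub> x)) = gr_class a k (c \<odot>\<^bsub>T\<^esub> x)"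
    if p: "p \<in> low k" for p
  proof -
    have pT: "p \<in> carrier T" using p by (rule low_closed)
    have "c \<odot>\<^bsub>T\<^esub> (p \<oplus>\<^bsub>T\<^esub> x) = c \<odot>\<^bsub>T\<^esub> p \<oplus>\<^bsub>T\<^esub> c \<odot>\<^bsub>T\<^esub> x"
      by (rule T_ext) (use x pT in \<open>simp_all add: T_add_apply T_smult_apply T_smult_closed T_closed,
        simp add: tensor_scale_def fun_eq_iff distrib_left\<close>)
    then show ?thesis
      using x pT low_smult[OF p] by (simp add: cos_smult T_closed gr_class_coset T_smult_closed gr_class_low)
  qed
  then show ?thesis
    unfolding gr_piece_simps using low_zero by (auto simp: gr_class_def[of a k x])
qed

text \<open>Degree at most i - 1 times degree at most j stays below i + j, in either order. This
  gain of one from a single factor makes the product of graded pieces independent of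
  representatives.\<close>

lemma low_mult:
  assumes x: "x \<in> low i" and y: "y \<in> low (Suc j)"
  shows "x \<otimes>\<^bsub>T\<^esub> y \<in> low (i + j)" "y \<otimes>\<^bsub>T\<^esub> x \<in> low (i + j)"
proof -
  have xT: "x \<in> carrier T" and yT: "y \<in> carrier T" using x y low_closed by auto
  have gen: "length w < i + j"
    if uv: "u \<in> carrier T" "v \<in> carrier T" "k \<in> carrier G" "(u \<otimes>\<^bsub>T\<^esub> v) k w \<noteq> 0"
      and or: "u \<in> low i \<and> v \<in> low (Suc j) \<or> u \<in> low (Suc j) \<and> v \<in> low i" for u v k w
  proof -
    have "(\<Sum>g\<in>carrier G. (u g \<odot>\<odot> act g (v (inv g \<otimes> k))) w) \<noteq> 0"
      using uv by (simp add: T_mult_apply sum_fun_apply)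
    then obtain g where g: "g \<in> carrier G" and "(u g \<odot>\<odot> act g (v (inv g \<otimes> k))) w \<noteq> 0"
      by (rule sum.not_neutral_contains_not_neutral)
    then have "(\<Sum>n\<le>length w. u g (take n w) * act g (v (inv g \<otimes> k)) (drop n w)) \<noteq> 0"
      by (simp add: tensor_mult_def)
    then obtain n where n: "n \<in> {..length w}" "u g (take n w) * act g (v (inv g \<otimes> k)) (drop n w) \<noteq> 0"
      by (rule sum.not_neutral_contains_not_neutral)
    from n(2) have "act g (v (inv g \<otimes> k)) (drop n w) \<noteq> 0" by auto
    then obtain w' where w': "length w' = length (drop n w)" "v (inv g \<otimes> k) w' \<noteq> 0"
      by (rule tensor_action_length)
    have "inv g \<otimes> k \<in> carrier G" using g uv by simp
    then have "length (take n w) < i \<and> length w' < Suc j \<or> length (take n w) < Suc j \<and> length w' < i"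
    proof -
      have "u g (take n w) \<noteq> 0" using n(2) by auto
      then show ?thesis using or g w'(2) \<open>inv g \<otimes> k \<in> carrier G\<close> unfolding low_def by blast
    qed
    then show ?thesis using n(1) w'(1) by auto
  qed
  show "x \<otimes>\<^bsub>T\<^esub> y \<in> low (i + j)"
    unfolding low_def using gen[OF xT yT] x y xT yT by (auto simp: T_closed)
  show "y \<otimes>\<^bsub>T\<^esub> x \<in> low (i + j)"
    unfolding low_def using gen[OF yT xT] x y xT yT by (auto simp: T_closed)
qed

text \<open>Replacing x by p + x and y by q + y changes the product by p (q + y) + x q, which has
  degree below i + j. Hence the union over representatives is one class.\<close>

lemma gr_piece_mult_class:
  assumes x: "x \<in> low (Suc i)" and y: "y \<in> low (Suc j)"
  shows "gr_piece_mult (A a) (F a) i j (gr_class a i x) (gr_class a j y) = gr_class a (i + j) (x \<otimes>\<^bsub>T\<^esub> y)"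
proof -
  have xT: "x \<in> carrier T" and yT: "y \<in> carrier T" using x y low_closed by auto
  have 1: "filt_prev (A a) (F a) (i + j) +>\<^bsub>A a\<^esub> (cos a (p \<oplus>\<^bsub>T\<^esub> x) \<otimes>\<^bsub>A a\<^esub> cos a (q \<oplus>\<^bsub>T\<^esub> y)) =
      gr_class a (i + j) (x \<otimes>\<^bsub>T\<^esub> y)" if p: "p \<in> low i" and q: "q \<in> low j" for p q
  proof -
    have pT: "p \<in> carrier T" and qT: "q \<in> carrier T" using p q low_closed by auto
    have q': "q \<in> low (Suc j)" using q low_mono[of j "Suc j"] by auto
    have "(p \<oplus>\<^bsub>T\<^esub> x) \<otimes>\<^bsub>T\<^esub> (q \<oplus>\<^bsub>T\<^esub> y) =
        (p \<otimes>\<^bsub>T\<^esub> (q \<oplus>\<^bsub>T\<^esub> y) \<oplus>\<^bsub>T\<^esub> x \<otimes>\<^bsub>T\<^esub> q) \<oplus>\<^bsub>T\<^esub> x \<otimes>\<^bsub>T\<^esub> y"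
      using pT qT xT yT by (simp add: T.l_distr T.r_distr T.a_assoc T.a_lcomm T_closed)
    moreover have "p \<otimes>\<^bsub>T\<^esub> (q \<oplus>\<^bsub>T\<^esub> y) \<oplus>\<^bsub>T\<^esub> x \<otimes>\<^bsub>T\<^esub> q \<in> low (i + j)"
      using low_mult(1)[OF p low_add[OF q' y]] low_mult(2)[OF q x] low_add by (simp add: add.commute)
    ultimately show ?thesis
      using pT qT xT yT by (simp add: cos_mult T_closed gr_class_coset gr_class_low)
  qed
  show ?thesis
    unfolding gr_piece_mult_def using 1 low_zero[of i] low_zero[of j]
    by (auto simp: gr_class_def[of a i x] gr_class_def[of a j y])
qed

end

section \<open>Homogeneous parts and two transfer principles\<close>

definition hpart :: "nat \<Rightarrow> ('n list \<Rightarrow> complex) \<Rightarrow> 'n list \<Rightarrow> complex" where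
  "hpart k t = (\<lambda>w. if length w = k then t w else 0)"

lemma hpart_add: "hpart k (s + t) = hpart k s + hpart k t"
  by (auto simp: hpart_def fun_eq_iff)

lemma hpart_diff: "hpart k (s - t) = hpart k s - hpart k t"
  by (auto simp: hpart_def fun_eq_iff)

lemma hpart_scale: "hpart k (tensor_scale c t) = tensor_scale c (hpart k t)"
  by (auto simp: hpart_def tensor_scale_def fun_eq_iff)

lemma hpart_zero [simp]: "hpart k 0 = 0"
  by (auto simp: hpart_def fun_eq_iff)

lemma hpart_sum: "hpart k (sum f I) = (\<Sum>i\<in>I. hpart k (f i))"
  by (auto simp: hpart_def fun_eq_iff sum_fun_apply)

lemma hpart_hpart: "hpart j (hpart k t) = (if j = k then hpart k t else 0)"
  by (auto simp: hpart_def fun_eq_iff)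

lemma hpart_action: "tensor_action M (hpart k t) = hpart k (tensor_action M t)"
  by (auto simp: hpart_def tensor_action_eq fun_eq_iff intro!: sum.neutral sum.cong)

lemma finite_support_hpart: "finite_support t \<Longrightarrow> finite_support (hpart k t)"
  unfolding finite_support_def hpart_def by (rule rev_finite_subset) auto

text \<open>For a fixed cut of a word only the summand \<open>i\<close> equal to the length of the
  left piece can contribute, and it does so exactly when the whole word has length
  \<open>k\<close>.\<close>

lemma hpart_mult: "hpart k (s \<odot>\<odot> t) = (\<Sum>i\<le>k. hpart i s \<odot>\<odot> hpart (k - i) t)"
proof
  fix w
  have "(\<Sum>i\<le>k. hpart i s \<odot>\<odot> hpart (k - i) t) w =
      (\<Sum>i\<le>k. \<Sum>j\<le>length w. hpart i s (take j w) * hpart (k - i) t (drop j w))"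
    by (simp add: sum_fun_apply tensor_mult_def)
  also have "\<dots> = (\<Sum>j\<le>length w. \<Sum>i\<le>k. hpart i s (take j w) * hpart (k - i) t (drop j w))"
    by (rule sum.swap)
  also have "\<dots> = (\<Sum>j\<le>length w. if length w = k then s (take j w) * t (drop j w) else 0)"
  proof (rule sum.cong[OF refl])
    fix j assume "j \<in> {..length w}"
    then have j: "length (take j w) = j" by simp
    have "(\<Sum>i\<le>k. hpart i s (take j w) * hpart (k - i) t (drop j w)) =
        (\<Sum>i\<le>k. if i = j then s (take j w) * hpart (k - j) t (drop j w) else 0)"
      using j by (intro sum.cong) (auto simp: hpart_def)
    also have "\<dots> = (if length w = k then s (take j w) * t (drop j w) else 0)"
      using \<open>j \<in> {..length w}\<close> by (auto simp: hpart_def)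
    finally show "(\<Sum>i\<le>k. hpart i s (take j w) * hpart (k - i) t (drop j w)) =
      (if length w = k then s (take j w) * t (drop j w) else 0)" .
  qed
  also have "\<dots> = hpart k (s \<odot>\<odot> t) w"
    by (simp add: hpart_def tensor_mult_def)
  finally show "hpart k (s \<odot>\<odot> t) w = (\<Sum>i\<le>k. hpart i s \<odot>\<odot> hpart (k - i) t) w" by simp
qed

lemma hpart_content: "mset_content (hpart k t) M = (if size M = k then mset_content t M else 0)"
  unfolding mset_content_def hpart_def by (auto intro!: sum.cong sum.neutral)

text \<open>A surjective endomorphism of a finite-dimensional space is injective. If a nonzero
  \<open>c\<close> is sent to 0, one basis vector becomes redundant for the image, which is then
  spanned by fewer vectors than the independent family of unit vectors it contains.\<close>

lemma finite_coordinates_surj_inj: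
  fixes N :: "('j \<Rightarrow> complex) \<Rightarrow> 'j \<Rightarrow> complex"
  assumes J: "finite J"
    and add: "\<And>x y. x \<in> V \<Longrightarrow> y \<in> V \<Longrightarrow> N (x + y) = N x + N y"
    and scale: "\<And>c x. x \<in> V \<Longrightarrow> N (\<lambda>j. c * x j) = (\<lambda>j. c * N x j)"
    and V: "V = {x. \<forall>j. j \<notin> J \<longrightarrow> x j = 0}"
    and surj: "V \<subseteq> N ` V" and c: "c \<in> V" "N c = 0"
  shows "c = 0"
proof (rule ccontr)
  assume "c \<noteq> 0"
  then obtain j0 where j0: "c j0 \<noteq> 0" by (auto simp: fun_eq_iff)
  then have "j0 \<in> J" using c V by auto
  interpret vs: vector_space "\<lambda>(c::complex) (x :: 'j \<Rightarrow> complex) j. c * x j"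
    by standard (auto simp: fun_eq_iff algebra_simps)
  define d :: "'j \<Rightarrow> 'j \<Rightarrow> complex" where "d i = (\<lambda>j. if j = i then 1 else 0)" for i
  have dV: "(\<lambda>j. k * d i j) \<in> V" if "i \<in> J" for i k using that by (auto simp: V d_def)
  have V_add: "x + y \<in> V" if "x \<in> V" "y \<in> V" for x y using that by (simp add: V)
  have expand: "x = (\<Sum>i\<in>J. (\<lambda>j. x i * d i j))" if "x \<in> V" for x
  proof
    fix j
    have "(\<Sum>i\<in>J. (\<lambda>j. x i * d i j)) j = (\<Sum>i\<in>J. if j = i then x j else 0)"
      by (auto simp: sum_fun_apply d_def intro!: sum.cong)
    then show "x j = (\<Sum>i\<in>J. (\<lambda>j. x i * d i j)) j"
      using J that by (auto simp: V)
  qed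
  have N0: "N 0 = 0" using add[of 0 0] by (simp add: V)
  have N_sum: "(\<forall>i\<in>K. f i \<in> V) \<longrightarrow> N (sum f K) = (\<Sum>i\<in>K. N (f i)) \<and> sum f K \<in> V" if "finite K"
    for f :: "'j \<Rightarrow> 'j \<Rightarrow> complex" and K
    using that
  proof (rule finite_induct)
    have "sum f {} = 0" "(\<Sum>i\<in>{}. N (f i)) = 0" by (rule sum.empty)+
    moreover have "(0 :: 'j \<Rightarrow> complex) \<in> V" by (simp add: V)
    ultimately show "(\<forall>i\<in>{}. f i \<in> V) \<longrightarrow> N (sum f {}) = (\<Sum>i\<in>{}. N (f i)) \<and> sum f {} \<in> V"
      using N0 by metis
    fix i K assume K: "finite K" "i \<notin> K"
      and IH: "(\<forall>i\<in>K. f i \<in> V) \<longrightarrow> N (sum f K) = (\<Sum>i\<in>K. N (f i)) \<and> sum f K \<in> V"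
    have e: "sum f (insert i K) = f i + sum f K"
      "(\<Sum>i\<in>insert i K. N (f i)) = N (f i) + (\<Sum>i\<in>K. N (f i))"
      using K by (rule sum.insert)+
    show "(\<forall>i\<in>insert i K. f i \<in> V) \<longrightarrow> N (sum f (insert i K)) = (\<Sum>i\<in>insert i K. N (f i)) \<and> sum f (insert i K) \<in> V"
      unfolding e using IH add V_add by (metis insert_iff)
  qed
  define W where "W = (\<lambda>i. N (d i)) ` (J - {j0})"
  have "N x \<in> vs.span W" if x: "x \<in> V" for x
  proof -
    \<comment> \<open>Subtracting this multiple of \<open>c\<close> clears the coordinate
      \<open>j0\<close> without changing the value of \<open>N\<close>.\<close>
    define k where "k = x j0 / c j0"
    define y where "y = (\<lambda>j. x j - k * c j)"
    have y: "y \<in> V" "y j0 = 0" using x c j0 by (auto simp: V y_def k_def)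
    have kc: "(\<lambda>j. k * c j) \<in> V" using c by (simp add: V)
    have "x = y + (\<lambda>j. k * c j)" by (auto simp: y_def)
    then have "N x = N y + (\<lambda>j. k * N c j)"
      using add[OF y(1) kc] scale[OF c(1)] by simp
    also have "\<dots> = N y" using c by (simp add: fun_eq_iff)
    also have "N y = (\<Sum>i\<in>J. N (\<lambda>j. y i * d i j))"
      using expand[OF y(1)] N_sum[OF J, of "\<lambda>i j. y i * d i j"] dV by metis
    also have "\<dots> = (\<Sum>i\<in>J. (\<lambda>j. y i * N (d i) j))"
      by (rule sum.cong[OF refl]) (use dV[of _ 1] scale in simp)
    also have "\<dots> = (\<Sum>i\<in>J - {j0}. (\<lambda>j. y i * N (d i) j))"
    proof (rule sum.mono_neutral_right)
      show "\<forall>i\<in>J - (J - {j0}). (\<lambda>j. y i * N (d i) j) = 0" using y(2) by (auto simp: fun_eq_iff)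
    qed (use J in auto)
    also have "\<dots> \<in> vs.span W"
      by (intro vs.span_sum vs.span_scale vs.span_base) (auto simp: W_def)
    finally show ?thesis .
  qed
  then have VW: "V \<subseteq> vs.span W" using surj by blast
  have inj: "inj_on d J"
    by (rule inj_onI) (metis d_def zero_neq_one)
  have "vs.independent (d ` J)"
  proof (rule vs.independent_if_scalars_zero)
    show "finite (d ` J)" using J by simp
    fix f x assume sum: "(\<Sum>x\<in>d ` J. (\<lambda>j. f x * x j)) = 0" and "x \<in> d ` J"
    then obtain i where i: "i \<in> J" "x = d i" by blast
    have "0 = (\<Sum>x\<in>d ` J. (\<lambda>j. f x * x j)) i" using sum by simp
    also have "\<dots> = (\<Sum>l\<in>J. f (d l) * d l i)"
      by (simp add: sum_fun_apply sum.reindex[OF inj])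
    also have "\<dots> = (\<Sum>l\<in>J. if l = i then f (d i) else 0)" by (rule sum.cong) (auto simp: d_def)
    also have "\<dots> = f x" using J i by simp
    finally show "f x = 0" by simp
  qed
  moreover have "d ` J \<subseteq> V" using dV[of _ 1] by auto
  moreover have "finite W" using J by (simp add: W_def)
  ultimately have "card (d ` J) \<le> card W"
    using VW vs.independent_span_bound by blast
  also have "\<dots> \<le> card (J - {j0})" unfolding W_def using J by (intro card_image_le) simp
  also have "\<dots> < card J" using J \<open>j0 \<in> J\<close> by (intro psubset_card_mono) auto
  finally show False using inj by (simp add: card_image)
qed

text \<open>Two images of one algebra under maps with the same fibres are isomorphic. All laws are
  drawn from representatives in \<open>R\<close>, so gr A and S(V) # G can be compared although both
  are only given as records.\<close>

lemma algebra_iso_of_common_cover: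
  fixes R :: "(complex, 'r) module" and S1 :: "(complex, 's) module" and S2 :: "(complex, 't) module"
  assumes p: "p ` carrier R = carrier S1" and q: "q ` carrier R = carrier S2"
    and fibres: "\<And>x y. x \<in> carrier R \<Longrightarrow> y \<in> carrier R \<Longrightarrow> p x = p y \<longleftrightarrow> q x = q y"
    and closed: "\<one>\<^bsub>R\<^esub> \<in> carrier R"
      "\<And>x y. x \<in> carrier R \<Longrightarrow> y \<in> carrier R \<Longrightarrow> x \<otimes>\<^bsub>R\<^esub> y \<in> carrier R \<and> x \<oplus>\<^bsub>R\<^esub> y \<in> carrier R"
      "\<And>c x. x \<in> carrier R \<Longrightarrow> c \<odot>\<^bsub>R\<^esub> x \<in> carrier R"
    and p_hom: "p \<one>\<^bsub>R\<^esub> = \<one>\<^bsub>S1\<^esub>"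
      "\<And>x y. x \<in> carrier R \<Longrightarrow> y \<in> carrier R \<Longrightarrow> p (x \<otimes>\<^bsub>R\<^esub> y) = p x \<otimes>\<^bsub>S1\<^esub> p y"
      "\<And>x y. x \<in> carrier R \<Longrightarrow> y \<in> carrier R \<Longrightarrow> p (x \<oplus>\<^bsub>R\<^esub> y) = p x \<oplus>\<^bsub>S1\<^esub> p y"
      "\<And>c x. x \<in> carrier R \<Longrightarrow> p (c \<odot>\<^bsub>R\<^esub> x) = c \<odot>\<^bsub>S1\<^esub> p x"
    and q_hom: "q \<one>\<^bsub>R\<^esub> = \<one>\<^bsub>S2\<^esub>"
      "\<And>x y. x \<in> carrier R \<Longrightarrow> y \<in> carrier R \<Longrightarrow> q (x \<otimes>\<^bsub>R\<^esub> y) = q x \<otimes>\<^bsub>S2\<^esub> q y"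
      "\<And>x y. x \<in> carrier R \<Longrightarrow> y \<in> carrier R \<Longrightarrow> q (x \<oplus>\<^bsub>R\<^esub> y) = q x \<oplus>\<^bsub>S2\<^esub> q y"
      "\<And>c x. x \<in> carrier R \<Longrightarrow> q (c \<odot>\<^bsub>R\<^esub> x) = c \<odot>\<^bsub>S2\<^esub> q x"
  obtains f where "algebra_iso S1 S2 f" "\<And>x. x \<in> carrier R \<Longrightarrow> f (p x) = q x"
proof -
  define f where "f z = q (SOME x. x \<in> carrier R \<and> p x = z)" for z
  have f: "f (p x) = q x" if "x \<in> carrier R" for x
  proof -
    have "(SOME y. y \<in> carrier R \<and> p y = p x) \<in> carrier R \<and> p (SOME y. y \<in> carrier R \<and> p y = p x) = p x"
      by (rule someI[of "\<lambda>y. y \<in> carrier R \<and> p y = p x" x]) (simp add: that)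
    then show ?thesis using fibres that unfolding f_def by blast
  qed
  have S1: "\<exists>x\<in>carrier R. z = p x" if "z \<in> carrier S1" for z using that p by blast
  have "f \<in> ring_hom S1 S2"
  proof (rule ring_hom_memI)
    show "f z \<in> carrier S2" if "z \<in> carrier S1" for z using S1[OF that] f q by auto
    fix z z' assume "z \<in> carrier S1" "z' \<in> carrier S1"
    then obtain x y where xy: "x \<in> carrier R" "z = p x" "y \<in> carrier R" "z' = p y" using S1 by metis
    show "f (z \<otimes>\<^bsub>S1\<^esub> z') = f z \<otimes>\<^bsub>S2\<^esub> f z'"
      using xy f[of "x \<otimes>\<^bsub>R\<^esub> y"] closed by (simp add: f p_hom q_hom)
    show "f (z \<oplus>\<^bsub>S1\<^esub> z') = f z \<oplus>\<^bsub>S2\<^esub> f z'"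
      using xy f[of "x \<oplus>\<^bsub>R\<^esub> y"] closed by (simp add: f p_hom q_hom)
  next
    show "f \<one>\<^bsub>S1\<^esub> = \<one>\<^bsub>S2\<^esub>" using f[OF closed(1)] by (simp add: p_hom q_hom)
  qed
  moreover have "bij_betw f (carrier S1) (carrier S2)"
  proof (rule bij_betw_imageI)
    show "inj_on f (carrier S1)"
    proof (rule inj_onI)
      fix z z' assume "z \<in> carrier S1" "z' \<in> carrier S1" and eq: "f z = f z'"
      then obtain x y where xy: "x \<in> carrier R" "z = p x" "y \<in> carrier R" "z' = p y" using S1 by metis
      then show "z = z'" using eq f fibres by metis
    qed
    have "f ` carrier S1 = (\<lambda>x. f (p x)) ` carrier R" unfolding p[symmetric] by (rule image_image)
    then show "f ` carrier S1 = carrier S2" using f q by simp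
  qed
  moreover have "f (c \<odot>\<^bsub>S1\<^esub> z) = c \<odot>\<^bsub>S2\<^esub> f z" if z: "z \<in> carrier S1" for c z
  proof -
    obtain x where x: "x \<in> carrier R" "z = p x" using S1[OF z] by blast
    then show ?thesis using f[of "c \<odot>\<^bsub>R\<^esub> x"] closed by (simp add: f p_hom q_hom)
  qed
  ultimately have "algebra_iso S1 S2 f" by (simp add: algebra_iso_def ring_iso_def)
  then show thesis using f that by blast
qed

section \<open>The graded map from T(V) # G onto gr A\<close>

context finite_group_rep
begin

lemma part_eq: "part k x = (\<lambda>g\<in>carrier G. hpart k (x g))"
  by (simp add: part_def hpart_def)

lemma part_apply: "g \<in> carrier G \<Longrightarrow> part k x g = hpart k (x g)"
  by (simp add: part_eq)

lemma part_closed: "x \<in> carrier T \<Longrightarrow> part k x \<in> carrier T"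
  unfolding carrier_T by (auto simp: part_eq finite_support_hpart)

lemma part_length: "g \<in> carrier G \<Longrightarrow> part k x g w \<noteq> 0 \<Longrightarrow> length w = k"
  by (auto simp: part_apply hpart_def split: if_splits)

lemma part_low: "x \<in> carrier T \<Longrightarrow> part k x \<in> low (Suc k)"
  unfolding low_def by (auto simp: part_closed dest: part_length)

lemma part_add: "x \<in> carrier T \<Longrightarrow> y \<in> carrier T \<Longrightarrow> part k (x \<oplus>\<^bsub>T\<^esub> y) = part k x \<oplus>\<^bsub>T\<^esub> part k y"
  by (rule T_ext) (auto simp: part_closed T_closed part_apply T_add_apply hpart_add simp del: fun_apply_simps)

lemma part_smult: "x \<in> carrier T \<Longrightarrow> part k (c \<odot>\<^bsub>T\<^esub> x) = c \<odot>\<^bsub>T\<^esub> part k x"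
  by (rule T_ext) (auto simp: part_closed T_smult_closed part_apply T_smult_apply hpart_scale)

lemma part_minus: "x \<in> carrier T \<Longrightarrow> y \<in> carrier T \<Longrightarrow> part k (x \<ominus>\<^bsub>T\<^esub> y) = part k x \<ominus>\<^bsub>T\<^esub> part k y"
  by (rule T_ext) (auto simp: part_closed T_closed part_apply T_minus_apply hpart_diff simp del: fun_apply_simps)

lemma part_one: "part k \<one>\<^bsub>T\<^esub> = (if k = 0 then \<one>\<^bsub>T\<^esub> else \<zero>\<^bsub>T\<^esub>)"
proof (rule T_ext)
  fix g assume g: "g \<in> carrier G"
  have "hpart k (word_tensor []) = (if k = 0 then word_tensor [] else 0 :: 'n list \<Rightarrow> complex)"
    by (auto simp: hpart_def word_tensor_def fun_eq_iff)
  then show "part k \<one>\<^bsub>T\<^esub> g = (if k = 0 then \<one>\<^bsub>T\<^esub> else \<zero>\<^bsub>T\<^esub>) g"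
    using g by (cases "k = 0") (simp_all add: part_apply T_one elem_apply T_zero)
qed (auto simp: part_closed T_zero_closed)

lemma part_part: "x \<in> carrier T \<Longrightarrow> part j (part k x) = (if j = k then part k x else \<zero>\<^bsub>T\<^esub>)"
  by (rule T_ext) (auto simp: part_closed T_zero_closed part_apply hpart_hpart, simp add: T_zero)

lemma part_mult:
  assumes "x \<in> carrier T" "y \<in> carrier T"
  shows "part k (x \<otimes>\<^bsub>T\<^esub> y) = (\<Oplus>\<^bsub>T\<^esub>i\<in>{..k}. part i x \<otimes>\<^bsub>T\<^esub> part (k - i) y)"
proof (rule T_ext)
  fix g assume g: "g \<in> carrier G"
  have "part k (x \<otimes>\<^bsub>T\<^esub> y) g = (\<Sum>h\<in>carrier G. \<Sum>i\<le>k. hpart i (x h) \<odot>\<odot> act h (hpart (k - i) (y (inv h \<otimes> g))))"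
    using assms g by (simp add: part_apply T_mult_apply hpart_sum hpart_mult hpart_action)
  also have "\<dots> = (\<Sum>i\<le>k. \<Sum>h\<in>carrier G. hpart i (x h) \<odot>\<odot> act h (hpart (k - i) (y (inv h \<otimes> g))))"
    by (rule sum.swap)
  also have "\<dots> = (\<Sum>i\<le>k. (part i x \<otimes>\<^bsub>T\<^esub> part (k - i) y) g)"
    using assms g by (intro sum.cong) (simp_all add: T_mult_apply part_closed part_apply)
  also have "\<dots> = (\<Oplus>\<^bsub>T\<^esub>i\<in>{..k}. part i x \<otimes>\<^bsub>T\<^esub> part (k - i) y) g"
    using assms g by (subst T_finsum) (auto simp: part_closed T_closed)
  finally show "part k (x \<otimes>\<^bsub>T\<^esub> y) g = (\<Oplus>\<^bsub>T\<^esub>i\<in>{..k}. part i x \<otimes>\<^bsub>T\<^esub> part (k - i) y) g" .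
qed (use assms in \<open>auto intro!: part_closed T_closed T.finsum_closed\<close>)

abbreviation Gr where "Gr a \<equiv> assoc_graded (A a) (F a)"

text \<open>Every homogeneous part is sent to its class, not only the leading one; this makes the
  map additive and multiplicative on all of T(V) # G.\<close>

definition gr_map where
  "gr_map a x = (\<lambda>k. gr_class a k (part k x))"

lemma part_vanishes:
  assumes "x \<in> low N" "N \<le> k"
  shows "part k x = \<zero>\<^bsub>T\<^esub>"
proof (rule T_ext)
  show "part k x \<in> carrier T" using assms by (intro part_closed low_closed)
  fix g assume g: "g \<in> carrier G"
  have "part k x g w = 0" for w
    using assms g unfolding low_def by (force simp: part_apply hpart_def)
  then show "part k x g = \<zero>\<^bsub>T\<^esub> g" using g by (simp add: T_zero fun_eq_iff)
qed (rule T_zero_closed)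

lemma gr_map_closed:
  assumes x: "x \<in> carrier T"
  shows "gr_map a x \<in> carrier (Gr a)"
proof -
  obtain N where "x \<in> low N" using low_exists[OF x] by blast
  then have "gr_map a x k = \<zero>\<^bsub>P a k\<^esub>" if "N \<le> k" for k
    using that by (simp add: gr_map_def part_vanishes gr_piece_zero)
  then have "{k. gr_map a x k \<noteq> \<zero>\<^bsub>P a k\<^esub>} \<subseteq> {..<N}"
    by (auto simp: not_less[symmetric])
  then have "finite {k. gr_map a x k \<noteq> \<zero>\<^bsub>P a k\<^esub>}" by (rule finite_subset) simp
  then show ?thesis
    using x by (auto simp: assoc_graded_def gr_map_def gr_piece_carrier intro: part_low)
qed

text \<open>A representative is chosen in each degree, and \<open>x\<close> takes its words of
  length k from the k-th one for the finitely many k with a nonzero class. The shorter words of that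
  representative do not affect the class.\<close>

lemma gr_map_surj:
  assumes z: "z \<in> carrier (Gr a)"
  shows "\<exists>x\<in>carrier T. gr_map a x = z"
proof -
  define D where "D = {k. z k \<noteq> \<zero>\<^bsub>P a k\<^esub>}"
  have D: "finite D" and zk: "\<And>k. z k \<in> gr_class a k ` low (Suc k)"
    using z by (auto simp: assoc_graded_def D_def gr_piece_carrier)
  obtain y where y: "\<And>k. y k \<in> low (Suc k)" "\<And>k. z k = gr_class a k (y k)"
  proof -
    have "\<forall>k. \<exists>y. y \<in> low (Suc k) \<and> z k = gr_class a k y" using zk by blast
    from choice[OF this] show thesis using that by blast
  qed
  have yT: "y k \<in> carrier T" for k using y(1) low_closed by blast
  define x where "x = (\<lambda>g\<in>carrier G. \<lambda>w. if length w \<in> D then y (length w) g w else 0)"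
  have xT: "x \<in> carrier T"
    unfolding carrier_T
  proof (intro conjI ballI)
    fix g assume g: "g \<in> carrier G"
    have "{w. x g w \<noteq> 0} \<subseteq> (\<Union>k\<in>D. {w. y k g w \<noteq> 0})"
      using g by (auto simp: x_def split: if_splits)
    moreover have "finite {w. y k g w \<noteq> 0}" for k
      using carrier_T_support[OF yT g] by (simp add: finite_support_def)
    ultimately show "finite_support (x g)"
      unfolding finite_support_def using D by (meson finite_UN finite_subset)
  qed (simp add: x_def)
  have "gr_class a k (part k x) = z k" for k
  proof (cases "k \<in> D")
    case True
    have "part k x = part k (y k)"
      by (rule T_ext) (use xT yT True in \<open>auto simp: part_closed part_apply hpart_def x_def\<close>)
    have low: "\<ominus>\<^bsub>T\<^esub> (y k \<ominus>\<^bsub>T\<^esub> part k (y k)) \<in> low k"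
    proof (rule low_a_inv, unfold low_def, intro CollectI conjI ballI allI impI)
      show "y k \<ominus>\<^bsub>T\<^esub> part k (y k) \<in> carrier T" using yT part_closed by simp
      fix g w assume "g \<in> carrier G" "(y k \<ominus>\<^bsub>T\<^esub> part k (y k)) g w \<noteq> 0"
      then show "length w < k"
        using y(1)[of k] yT[of k] by (auto simp: T_minus_apply part_closed part_apply hpart_def low_def less_Suc_eq split: if_splits)
    qed
    have "part k (y k) = \<ominus>\<^bsub>T\<^esub> (y k \<ominus>\<^bsub>T\<^esub> part k (y k)) \<oplus>\<^bsub>T\<^esub> y k"
      by (rule T_ext) (use yT[of k] in \<open>simp_all add: T_closed part_closed T_add_apply T_a_inv_apply T_minus_apply\<close>)
    then have "gr_class a k (part k (y k)) = gr_class a k (y k)"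
      using gr_class_low[OF yT[of k] low, of a] by simp
    then show ?thesis using \<open>part k x = part k (y k)\<close> y(2) by simp
  next
    case False
    then have "part k x = \<zero>\<^bsub>T\<^esub>"
    proof (intro T_ext)
      fix g assume "g \<in> carrier G"
      then show "part k x g = \<zero>\<^bsub>T\<^esub> g"
        using False by (auto simp: part_apply hpart_def x_def T_zero fun_eq_iff)
    qed (use xT in \<open>simp_all add: part_closed T_zero_closed\<close>)
    then show ?thesis using False by (simp add: D_def gr_piece_zero)
  qed
  then show ?thesis using xT by (auto simp: gr_map_def)
qed

lemma gr_map_add:
  assumes "x \<in> carrier T" "y \<in> carrier T"
  shows "gr_map a (x \<oplus>\<^bsub>T\<^esub> y) = gr_map a x \<oplus>\<^bsub>Gr a\<^esub> gr_map a y"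
  using assms by (simp add: assoc_graded_def gr_map_def part_add gr_piece_add part_closed)

lemma gr_map_smult:
  assumes "x \<in> carrier T"
  shows "gr_map a (c \<odot>\<^bsub>T\<^esub> x) = c \<odot>\<^bsub>Gr a\<^esub> gr_map a x"
  using assms by (simp add: assoc_graded_def gr_map_def part_smult gr_piece_smult part_closed)

lemma gr_map_one: "gr_map a \<one>\<^bsub>T\<^esub> = \<one>\<^bsub>Gr a\<^esub>"
  by (auto simp: assoc_graded_def gr_map_def part_one gr_piece_zero A_simps(2) gr_class_coset fun_eq_iff)

text \<open>The degree k part of a product in gr A is a sum of classes;
  \<open>abelian_monoid_image\<close> moves the sum up to T(V) # G, where it is the degree k part of
  the product by \<open>part_mult\<close>.\<close>

lemma gr_map_mult:
  assumes x: "x \<in> carrier T" and y: "y \<in> carrier T"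
  shows "gr_map a (x \<otimes>\<^bsub>T\<^esub> y) = gr_map a x \<otimes>\<^bsub>Gr a\<^esub> gr_map a y"
proof
  fix k
  have prod_low: "part i x \<otimes>\<^bsub>T\<^esub> part (k - i) y \<in> low (Suc k)" if "i \<le> k" for i
    using low_mult(1)[OF part_low[OF x, of i] part_low[OF y, of "k - i"]] that by simp
  have "(gr_map a x \<otimes>\<^bsub>Gr a\<^esub> gr_map a y) k =
      (\<Oplus>\<^bsub>P a k\<^esub>i\<in>{..k}. gr_piece_mult (A a) (F a) i (k - i) (gr_class a i (part i x)) (gr_class a (k - i) (part (k - i) y)))"
    by (simp add: assoc_graded_def gr_map_def)
  also have "\<dots> = (\<Oplus>\<^bsub>P a k\<^esub>i\<in>{..k}. gr_class a k (part i x \<otimes>\<^bsub>T\<^esub> part (k - i) y))"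
  proof (rule abelian_monoid.finsum_cong')
    show "abelian_monoid (P a k)"
      by (rule abelian_monoid_image[OF T.abelian_monoid_axioms, of "low (Suc k)" _ "gr_class a k"])
        (auto simp: low_closed low_zero low_add gr_piece_carrier gr_piece_zero gr_piece_add)
  qed (use x y prod_low in \<open>auto simp: gr_piece_mult_class part_low gr_piece_carrier\<close>)
  also have "\<dots> = gr_class a k (\<Oplus>\<^bsub>T\<^esub>i\<in>{..k}. part i x \<otimes>\<^bsub>T\<^esub> part (k - i) y)"
    by (rule abelian_monoid_image(2)[OF T.abelian_monoid_axioms, of "low (Suc k)"])
      (use prod_low in \<open>auto simp: low_closed low_zero low_add gr_piece_carrier gr_piece_zero gr_piece_add\<close>)
  also have "\<dots> = gr_map a (x \<otimes>\<^bsub>T\<^esub> y) k"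
    using x y by (simp add: gr_map_def part_mult)
  finally show "gr_map a (x \<otimes>\<^bsub>T\<^esub> y) k = (gr_map a x \<otimes>\<^bsub>Gr a\<^esub> gr_map a y) k" by simp
qed

lemma gr_map_eq_iff:
  assumes "x \<in> carrier T" "y \<in> carrier T"
  shows "gr_map a x = gr_map a y \<longleftrightarrow> (\<forall>k. reducible a k (part k (x \<ominus>\<^bsub>T\<^esub> y)))"
  using assms by (simp add: gr_map_def fun_eq_iff gr_class_eq part_closed part_minus)

definition homogeneous :: "nat \<Rightarrow> ('g \<Rightarrow> 'n list \<Rightarrow> complex) set" where
  "homogeneous k = {x \<in> carrier T. \<forall>g\<in>carrier G. \<forall>w. x g w \<noteq> 0 \<longrightarrow> length w = k}"

lemma homogeneous_part: "x \<in> homogeneous k \<Longrightarrow> part k x = x"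
  by (rule T_ext) (auto simp: homogeneous_def part_closed part_apply hpart_def fun_eq_iff)

lemma part_homogeneous: "x \<in> carrier T \<Longrightarrow> part k x \<in> homogeneous k"
  unfolding homogeneous_def using part_closed part_length by blast

lemma homogeneous_eq: "homogeneous k = part k ` carrier T"
proof (intro equalityI subsetI)
  fix x assume x: "x \<in> homogeneous k"
  then have "x \<in> carrier T" by (simp add: homogeneous_def)
  then show "x \<in> part k ` carrier T" using homogeneous_part[OF x] by (metis image_eqI)
qed (use part_homogeneous in blast)

lemma gr_map_homogeneous: "gr_map a ` homogeneous k = assoc_graded_component (A a) (F a) k"
proof (intro equalityI subsetI)
  fix z assume "z \<in> gr_map a ` homogeneous k"
  then obtain x where x: "x \<in> carrier T" "z = gr_map a (part k x)"
    unfolding homogeneous_eq by blast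
  then have "z j = \<zero>\<^bsub>P a j\<^esub>" if "j \<noteq> k" for j
    using that by (simp add: gr_map_def part_part gr_piece_zero)
  then show "z \<in> assoc_graded_component (A a) (F a) k"
    using x by (simp add: assoc_graded_component_def gr_map_closed part_closed)
next
  fix z assume z: "z \<in> assoc_graded_component (A a) (F a) k"
  then obtain x where x: "x \<in> carrier T" "z = gr_map a x"
    unfolding assoc_graded_component_def using gr_map_surj by blast
  have "gr_map a (part k x) = z"
  proof
    fix j
    show "gr_map a (part k x) j = z j"
    proof (cases "j = k")
      case True
      then show ?thesis using x by (simp add: gr_map_def part_part)
    next
      case False
      then have "z j = \<zero>\<^bsub>P a j\<^esub>" using z by (simp add: assoc_graded_component_def)
      then show ?thesis using False x by (simp add: gr_map_def part_part gr_piece_zero)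
    qed
  qed
  then show "z \<in> gr_map a ` homogeneous k" using x part_homogeneous by blast
qed

end

section \<open>The symmetric algebra as a quotient\<close>

abbreviation sym_class :: "('n::finite list \<Rightarrow> complex) \<Rightarrow> ('n list \<Rightarrow> complex) set" where
  "sym_class t \<equiv> sym_ideal +>\<^bsub>tensor_algebra\<^esub> t"

lemma sym_class_eq:
  fixes s t :: "'n::finite list \<Rightarrow> complex"
  assumes "finite_support s" "finite_support t"
  shows "sym_class s = sym_class t \<longleftrightarrow> s - t \<in> sym_ideal"
  using tensor.quotient_eq_iff_same_a_r_cos[OF sym_ideal, of s t] assms by (simp add: tensor_a_minus)

lemma sym_class_self: "t \<in> sym_class (t :: 'n::finite list \<Rightarrow> complex)"
  unfolding a_r_coset_def' by (rule UN_I[OF sym_ideal_zero]) simp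

lemma sym_class_elem:
  fixes s t :: "'n::finite list \<Rightarrow> complex"
  assumes "s \<in> sym_class t"
  shows "s - t \<in> sym_ideal"
  using assms unfolding a_r_coset_def' by auto

lemma sym_algebra_simps:
  "carrier sym_algebra = sym_class ` {t :: 'n::finite list \<Rightarrow> complex. finite_support t}"
  "\<zero>\<^bsub>sym_algebra\<^esub> = sym_class (0 :: 'n list \<Rightarrow> complex)"
  "\<one>\<^bsub>sym_algebra\<^esub> = sym_class (word_tensor [] :: 'n list \<Rightarrow> complex)"
proof -
  show "carrier sym_algebra = sym_class ` {t :: 'n list \<Rightarrow> complex. finite_support t}"
    by (auto simp: sym_algebra_def quot_alg_def A_RCOSETS_def')
  have "sym_class (0 :: 'n list \<Rightarrow> complex) = sym_ideal"
    by (simp add: a_r_coset_def')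
  then show "\<zero>\<^bsub>sym_algebra\<^esub> = sym_class (0 :: 'n list \<Rightarrow> complex)"
    by (simp add: sym_algebra_def quot_alg_def)
  show "\<one>\<^bsub>sym_algebra\<^esub> = sym_class (word_tensor [] :: 'n list \<Rightarrow> complex)"
    by (simp add: sym_algebra_def quot_alg_def)
qed

lemma sym_class_add:
  fixes s t :: "'n::finite list \<Rightarrow> complex"
  assumes "finite_support s" "finite_support t"
  shows "sym_class s \<oplus>\<^bsub>sym_algebra\<^esub> sym_class t = sym_class (s + t)"
  using ideal.a_rcos_sum[OF sym_ideal, of s t] assms by (simp add: sym_algebra_def quot_alg_def)

lemma sym_class_mult:
  fixes s t :: "'n::finite list \<Rightarrow> complex"
  assumes "finite_support s" "finite_support t"
  shows "sym_class s \<otimes>\<^bsub>sym_algebra\<^esub> sym_class t = sym_class (s \<odot>\<odot> t)"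
  using ideal.rcoset_mult_add[OF sym_ideal, of s t] assms by (simp add: sym_algebra_def quot_alg_def)

lemma tensor_scale_diff: "tensor_scale c (s - t) = tensor_scale c s - tensor_scale c t"
  by (simp add: tensor_scale_def fun_eq_iff right_diff_distrib)

lemma sym_class_smult:
  fixes t :: "'n::finite list \<Rightarrow> complex"
  assumes t: "finite_support t"
  shows "c \<odot>\<^bsub>sym_algebra\<^esub> sym_class t = sym_class (tensor_scale c t)"
proof -
  have "sym_class (tensor_scale c s) = sym_class (tensor_scale c t)" if "s \<in> sym_class t" for s
  proof -
    have d: "s - t \<in> sym_ideal" using that by (rule sym_class_elem)
    have "finite_support ((s - t) + t)" using sym_ideal_finite_support[OF d] t by (rule finite_support_add)
    then have "finite_support s" by simp
    then show ?thesis
      using sym_ideal_scale[OF d, of c] t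
      by (simp add: sym_class_eq finite_support_scale tensor_scale_diff del: fun_apply_simps)
  qed
  then have "(\<lambda>s. sym_class (tensor_scale c s)) ` sym_class t = {sym_class (tensor_scale c t)}"
    using sym_class_self[of t] by blast
  then show ?thesis by (simp add: sym_algebra_def quot_alg_def)
qed

text \<open>Only exchanges of neighbours have to be considered, and \<open>M\<close> carries the
  commutator of two basis vectors to the commutator of their images, which is again a
  generator.\<close>

lemma sym_ideal_action:
  fixes t :: "'n::finite list \<Rightarrow> complex"
  assumes "t \<in> sym_ideal"
  shows "tensor_action M t \<in> sym_ideal"
proof -
  have t: "finite_support t" "\<And>N. mset_content t N = 0"
    using assms by (auto simp: sym_ideal_iff)
  show ?thesis
  proof (rule content_zero_induct[OF t, where N = "\<lambda>t. tensor_action M t \<in> sym_ideal"])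
    show "tensor_action M (0 :: 'n list \<Rightarrow> complex) \<in> sym_ideal"
      unfolding tensor_action_zero by (rule sym_ideal_zero)
    show "tensor_action M (r + s) \<in> sym_ideal"
      if "tensor_action M r \<in> sym_ideal" "tensor_action M s \<in> sym_ideal" for r s :: "'n list \<Rightarrow> complex"
      unfolding tensor_action_add using that by (rule sym_ideal_add)
    show "tensor_action M (tensor_scale c s) \<in> sym_ideal"
      if "tensor_action M s \<in> sym_ideal" for c and s :: "'n list \<Rightarrow> complex"
      unfolding tensor_action_scale using that by (rule sym_ideal_scale)
    show "tensor_action M (word_tensor w - word_tensor w') \<in> sym_ideal"
      if "mset w = mset w'" for w w' :: "'n list"
    proof (rule swap_connected[where R = "\<lambda>w w'. tensor_action M (word_tensor w - word_tensor w') \<in> sym_ideal", OF _ _ _ that])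
      fix u v w :: "'n list"
      have "word_tensor w - word_tensor w = (0 :: 'n list \<Rightarrow> complex)" by (rule diff_self)
      then show "tensor_action M (word_tensor w - word_tensor w) \<in> sym_ideal"
        using sym_ideal_zero tensor_action_zero by metis
      assume "tensor_action M (word_tensor u - word_tensor v) \<in> sym_ideal"
        "tensor_action M (word_tensor v - word_tensor w) \<in> sym_ideal"
      then have "tensor_action M (word_tensor u - word_tensor v) + tensor_action M (word_tensor v - word_tensor w) \<in> sym_ideal"
        by (rule sym_ideal_add)
      then show "tensor_action M (word_tensor u - word_tensor w) \<in> sym_ideal"
        unfolding tensor_action_add[symmetric] by (simp only: add_diff_eq diff_add_cancel)
    next
      fix u v :: "'n list" and x y :: 'n
      define D where "D = tensor_of_vectors [axis x 1, axis y 1] - (tensor_of_vectors [axis y 1, axis x 1] :: 'n list \<Rightarrow> complex)"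
      have D: "word_tensor (u @ [x, y] @ v) - word_tensor (u @ [y, x] @ v) = word_tensor u \<odot>\<odot> D \<odot>\<odot> word_tensor v"
        using tensor_of_axes[of "[x, y]"] tensor_of_axes[of "[y, x]"] unfolding D_def
        by (simp add: tensor_mult_diff_left tensor_mult_diff_right word_tensor_mult del: fun_apply_simps)
      have "tensor_action M D \<in> sym_ideal"
        unfolding D_def tensor_action_diff tensor_action_vectors list.map sym_ideal_alt
        by (rule set_mp[OF tensor.genideal_self[OF sym_generators_closed]]) blast
      then show "tensor_action M (word_tensor (u @ [x, y] @ v) - word_tensor (u @ [y, x] @ v)) \<in> sym_ideal"
        unfolding D tensor_action_mult
        by (intro sym_ideal_mult finite_support_action finite_support_word)
    qed
  qed
qed

lemma abelian_monoid_sym_algebra: "abelian_monoid (sym_algebra :: (complex, ('n::finite list \<Rightarrow> complex) set) module)"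
  by (rule abelian_monoid_image[OF tensor.abelian_monoid_axioms, of "{t. finite_support t}" _ sym_class])
    (auto simp: sym_algebra_simps sym_class_add)

lemma sym_finsum:
  fixes f :: "'i \<Rightarrow> 'n::finite list \<Rightarrow> complex"
  assumes "\<And>i. i \<in> I \<Longrightarrow> finite_support (f i)"
  shows "(\<Oplus>\<^bsub>sym_algebra\<^esub>i\<in>I. sym_class (f i)) = sym_class (sum f I)"
proof -
  have "(\<Oplus>\<^bsub>sym_algebra\<^esub>i\<in>I. sym_class (f i)) = sym_class (finsum tensor_algebra f I)"
    by (rule abelian_monoid_image(2)[OF tensor.abelian_monoid_axioms, of "{t. finite_support t}" _ sym_class])
      (use assms in \<open>auto simp: sym_algebra_simps sym_class_add\<close>)
  then show ?thesis using assms by (simp add: tensor_finsum)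
qed

section \<open>The map onto S(V) # G and the comparison with gr A\<close>

context finite_group_rep
begin

abbreviation S where "S \<equiv> sym_skew G \<rho>"

text \<open>The action on S(V) is an image of sets. The image of a coset fills the whole target
  coset, since the inverse of \<open>g\<close> preserves the ideal as well.\<close>

lemma sym_action_class:
  assumes g: "g \<in> carrier G" and t: "finite_support t"
  shows "sym_action (\<rho> g) (sym_class t) = sym_class (act g t)"
proof -
  have inv: "act g (act (inv g) s) = s" for s
    using g by (simp add: act_one flip: act_mult)
  show ?thesis
    unfolding sym_action_def
  proof (intro equalityI subsetI)
    fix s assume "s \<in> act g ` sym_class t"
    then obtain i where i: "i \<in> sym_ideal" "s = act g (i + t)" by (auto simp: a_r_coset_def')
    then have "s = act g i + act g t" by (simp add: tensor_action_add)
    then show "s \<in> sym_class (act g t)"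
      using sym_ideal_action[OF i(1)] by (auto simp: a_r_coset_def')
  next
    fix s assume "s \<in> sym_class (act g t)"
    then obtain i where i: "i \<in> sym_ideal" "s = i + act g t" by (auto simp: a_r_coset_def')
    then have "s = act g (act (inv g) i + t)" by (simp add: tensor_action_add inv)
    moreover have "act (inv g) i + t \<in> sym_class t"
      using sym_ideal_action[OF i(1)] by (auto simp: a_r_coset_def')
    ultimately show "s \<in> act g ` sym_class t" by blast
  qed
qed

definition sym_map where
  "sym_map x = (\<lambda>g\<in>carrier G. sym_class (x g))"

lemma S_simps:
  "carrier S = carrier G \<rightarrow>\<^sub>E carrier sym_algebra"
  "X \<otimes>\<^bsub>S\<^esub> Y = (\<lambda>k\<in>carrier G. \<Oplus>\<^bsub>sym_algebra\<^esub>g\<in>carrier G. X g \<otimes>\<^bsub>sym_algebra\<^esub> sym_action (\<rho> g) (Y (inv g \<otimes> k)))"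
  "\<one>\<^bsub>S\<^esub> = (\<lambda>k\<in>carrier G. if k = \<one> then \<one>\<^bsub>sym_algebra\<^esub> else \<zero>\<^bsub>sym_algebra\<^esub>)"
  "X \<oplus>\<^bsub>S\<^esub> Y = (\<lambda>k\<in>carrier G. X k \<oplus>\<^bsub>sym_algebra\<^esub> Y k)"
  "c \<odot>\<^bsub>S\<^esub> X = (\<lambda>k\<in>carrier G. c \<odot>\<^bsub>sym_algebra\<^esub> X k)"
  by (simp_all add: sym_skew_def skew_group_algebra_def)

lemma sym_map_surj: "sym_map ` carrier T = carrier S"
proof (intro equalityI subsetI)
  fix X assume "X \<in> sym_map ` carrier T"
  then show "X \<in> carrier S"
    by (auto simp: S_simps sym_map_def sym_algebra_simps carrier_T)
next
  fix X assume X: "X \<in> carrier S"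
  then have "\<forall>g\<in>carrier G. \<exists>t. finite_support t \<and> X g = sym_class t"
    by (auto simp: S_simps sym_algebra_simps PiE_def Pi_def)
  from bchoice[OF this] obtain t where t: "\<forall>g\<in>carrier G. finite_support (t g) \<and> X g = sym_class (t g)" by blast
  have "restrict t (carrier G) \<in> carrier T" using t by (simp add: carrier_T)
  moreover have "sym_map (restrict t (carrier G)) = X"
    using t X by (intro extensionalityI[of _ "carrier G"]) (auto simp: sym_map_def S_simps PiE_def)
  ultimately show "X \<in> sym_map ` carrier T" by blast
qed

lemma sym_map_one: "sym_map \<one>\<^bsub>T\<^esub> = \<one>\<^bsub>S\<^esub>"
  unfolding sym_map_def S_simps by (rule restrict_ext) (auto simp: T_one elem_apply sym_algebra_simps)

lemma sym_map_add: "x \<in> carrier T \<Longrightarrow> y \<in> carrier T \<Longrightarrow> sym_map (x \<oplus>\<^bsub>T\<^esub> y) = sym_map x \<oplus>\<^bsub>S\<^esub> sym_map y"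
  unfolding sym_map_def S_simps by (rule restrict_ext) (auto simp: T_add_apply sym_class_add carrier_T_support)

lemma sym_map_smult: "x \<in> carrier T \<Longrightarrow> sym_map (c \<odot>\<^bsub>T\<^esub> x) = c \<odot>\<^bsub>S\<^esub> sym_map x"
  unfolding sym_map_def S_simps by (rule restrict_ext) (auto simp: T_smult_apply sym_class_smult carrier_T_support)

lemma sym_map_mult:
  assumes x: "x \<in> carrier T" and y: "y \<in> carrier T"
  shows "sym_map (x \<otimes>\<^bsub>T\<^esub> y) = sym_map x \<otimes>\<^bsub>S\<^esub> sym_map y"
  unfolding sym_map_def[of "x \<otimes>\<^bsub>T\<^esub> y"] S_simps
proof (rule restrict_ext)
  fix k assume k: "k \<in> carrier G"
  have fin: "finite_support (x g)" "finite_support (act g (y (inv g \<otimes> k)))" if "g \<in> carrier G" for g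
    using x y k that by (auto intro!: carrier_T_support finite_support_action)
  have "(\<Oplus>\<^bsub>sym_algebra\<^esub>g\<in>carrier G. sym_map x g \<otimes>\<^bsub>sym_algebra\<^esub> sym_action (\<rho> g) (sym_map y (inv g \<otimes> k))) =
      (\<Oplus>\<^bsub>sym_algebra\<^esub>g\<in>carrier G. sym_class (x g \<odot>\<odot> act g (y (inv g \<otimes> k))))"
  proof (rule abelian_monoid.finsum_cong'[OF abelian_monoid_sym_algebra refl])
    show "(\<lambda>g. sym_class (x g \<odot>\<odot> act g (y (inv g \<otimes> k)))) \<in> carrier G \<rightarrow> carrier sym_algebra"
      using fin by (auto simp: sym_algebra_simps intro!: finite_support_mult)
    fix g assume g: "g \<in> carrier G"
    have "sym_action (\<rho> g) (sym_map y (inv g \<otimes> k)) = sym_class (act g (y (inv g \<otimes> k)))"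
      using g k carrier_T_support[OF y] by (simp add: sym_map_def sym_action_class)
    then show "sym_map x g \<otimes>\<^bsub>sym_algebra\<^esub> sym_action (\<rho> g) (sym_map y (inv g \<otimes> k)) =
        sym_class (x g \<odot>\<odot> act g (y (inv g \<otimes> k)))"
      using g fin by (simp add: sym_map_def sym_class_mult)
  qed
  also have "\<dots> = sym_class (\<Sum>g\<in>carrier G. x g \<odot>\<odot> act g (y (inv g \<otimes> k)))"
    using fin by (intro sym_finsum finite_support_mult)
  also have "\<dots> = sym_class ((x \<otimes>\<^bsub>T\<^esub> y) k)"
    using x y k by (simp add: T_mult_apply)
  finally show "sym_class ((x \<otimes>\<^bsub>T\<^esub> y) k) =
    (\<Oplus>\<^bsub>sym_algebra\<^esub>g\<in>carrier G. sym_map x g \<otimes>\<^bsub>sym_algebra\<^esub> sym_action (\<rho> g) (sym_map y (inv g \<otimes> k)))"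
    by simp
qed

lemma sym_map_eq_iff:
  assumes "x \<in> carrier T" "y \<in> carrier T"
  shows "sym_map x = sym_map y \<longleftrightarrow> (\<forall>g\<in>carrier G. (x \<ominus>\<^bsub>T\<^esub> y) g \<in> sym_ideal)"
proof -
  have "sym_map x = sym_map y \<longleftrightarrow> (\<forall>g\<in>carrier G. sym_class (x g) = sym_class (y g))"
    unfolding sym_map_def restrict_def fun_eq_iff by auto
  then show ?thesis
    using assms by (simp add: T_minus_apply sym_class_eq carrier_T_support del: fun_apply_simps)
qed

text \<open>The symmetric ideal is homogeneous, because the content at a multiset involves only
  words of its size.\<close>

lemma sym_ideal_parts:
  assumes "z \<in> carrier T" "g \<in> carrier G"
  shows "z g \<in> sym_ideal \<longleftrightarrow> (\<forall>k. part k z g \<in> sym_ideal)"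
  using assms carrier_T_support[OF assms]
  by (auto simp: sym_ideal_iff part_apply hpart_content finite_support_hpart)

lemma sym_map_homogeneous: "sym_map ` homogeneous k = sym_skew_degree G k"
proof (intro equalityI subsetI)
  fix X assume "X \<in> sym_map ` homogeneous k"
  then show "X \<in> sym_skew_degree G k"
    by (auto simp: sym_map_def sym_skew_degree_def sym_degree_def homogeneous_def tensor_degree_def carrier_T)
next
  fix X :: "'g \<Rightarrow> ('n list \<Rightarrow> complex) set"
  assume X: "X \<in> sym_skew_degree G k"
  then have "\<forall>g\<in>carrier G. \<exists>t. t \<in> tensor_degree k \<and> X g = sym_class t"
    by (auto simp: sym_skew_degree_def sym_degree_def PiE_def Pi_def)
  from bchoice[OF this] obtain t where t: "\<forall>g\<in>carrier G. t g \<in> tensor_degree k \<and> X g = sym_class (t g)" by blast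
  have "restrict t (carrier G) \<in> homogeneous k" using t by (simp add: homogeneous_def carrier_T tensor_degree_def)
  moreover have "sym_map (restrict t (carrier G)) = X"
    using t X by (intro extensionalityI[of _ "carrier G"]) (auto simp: sym_map_def sym_skew_degree_def PiE_def)
  ultimately show "X \<in> sym_map ` homogeneous k" by blast
qed

text \<open>Both gr A and S(V) # G are images of T(V) # G. Their fibres agree in each degree:
  components in the symmetric ideal give the zero class by sorting, and the converse is
  \<open>pbw\<close>. Both maps carry homogeneous elements onto the graded components, so the
  isomorphism respects degrees.\<close>

lemma graded_hecke_sufficient:
  assumes forms: "form_family G a" and inv: "hecke_invariant a" and jac: "hecke_jacobi a"
  shows "graded_hecke G \<rho> a"
proof -
  have reducible_iff: "reducible a k z \<longleftrightarrow> (\<forall>g\<in>carrier G. z g \<in> sym_ideal)" if z: "z \<in> homogeneous k" for k z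
  proof
    have zT: "z \<in> carrier T" using z by (simp add: homogeneous_def)
    show "reducible a k z" if "\<forall>g\<in>carrier G. z g \<in> sym_ideal"
      using z that zT by (intro sym_ideal_reducible) (auto simp: homogeneous_def)
    assume "reducible a k z"
    then obtain y where y: "y \<in> low k" "z \<ominus>\<^bsub>T\<^esub> y \<in> I a" by (auto simp: reducible_def)
    have yT: "y \<in> carrier T" using y(1) by (rule low_closed)
    have "z \<ominus>\<^bsub>T\<^esub> y \<in> low (Suc k)"
      unfolding a_minus_def
    proof (rule low_add)
      show "z \<in> low (Suc k)" using z by (auto simp: homogeneous_def low_def)
      show "\<ominus>\<^bsub>T\<^esub> y \<in> low (Suc k)" using low_a_inv[OF y(1)] low_mono[of k "Suc k"] by auto
    qed
    then have "part k (z \<ominus>\<^bsub>T\<^esub> y) g \<in> sym_ideal" if "g \<in> carrier G" for g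
      using pbw[OF forms inv jac y(2)] that by blast
    moreover have "part k (z \<ominus>\<^bsub>T\<^esub> y) = z"
      using zT yT by (simp add: part_minus homogeneous_part[OF z] part_vanishes[OF y(1)]) (simp add: a_minus_def)
    ultimately show "\<forall>g\<in>carrier G. z g \<in> sym_ideal" by simp
  qed
  have fibres: "gr_map a x = gr_map a y \<longleftrightarrow> sym_map x = sym_map y"
    if "x \<in> carrier T" "y \<in> carrier T" for x y
  proof -
    have d: "x \<ominus>\<^bsub>T\<^esub> y \<in> carrier T" using that by simp
    show ?thesis
      unfolding gr_map_eq_iff[OF that] sym_map_eq_iff[OF that]
      using reducible_iff[OF part_homogeneous[OF d]] sym_ideal_parts[OF d] by blast
  qed
  have gr: "gr_map a ` carrier T = carrier (Gr a)"
    using gr_map_closed gr_map_surj by blast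
  obtain f where f: "algebra_iso (Gr a) S f" "\<And>x. x \<in> carrier T \<Longrightarrow> f (gr_map a x) = sym_map x"
    by (rule algebra_iso_of_common_cover[OF gr sym_map_surj fibres])
      (auto simp: T_closed T_smult_closed gr_map_one gr_map_mult gr_map_add gr_map_smult
        sym_map_one sym_map_mult sym_map_add sym_map_smult)
  have "f ` assoc_graded_component (A a) (F a) k = sym_skew_degree G k" for k
  proof -
    have "f ` assoc_graded_component (A a) (F a) k = (\<lambda>x. f (gr_map a x)) ` homogeneous k"
      unfolding gr_map_homogeneous[symmetric] by (rule image_image)
    also have "\<dots> = sym_map ` homogeneous k"
      by (rule image_cong) (auto simp: homogeneous_def f(2))
    finally show ?thesis by (simp add: sym_map_homogeneous)
  qed
  then show ?thesis using f(1) by (auto simp: graded_hecke_def Let_def)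
qed

text \<open>A word with at most one letter is the only arrangement of its multiset, so its
  coefficient is a content.\<close>

lemma sym_ideal_low_degree:
  fixes t :: "'n list \<Rightarrow> complex"
  assumes "t \<in> sym_ideal" "length w \<le> 1"
  shows "t w = 0"
proof -
  have "{w'. mset w' = mset w} = {w}"
    using assms(2) by (cases w rule: remdups_adj.cases) auto
  then have "mset_content t (mset w) = t w" by (simp add: mset_content_def)
  then show ?thesis using assms(1) sym_ideal_content by metis
qed

text \<open>
  In degrees at most one, \<open>S(V) # G\<close> and \<open>T(V) # G\<close> agree, and a graded isomorphism
  turns \<open>gr_map\<close> into a surjective endomorphism of a finite-dimensional space.
\<close>

lemma graded_hecke_injective:
  assumes hecke: "graded_hecke G \<rho> a" and k: "k \<le> 1"
    and x: "x \<in> homogeneous k" "gr_map a x = gr_map a \<zero>\<^bsub>T\<^esub>"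
  shows "x = \<zero>\<^bsub>T\<^esub>"
proof -
  obtain f where iso: "algebra_iso (Gr a) S f"
    and comp: "\<And>k. f ` assoc_graded_component (A a) (F a) k = sym_skew_degree G k"
    using hecke by (auto simp: graded_hecke_def Let_def)
  have f_add: "f (X \<oplus>\<^bsub>Gr a\<^esub> Y) = f X \<oplus>\<^bsub>S\<^esub> f Y" if "X \<in> carrier (Gr a)" "Y \<in> carrier (Gr a)" for X Y
    using iso that by (auto simp: algebra_iso_def ring_iso_def ring_hom_def)
  have f_smult: "f (c \<odot>\<^bsub>Gr a\<^esub> X) = c \<odot>\<^bsub>S\<^esub> f X" if "X \<in> carrier (Gr a)" for c X
    using iso that by (auto simp: algebra_iso_def)
  define J where "J = carrier G \<times> {w :: 'n list. length w = k}"
  have J: "finite J" unfolding J_def using finite_G finite_words_of_length by (rule finite_cartesian_product)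
  define V where "V = {c :: 'g \<times> 'n list \<Rightarrow> complex. \<forall>j. j \<notin> J \<longrightarrow> c j = 0}"
  define enc where "enc x = (\<lambda>(g, w). if (g, w) \<in> J then x g w else 0)" for x :: "'g \<Rightarrow> 'n list \<Rightarrow> complex"
  define dec where "dec c = (\<lambda>g\<in>carrier G. \<lambda>w. c (g, w))" for c :: "'g \<times> 'n list \<Rightarrow> complex"
  have enc_V: "enc x \<in> V" for x by (auto simp: enc_def V_def)
  have dec_H: "dec c \<in> homogeneous k" if "c \<in> V" for c
  proof -
    have "finite_support (dec c g)" if "g \<in> carrier G" for g
      unfolding finite_support_bound using that \<open>c \<in> V\<close>
      by (intro exI[of _ k]) (auto simp: dec_def V_def J_def)
    then show ?thesis using that by (auto simp: homogeneous_def carrier_T dec_def V_def J_def)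
  qed
  have HT: "x \<in> homogeneous k \<Longrightarrow> x \<in> carrier T" for x by (simp add: homogeneous_def)
  have dec_enc: "dec (enc x) = x" if "x \<in> homogeneous k" for x
    by (rule T_ext[OF HT[OF dec_H[OF enc_V]] HT[OF that]])
      (use that in \<open>auto simp: dec_def enc_def J_def homogeneous_def fun_eq_iff\<close>)
  have enc_dec: "enc (dec c) = c" if "c \<in> V" for c
    using that by (auto simp: dec_def enc_def V_def J_def fun_eq_iff)
  have sym_inj: "y = y'" if "y \<in> homogeneous k" "y' \<in> homogeneous k" "sym_map y = sym_map y'" for y y'
  proof (rule T_ext[OF HT[OF that(1)] HT[OF that(2)]])
    fix g assume g: "g \<in> carrier G"
    show "y g = y' g"
    proof
      fix w
      show "y g w = y' g w"
      proof (cases "length w = k")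
        case True
        have "(y \<ominus>\<^bsub>T\<^esub> y') g \<in> sym_ideal" using that sym_map_eq_iff HT g by blast
        then have "(y \<ominus>\<^bsub>T\<^esub> y') g w = 0" using sym_ideal_low_degree True k by blast
        then show ?thesis using that HT g by (simp add: T_minus_apply)
      next
        case False
        then show ?thesis using that g unfolding homogeneous_def by force
      qed
    qed
  qed
  \<comment> \<open>In degree at most one \<open>sym_map\<close> is injective on homogeneous
    elements, so \<open>lift\<close> is its inverse on this component of S(V) # G.\<close>
  define lift where "lift X = (SOME y. y \<in> homogeneous k \<and> sym_map y = X)" for X
  have lift: "lift X \<in> homogeneous k \<and> sym_map (lift X) = X" if "X \<in> sym_skew_degree G k" for X
  proof -
    have "X \<in> sym_map ` homogeneous k" using that by (simp only: sym_map_homogeneous)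
    then have "\<exists>y. y \<in> homogeneous k \<and> sym_map y = X" by blast
    then show ?thesis unfolding lift_def by (rule someI_ex)
  qed
  have lift_sym: "lift (sym_map y) = y" if "y \<in> homogeneous k" for y
  proof -
    have "sym_map y \<in> sym_skew_degree G k" unfolding sym_map_homogeneous[symmetric] using that by (rule imageI)
    from lift[OF this] show ?thesis using sym_inj that by blast
  qed
  \<comment> \<open>The abstract isomorphism read back in T(V) # G. It is surjective since
    \<open>f\<close> maps components onto components, and an element with the class of 0 is sent to
    0.\<close>
  define M where "M x = lift (f (gr_map a x))" for x
  have fgr: "f (gr_map a x) \<in> sym_skew_degree G k" if "x \<in> homogeneous k" for x
    unfolding comp[symmetric] gr_map_homogeneous[symmetric] using that by (intro imageI)
  have M_H: "M x \<in> homogeneous k" and M_sym: "sym_map (M x) = f (gr_map a x)" if "x \<in> homogeneous k" for x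
    using lift[OF fgr[OF that]] by (simp_all add: M_def)
  have H_add: "x \<oplus>\<^bsub>T\<^esub> y \<in> homogeneous k" if "x \<in> homogeneous k" "y \<in> homogeneous k" for x y
    using that unfolding homogeneous_def by (auto simp: T_closed T_add_apply) (metis add.right_neutral)
  have H_smult: "c \<odot>\<^bsub>T\<^esub> x \<in> homogeneous k" if "x \<in> homogeneous k" for x c
    using that unfolding homogeneous_def by (auto simp: T_smult_closed T_smult_apply tensor_scale_def)
  have M_add: "M (x \<oplus>\<^bsub>T\<^esub> y) = M x \<oplus>\<^bsub>T\<^esub> M y" if "x \<in> homogeneous k" "y \<in> homogeneous k" for x y
    by (rule sym_inj) (use that in \<open>simp_all add: M_H H_add M_sym sym_map_add HT gr_map_add f_add gr_map_closed\<close>)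
  have M_smult: "M (c \<odot>\<^bsub>T\<^esub> x) = c \<odot>\<^bsub>T\<^esub> M x" if "x \<in> homogeneous k" for c x
    by (rule sym_inj) (use that in \<open>simp_all add: M_H H_smult M_sym sym_map_smult HT gr_map_smult f_smult gr_map_closed\<close>)
  have M_surj: "\<exists>x\<in>homogeneous k. M x = y" if y: "y \<in> homogeneous k" for y
  proof -
    have "sym_map y \<in> f ` gr_map a ` homogeneous k"
      unfolding gr_map_homogeneous comp sym_map_homogeneous[symmetric] using y by (rule imageI)
    then obtain x where "x \<in> homogeneous k" "sym_map y = f (gr_map a x)" by blast
    then show ?thesis using lift_sym[OF y] by (auto simp: M_def)
  qed
  have dec_add: "dec (c + d) = dec c \<oplus>\<^bsub>T\<^esub> dec d" for c d
    by (auto simp: dec_def T_add fun_eq_iff)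
  have enc_add: "enc (x \<oplus>\<^bsub>T\<^esub> y) = enc x + enc y" for x y
    by (auto simp: enc_def J_def T_add fun_eq_iff)
  have dec_smult: "dec (\<lambda>j. c * d j) = c \<odot>\<^bsub>T\<^esub> dec d" for c d
    by (auto simp: dec_def T_smult tensor_scale_def fun_eq_iff)
  have enc_smult: "enc (c \<odot>\<^bsub>T\<^esub> x) = (\<lambda>j. c * enc x j)" for c x
    by (auto simp: enc_def J_def T_smult tensor_scale_def fun_eq_iff)
  have zero_H: "\<zero>\<^bsub>T\<^esub> \<in> homogeneous k" unfolding homogeneous_def by (auto simp: T_zero_closed) (simp add: T_zero)
  have M_zero: "M \<zero>\<^bsub>T\<^esub> = \<zero>\<^bsub>T\<^esub>"
  proof -
    have "M \<zero>\<^bsub>T\<^esub> \<oplus>\<^bsub>T\<^esub> M \<zero>\<^bsub>T\<^esub> = M \<zero>\<^bsub>T\<^esub>" using M_add[OF zero_H zero_H] T_zero_closed by simp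
    then show ?thesis using HT[OF M_H[OF zero_H]] T.add.l_cancel_one by simp
  qed
  have "enc x = 0"
  proof (rule finite_coordinates_surj_inj[OF J, where N = "\<lambda>c. enc (M (dec c))" and V = V])
    show "enc (M (dec (c + d))) = enc (M (dec c)) + enc (M (dec d))" if "c \<in> V" "d \<in> V" for c d
      using that dec_H by (simp only: dec_add M_add enc_add)
    show "enc (M (dec (\<lambda>j. c * d j))) = (\<lambda>j. c * enc (M (dec d)) j)" if "d \<in> V" for c d
      using that dec_H by (simp only: dec_smult M_smult enc_smult)
    show "V = {c. \<forall>j. j \<notin> J \<longrightarrow> c j = 0}" by (rule V_def)
    show "V \<subseteq> (\<lambda>c. enc (M (dec c))) ` V"
    proof
      fix c assume c: "c \<in> V"
      obtain y where y: "y \<in> homogeneous k" "M y = dec c" using M_surj[OF dec_H[OF c]] by blast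
      then have "c = enc (M (dec (enc y)))" using enc_dec[OF c] dec_enc by simp
      then show "c \<in> (\<lambda>c. enc (M (dec c))) ` V" using enc_V by blast
    qed
    show "enc x \<in> V" by (rule enc_V)
    have "M x = \<zero>\<^bsub>T\<^esub>" using x(2) M_zero by (simp add: M_def)
    then show "enc (M (dec (enc x))) = 0"
      unfolding dec_enc[OF x(1)] by (auto simp: enc_def T_zero J_def fun_eq_iff)
  qed
  then have "x = dec 0" using dec_enc[OF x(1)] by simp
  then show ?thesis by (auto simp: dec_def T_zero fun_eq_iff)
qed

text \<open>For necessity the ideal must contain no nonzero element of degree at most one. The
  degree one part of such an element is congruent to minus its degree zero part, so its class
  vanishes and it is 0. What remains is homogeneous of degree 0 and congruent to 0.\<close>

theorem graded_hecke_iff: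
  assumes forms: "form_family G a"
  shows "graded_hecke G \<rho> a \<longleftrightarrow> hecke_invariant a \<and> hecke_jacobi a"
proof
  assume "hecke_invariant a \<and> hecke_jacobi a"
  then show "graded_hecke G \<rho> a" using graded_hecke_sufficient[OF forms] by blast
next
  assume hecke: "graded_hecke G \<rho> a"
  have faithful: "x = \<zero>\<^bsub>T\<^esub>" if xI: "x \<in> I a" and low: "x \<in> low 2" for x
  proof -
    have xT: "x \<in> carrier T" using low by (rule low_closed)
    have zero_class: "gr_map a y = gr_map a \<zero>\<^bsub>T\<^esub>" if y: "y \<in> homogeneous k" "reducible a k y" for y k
    proof -
      have yT: "y \<in> carrier T" using y by (simp add: homogeneous_def)
      have "y \<ominus>\<^bsub>T\<^esub> \<zero>\<^bsub>T\<^esub> = y" using yT by (simp add: a_minus_def)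
      moreover have "reducible a j (part j y)" for j
        using y homogeneous_part[OF y(1)] part_part[OF yT, of j k] reducible_zero[of a j] by (cases "j = k") auto
      ultimately show ?thesis using yT T_zero_closed by (simp add: gr_map_eq_iff)
    qed
    have split: "x = part 1 x \<oplus>\<^bsub>T\<^esub> part 0 x"
    proof (rule T_ext)
      fix g assume g: "g \<in> carrier G"
      have "x g w = hpart 1 (x g) w + hpart 0 (x g) w" for w
      proof (cases "x g w = 0")
        case False
        then have "length w < 2" using low g unfolding low_def by blast
        then have "length w = 0 \<or> length w = 1" by arith
        then show ?thesis by (auto simp: hpart_def)
      qed (auto simp: hpart_def)
      then show "x g = (part 1 x \<oplus>\<^bsub>T\<^esub> part 0 x) g"
        using g by (simp add: T_add_apply part_apply fun_eq_iff)
    qed (use xT in \<open>auto simp: part_closed T_closed\<close>)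
    have "part 1 x \<ominus>\<^bsub>T\<^esub> \<ominus>\<^bsub>T\<^esub> part 0 x = x"
      using xT split by (simp add: a_minus_def part_closed)
    moreover have "\<ominus>\<^bsub>T\<^esub> part 0 x \<in> low 1" using part_low[OF xT, of 0] low_a_inv by simp
    ultimately have "reducible a 1 (part 1 x)" unfolding reducible_def using xI by metis
    then have "part 1 x = \<zero>\<^bsub>T\<^esub>"
      using graded_hecke_injective[OF hecke] zero_class part_homogeneous[OF xT] by blast
    then have x0: "part 0 x = x" using split part_closed[OF xT] by simp
    have "x \<ominus>\<^bsub>T\<^esub> \<zero>\<^bsub>T\<^esub> = x" using xT by (simp add: a_minus_def)
    then have "reducible a 0 x" unfolding reducible_def using xI low_zero by metis
    moreover have "x \<in> homogeneous 0" using part_homogeneous[OF xT, of 0] x0 by simp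
    ultimately show ?thesis using graded_hecke_injective[OF hecke, of 0] zero_class by blast
  qed
  show "hecke_invariant a \<and> hecke_jacobi a"
    using hecke_invariant_necessary hecke_jacobi_necessary faithful by blast
qed

end

section \<open>Skew-symmetric forms supported on fixed-space complements\<close>

text \<open>Alternating forms on a plane form a line, so an endomorphism rescales them by its
  determinant. The basis inside \<open>det_on\<close> is an arbitrary choice, and the computation
  runs in that very basis.\<close>

lemma det_on_two_dim:
  fixes b :: "complex^'n \<Rightarrow> complex^'n \<Rightarrow> complex" and M :: "complex^'n^'n"
  assumes b: "skew_bilinear_form b" and sub: "vec.subspace W" and dim: "vec.dim W = 2"
    and M: "\<And>v. v \<in> W \<Longrightarrow> M *v v \<in> W" and xy: "x \<in> W" "y \<in> W"
  shows "b (M *v x) (M *v y) = det_on W (\<lambda>v. M *v v) * b x y"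
proof -
  define B where "B = (SOME B. is_basis_of B W)"
  have "\<exists>B. is_basis_of B W"
    using vec.basis_exists[of W] vec.span_subspace[OF _ _ sub] unfolding is_basis_of_def by metis
  then have "is_basis_of B W" unfolding B_def by (rule someI_ex)
  then have ind: "vec.independent B" and span: "vec.span B = W" by (auto simp: is_basis_of_def)
  have "card B = 2" using vec.dim_eq_card[OF refl ind] vec.dim_span[of B] span dim by simp
  then obtain b1 b2 where B: "B = {b1, b2}" "b1 \<noteq> b2" by (meson card_2_iff)
  have rep: "v = vec.representation B v b1 *s b1 + vec.representation B v b2 *s b2" if "v \<in> W" for v
    using vec.sum_representation_eq[OF ind, of v B] that span B by simp
  have BW: "b1 \<in> W" "b2 \<in> W" using span B vec.span_base[of b1 B] vec.span_base[of b2 B] by auto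
  define m where "m i j = vec.representation B (M *v i) j" for i j
  have det: "det_on W (\<lambda>v. M *v v) = m b1 b1 * m b2 b2 - m b1 b2 * m b2 b1"
  proof -
    have "{p. p permutes B} = {id, Transposition.transpose b1 b2}"
      by (auto simp: B permutes_doubleton_iff)
    moreover have "id \<noteq> Transposition.transpose b1 b2"
      using B(2) by (metis id_apply transpose_apply_first)
    ultimately show ?thesis
      unfolding det_on_def B_def[symmetric] Let_def m_def using B
      by (simp add: sign_swap_id)
  qed
  define X1 X2 Y1 Y2 where "X1 = vec.representation B x b1" and "X2 = vec.representation B x b2"
    and "Y1 = vec.representation B y b1" and "Y2 = vec.representation B y b2"
  have x: "x = X1 *s b1 + X2 *s b2" and y: "y = Y1 *s b1 + Y2 *s b2"
    unfolding X1_def X2_def Y1_def Y2_def using rep xy by auto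
  have Mb: "M *v b1 = m b1 b1 *s b1 + m b1 b2 *s b2" "M *v b2 = m b2 b1 *s b1 + m b2 b2 *s b2"
    unfolding m_def using rep M BW by auto
  have comb: "b (p *s u + q *s w) (r *s u + s *s w) = (p * s - q * r) * b u w" for p q r s u w
    using skew_formD(5)[OF b, of w u] skew_form_self[OF b]
    by (simp add: skew_formD(1-4)[OF b] algebra_simps)
  have "b (M *v x) (M *v y) = b (X1 *s (M *v b1) + X2 *s (M *v b2)) (Y1 *s (M *v b1) + Y2 *s (M *v b2))"
    unfolding x y by (simp add: vec.add vec.scale)
  also have "\<dots> = (X1 * Y2 - X2 * Y1) * b (M *v b1) (M *v b2)" by (rule comb)
  also have "b (M *v b1) (M *v b2) = det_on W (\<lambda>v. M *v v) * b b1 b2"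
    unfolding Mb comb det ..
  also have "(X1 * Y2 - X2 * Y1) * (det_on W (\<lambda>v. M *v v) * b b1 b2) = det_on W (\<lambda>v. M *v v) * b x y"
    unfolding x y comb by simp
  finally show ?thesis .
qed

section \<open>Orthogonal decomposition along a fixed space\<close>

locale hermitian_rep = finite_group_rep +
  fixes ip :: "complex^'c \<Rightarrow> complex^'c \<Rightarrow> complex"
  assumes herm: "hermitian_inner_product ip" and ip_inv: "invariant_form G \<rho> ip"
begin

lemma ip_add_left: "ip (u + v) w = ip u w + ip v w"
  and ip_scale_left: "ip (c *s v) w = c * ip v w"
  and ip_cnj: "ip w v = cnj (ip v w)"
  using herm unfolding hermitian_inner_product_def by blast+

lemma ip_add_right: "ip u (v + w) = ip u v + ip u w"
proof -
  have "ip u (v + w) = cnj (ip (v + w) u)" by (rule ip_cnj)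
  also have "\<dots> = ip u v + ip u w" by (simp add: ip_add_left ip_cnj[symmetric])
  finally show ?thesis .
qed

lemma ip_scale_right: "ip v (c *s w) = cnj c * ip v w"
proof -
  have "ip v (c *s w) = cnj (ip (c *s w) v)" by (rule ip_cnj)
  also have "\<dots> = cnj c * ip v w" by (simp add: ip_scale_left ip_cnj[symmetric])
  finally show ?thesis .
qed

lemma ip_diff_left: "ip (u - v) w = ip u w - ip v w"
  using ip_add_left[of "u - v" v w] by simp

lemma ip_diff_right: "ip u (v - w) = ip u v - ip u w"
  using ip_add_right[of u "v - w" w] by simp

lemma ip_zero_left: "ip 0 v = 0"
  using ip_scale_left[of 0 0 v] by simp

lemma ip_self_eq_0:
  assumes "ip v v = 0"
  shows "v = 0"
proof (rule ccontr)
  assume "v \<noteq> 0"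
  then have "0 < Re (ip v v)" using herm unfolding hermitian_inner_product_def by blast
  then show False using assms by simp
qed

lemma ip_rho: "g \<in> carrier G \<Longrightarrow> ip (\<rho> g *v v) (\<rho> g *v w) = ip v w"
  using ip_inv unfolding invariant_form_def by blast

abbreviation "fix g \<equiv> fixed_space (\<rho> g)"
abbreviation "perp g \<equiv> orth_compl ip (fix g)"

lemma fix_iff: "v \<in> fix g \<longleftrightarrow> \<rho> g *v v = v"
  by (simp add: fixed_space_def)

lemma subspace_fix: "vec.subspace (fix g)"
  by (rule vec.subspaceI) (simp_all add: fixed_space_def vec.add vec.scale)

lemma subspace_perp: "vec.subspace (perp g)"
  by (rule vec.subspaceI) (auto simp: orth_compl_def ip_zero_left ip_add_left ip_scale_left)

text \<open>\<open>g\<close> preserves the inner product and a fixed vector is its own image, so v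
  and g v have the same product with it.\<close>

lemma moved_perp:
  assumes g: "g \<in> carrier G"
  shows "v - \<rho> g *v v \<in> perp g"
  unfolding orth_compl_def
proof (intro CollectI ballI)
  fix u assume "u \<in> fix g"
  then have "ip (\<rho> g *v v) u = ip v u" using ip_rho[OF g, of v u] by (simp add: fix_iff)
  then show "ip (v - \<rho> g *v v) u = 0" by (simp add: ip_diff_left)
qed

lemma fix_perp_Int: "fix g \<inter> perp g = {0}"
  using ip_self_eq_0 vec.subspace_0[OF subspace_fix] vec.subspace_0[OF subspace_perp]
  by (auto simp: orth_compl_def)

text \<open>Applying \<open>g\<close> shifts the exponents by one, and the sum closes up because the
  power with exponent \<open>order G\<close> is the identity. The order of the group serves for
  every \<open>g\<close>; the orbit may be run through several times.\<close>

lemma orbit_sum: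
  assumes g: "g \<in> carrier G"
  shows "(\<Sum>i<order G. \<rho> (g [^] i) *v v) \<in> fix g"
proof -
  have "\<rho> g *v (\<Sum>i<order G. \<rho> (g [^] i) *v v) = (\<Sum>i<order G. \<rho> (g [^] Suc i) *v v)"
    unfolding vec.sum
  proof (rule sum.cong[OF refl])
    fix i :: nat
    have "g [^] Suc i = g \<otimes> g [^] i" using g nat_pow_Suc2 by blast
    then show "\<rho> g *v (\<rho> (g [^] i) *v v) = \<rho> (g [^] Suc i) *v v" using g by (simp only: rho_mult_vec nat_pow_closed)
  qed
  also have "\<dots> + \<rho> (g [^] (0::nat)) *v v = (\<Sum>i<order G. \<rho> (g [^] i) *v v) + \<rho> (g [^] order G) *v v"
    using sum.lessThan_Suc_shift[of "\<lambda>i. \<rho> (g [^] i) *v v" "order G"]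
    by (simp add: add.commute)
  finally show ?thesis
    using pow_order_eq_1[OF g] by (simp add: fix_iff)
qed

lemma order_pos: "of_nat (order G) \<noteq> (0::complex)"
  using finite_G order_gt_0_iff_finite by simp

text \<open>The mean over the powers of \<open>g\<close> is the projection to the fixed space. The
  remainder is a mean of vectors v - g^i v, which are telescoping sums of vectors of the kind
  treated in \<open>moved_perp\<close>.\<close>

lemma fix_perp_decomp:
  assumes g: "g \<in> carrier G"
  obtains p q where "v = p + q" "p \<in> fix g" "q \<in> perp g"
proof -
  define p where "p = (1 / of_nat (order G)) *s (\<Sum>i<order G. \<rho> (g [^] i) *v v)"
  have p: "p \<in> fix g" unfolding p_def using orbit_sum[OF g] vec.subspace_scale[OF subspace_fix] by blast
  have powers: "v - \<rho> (g [^] i) *v v \<in> perp g" for i :: nat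
  proof (induction i)
    case 0
    then show ?case using vec.subspace_0[OF subspace_perp] by simp
  next
    case (Suc i)
    have "g [^] Suc i = g \<otimes> g [^] i" using g nat_pow_Suc2 by blast
    then have eq: "v - \<rho> (g [^] Suc i) *v v =
        (v - \<rho> (g [^] i) *v v) + (\<rho> (g [^] i) *v v - \<rho> g *v (\<rho> (g [^] i) *v v))"
      using g by (simp only: rho_mult_vec nat_pow_closed) simp
    show ?case unfolding eq by (rule vec.subspace_add[OF subspace_perp Suc moved_perp[OF g]])
  qed
  have "v = (1 / of_nat (order G)) *s (\<Sum>i<order G. v)"
    unfolding vec_eq_iff vector_smult_component sum_component using order_pos by simp
  then have "v - p = (1 / of_nat (order G)) *s (\<Sum>i<order G. v - \<rho> (g [^] i) *v v)"
    unfolding p_def sum_subtractf vec.scale_right_diff_distrib by simp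
  then have "v - p \<in> perp g"
    by (simp only:)
      (intro vec.subspace_scale[OF subspace_perp] vec.subspace_sum[OF subspace_perp] powers)
  then show thesis using p that[of p "v - p"] by simp
qed

lemma dim_perp:
  assumes g: "g \<in> carrier G"
  shows "vec.dim (perp g) = codim (fix g)"
proof -
  have "{x + y | x y. x \<in> fix g \<and> y \<in> perp g} = (UNIV :: (complex^'c) set)"
  proof -
    have "v \<in> {x + y | x y. x \<in> fix g \<and> y \<in> perp g}" for v
    proof -
      obtain p q where "v = p + q" "p \<in> fix g" "q \<in> perp g" by (rule fix_perp_decomp[OF g])
      then show ?thesis by blast
    qed
    then show ?thesis by blast
  qed
  then have "vec.dim (UNIV :: (complex^'c) set) = vec.dim (fix g) + vec.dim (perp g)"
    using vec.dim_sums_Int[OF subspace_fix subspace_perp, of g g] by (simp add: fix_perp_Int)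
  then show ?thesis by (simp add: codim_def)
qed

lemma centralizer_iff: "h \<in> centralizer G g \<longleftrightarrow> h \<in> carrier G \<and> h \<otimes> g = g \<otimes> h"
  by (simp add: centralizer_def)

lemma centralizer_fix:
  assumes "g \<in> carrier G" "h \<in> centralizer G g" "v \<in> fix g"
  shows "\<rho> h *v v \<in> fix g"
proof -
  have h: "h \<in> carrier G" "h \<otimes> g = g \<otimes> h" using assms(2) by (simp_all add: centralizer_iff)
  show ?thesis
    using rho_mult_vec[OF assms(1) h(1), of v] rho_mult_vec[OF h(1) assms(1), of v] h(2) assms(3)
    by (simp add: fix_iff)
qed

text \<open>The inverse of \<open>h\<close> commutes with \<open>g\<close> too and so maps V^g to
  itself; unitarity moves it to the other side of the inner product.\<close>

lemma centralizer_perp: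
  assumes g: "g \<in> carrier G" and h: "h \<in> centralizer G g" and v: "v \<in> perp g"
  shows "\<rho> h *v v \<in> perp g"
  unfolding orth_compl_def
proof (intro CollectI ballI)
  fix u assume u: "u \<in> fix g"
  have hG: "h \<in> carrier G" "h \<otimes> g = g \<otimes> h" using h by (simp_all add: centralizer_iff)
  have "inv h \<otimes> g = g \<otimes> inv h" using g hG by (metis inv_closed inv_solve_left inv_solve_right m_assoc m_closed)
  then have "inv h \<in> centralizer G g" using hG by (simp add: centralizer_iff)
  then have "\<rho> (inv h) *v u \<in> fix g" using centralizer_fix g u by blast
  then have "ip v (\<rho> (inv h) *v u) = 0" using v by (simp add: orth_compl_def)
  then show "ip (\<rho> h *v v) u = 0" using ip_rho[OF hG(1), of v "\<rho> (inv h) *v u"] hG by simp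
qed

definition supported :: "(complex^'c \<Rightarrow> complex^'c \<Rightarrow> complex) \<Rightarrow> 'a \<Rightarrow> bool" where
  "supported b g \<longleftrightarrow> skew_bilinear_form b \<and> (\<forall>u\<in>fix g. \<forall>v. b u v = 0)"

lemma supportedD:
  assumes "supported b g"
  shows "skew_bilinear_form b" "u \<in> fix g \<Longrightarrow> b u v = 0" "u \<in> fix g \<Longrightarrow> b v u = 0"
proof -
  show b: "skew_bilinear_form b" and u: "u \<in> fix g \<Longrightarrow> b u v = 0"
    using assms unfolding supported_def by blast+
  show "u \<in> fix g \<Longrightarrow> b v u = 0" using u skew_formD(5)[OF b, of v u] by simp
qed

lemma supported_add_fix:
  assumes b: "supported b g" and p: "p \<in> fix g" "q \<in> fix g"
  shows "b (p + v) (q + w) = b v w"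
  using b p by (simp add: skew_formD(1,3)[OF supportedD(1)[OF b]] supportedD[OF b])

text \<open>The form ignores components in V^g, and elements of Z(g) respect the decomposition. On
  the plane orthogonal to V^g the factor is the determinant, which is how chi_g is defined.\<close>

lemma supported_chi:
  assumes g: "g \<in> carrier G" and codim: "codim (fix g) = 2" and h: "h \<in> centralizer G g"
    and b: "supported b g"
  shows "b (\<rho> h *v x) (\<rho> h *v y) = chi \<rho> ip g h * b x y"
proof -
  obtain p x' where x: "x = p + x'" "p \<in> fix g" "x' \<in> perp g" by (rule fix_perp_decomp[OF g])
  obtain q y' where y: "y = q + y'" "q \<in> fix g" "y' \<in> perp g" by (rule fix_perp_decomp[OF g])
  have "b (\<rho> h *v x) (\<rho> h *v y) = b (\<rho> h *v x') (\<rho> h *v y')"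
    unfolding x(1) y(1) vec.add
    by (rule supported_add_fix[OF b]) (use centralizer_fix[OF g h] x y in auto)
  also have "\<dots> = chi \<rho> ip g h * b x' y'"
    unfolding chi_def
    by (rule det_on_two_dim[OF supportedD(1)[OF b] subspace_perp])
      (use dim_perp[OF g] codim centralizer_perp[OF g h] x y in auto)
  also have "b x' y' = b x y"
    unfolding x(1) y(1) using supported_add_fix[OF b x(2) y(2)] by simp
  finally show ?thesis .
qed

text \<open>A Gram determinant with \<open>w1\<close> and \<open>w2\<close> in the conjugate-linear
  argument, hence bilinear in \<open>v\<close> and \<open>w\<close>: an explicit alternating form
  that ignores everything orthogonal to \<open>w1\<close> and \<open>w2\<close>.\<close>

definition gram :: "complex^'c \<Rightarrow> complex^'c \<Rightarrow> complex^'c \<Rightarrow> complex^'c \<Rightarrow> complex" where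
  "gram w1 w2 v w = ip v w1 * ip w w2 - ip v w2 * ip w w1"

lemma gram_skew: "skew_bilinear_form (gram w1 w2)"
  unfolding skew_bilinear_form_def gram_def
  by (simp add: ip_add_left ip_scale_left algebra_simps)

lemma gram_nonzero:
  assumes "vec.independent {w1, w2}" "w1 \<noteq> w2"
  shows "gram w1 w2 w1 w2 \<noteq> 0"
proof
  assume "gram w1 w2 w1 w2 = 0"
  then have gram: "ip w1 w1 * ip w2 w2 = ip w1 w2 * ip w2 w1" by (simp add: gram_def)
  \<comment> \<open>A vanishing Gram determinant is the equality case of Cauchy-Schwarz: this
    combination is orthogonal to both vectors, hence to itself.\<close>
  define v where "v = ip w2 w2 *s w1 - ip w1 w2 *s w2"
  have "ip v w1 = 0" "ip v w2 = 0"
    using gram by (simp_all add: v_def ip_diff_left ip_scale_left mult.commute)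
  then have "ip v v = 0"
    by (subst (2) v_def) (simp add: ip_diff_right ip_scale_right)
  then have "v = 0" by (rule ip_self_eq_0)
  moreover have "ip w2 w2 \<noteq> 0"
  proof
    assume "ip w2 w2 = 0"
    then have "w2 = 0" by (rule ip_self_eq_0)
    then show False using assms(1) vec.dependent_zero[of "{w1, w2}"] by blast
  qed
  ultimately have "w1 = (ip w1 w2 / ip w2 w2) *s w2"
    unfolding v_def by (simp add: vec_eq_iff field_simps)
  then have "w1 \<in> vec.span {w2}" using vec.span_scale[OF vec.span_base, of w2 "{w2}"] by (metis insertI1)
  then show False using assms by (auto simp: vec.independent_insert)
qed

section \<open>Forms with the fixed space in the radical, in codimension two\<close>

lemma span_pair: "v \<in> vec.span {w1, w2} \<Longrightarrow> \<exists>c d. v = c *s w1 + d *s w2"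
  by (auto simp: vec.span_insert vec.span_singleton algebra_simps)

context
  fixes g w1 w2
  assumes g: "g \<in> carrier G" and w: "w1 \<noteq> w2" "is_basis_of {w1, w2} (perp g)"
begin

lemma basis_facts: "vec.independent {w1, w2}" "w1 \<in> perp g" "w2 \<in> perp g" "vec.span {w1, w2} = perp g"
  using w vec.span_base[of w1 "{w1, w2}"] vec.span_base[of w2 "{w1, w2}"] by (auto simp: is_basis_of_def)

lemma gram_supported: "supported (gram w1 w2) g"
proof -
  have "ip u w1 = 0" "ip u w2 = 0" if "u \<in> fix g" for u
    using that basis_facts ip_cnj[of u] by (auto simp: orth_compl_def)
  then show ?thesis by (simp add: supported_def gram_skew) (simp add: gram_def)
qed

abbreviation "gr0 \<equiv> gram w1 w2 w1 w2"

lemma gr0: "gr0 \<noteq> 0"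
  by (rule gram_nonzero[OF basis_facts(1) w(1)])

lemma basis_decomp:
  obtains p c d where "v = p + (c *s w1 + d *s w2)" "p \<in> fix g"
proof -
  obtain p q where pq: "v = p + q" "p \<in> fix g" "q \<in> perp g" by (rule fix_perp_decomp[OF g])
  obtain c d where "q = c *s w1 + d *s w2" using span_pair pq(3) basis_facts(4) by metis
  then show thesis using that pq by blast
qed

text \<open>Modulo V^g both forms are evaluated by the 2 by 2 determinant of coordinates with
  respect to \<open>w1\<close> and \<open>w2\<close>, so they are proportional.\<close>

lemma supported_eq:
  assumes b: "supported b g"
  shows "b v w * gr0 = b w1 w2 * gram w1 w2 v w"
proof -
  obtain p c d where v: "v = p + (c *s w1 + d *s w2)" "p \<in> fix g" by (rule basis_decomp)
  obtain q c' d' where w: "w = q + (c' *s w1 + d' *s w2)" "q \<in> fix g" by (rule basis_decomp)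
  have eval: "f v w = (c * d' - d * c') * f w1 w2" if f: "supported f g" for f
  proof -
    have fs: "skew_bilinear_form f" using f by (rule supportedD)
    show ?thesis
      unfolding v(1) w(1) supported_add_fix[OF f v(2) w(2)]
      using skew_formD(5)[OF fs, of w2 w1] skew_form_self[OF fs]
      by (simp add: skew_formD(1-4)[OF fs] algebra_simps)
  qed
  show ?thesis using eval[OF b] eval[OF gram_supported] by simp
qed

text \<open>Only the coordinates of the three vectors in a plane enter. The coefficient of each
  moved difference of a basis vector is a 3 by 3 determinant with two equal rows.\<close>

lemma supported_jacobi:
  assumes b: "supported b g"
  shows "b u v *s (\<rho> g *v w - w) + b v w *s (\<rho> g *v u - u) + b w u *s (\<rho> g *v v - v) = 0"
proof -
  obtain p c d where u: "u = p + (c *s w1 + d *s w2)" "p \<in> fix g" by (rule basis_decomp)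
  obtain q c' d' where v: "v = q + (c' *s w1 + d' *s w2)" "q \<in> fix g" by (rule basis_decomp)
  obtain r c'' d'' where w: "w = r + (c'' *s w1 + d'' *s w2)" "r \<in> fix g" by (rule basis_decomp)
  have bs: "skew_bilinear_form b" using b by (rule supportedD)
  have eval: "b (p + (c *s w1 + d *s w2)) (q + (c' *s w1 + d' *s w2)) = (c * d' - d * c') * b w1 w2"
    if "p \<in> fix g" "q \<in> fix g" for p q c d c' d'
    unfolding supported_add_fix[OF b that]
    using skew_formD(5)[OF bs, of w2 w1] skew_form_self[OF bs]
    by (simp add: skew_formD(1-4)[OF bs] algebra_simps)
  have move: "\<rho> g *v (p + (c *s w1 + d *s w2)) - (p + (c *s w1 + d *s w2)) =
      c *s (\<rho> g *v w1 - w1) + d *s (\<rho> g *v w2 - w2)" if "p \<in> fix g" for p c d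
    using that unfolding vec.add vec.scale
    by (simp add: fix_iff vec.scale_right_diff_distrib)
  show ?thesis
    unfolding u(1) v(1) w(1) eval[OF u(2) v(2)] eval[OF v(2) w(2)] eval[OF w(2) u(2)]
      move[OF u(2)] move[OF v(2)] move[OF w(2)]
    by (simp add: vec_eq_iff algebra_simps)
qed

end

lemma codim2_basis:
  assumes g: "g \<in> carrier G" and "codim (fix g) = 2"
  obtains w1 w2 where "w1 \<noteq> w2" "is_basis_of {w1, w2} (perp g)"
proof -
  obtain B where B: "B \<subseteq> perp g" "vec.independent B" "perp g \<subseteq> vec.span B" "card B = vec.dim (perp g)"
    using vec.basis_exists[of "perp g"] by metis
  then have "vec.span B = perp g" using vec.span_subspace[OF _ _ subspace_perp] by blast
  moreover have "card B = 2" using B(4) dim_perp[OF g] assms(2) by simp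
  then obtain w1 w2 where "B = {w1, w2}" "w1 \<noteq> w2" by (meson card_2_iff)
  ultimately show thesis using that B(2) by (auto simp: is_basis_of_def)
qed

text \<open>One nonzero form with V^g in its radical detects chi_g. The condition on determinants
  becomes invariance of this form under Z(g), which mentions neither the orthogonal complement nor a
  basis.\<close>

lemma codim2_trivial_chi_iff:
  assumes g: "g \<in> carrier G" and codim: "codim (fix g) = 2" and b: "supported b g" and ne: "b x0 y0 \<noteq> 0"
  shows "codim2_trivial_chi G \<rho> ip g \<longleftrightarrow>
    (\<forall>h\<in>centralizer G g. \<forall>x y. b (\<rho> h *v x) (\<rho> h *v y) = b x y)"
proof -
  have "chi \<rho> ip g h = 1 \<longleftrightarrow> (\<forall>x y. b (\<rho> h *v x) (\<rho> h *v y) = b x y)" if "h \<in> centralizer G g" for h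
    unfolding supported_chi[OF g codim that b] using ne by auto
  then show ?thesis unfolding codim2_trivial_chi_def using codim by blast
qed

lemma codim2_invariant:
  assumes g: "g \<in> carrier G" and P: "codim2_trivial_chi G \<rho> ip g" and b: "supported b g"
    and h: "h \<in> centralizer G g"
  shows "b (\<rho> h *v x) (\<rho> h *v y) = b x y"
  using supported_chi[OF g _ h b] P h unfolding codim2_trivial_chi_def by simp

section \<open>Passage to conjugate elements\<close>

lemma conj_fix:
  assumes g: "g \<in> carrier G" and k: "k \<in> carrier G"
  shows "v \<in> fix (inv k \<otimes> g \<otimes> k) \<longleftrightarrow> \<rho> k *v v \<in> fix g"
proof -
  have "\<rho> (inv k \<otimes> g \<otimes> k) *v v = \<rho> (inv k) *v (\<rho> g *v (\<rho> k *v v))"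
    using g k by (simp add: rho_mult_vec)
  moreover have "\<rho> (inv k) *v z = v \<longleftrightarrow> z = \<rho> k *v v" for z
    using k by (metis rho_inv_vec)
  ultimately show ?thesis by (simp add: fix_iff)
qed

lemma conj_codim:
  assumes g: "g \<in> carrier G" and k: "k \<in> carrier G"
  shows "codim (fix (inv k \<otimes> g \<otimes> k)) = codim (fix g)"
proof -
  have "fix g = (*v) (\<rho> k) ` fix (inv k \<otimes> g \<otimes> k)"
  proof (intro equalityI subsetI)
    fix v assume "v \<in> fix g"
    then have "\<rho> (inv k) *v v \<in> fix (inv k \<otimes> g \<otimes> k)" using conj_fix[OF g k] k by simp
    then show "v \<in> (*v) (\<rho> k) ` fix (inv k \<otimes> g \<otimes> k)" using k by (metis image_eqI rho_inv_vec(2))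
  qed (use conj_fix[OF g k] in auto)
  moreover have "vec.dim ((*v) (\<rho> k) ` fix (inv k \<otimes> g \<otimes> k)) = vec.dim (fix (inv k \<otimes> g \<otimes> k))"
    by (rule vec.dim_image_eq[OF matrix_vector_mul_linear_gen]) (rule inj_onI, metis k rho_inv_vec(1))
  ultimately show ?thesis by (simp add: codim_def)
qed

lemma conj_centralizer:
  assumes g: "g \<in> carrier G" and k: "k \<in> carrier G" and h: "h \<in> centralizer G (inv k \<otimes> g \<otimes> k)"
  shows "k \<otimes> h \<otimes> inv k \<in> centralizer G g"
proof -
  have hG: "h \<in> carrier G" and eq: "h \<otimes> (inv k \<otimes> g \<otimes> k) = inv k \<otimes> g \<otimes> k \<otimes> h"
    using h by (simp_all add: centralizer_iff)
  have l: "k \<otimes> (inv k \<otimes> x) = x" "inv k \<otimes> (k \<otimes> x) = x" if "x \<in> carrier G" for x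
    using k that by (simp_all flip: m_assoc)
  have "k \<otimes> h \<otimes> inv k \<otimes> g = k \<otimes> (h \<otimes> (inv k \<otimes> g \<otimes> k)) \<otimes> inv k"
    using g k hG by (simp add: m_assoc)
  also have "\<dots> = g \<otimes> (k \<otimes> h \<otimes> inv k)"
    unfolding eq using g k hG by (simp add: m_assoc l)
  finally show ?thesis using k hG by (simp add: centralizer_iff)
qed

text \<open>The determinants for \<open>g\<close> and its conjugate are not compared directly. A
  form for \<open>g\<close> is pulled back along \<open>k\<close>; the pullback ignores the fixed
  space of the conjugate and is invariant under its centralizer, so the criterion by forms
  applies.\<close>

lemma codim2_trivial_chi_conj:
  assumes g: "g \<in> carrier G" and k: "k \<in> carrier G" and P: "codim2_trivial_chi G \<rho> ip g"
  shows "codim2_trivial_chi G \<rho> ip (inv k \<otimes> g \<otimes> k)"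
proof -
  let ?g' = "inv k \<otimes> g \<otimes> k"
  have g': "?g' \<in> carrier G" using g k by simp
  have codim: "codim (fix g) = 2" "codim (fix ?g') = 2"
    using P conj_codim[OF g k] by (simp_all add: codim2_trivial_chi_def)
  obtain w1 w2 where w: "w1 \<noteq> w2" "is_basis_of {w1, w2} (perp g)" by (rule codim2_basis[OF g codim(1)])
  define b where "b = gram w1 w2"
  have b: "supported b g" and ne: "b w1 w2 \<noteq> 0"
    unfolding b_def using gram_supported[OF g w] gr0[OF g w] by auto
  define b' where "b' x y = b (\<rho> k *v x) (\<rho> k *v y)" for x y
  have "skew_bilinear_form b'"
    unfolding skew_bilinear_form_def b'_def vec.add vec.scale
    by (intro conjI allI; rule skew_formD[OF supportedD(1)[OF b]])
  then have b': "supported b' ?g'"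
    unfolding supported_def b'_def using conj_fix[OF g k] supportedD(2)[OF b] by blast
  have ne': "b' (\<rho> (inv k) *v w1) (\<rho> (inv k) *v w2) \<noteq> 0"
    using ne k by (simp add: b'_def)
  have "b' (\<rho> h *v x) (\<rho> h *v y) = b' x y" if h: "h \<in> centralizer G ?g'" for h x y
  proof -
    have hG: "h \<in> carrier G" using h by (simp add: centralizer_iff)
    have "\<rho> k *v (\<rho> h *v z) = \<rho> (k \<otimes> h \<otimes> inv k) *v (\<rho> k *v z)" for z
      using k hG by (simp add: rho_mult_vec)
    then show ?thesis
      unfolding b'_def using codim2_invariant[OF g P b conj_centralizer[OF g k h]] by simp
  qed
  then show ?thesis using codim2_trivial_chi_iff[OF g' codim(2) b' ne'] by blast
qed

text \<open>The Jacobi identity for two fixed vectors and a moved one shows that \<open>b\<close>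
  vanishes on pairs of fixed vectors. As \<open>g\<close> lies in its own centralizer, b(u, -) for
  fixed u is constant along orbits; orbit sums are fixed, so V^g is in the radical. A pair with
  nonzero value then spans a complement of V^g, which gives codimension 2, and the invariance under
  Z(g) becomes the triviality of chi_g.\<close>

lemma hecke_form_classification:
  assumes g: "g \<in> carrier G" and b: "skew_bilinear_form b" and ne: "b x y \<noteq> 0" and moved: "fix g \<noteq> UNIV"
    and inv: "\<And>h v w. h \<in> centralizer G g \<Longrightarrow> b (\<rho> h *v v) (\<rho> h *v w) = b v w"
    and jac: "\<And>u v w. b u v *s (\<rho> g *v w - w) + b v w *s (\<rho> g *v u - u) + b w u *s (\<rho> g *v v - v) = 0"
  shows "codim2_trivial_chi G \<rho> ip g \<and> supported b g"
proof -
  have gZ: "g \<in> centralizer G g" using g by (simp add: centralizer_iff)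
  obtain w where "w \<notin> fix g" using moved by blast
  then have w: "\<rho> g *v w - w \<noteq> 0" by (simp add: fix_iff)
  have fix_fix: "b u v = 0" if "u \<in> fix g" "v \<in> fix g" for u v
  proof -
    have "b u v *s (\<rho> g *v w - w) = 0" using jac[of u v w] that by (simp add: fix_iff)
    then show ?thesis using w by simp
  qed
  have powers: "b u (\<rho> (g [^] i) *v v) = b u v" if u: "u \<in> fix g" for u v and i :: nat
  proof (induction i)
    case (Suc i)
    have "g [^] Suc i = g \<otimes> g [^] i" using g nat_pow_Suc2 by blast
    then have "b u (\<rho> (g [^] Suc i) *v v) = b (\<rho> g *v u) (\<rho> g *v (\<rho> (g [^] i) *v v))"
      using u g by (simp only: rho_mult_vec nat_pow_closed fix_iff)
    then show ?case using Suc inv[OF gZ] by simp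
  qed simp
  have fix_zero: "b u v = 0" if u: "u \<in> fix g" for u v
  proof -
    have sum: "b u (sum f A) = (\<Sum>i\<in>A. b u (f i))" for f :: "nat \<Rightarrow> _" and A
      by (induction A rule: infinite_finite_induct) (simp_all add: skew_form_zero[OF b] skew_formD(3)[OF b])
    have "0 = b u (\<Sum>i<order G. \<rho> (g [^] i) *v v)" using fix_fix[OF u orbit_sum[OF g]] by simp
    also have "\<dots> = of_nat (order G) * b u v" unfolding sum by (simp add: powers[OF u])
    finally show ?thesis using order_pos by simp
  qed
  then have supp: "supported b g" using b by (simp add: supported_def)
  have "codim (fix g) = 2"
  proof -
    let ?Y = "vec.span {x, y}"
    have "z \<in> {p + q | p q. p \<in> fix g \<and> q \<in> ?Y}" for z
    proof -
      \<comment> \<open>By the Jacobi identity this vector is fixed by \<open>g\<close>; dividing by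
        b(x, y) writes \<open>z\<close> as a fixed vector plus a combination of \<open>x\<close> and
        \<open>y\<close>.\<close>
      define p where "p = b x y *s z + b y z *s x + b z x *s y"
      have "\<rho> g *v p - p = b x y *s (\<rho> g *v z - z) + b y z *s (\<rho> g *v x - x) + b z x *s (\<rho> g *v y - y)"
        unfolding p_def vec.add vec.scale by (simp add: vec.scale_right_diff_distrib)
      then have "p \<in> fix g" using jac[of x y z] by (simp add: fix_iff)
      then have "(1 / b x y) *s p \<in> fix g" using vec.subspace_scale[OF subspace_fix] by blast
      moreover have "(- b y z / b x y) *s x + (- b z x / b x y) *s y \<in> ?Y"
        by (intro vec.span_add vec.span_scale vec.span_base) auto
      moreover have "z = (1 / b x y) *s p + ((- b y z / b x y) *s x + (- b z x / b x y) *s y)"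
        unfolding p_def using ne by (simp add: vec_eq_iff field_simps)
      ultimately show ?thesis by blast
    qed
    then have sum: "{p + q | p q. p \<in> fix g \<and> q \<in> ?Y} = UNIV" by blast
    have Int: "fix g \<inter> ?Y = {0}"
    proof -
      have "v = 0" if v: "v \<in> fix g" "v \<in> ?Y" for v
      proof -
        obtain c d where cd: "v = c *s x + d *s y" using span_pair v(2) by blast
        have "c * b x y = 0" using fix_zero[OF v(1), of y]
          unfolding cd by (simp add: skew_formD(1,2)[OF b] skew_form_self[OF b])
        moreover have "d * b y x = 0" using fix_zero[OF v(1), of x]
          unfolding cd by (simp add: skew_formD(1,2)[OF b] skew_form_self[OF b])
        ultimately show "v = 0" using cd ne skew_formD(5)[OF b, of y x] by simp
      qed
      then show ?thesis using vec.subspace_0[OF subspace_fix] vec.span_zero by blast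
    qed
    have "vec.independent {x, y}" and "x \<noteq> y"
    proof -
      show "x \<noteq> y" using ne skew_form_self[OF b] by auto
      have "y \<noteq> 0" using ne skew_form_zero[OF b] by auto
      moreover have "x \<notin> vec.span {y}"
      proof
        assume "x \<in> vec.span {y}"
        then obtain c where "x = c *s y" by (auto simp: vec.span_singleton)
        then show False using ne skew_form_self[OF b, of y] by (simp add: skew_formD(2)[OF b])
      qed
      ultimately show "vec.independent {x, y}" by (simp add: vec.independent_insert)
    qed
    then have "vec.dim ?Y = 2" by (simp add: vec.dim_eq_card_independent)
    then have "vec.dim (UNIV :: (complex^'c) set) = vec.dim (fix g) + 2"
      using vec.dim_sums_Int[OF subspace_fix vec.subspace_span, of g "{x, y}"] sum Int by simp
    then show ?thesis by (simp add: codim_def)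
  qed
  then show ?thesis
    using codim2_trivial_chi_iff[OF g _ supp ne] inv supp by blast
qed

end

section \<open>Functionals on the exterior square\<close>

lemma tensor2_linear:
  "tensor2 (u + v) w = tensor2 u w + tensor2 v w" "tensor2 (c *s v) w = c *s tensor2 v w"
  "tensor2 u (v + w) = tensor2 u v + tensor2 u w" "tensor2 v (c *s w) = c *s tensor2 v w"
  by (simp_all add: tensor2_def vec_eq_iff algebra_simps)

lemma ext2_rel_refl: "ext2_rel t t"
  by (simp add: ext2_rel_def vec.span_zero)

lemma wedge_linear:
  fixes u v w :: "complex^'n::finite"
  shows "wedge (u + v) w = wedge u w + wedge v w" "wedge (c *s v) w = ext2_scale c (wedge v w)"
    "wedge u (v + w) = wedge u v + wedge u w" "wedge v (c *s w) = ext2_scale c (wedge v w)"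
  by (transfer, simp add: tensor2_linear ext2_rel_refl)+

lemma wedge_self: "wedge v v = (0 :: 'n::finite ext2)"
  by transfer (simp add: ext2_rel_def vec.span_base)

text \<open>Polarisation of \<open>wedge_self\<close>.\<close>

lemma wedge_skew: "wedge w v = - wedge v (w :: complex^'n::finite)"
proof -
  have "wedge (v + w) (v + w) = wedge v v + wedge w v + (wedge v w + wedge w w)"
    by (simp only: wedge_linear add_ac)
  then have "wedge w v + wedge v w = 0" by (simp add: wedge_self)
  then show ?thesis by (simp add: eq_neg_iff_add_eq_0)
qed

lemma ext2_abs:
  "abs_ext2 (s + t) = abs_ext2 s + (abs_ext2 t :: 'n::finite ext2)"
  "abs_ext2 (c *s t) = ext2_scale c (abs_ext2 t :: 'n ext2)"
  "abs_ext2 0 = (0 :: 'n ext2)"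
  "abs_ext2 (tensor2 v w) = (wedge v w :: 'n ext2)"
  by (simp_all add: plus_ext2.abs_eq ext2_scale.abs_eq zero_ext2_def wedge_def)

lemma ext2_abs_rep: "abs_ext2 (rep_ext2 x) = x"
  by (rule Quotient_abs_rep[OF Quotient_ext2])

lemma ext2_rep_abs: "ext2_rel (rep_ext2 (abs_ext2 t)) t"
  by (rule Quotient_rep_abs[OF Quotient_ext2 ext2_rel_refl])

lemma tensor2_axes_expand:
  "t = (\<Sum>p\<in>UNIV. t $ p *s tensor2 (axis (fst p) 1) (axis (snd p) (1::complex)))"
proof -
  have "(\<Sum>p\<in>UNIV. t $ p *s tensor2 (axis (fst p) 1) (axis (snd p) (1::complex))) $ q =
      (\<Sum>p\<in>UNIV. if p = q then t $ q else 0)" for q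
    unfolding sum_component by (rule sum.cong) (auto simp: tensor2_def axis_def prod_eq_iff)
  then show ?thesis by (simp add: vec_eq_iff)
qed

lemma ext2_expand:
  "x = (\<Sum>p\<in>UNIV. ext2_scale (rep_ext2 x $ p) (wedge (axis (fst p) 1) (axis (snd p) 1)))"
proof -
  have abs_sum: "abs_ext2 (sum f A) = (\<Sum>i\<in>A. abs_ext2 (f i))" for f :: "'a \<times> 'a \<Rightarrow> complex^('a \<times> 'a)" and A
    by (induction A rule: infinite_finite_induct) (simp_all add: ext2_abs)
  have "x = abs_ext2 (\<Sum>p\<in>UNIV. rep_ext2 x $ p *s tensor2 (axis (fst p) 1) (axis (snd p) 1))"
    by (subst tensor2_axes_expand[symmetric]) (simp add: ext2_abs_rep)
  then show ?thesis by (simp add: abs_sum ext2_abs)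
qed

lemma ext2_induct [case_names wedge add]:
  fixes x :: "'n::finite ext2"
  assumes wedge: "\<And>c v w. P (ext2_scale c (wedge v w))" and add: "\<And>x y. P x \<Longrightarrow> P y \<Longrightarrow> P (x + y)"
  shows "P x"
proof -
  have zero: "P 0" using wedge[of 0] by simp
  have sum: "P (\<Sum>p\<in>A. ext2_scale (c p) (wedge (v p) (w p)))" for A :: "('n \<times> 'n) set" and c v w
    by (induction A rule: infinite_finite_induct) (simp_all add: zero wedge add)
  show ?thesis by (subst ext2_expand) (rule sum)
qed

lemma ext2_map_wedge: "ext2_map M (wedge v w) = wedge (M *v v) (M *v w)"
  by transfer (simp add: tensor2_map_tensor2 ext2_rel_refl)

lemma tensor2_map_linear:
  "tensor2_map M (s + t) = tensor2_map M s + tensor2_map M t"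
  "tensor2_map M (c *s t) = c *s tensor2_map M t"
  using linear_tensor2_map[of M] unfolding Vector_Spaces.linear_iff by blast+

lemma ext2_map_add: "ext2_map M (x + y) = ext2_map M x + ext2_map M y"
  by transfer (simp add: tensor2_map_linear ext2_rel_refl)

lemma ext2_map_scale: "ext2_map M (ext2_scale c x) = ext2_scale c (ext2_map M x)"
  by transfer (simp add: tensor2_map_linear ext2_rel_refl)

lemma ext2_map_sum: "ext2_map M (sum f A) = (\<Sum>i\<in>A. ext2_map M (f i))"
proof -
  have "ext2_map M 0 = 0" using ext2_map_scale[of M 0 0] by simp
  then show ?thesis by (induction A rule: infinite_finite_induct) (simp_all add: ext2_map_add)
qed

lemma linear_functionalI:
  assumes "\<And>x y. f (x + y) = f x + f y" "\<And>c x. f (ext2_scale c x) = c * f x"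
  shows "Vector_Spaces.linear ext2_scale (*) f"
  using assms
  by (intro Vector_Spaces.linear_iff[THEN iffD2])
    (simp add: ext2.vector_space_axioms vector_space_over_itself.vector_space_axioms)

lemma linear_functionalD:
  assumes "Vector_Spaces.linear ext2_scale (*) f"
  shows "f (x + y) = f x + f y" "f (ext2_scale c x) = c * f x"
  using assms unfolding Vector_Spaces.linear_iff by blast+

lemma linear_functional_eq:
  assumes f: "Vector_Spaces.linear ext2_scale (*) f" and g: "Vector_Spaces.linear ext2_scale (*) g"
    and "\<And>v w. f (wedge v w) = g (wedge v w)"
  shows "f = g"
proof
  fix x
  show "f x = g x"
    by (induction x rule: ext2_induct) (simp_all add: linear_functionalD[OF f] linear_functionalD[OF g] assms(3))
qed

text \<open>The form is evaluated on the chosen representative tensor of the class. Independence of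
  that choice is \<open>ext2_lift_abs\<close> and rests on skewness.\<close>

definition ext2_lift :: "(complex^'n \<Rightarrow> complex^'n \<Rightarrow> complex) \<Rightarrow> 'n::finite ext2 \<Rightarrow> complex" where
  "ext2_lift b x = (\<Sum>p\<in>UNIV. rep_ext2 x $ p * b (axis (fst p) 1) (axis (snd p) 1))"

text \<open>The extension of \<open>b\<close> to tensors takes the square of a vector v to b(v, v) =
  0, so it vanishes on the subspace that is divided out.\<close>

lemma ext2_lift_abs:
  fixes b :: "complex^'n::finite \<Rightarrow> complex^'n \<Rightarrow> complex"
  assumes b: "skew_bilinear_form b"
  shows "ext2_lift b (abs_ext2 t) = (\<Sum>p\<in>UNIV. t $ p * b (axis (fst p) 1) (axis (snd p) 1))"
proof -
  define F where "F t = (\<Sum>p\<in>UNIV. t $ p * b (axis (fst p) 1) (axis (snd p) 1))" for t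
  have "F s = 0" if "s \<in> vec.span (range (\<lambda>v. tensor2 v v))" for s
    using that
  proof (rule vec.span_induct)
    show "vec.subspace {s. F s = 0}"
      by (rule vec.subspaceI) (simp_all add: F_def distrib_right sum.distrib mult.assoc flip: sum_distrib_left)
    fix s :: "complex^('n \<times> 'n)"
    assume "s \<in> range (\<lambda>v. tensor2 v v)"
    then obtain v where "s = tensor2 v v" by blast
    then have "F s = b v v" by (simp add: F_def tensor2_def skew_form_expand[OF b, of v v])
    then show "F s = 0" by (simp add: skew_form_self[OF b])
  qed
  then have "F (rep_ext2 (abs_ext2 t) - t) = 0" using ext2_rep_abs[of t] by (simp add: ext2_rel_def)
  then show ?thesis by (simp add: F_def ext2_lift_def left_diff_distrib sum_subtractf)
qed

lemma ext2_lift_wedge: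
  assumes b: "skew_bilinear_form b"
  shows "ext2_lift b (wedge v w) = b v w"
  unfolding ext2_abs(4)[symmetric] ext2_lift_abs[OF b] skew_form_expand[OF b, of v w]
  by (simp add: tensor2_def)

lemma ext2_lift_linear:
  assumes b: "skew_bilinear_form b"
  shows "Vector_Spaces.linear ext2_scale (*) (ext2_lift b)"
proof (rule linear_functionalI)
  fix x y :: "'a ext2" and c
  have "ext2_lift b (abs_ext2 (rep_ext2 x + rep_ext2 y)) = ext2_lift b (abs_ext2 (rep_ext2 x)) + ext2_lift b (abs_ext2 (rep_ext2 y))"
    unfolding ext2_lift_abs[OF b] by (simp add: distrib_right sum.distrib)
  then show "ext2_lift b (x + y) = ext2_lift b x + ext2_lift b y" by (simp add: ext2_abs ext2_abs_rep)
  have "ext2_lift b (abs_ext2 (c *s rep_ext2 x)) = c * ext2_lift b (abs_ext2 (rep_ext2 x))"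
    unfolding ext2_lift_abs[OF b] by (simp add: sum_distrib_left mult.assoc)
  then show "ext2_lift b (ext2_scale c x) = c * ext2_lift b x" by (simp add: ext2_abs ext2_abs_rep)
qed

lemma wedge_form_skew:
  fixes f :: "'n::finite ext2 \<Rightarrow> complex"
  assumes f: "Vector_Spaces.linear ext2_scale (*) f"
  shows "skew_bilinear_form (\<lambda>v w. f (wedge v w))"
proof -
  have "f (wedge w v) = - f (wedge v w)" for v w
  proof -
    have "f (wedge w v + wedge v w) = f (ext2_scale 0 0)" by (simp add: wedge_skew[of w v])
    then show ?thesis unfolding linear_functionalD[OF f] by (simp add: eq_neg_iff_add_eq_0)
  qed
  then show ?thesis
    unfolding skew_bilinear_form_def wedge_linear linear_functionalD[OF f] by blast
qed

lemma ext2_lift_of_functional: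
  assumes f: "Vector_Spaces.linear ext2_scale (*) f"
  shows "ext2_lift (\<lambda>v w. f (wedge v w)) = f"
  by (rule linear_functional_eq[OF ext2_lift_linear[OF wedge_form_skew[OF f]] f])
    (rule ext2_lift_wedge[OF wedge_form_skew[OF f]])

text \<open>The wedges of basis vectors are a finite spanning set and bound every independent
  set.\<close>

lemma ext2_independent_finite:
  fixes B :: "'n::finite ext2 set"
  assumes "ext2.independent B"
  shows "finite B"
proof -
  let ?W = "range (\<lambda>p :: 'n \<times> 'n. wedge (axis (fst p) 1) (axis (snd p) (1::complex)))"
  have "x \<in> ext2.span ?W" for x :: "'n ext2"
    by (subst ext2_expand) (intro ext2.span_sum ext2.span_scale ext2.span_base, blast)
  then show ?thesis using ext2.independent_span_bound[OF _ assms, of ?W] by auto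
qed

section \<open>Invariant functionals on the exterior square\<close>

context finite_group_rep
begin

lemma ext2_map_rho_mult:
  assumes "g \<in> carrier G" "h \<in> carrier G"
  shows "ext2_map (\<rho> g) (ext2_map (\<rho> h) x) = ext2_map (\<rho> (g \<otimes> h)) x"
  by (induction x rule: ext2_induct)
    (simp_all add: ext2_map_add ext2_map_scale ext2_map_wedge rho_mult_vec assms)

text \<open>
  Averaging over \<open>H\<close> extends the coordinate functionals of a basis of the invariants
  to invariant functionals.
\<close>

lemma invariant_functionals_dual_basis:
  assumes H: "subgroup H G"
  obtains B \<psi> where "finite B" "card B = ext2.dim (ext2_invariants \<rho> H)"
    "\<And>b. b \<in> B \<Longrightarrow> invariant_ext2_functional \<rho> H (\<psi> b)"
    "\<And>b b'. b \<in> B \<Longrightarrow> b' \<in> B \<Longrightarrow> \<psi> b b' = (if b = b' then 1 else 0)"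
    "\<And>\<phi>. invariant_ext2_functional \<rho> H \<phi> \<Longrightarrow> (\<And>b. b \<in> B \<Longrightarrow> \<phi> b = 0) \<Longrightarrow> \<phi> = (\<lambda>x. 0)"
proof -
  define Inv where "Inv = ext2_invariants \<rho> H"
  \<comment> \<open>It projects onto the invariants and does not change when its argument is moved
    by an element of \<open>H\<close>. The first property gives coordinates in a basis of the
    invariants, the second makes them invariant functionals.\<close>
  define avg where "avg x = ext2_scale (1 / of_nat (card H)) (\<Sum>h\<in>H. ext2_map (\<rho> h) x)" for x
  have HG: "h \<in> H \<Longrightarrow> h \<in> carrier G" for h using subgroup.mem_carrier[OF H] .
  have finH: "finite H" using subgroup.subset[OF H] finite_G by (rule finite_subset)
  then have card: "of_nat (card H) \<noteq> (0::complex)" using subgroup.one_closed[OF H] by auto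
  have reindex: "(\<Sum>h\<in>H. f (h \<otimes> k)) = (\<Sum>h\<in>H. f h)" "(\<Sum>h\<in>H. f (k \<otimes> h)) = (\<Sum>h\<in>H. f h)" if k: "k \<in> H" for k and f :: "'g \<Rightarrow> 'n ext2"
  proof -
    have kG: "k \<in> carrier G" and ik: "inv k \<in> H" using k HG subgroup.m_inv_closed[OF H] by auto
    show "(\<Sum>h\<in>H. f (h \<otimes> k)) = (\<Sum>h\<in>H. f h)"
      by (rule sum.reindex_bij_witness[of _ "\<lambda>h. h \<otimes> inv k" "\<lambda>h. h \<otimes> k"])
        (use k ik kG HG subgroup.m_closed[OF H] in \<open>auto simp: m_assoc\<close>)
    show "(\<Sum>h\<in>H. f (k \<otimes> h)) = (\<Sum>h\<in>H. f h)"
      by (rule sum.reindex_bij_witness[of _ "\<lambda>h. inv k \<otimes> h" "\<lambda>h. k \<otimes> h"])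
        (use k ik kG HG subgroup.m_closed[OF H] in \<open>auto simp flip: m_assoc\<close>)
  qed
  have avg_Inv: "avg x \<in> Inv" for x
    unfolding Inv_def ext2_invariants_def avg_def
    by (auto simp: ext2_map_scale ext2_map_sum ext2_map_rho_mult HG reindex(2)[of _ "\<lambda>h. ext2_map (\<rho> h) x"])
  have avg_map: "avg (ext2_map (\<rho> k) x) = avg x" if "k \<in> H" for k x
    unfolding avg_def using that by (simp add: ext2_map_rho_mult HG reindex(1)[of _ "\<lambda>h. ext2_map (\<rho> h) x"])
  have avg_add: "avg (x + y) = avg x + avg y" for x y
    by (simp add: avg_def ext2_map_add sum.distrib ext2.scale_right_distrib)
  have avg_scale: "avg (ext2_scale c x) = ext2_scale c (avg x)" for c x
    by (simp add: avg_def ext2_map_scale mult.commute flip: ext2.scale_sum_right)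
  have avg_id: "avg x = x" if "x \<in> Inv" for x
  proof -
    have "(\<Sum>h\<in>H. ext2_map (\<rho> h) x) = (\<Sum>h\<in>H. ext2_scale 1 x)"
      using that by (intro sum.cong) (auto simp: Inv_def ext2_invariants_def)
    also have "\<dots> = ext2_scale (of_nat (card H)) x"
      unfolding ext2.scale_sum_left[symmetric] by simp
    finally show ?thesis using card by (simp add: avg_def)
  qed
  obtain B where B: "B \<subseteq> Inv" "ext2.independent B" "Inv \<subseteq> ext2.span B" "card B = ext2.dim Inv"
    using ext2.basis_exists by metis
  have finB: "finite B" using B(2) by (rule ext2_independent_finite)
  define \<psi> where "\<psi> b x = ext2.representation B (avg x) b" for b x
  have span: "avg x \<in> ext2.span B" for x using avg_Inv B(3) by blast
  show thesis
  proof (rule that[of B \<psi>])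
    show "finite B" by (rule finB)
    show "card B = ext2.dim (ext2_invariants \<rho> H)" using B(4) by (simp add: Inv_def)
    show "invariant_ext2_functional \<rho> H (\<psi> b)" for b
      unfolding invariant_ext2_functional_def
    proof (intro conjI ballI allI)
      show "Vector_Spaces.linear ext2_scale (*) (\<psi> b)"
        by (rule linear_functionalI)
          (simp_all add: \<psi>_def avg_add avg_scale ext2.representation_add[OF B(2) span span]
            ext2.representation_scale[OF B(2) span])
    qed (simp add: \<psi>_def avg_map)
    show "\<psi> b b' = (if b = b' then 1 else 0)" if "b \<in> B" "b' \<in> B" for b b'
    proof -
      have "avg b' = b'" using that B(1) avg_id by blast
      then show ?thesis using ext2.representation_basis[OF B(2) that(2)] by (simp add: \<psi>_def)
    qed
    fix \<phi> assume \<phi>: "invariant_ext2_functional \<rho> H \<phi>" and zero: "\<And>b. b \<in> B \<Longrightarrow> \<phi> b = 0"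
    have lin: "Vector_Spaces.linear ext2_scale (*) \<phi>" and inv: "\<And>h x. h \<in> H \<Longrightarrow> \<phi> (ext2_map (\<rho> h) x) = \<phi> x"
      using \<phi> by (auto simp: invariant_ext2_functional_def)
    have \<phi>0: "\<phi> 0 = 0" using linear_functionalD(2)[OF lin, of 0 0] by simp
    have \<phi>_sum: "\<phi> (sum f A) = (\<Sum>i\<in>A. \<phi> (f i))" for f :: "'i \<Rightarrow> 'n ext2" and A
      by (induction A rule: infinite_finite_induct) (simp_all add: \<phi>0 linear_functionalD(1)[OF lin])
    \<comment> \<open>An invariant functional takes the same value on all terms of the mean, so it
      is determined by its values on the invariants.\<close>
    have avg_eq: "\<phi> (avg x) = \<phi> x" for x
      unfolding avg_def linear_functionalD(2)[OF lin] \<phi>_sum using inv card by simp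
    show "\<phi> = (\<lambda>x. 0)"
    proof
      fix x
      have "avg x = (\<Sum>b\<in>B. ext2_scale (ext2.representation B (avg x) b) b)"
        using ext2.sum_representation_eq[OF B(2) span finB order_refl] by simp
      then have "\<phi> (avg x) = \<phi> (\<Sum>b\<in>B. ext2_scale (ext2.representation B (avg x) b) b)"
        by (rule arg_cong)
      also have "\<dots> = (\<Sum>b\<in>B. ext2.representation B (avg x) b * \<phi> b)"
        unfolding \<phi>_sum linear_functionalD(2)[OF lin] ..
      finally have "\<phi> (avg x) = (\<Sum>b\<in>B. ext2.representation B (avg x) b * \<phi> b)" .
      then show "\<phi> x = 0" using zero avg_eq by simp
    qed
  qed
qed

end

text \<open>\<open>\<kappa>\<close> restricts to a linear isomorphism from \<open>S\<close> onto the
  functions on \<open>J\<close>: it is injective, and each unit vector has a preimage. These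
  preimages form the basis that is counted.\<close>

lemma (in vector_space) dim_eq_card_coordinates:
  fixes \<kappa> :: "'b \<Rightarrow> 'j \<Rightarrow> 'a"
  assumes S: "subspace S" and J: "finite J"
    and add: "\<And>x y j. x \<in> S \<Longrightarrow> y \<in> S \<Longrightarrow> j \<in> J \<Longrightarrow> \<kappa> (x + y) j = \<kappa> x j + \<kappa> y j"
    and scale: "\<And>c x j. x \<in> S \<Longrightarrow> j \<in> J \<Longrightarrow> \<kappa> (c *s x) j = c * \<kappa> x j"
    and inj: "\<And>x. x \<in> S \<Longrightarrow> (\<And>j. j \<in> J \<Longrightarrow> \<kappa> x j = 0) \<Longrightarrow> x = 0"
    and dual: "\<And>j. j \<in> J \<Longrightarrow> \<exists>x\<in>S. \<forall>i\<in>J. \<kappa> x i = (if i = j then 1 else 0)"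
  shows "dim S = card J"
proof -
  obtain e where e: "\<And>j. j \<in> J \<Longrightarrow> e j \<in> S" "\<And>i j. i \<in> J \<Longrightarrow> j \<in> J \<Longrightarrow> \<kappa> (e j) i = (if i = j then 1 else 0)"
    using dual by metis
  have zero: "\<kappa> 0 i = 0" if "i \<in> J" for i
    using scale[OF subspace_0[OF S] that, of 0] by simp
  have sums: "(\<Sum>j\<in>K. f j *s e j) \<in> S \<and> (\<forall>i\<in>J. \<kappa> (\<Sum>j\<in>K. f j *s e j) i = (if i \<in> K then f i else 0))"
    if "finite K" "K \<subseteq> J" for f K
    using that
  proof (induction K rule: finite_induct)
    case empty
    then show ?case using subspace_0[OF S] zero by simp
  next
    case (insert j K)
    have "f j *s e j \<in> S" using e(1) insert.prems subspace_scale[OF S] by simp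
    moreover have "(\<Sum>j\<in>K. f j *s e j) \<in> S" using insert by blast
    moreover have "\<kappa> (f j *s e j) i = (if i = j then f j else 0)" if "i \<in> J" for i
      using scale[of "e j" i "f j"] e insert.prems that by simp
    ultimately show ?case
      using insert subspace_add[OF S] add by auto
  qed
  have inj_e: "inj_on e J"
    by (rule inj_onI) (metis e(2) zero_neq_one)
  show ?thesis
  proof (rule dim_unique)
    show "e ` J \<subseteq> S" using e by blast
    show "S \<subseteq> span (e ` J)"
    proof
      fix x assume x: "x \<in> S"
      let ?y = "\<Sum>j\<in>J. \<kappa> x j *s e j"
      have y: "?y \<in> S" "\<And>i. i \<in> J \<Longrightarrow> \<kappa> ?y i = \<kappa> x i" using sums[OF J order_refl, of "\<kappa> x"] by auto
      define z where "z = - 1 *s ?y"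
      have z: "z \<in> S" "\<And>i. i \<in> J \<Longrightarrow> \<kappa> z i = - \<kappa> x i"
        using subspace_scale[OF S y(1)] scale[OF y(1)] y(2) by (simp_all add: z_def del: scale_minus_left)
      have "x + z = 0"
        by (rule inj) (use x z add[OF x z(1)] subspace_add[OF S] in simp_all)
      then have "x = ?y" by (simp add: z_def)
      moreover have "?y \<in> span (e ` J)" by (intro span_sum span_scale span_base) blast
      ultimately show "x \<in> span (e ` J)" by simp
    qed
    show "independent (e ` J)"
    proof (rule independent_if_scalars_zero)
      fix f x assume sum: "(\<Sum>x\<in>e ` J. f x *s x) = 0" and "x \<in> e ` J"
      then obtain j where j: "j \<in> J" "x = e j" by blast
      have "(\<Sum>j\<in>J. f (e j) *s e j) = 0" using sum by (simp add: sum.reindex[OF inj_e])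
      then have "\<kappa> 0 j = f (e j)" using sums[OF J order_refl, of "\<lambda>j. f (e j)"] j(1) by auto
      then show "f x = 0" using zero j by simp
    qed (use J in simp)
    show "card (e ` J) = card J" by (rule card_image[OF inj_e])
  qed
qed

section \<open>The space of graded Hecke families\<close>

locale class_rep = hermitian_rep +
  fixes C :: "'a set" and w1 w2 :: "'a \<Rightarrow> complex^'c"
  assumes reps: "class_representatives G C"
    and basis: "\<And>g. g \<in> C \<Longrightarrow> codim2_trivial_chi G \<rho> ip g \<Longrightarrow>
      w1 g \<noteq> w2 g \<and> is_basis_of {w1 g, w2 g} (perp g)"
begin

abbreviation "special \<equiv> codim2_trivial_chi G \<rho> ip"

section \<open>Representatives of the conjugacy classes\<close>

lemma C_carrier: "g \<in> C \<Longrightarrow> g \<in> carrier G"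
  using reps by (auto simp: class_representatives_def)

lemma C_unique: "g \<in> carrier G \<Longrightarrow> c \<in> C \<Longrightarrow> c' \<in> C \<Longrightarrow> c \<in> conj_class G g \<Longrightarrow> c' \<in> conj_class G g \<Longrightarrow> c = c'"
  using reps unfolding class_representatives_def by blast

lemma conj_inverse:
  assumes "g \<in> carrier G" "h \<in> carrier G"
  shows "h \<otimes> (inv h \<otimes> g \<otimes> h) \<otimes> inv h = g"
proof -
  have "h \<otimes> (inv h \<otimes> g \<otimes> h) \<otimes> inv h = h \<otimes> inv h \<otimes> g \<otimes> (h \<otimes> inv h)"
    using assms by (simp only: m_assoc m_closed inv_closed)
  then show ?thesis using assms by simp
qed

lemma conj_class_sym:
  assumes "c \<in> conj_class G g" "g \<in> carrier G"
  shows "g \<in> conj_class G c"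
proof -
  obtain h where h: "h \<in> carrier G" "c = inv h \<otimes> g \<otimes> h" using assms(1) by (auto simp: conj_class_def)
  have "g = inv (inv h) \<otimes> c \<otimes> inv h" using h conj_inverse[OF assms(2) h(1)] by simp
  then show ?thesis using h(1) unfolding conj_class_def by blast
qed

lemma carrier_decomp:
  assumes "g \<in> carrier G"
  obtains c h where "c \<in> C" "h \<in> carrier G" "g = inv h \<otimes> c \<otimes> h"
proof -
  obtain c where c: "c \<in> C" "c \<in> conj_class G g"
    using reps assms unfolding class_representatives_def by blast
  then have "g \<in> conj_class G c" using conj_class_sym assms by blast
  then show thesis using that c(1) by (auto simp: conj_class_def)
qed

lemma representative_unique:
  assumes "c \<in> C" "c' \<in> C" "h \<in> carrier G" "h' \<in> carrier G" "inv h \<otimes> c \<otimes> h = inv h' \<otimes> c' \<otimes> h'"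
  shows "c = c'"
proof -
  let ?g = "inv h \<otimes> c \<otimes> h"
  have "?g \<in> carrier G" using assms C_carrier by simp
  moreover have "?g \<in> conj_class G c" using assms(3) by (auto simp: conj_class_def)
  then have "c \<in> conj_class G ?g" using conj_class_sym C_carrier assms(1) by blast
  moreover have "?g \<in> conj_class G c'" unfolding assms(5) using assms(4) by (auto simp: conj_class_def)
  then have "c' \<in> conj_class G ?g" using conj_class_sym C_carrier assms(2) by blast
  ultimately show ?thesis using C_unique assms(1,2) by blast
qed

definition admissible :: "('a \<Rightarrow> 'c ext2 \<Rightarrow> complex) \<Rightarrow> bool" where
  "admissible \<phi> \<longleftrightarrow> (\<forall>g\<in>C. fixed_space (\<rho> g) = UNIV \<longrightarrow>
     invariant_ext2_functional \<rho> (centralizer G g) (\<phi> g))"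

text \<open>The form prescribed at a representative. Dividing by the Gram determinant normalises it
  to the value \<open>c g\<close> on the chosen basis of the plane.\<close>

definition base_form :: "('a \<Rightarrow> complex) \<Rightarrow> ('a \<Rightarrow> 'c ext2 \<Rightarrow> complex) \<Rightarrow> 'a \<Rightarrow> complex^'c \<Rightarrow> complex^'c \<Rightarrow> complex" where
  "base_form c \<phi> g v w =
     (if special g then c g / gram (w1 g) (w2 g) (w1 g) (w2 g) * gram (w1 g) (w2 g) v w
      else if fix g = UNIV then \<phi> g (wedge v w) else 0)"

lemma not_special_UNIV: "fix g = UNIV \<Longrightarrow> \<not> special g"
  by (simp add: codim2_trivial_chi_def codim_def)

lemma skew_form_scale:
  assumes b: "skew_bilinear_form b"
  shows "skew_bilinear_form (\<lambda>v w. c * b v w)"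
proof -
  note s = skew_formD[OF b]
  have skew: "c * b w v = - (c * b v w)" for v w
    by (subst s(5)) simp
  show ?thesis
    unfolding skew_bilinear_form_def s(1-4)
    by (intro conjI allI, simp_all only: distrib_left mult.left_commute) (rule skew)
qed

lemma skew_form_0: "skew_bilinear_form (\<lambda>v w. 0)"
  by (simp add: skew_bilinear_form_def)

lemma base_special:
  assumes "g \<in> C" "special g"
  shows "supported (base_form c \<phi> g) g" "base_form c \<phi> g (w1 g) (w2 g) = c g"
proof -
  note w = C_carrier[OF assms(1)] conjunct1[OF basis[OF assms]] conjunct2[OF basis[OF assms]]
  have eq: "base_form c \<phi> g = (\<lambda>v w. c g / gram (w1 g) (w2 g) (w1 g) (w2 g) * gram (w1 g) (w2 g) v w)"
    using assms by (simp add: base_form_def fun_eq_iff)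
  show "supported (base_form c \<phi> g) g"
    unfolding eq supported_def
    using supportedD(2)[OF gram_supported[OF w]]
    by (intro conjI skew_form_scale gram_skew) simp
  show "base_form c \<phi> g (w1 g) (w2 g) = c g"
    unfolding eq using gr0[OF w] by simp
qed

lemma base_UNIV: "fix g = UNIV \<Longrightarrow> base_form c \<phi> g = (\<lambda>v w. \<phi> g (wedge v w))"
  using not_special_UNIV by (simp add: base_form_def fun_eq_iff)

lemma base_other: "\<not> special g \<Longrightarrow> fix g \<noteq> UNIV \<Longrightarrow> base_form c \<phi> g = (\<lambda>v w. 0)"
  by (simp add: base_form_def fun_eq_iff)

lemma base_skew:
  assumes "g \<in> C" "admissible \<phi>"
  shows "skew_bilinear_form (base_form c \<phi> g)"
proof -
  consider "special g" | "fix g = UNIV" | "\<not> special g" "fix g \<noteq> UNIV" by blast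
  then show ?thesis
  proof cases
    case 1
    then show ?thesis using base_special assms(1) supportedD(1) by blast
  next
    case 2
    then have "Vector_Spaces.linear ext2_scale (*) (\<phi> g)"
      using assms by (auto simp: admissible_def invariant_ext2_functional_def)
    then show ?thesis unfolding base_UNIV[OF 2] by (rule wedge_form_skew)
  next
    case 3
    then show ?thesis by (simp add: base_other skew_form_0)
  qed
qed

lemma base_invariant:
  assumes "g \<in> C" "admissible \<phi>" "h \<in> centralizer G g"
  shows "base_form c \<phi> g (\<rho> h *v v) (\<rho> h *v w) = base_form c \<phi> g v w"
proof -
  consider "special g" | "fix g = UNIV" | "\<not> special g" "fix g \<noteq> UNIV" by blast
  then show ?thesis
  proof cases
    case 1
    then show ?thesis using codim2_invariant[OF C_carrier[OF assms(1)] 1 base_special(1)[OF assms(1) 1] assms(3)] by blast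
  next
    case 2
    then have "\<phi> g (ext2_map (\<rho> h) (wedge v w)) = \<phi> g (wedge v w)"
      using assms by (auto simp: admissible_def invariant_ext2_functional_def)
    then show ?thesis unfolding base_UNIV[OF 2] by (simp add: ext2_map_wedge)
  next
    case 3
    then show ?thesis by (simp add: base_other)
  qed
qed

lemma base_jacobi:
  assumes "g \<in> C" "admissible \<phi>"
  shows "base_form c \<phi> g u v *s (\<rho> g *v w - w) + base_form c \<phi> g v w *s (\<rho> g *v u - u)
    + base_form c \<phi> g w u *s (\<rho> g *v v - v) = 0"
proof -
  consider "special g" | "fix g = UNIV" | "\<not> special g" "fix g \<noteq> UNIV" by blast
  then show ?thesis
  proof cases
    case 1
    then show ?thesis
      using supported_jacobi[OF C_carrier[OF assms(1)] conjunct1[OF basis[OF assms(1) 1]]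
          conjunct2[OF basis[OF assms(1) 1]] base_special(1)[OF assms(1) 1]] by blast
  next
    case 2
    then have "\<rho> g *v z = z" for z using fix_iff[of z g] by simp
    then show ?thesis by simp
  next
    case 3
    then show ?thesis by (simp add: base_other)
  qed
qed

text \<open>All clauses of \<open>constructed_family\<close> in one: \<open>base_form\<close> at the
  representatives, zero for classes of neither kind, transported along conjugation. Existence,
  uniqueness and the two Hecke conditions are proved in this uniform shape.\<close>

definition extends where
  "extends c \<phi> a \<longleftrightarrow> form_family G a \<and> (\<forall>g\<in>C. \<forall>h\<in>carrier G. \<forall>v w.
     a (inv h \<otimes> g \<otimes> h) v w = base_form c \<phi> g (\<rho> h *v v) (\<rho> h *v w))"

lemma extends_form: "extends c \<phi> a \<Longrightarrow> form_family G a"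
  by (simp add: extends_def)

lemma extendsD:
  "extends c \<phi> a \<Longrightarrow> g \<in> C \<Longrightarrow> h \<in> carrier G \<Longrightarrow> a (inv h \<otimes> g \<otimes> h) v w = base_form c \<phi> g (\<rho> h *v v) (\<rho> h *v w)"
  by (simp add: extends_def)

lemma extends_base:
  assumes "extends c \<phi> a" "g \<in> C"
  shows "a g = base_form c \<phi> g"
  using extendsD[OF assms one_closed] C_carrier[OF assms(2)] by (simp add: fun_eq_iff)

text \<open>A representative and a conjugating element are chosen for each group element. The
  representative is unique, and two conjugating elements differ by an element of its centralizer,
  under which \<open>base_form\<close> is invariant; so the choice does not matter.\<close>

lemma extends_exists:
  assumes adm: "admissible \<phi>"
  shows "\<exists>a. extends c \<phi> a"
proof -
  have "\<forall>g\<in>carrier G. \<exists>p. fst p \<in> C \<and> snd p \<in> carrier G \<and> g = inv (snd p) \<otimes> fst p \<otimes> snd p"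
    using carrier_decomp by (metis fst_conv snd_conv)
  from bchoice[OF this] obtain p where p: "\<And>g. g \<in> carrier G \<Longrightarrow> fst (p g) \<in> C \<and> snd (p g) \<in> carrier G \<and>
      g = inv (snd (p g)) \<otimes> fst (p g) \<otimes> snd (p g)" by blast
  define a where "a g = (if g \<in> carrier G then
      (\<lambda>v w. base_form c \<phi> (fst (p g)) (\<rho> (snd (p g)) *v v) (\<rho> (snd (p g)) *v w)) else 0)" for g
  have "form_family G a"
    unfolding form_family_def
  proof (intro conjI allI impI ballI)
    fix g assume g: "g \<in> carrier G"
    note s = skew_formD[OF base_skew[OF conjunct1[OF p[OF g]] adm]]
    show "skew_bilinear_form (a g)"
      unfolding skew_bilinear_form_def a_def if_P[OF g] vec.add vec.scale
      by (intro conjI allI; rule s)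
  qed (simp add: a_def)
  moreover have "a (inv h \<otimes> g \<otimes> h) v w = base_form c \<phi> g (\<rho> h *v v) (\<rho> h *v w)"
    if g: "g \<in> C" and h: "h \<in> carrier G" for g h v w
  proof -
    let ?g = "inv h \<otimes> g \<otimes> h"
    have gG: "g \<in> carrier G" and g': "?g \<in> carrier G" using C_carrier[OF g] h by simp_all
    define k where "k = snd (p ?g)"
    have k: "k \<in> carrier G" using p[OF g'] by (simp add: k_def)
    have fst: "fst (p ?g) = g"
      using representative_unique[of "fst (p ?g)" g k h] p[OF g'] g h by (simp add: k_def)
    then have eq: "?g = inv k \<otimes> g \<otimes> k" using p[OF g'] by (simp add: k_def)
    have "k \<otimes> inv h \<in> centralizer G g"
    proof -
      have "k \<otimes> inv h \<otimes> g = k \<otimes> ?g \<otimes> inv h" using gG h k by (simp add: m_assoc)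
      also have "\<dots> = k \<otimes> inv k \<otimes> g \<otimes> (k \<otimes> inv h)" unfolding eq using gG h k by (simp only: m_assoc m_closed inv_closed)
      finally show ?thesis using gG h k by (simp add: centralizer_iff)
    qed
    from base_invariant[OF g adm this, of c "\<rho> h *v v" "\<rho> h *v w"]
    have "base_form c \<phi> g (\<rho> k *v v) (\<rho> k *v w) = base_form c \<phi> g (\<rho> h *v v) (\<rho> h *v w)"
      using h k by (simp add: rho_mult_vec)
    then show ?thesis using g' fst by (simp add: a_def k_def)
  qed
  ultimately show ?thesis unfolding extends_def by blast
qed

lemma extends_unique:
  assumes "extends c \<phi> a" "extends c \<phi> a'"
  shows "a = a'"
proof
  fix g
  show "a g = a' g"
  proof (cases "g \<in> carrier G")
    case True
    then obtain c h where "c \<in> C" "h \<in> carrier G" "g = inv h \<otimes> c \<otimes> h" by (rule carrier_decomp)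
    then show ?thesis using extendsD[OF assms(1)] extendsD[OF assms(2)] by (simp add: fun_eq_iff)
  next
    case False
    then show ?thesis using assms[THEN extends_form] by (simp add: form_family_def)
  qed
qed

text \<open>Invariance is the composition of two conjugations. The Jacobi identity at a conjugate is
  the image, under the inverse of \<open>k\<close>, of the identity at the representative for the
  three vectors moved by \<open>k\<close>.\<close>

lemma extends_hecke:
  assumes adm: "admissible \<phi>" and a: "extends c \<phi> a"
  shows "hecke_invariant a" "hecke_jacobi a"
proof -
  show "hecke_invariant a"
    unfolding hecke_invariant_def
  proof (intro ballI allI)
    fix g h v w assume g: "g \<in> carrier G" and h: "h \<in> carrier G"
    obtain c0 k where ck: "c0 \<in> C" "k \<in> carrier G" "g = inv k \<otimes> c0 \<otimes> k" by (rule carrier_decomp[OF g])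
    have "inv h \<otimes> g \<otimes> h = inv (k \<otimes> h) \<otimes> c0 \<otimes> (k \<otimes> h)"
      using ck h C_carrier by (simp add: inv_mult_group m_assoc)
    then have "a (inv h \<otimes> g \<otimes> h) v w = base_form c \<phi> c0 (\<rho> (k \<otimes> h) *v v) (\<rho> (k \<otimes> h) *v w)"
      using extendsD[OF a ck(1), of "k \<otimes> h"] ck h by simp
    also have "\<dots> = a g (\<rho> h *v v) (\<rho> h *v w)"
      using extendsD[OF a ck(1,2)] ck h by (simp add: rho_mult_vec)
    finally show "a (inv h \<otimes> g \<otimes> h) v w = a g (\<rho> h *v v) (\<rho> h *v w)" .
  qed
  show "hecke_jacobi a"
    unfolding hecke_jacobi_def
  proof (intro ballI allI)
    fix g u v w assume g: "g \<in> carrier G"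
    obtain c0 k where ck: "c0 \<in> C" "k \<in> carrier G" "g = inv k \<otimes> c0 \<otimes> k" by (rule carrier_decomp[OF g])
    have a_eq: "a g v w = base_form c \<phi> c0 (\<rho> k *v v) (\<rho> k *v w)" for v w
      using extendsD[OF a ck(1,2)] ck(3) by simp
    have move: "\<rho> g *v z - z = \<rho> (inv k) *v (\<rho> c0 *v (\<rho> k *v z) - \<rho> k *v z)" for z
      using ck C_carrier by (simp add: rho_mult_vec vec.diff)
    have "a g u v *s (\<rho> g *v w - w) + a g v w *s (\<rho> g *v u - u) + a g w u *s (\<rho> g *v v - v) =
      \<rho> (inv k) *v (base_form c \<phi> c0 (\<rho> k *v u) (\<rho> k *v v) *s (\<rho> c0 *v (\<rho> k *v w) - \<rho> k *v w)
        + base_form c \<phi> c0 (\<rho> k *v v) (\<rho> k *v w) *s (\<rho> c0 *v (\<rho> k *v u) - \<rho> k *v u)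
        + base_form c \<phi> c0 (\<rho> k *v w) (\<rho> k *v u) *s (\<rho> c0 *v (\<rho> k *v v) - \<rho> k *v v))"
      unfolding a_eq move vec.add vec.scale ..
    then show "a g u v *s (\<rho> g *v w - w) + a g v w *s (\<rho> g *v u - u) + a g w u *s (\<rho> g *v v - v) = 0"
      unfolding base_jacobi[OF ck(1) adm] by simp
  qed
qed

section \<open>Comparison with the graded Hecke families\<close>

lemma families_iff: "a \<in> graded_hecke_families G \<rho> \<longleftrightarrow> form_family G a \<and> hecke_invariant a \<and> hecke_jacobi a"
  unfolding graded_hecke_families_def using graded_hecke_iff by blast

lemma extends_families: "admissible \<phi> \<Longrightarrow> extends c \<phi> a \<Longrightarrow> a \<in> graded_hecke_families G \<rho>"
  using families_iff extends_hecke extends_form by blast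

text \<open>The data are read off from the family: the value on the chosen basis and the functional
  that lifts the form. At a representative of neither kind \<open>hecke_form_classification\<close>
  leaves only the zero form.\<close>

lemma families_extends:
  assumes a: "a \<in> graded_hecke_families G \<rho>"
  defines "c \<equiv> \<lambda>g. a g (w1 g) (w2 g)" and "\<phi> \<equiv> \<lambda>g. ext2_lift (a g)"
  shows "admissible \<phi>" "extends c \<phi> a"
proof -
  have forms: "form_family G a" and inv: "hecke_invariant a" and jac: "hecke_jacobi a"
    using a families_iff by auto
  have skew: "skew_bilinear_form (a g)" if "g \<in> carrier G" for g
    using forms that by (simp add: form_family_def)
  have Zinv: "a g (\<rho> h *v v) (\<rho> h *v w) = a g v w" if g: "g \<in> carrier G" and h: "h \<in> centralizer G g" for g h v w
  proof -
    have hG: "h \<in> carrier G" "h \<otimes> g = g \<otimes> h" using h by (simp_all add: centralizer_iff)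
    have "inv h \<otimes> g \<otimes> h = g" using g hG by (simp add: m_assoc flip: hG(2)) (simp flip: m_assoc)
    then show ?thesis using inv g hG(1) unfolding hecke_invariant_def by metis
  qed
  have lift: "ext2_lift (a g) (wedge v w) = a g v w" if "g \<in> carrier G" for g v w
    by (rule ext2_lift_wedge[OF skew[OF that]])
  show "admissible \<phi>"
    unfolding admissible_def invariant_ext2_functional_def
  proof (intro ballI impI conjI allI)
    fix g assume "g \<in> C"
    then have g: "g \<in> carrier G" by (rule C_carrier)
    show lin: "Vector_Spaces.linear ext2_scale (*) (\<phi> g)"
      unfolding \<phi>_def by (rule ext2_lift_linear[OF skew[OF g]])
    fix h x assume h: "h \<in> centralizer G g"
    show "\<phi> g (ext2_map (\<rho> h) x) = \<phi> g x"
      by (induction x rule: ext2_induct)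
        (simp_all add: ext2_map_add ext2_map_scale ext2_map_wedge linear_functionalD[OF lin],
          simp add: \<phi>_def lift[OF g] Zinv[OF g h])
  qed
  have base: "a g v w = base_form c \<phi> g v w" if gC: "g \<in> C" for g v w
  proof -
    have g: "g \<in> carrier G" using gC by (rule C_carrier)
    have classified: "special g \<and> supported (a g) g" if "a g x y \<noteq> 0" "fix g \<noteq> UNIV" for x y
      by (rule hecke_form_classification[OF g skew[OF g] that Zinv[OF g]])
        (use jac g in \<open>auto simp: hecke_jacobi_def\<close>)
    consider "special g" | "fix g = UNIV" | "\<not> special g" "fix g \<noteq> UNIV" by blast
    then show ?thesis
    proof cases
      case 1
      have "fix g \<noteq> UNIV" using 1 not_special_UNIV by blast
      \<comment> \<open>Either some value of the form is nonzero and the classification applies, or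
        the form is zero and has everything in its radical.\<close>
      then have "supported (a g) g" using classified skew[OF g] unfolding supported_def by metis
      note eq = supported_eq[OF g conjunct1[OF basis[OF gC 1]] conjunct2[OF basis[OF gC 1]] this, of v w]
      show ?thesis
        using eq gr0[OF g conjunct1[OF basis[OF gC 1]] conjunct2[OF basis[OF gC 1]]] 1
        by (simp add: base_form_def c_def field_simps)
    next
      case 2
      then show ?thesis by (simp add: base_UNIV \<phi>_def lift[OF g])
    next
      case 3
      then show ?thesis using classified by (auto simp: base_other)
    qed
  qed
  show "extends c \<phi> a"
    unfolding extends_def
  proof (intro conjI ballI allI)
    fix g h v w assume "g \<in> C" "h \<in> carrier G"
    then show "a (inv h \<otimes> g \<otimes> h) v w = base_form c \<phi> g (\<rho> h *v v) (\<rho> h *v w)"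
      using inv C_carrier base unfolding hecke_invariant_def by metis
  qed (rule forms)
qed

text \<open>In codimension two the prescribed value and the radical determine the form through
  \<open>supported_eq\<close>. For a representative of neither kind, uniqueness of representatives
  shows that none of its conjugates lies in a class of one of the two kinds.\<close>

lemma constructed_iff:
  assumes adm: "admissible \<phi>"
  shows "constructed_family G \<rho> ip C w1 w2 c \<phi> a \<longleftrightarrow> extends c \<phi> a"
proof
  assume con: "constructed_family G \<rho> ip C w1 w2 c \<phi> a"
  then have forms: "form_family G a"
    and 1: "\<And>g. g \<in> C \<Longrightarrow> special g \<Longrightarrow> a g (w1 g) (w2 g) = c g \<and> (\<forall>u\<in>fix g. \<forall>v. a g u v = 0)"
    and 2: "\<And>g v w. g \<in> C \<Longrightarrow> fix g = UNIV \<Longrightarrow> a g v w = \<phi> g (wedge v w)"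
    and 3: "\<And>g h v w. g \<in> C \<Longrightarrow> special g \<or> fix g = UNIV \<Longrightarrow> h \<in> carrier G \<Longrightarrow>
      a (inv h \<otimes> g \<otimes> h) v w = a g (\<rho> h *v v) (\<rho> h *v w)"
    and 4: "\<And>g v w. g \<in> carrier G \<Longrightarrow> \<not> (\<exists>g'\<in>C. g \<in> conj_class G g' \<and> (special g' \<or> fix g' = UNIV)) \<Longrightarrow> a g v w = 0"
    unfolding constructed_family_def by blast+
  show "extends c \<phi> a"
    unfolding extends_def
  proof (intro conjI ballI allI)
    fix g h v w assume gC: "g \<in> C" and h: "h \<in> carrier G"
    have g: "g \<in> carrier G" using gC by (rule C_carrier)
    have skew: "skew_bilinear_form (a g)" using forms g by (simp add: form_family_def)
    consider "special g" | "fix g = UNIV" | "\<not> special g" "fix g \<noteq> UNIV" by blast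
    then show "a (inv h \<otimes> g \<otimes> h) v w = base_form c \<phi> g (\<rho> h *v v) (\<rho> h *v w)"
    proof cases
      case s: 1
      note w = g conjunct1[OF basis[OF gC s]] conjunct2[OF basis[OF gC s]]
      have "supported (a g) g" using 1[OF gC s] skew by (simp add: supported_def)
      from supported_eq[OF w this, of "\<rho> h *v v" "\<rho> h *v w"]
      show ?thesis
        using 1[OF gC s] 3[OF gC _ h] s gr0[OF w] by (simp add: base_form_def field_simps)
    next
      case 2
      then show ?thesis using 3[OF gC _ h] \<open>\<And>g v w. g \<in> C \<Longrightarrow> fix g = UNIV \<Longrightarrow> a g v w = \<phi> g (wedge v w)\<close> gC
        by (simp add: base_UNIV)
    next
      case other: 3
      have "\<not> (\<exists>g'\<in>C. inv h \<otimes> g \<otimes> h \<in> conj_class G g' \<and> (special g' \<or> fix g' = UNIV))"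
      proof
        assume "\<exists>g'\<in>C. inv h \<otimes> g \<otimes> h \<in> conj_class G g' \<and> (special g' \<or> fix g' = UNIV)"
        then obtain g' h' where g': "g' \<in> C" "special g' \<or> fix g' = UNIV" "h' \<in> carrier G"
          "inv h \<otimes> g \<otimes> h = inv h' \<otimes> g' \<otimes> h'" by (auto simp: conj_class_def)
        then have "g = g'" using representative_unique gC h by blast
        then show False using g' other by blast
      qed
      then show ?thesis using 4 g h other by (simp add: base_other)
    qed
  qed (rule forms)
next
  assume ext: "extends c \<phi> a"
  show "constructed_family G \<rho> ip C w1 w2 c \<phi> a"
    unfolding constructed_family_def
  proof (intro conjI ballI allI impI)
    show "form_family G a" using ext by (rule extends_form)
    show "a g (w1 g) (w2 g) = c g" if "g \<in> C" "special g" for g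
      using base_special(2)[OF that] extends_base[OF ext that(1)] by simp
    show "a g u v = 0" if "g \<in> C" "special g" "u \<in> fix g" for g u v
      using supportedD(2)[OF base_special(1)[OF that(1,2)] that(3)] extends_base[OF ext that(1)] by simp
    show "a g v w = \<phi> g (wedge v w)" if "g \<in> C" "fix g = UNIV" for g v w
      using base_UNIV[OF that(2)] extends_base[OF ext that(1)] by simp
    show "a (inv h \<otimes> g \<otimes> h) v w = a g (\<rho> h *v v) (\<rho> h *v w)" if "g \<in> C" "h \<in> carrier G" for g h v w
      using extendsD[OF ext that] extends_base[OF ext that(1)] by simp
    fix g v w
    assume g: "g \<in> carrier G" and no: "\<not> (\<exists>g'\<in>C. g \<in> conj_class G g' \<and> (special g' \<or> fix g' = UNIV))"
    obtain c0 h where ch: "c0 \<in> C" "h \<in> carrier G" "g = inv h \<otimes> c0 \<otimes> h" by (rule carrier_decomp[OF g])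
    then have "g \<in> conj_class G c0" by (auto simp: conj_class_def)
    then have "\<not> special c0" "fix c0 \<noteq> UNIV" using no ch(1) by auto
    then show "a g v w = 0" using extendsD[OF ext ch(1,2)] ch(3) by (simp add: base_other)
  qed
qed

section \<open>The dimension of the space of families\<close>

lemma families_subspace: "families.subspace (graded_hecke_families G \<rho>)"
proof (rule families.subspaceI)
  show "0 \<in> graded_hecke_families G \<rho>"
    unfolding families_iff by (simp add: form_family_def skew_bilinear_form_def hecke_invariant_def hecke_jacobi_def)
  fix a b assume "a \<in> graded_hecke_families G \<rho>" "b \<in> graded_hecke_families G \<rho>"
  then have ab: "form_family G a" "hecke_invariant a" "hecke_jacobi a" "form_family G b" "hecke_invariant b" "hecke_jacobi b"
    by (auto simp: families_iff)
  have "skew_bilinear_form (a g + b g)" if "g \<in> carrier G" for g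
  proof -
    have "skew_bilinear_form (a g)" "skew_bilinear_form (b g)" using ab that by (auto simp: form_family_def)
    note s = skew_formD[OF this(1)] and t = skew_formD[OF this(2)]
    show ?thesis
      unfolding skew_bilinear_form_def plus_fun_apply
      by (intro conjI allI) (simp_all only: s(1-4) t(1-4) distrib_left add_ac,
        metis s(5) t(5) minus_add_distrib)
  qed
  then have "form_family G (a + b)" using ab by (simp add: form_family_def)
  moreover have "hecke_invariant (a + b)" using ab by (simp add: hecke_invariant_def)
  moreover have "hecke_jacobi (a + b)"
    unfolding hecke_jacobi_def
  proof (intro ballI allI)
    fix g u v w assume "g \<in> carrier G"
    then have "(a g u v *s (\<rho> g *v w - w) + a g v w *s (\<rho> g *v u - u) + a g w u *s (\<rho> g *v v - v)) +
        (b g u v *s (\<rho> g *v w - w) + b g v w *s (\<rho> g *v u - u) + b g w u *s (\<rho> g *v v - v)) = 0"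
      using ab unfolding hecke_jacobi_def by simp
    then show "(a + b) g u v *s (\<rho> g *v w - w) + (a + b) g v w *s (\<rho> g *v u - u) + (a + b) g w u *s (\<rho> g *v v - v) = 0"
      by (simp only: plus_fun_apply vec.scale_left_distrib add_ac)
  qed
  ultimately show "a + b \<in> graded_hecke_families G \<rho>" by (simp add: families_iff)
next
  fix k a assume "a \<in> graded_hecke_families G \<rho>"
  then have a: "form_family G a" "hecke_invariant a" "hecke_jacobi a" by (auto simp: families_iff)
  have "form_family G (family_scale k a)"
    unfolding form_family_def family_scale_def using a skew_form_scale
    by (auto simp: form_family_def fun_eq_iff)
  moreover have "hecke_invariant (family_scale k a)" using a by (simp add: hecke_invariant_def family_scale_def)
  moreover have "hecke_jacobi (family_scale k a)"
    unfolding hecke_jacobi_def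
  proof (intro ballI allI)
    fix g u v w assume "g \<in> carrier G"
    then have "k *s (a g u v *s (\<rho> g *v w - w) + a g v w *s (\<rho> g *v u - u) + a g w u *s (\<rho> g *v v - v)) = 0"
      using a unfolding hecke_jacobi_def by simp
    then show "family_scale k a g u v *s (\<rho> g *v w - w) + family_scale k a g v w *s (\<rho> g *v u - u)
        + family_scale k a g w u *s (\<rho> g *v v - v) = 0"
      by (simp add: vec.scale_right_distrib family_scale_def)
  qed
  ultimately show "family_scale k a \<in> graded_hecke_families G \<rho>" by (simp add: families_iff)
qed

lemma subgroup_centralizer:
  assumes g: "g \<in> carrier G"
  shows "subgroup (centralizer G g) G"
proof (rule subgroupI)
  show "centralizer G g \<subseteq> carrier G" by (auto simp: centralizer_def)
  show "centralizer G g \<noteq> {}" using g by (auto simp: centralizer_iff)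
  show "inv h \<in> centralizer G g" if "h \<in> centralizer G g" for h
    using that g by (simp add: centralizer_iff) (metis inv_closed inv_solve_left inv_solve_right m_assoc m_closed)
  show "h \<otimes> k \<in> centralizer G g" if "h \<in> centralizer G g" "k \<in> centralizer G g" for h k
    using that g by (simp add: centralizer_iff) (metis m_assoc)
qed

text \<open>The count runs over classes, the coordinates below over representatives. Since the
  condition is stable under conjugation, a class containing an element that satisfies it also has
  such a representative.\<close>

lemma num_classes: "num_codim2_trivial_chi_classes G \<rho> ip = card {g \<in> C. special g}"
proof -
  have "bij_betw (conj_class G) {g \<in> C. special g} {conj_class G g | g. g \<in> carrier G \<and> special g}"
  proof (rule bij_betw_imageI)
    show "inj_on (conj_class G) {g \<in> C. special g}"
    proof (rule inj_onI)
      fix g g' assume g: "g \<in> {g \<in> C. special g}" "g' \<in> {g \<in> C. special g}" "conj_class G g = conj_class G g'"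
      have self: "x \<in> conj_class G x" if "x \<in> carrier G" for x
      proof -
        have "x = inv \<one> \<otimes> x \<otimes> \<one>" using that by simp
        then show ?thesis unfolding conj_class_def by blast
      qed
      have "g \<in> carrier G" "g' \<in> carrier G" using g C_carrier by auto
      then show "g = g'" using C_unique[of g g g'] self g by blast
    qed
    show "conj_class G ` {g \<in> C. special g} = {conj_class G g | g. g \<in> carrier G \<and> special g}"
    proof (intro equalityI subsetI)
      fix X assume "X \<in> {conj_class G g | g. g \<in> carrier G \<and> special g}"
      then obtain g where g: "g \<in> carrier G" "special g" "X = conj_class G g" by blast
      obtain c h where ch: "c \<in> C" "h \<in> carrier G" "g = inv h \<otimes> c \<otimes> h" by (rule carrier_decomp[OF g(1)])
      have cG: "c \<in> carrier G" using ch(1) by (rule C_carrier)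
      have c_eq: "c = inv (inv h) \<otimes> g \<otimes> inv h" using conj_inverse[OF cG ch(2)] ch by simp
      have "special c" unfolding c_eq by (rule codim2_trivial_chi_conj) (use g ch in simp_all)
      moreover have "conj_class G g = conj_class G c"
      proof -
        have sub: "conj_class G (inv k \<otimes> x \<otimes> k) \<subseteq> conj_class G x" if "x \<in> carrier G" "k \<in> carrier G" for x k
        proof
          fix y assume "y \<in> conj_class G (inv k \<otimes> x \<otimes> k)"
          then obtain l where l: "l \<in> carrier G" "y = inv l \<otimes> (inv k \<otimes> x \<otimes> k) \<otimes> l" by (auto simp: conj_class_def)
          then have "y = inv (k \<otimes> l) \<otimes> x \<otimes> (k \<otimes> l)" using that by (simp add: inv_mult_group m_assoc)
          then show "y \<in> conj_class G x" using l that unfolding conj_class_def by blast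
        qed
        show ?thesis
        proof (rule equalityI)
          show "conj_class G g \<subseteq> conj_class G c"
            unfolding ch(3) by (rule sub[OF cG ch(2)])
          have "conj_class G (inv (inv h) \<otimes> g \<otimes> inv h) \<subseteq> conj_class G g"
            by (rule sub[OF g(1) inv_closed[OF ch(2)]])
          then show "conj_class G c \<subseteq> conj_class G g" unfolding c_eq[symmetric] .
        qed
      qed
      ultimately show "X \<in> conj_class G ` {g \<in> C. special g}" using g ch(1) by auto
    qed (use C_carrier in auto)
  qed
  from bij_betw_same_card[OF this] show ?thesis
    unfolding num_codim2_trivial_chi_classes_def by (rule sym)
qed

text \<open>Coordinates of a family are its values on the chosen bases at the representatives of
  codimension two and, at those acting trivially, the values of the lifted functional on a basis of
  the invariants. They determine the family by \<open>extends_unique\<close>, and unit vectors are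
  attained by \<open>extends_exists\<close>.\<close>

lemma families_dim:
  "families.dim (graded_hecke_families G \<rho>) = num_codim2_trivial_chi_classes G \<rho> ip +
     (\<Sum>g | g \<in> C \<and> fixed_space (\<rho> g) = UNIV. ext2.dim (ext2_invariants \<rho> (centralizer G g)))"
proof -
  define U where "U = {g \<in> C. fix g = UNIV}"
  have finC: "finite C" using C_carrier by (intro finite_subset[OF _ finite_G]) blast
  have U: "g \<in> C" "g \<in> carrier G" "fix g = UNIV" "\<not> special g" if "g \<in> U" for g
    using that C_carrier not_special_UNIV by (auto simp: U_def)
  have "\<forall>g\<in>U. \<exists>p. finite (fst p) \<and> card (fst p) = ext2.dim (ext2_invariants \<rho> (centralizer G g)) \<and>
      (\<forall>b\<in>fst p. invariant_ext2_functional \<rho> (centralizer G g) (snd p b)) \<and>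
      (\<forall>b\<in>fst p. \<forall>b'\<in>fst p. snd p b b' = (if b = b' then 1 else 0)) \<and>
      (\<forall>\<phi>. invariant_ext2_functional \<rho> (centralizer G g) \<phi> \<longrightarrow> (\<forall>b\<in>fst p. \<phi> b = 0) \<longrightarrow> \<phi> = (\<lambda>x. 0))"
  proof
    fix g assume "g \<in> U"
    then have sub: "subgroup (centralizer G g) G" using U(2) subgroup_centralizer by blast
    show "\<exists>p. finite (fst p) \<and> card (fst p) = ext2.dim (ext2_invariants \<rho> (centralizer G g)) \<and>
      (\<forall>b\<in>fst p. invariant_ext2_functional \<rho> (centralizer G g) (snd p b)) \<and>
      (\<forall>b\<in>fst p. \<forall>b'\<in>fst p. snd p b b' = (if b = b' then 1 else 0)) \<and>
      (\<forall>\<phi>. invariant_ext2_functional \<rho> (centralizer G g) \<phi> \<longrightarrow> (\<forall>b\<in>fst p. \<phi> b = 0) \<longrightarrow> \<phi> = (\<lambda>x. 0))"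
    proof (rule invariant_functionals_dual_basis[OF sub])
      fix B \<psi>
      assume "finite B" "card B = ext2.dim (ext2_invariants \<rho> (centralizer G g))"
        "\<And>b. b \<in> B \<Longrightarrow> invariant_ext2_functional \<rho> (centralizer G g) (\<psi> b)"
        "\<And>b b'. b \<in> B \<Longrightarrow> b' \<in> B \<Longrightarrow> \<psi> b b' = (if b = b' then 1 else 0)"
        "\<And>\<phi>. invariant_ext2_functional \<rho> (centralizer G g) \<phi> \<Longrightarrow> (\<And>b. b \<in> B \<Longrightarrow> \<phi> b = 0) \<Longrightarrow> \<phi> = (\<lambda>x. 0)"
      then show ?thesis by (intro exI[of _ "(B, \<psi>)"]) simp
    qed
  qed
  from bchoice[OF this] obtain p where p: "\<forall>g\<in>U. finite (fst (p g)) \<and>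
      card (fst (p g)) = ext2.dim (ext2_invariants \<rho> (centralizer G g)) \<and>
      (\<forall>b\<in>fst (p g). invariant_ext2_functional \<rho> (centralizer G g) (snd (p g) b)) \<and>
      (\<forall>b\<in>fst (p g). \<forall>b'\<in>fst (p g). snd (p g) b b' = (if b = b' then 1 else 0)) \<and>
      (\<forall>\<phi>. invariant_ext2_functional \<rho> (centralizer G g) \<phi> \<longrightarrow> (\<forall>b\<in>fst (p g). \<phi> b = 0) \<longrightarrow> \<phi> = (\<lambda>x. 0))"
    by blast
  define B where "B g = fst (p g)" for g
  define \<psi> where "\<psi> g = snd (p g)" for g
  have B: "finite (B g)" "card (B g) = ext2.dim (ext2_invariants \<rho> (centralizer G g))"
    and \<psi>: "\<And>b. b \<in> B g \<Longrightarrow> invariant_ext2_functional \<rho> (centralizer G g) (\<psi> g b)"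
      "\<And>b b'. b \<in> B g \<Longrightarrow> b' \<in> B g \<Longrightarrow> \<psi> g b b' = (if b = b' then 1 else 0)"
    and \<psi>_inj: "\<And>\<phi>. invariant_ext2_functional \<rho> (centralizer G g) \<phi> \<Longrightarrow> (\<And>b. b \<in> B g \<Longrightarrow> \<phi> b = 0) \<Longrightarrow> \<phi> = (\<lambda>x. 0)"
    if "g \<in> U" for g
    using p that by (auto simp: B_def \<psi>_def)
  define K where "K = {g \<in> C. special g}"
  have finK: "finite K" and finU: "finite U" using finC by (simp_all add: K_def U_def)
  define J where "J = (Inl ` K \<union> Inr ` (SIGMA g:U. B g) :: ('a + 'a \<times> 'c ext2) set)"
  define \<kappa> where "\<kappa> a j = (case j of Inl g \<Rightarrow> a g (w1 g) (w2 g) | Inr (g, b) \<Rightarrow> ext2_lift (a g) b)"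
    for a :: "'a \<Rightarrow> complex^'c \<Rightarrow> complex^'c \<Rightarrow> complex" and j
  have "families.dim (graded_hecke_families G \<rho>) = card J"
  proof (rule families.dim_eq_card_coordinates[OF families_subspace, where \<kappa> = \<kappa>])
    show "finite J" using finK finU B(1) by (auto simp: J_def)
    show "\<kappa> (a + a') j = \<kappa> a j + \<kappa> a' j" for a a' j
      by (auto simp: \<kappa>_def ext2_lift_def distrib_left sum.distrib split: sum.split)
    show "\<kappa> (family_scale k a) j = k * \<kappa> a j" for k a j
      by (auto simp: \<kappa>_def ext2_lift_def family_scale_def sum_distrib_left mult.left_commute split: sum.split)
    show "a = 0" if a: "a \<in> graded_hecke_families G \<rho>" and zero: "\<And>j. j \<in> J \<Longrightarrow> \<kappa> a j = 0" for a
    proof -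
      define c where "c = (\<lambda>g. a g (w1 g) (w2 g))"
      define \<phi> where "\<phi> = (\<lambda>g. ext2_lift (a g))"
      have adm: "admissible \<phi>" and ext: "extends c \<phi> a"
        unfolding c_def \<phi>_def using families_extends[OF a] by auto
      have c0: "c g = 0" if "g \<in> K" for g
        using zero[of "Inl g"] that by (simp add: J_def \<kappa>_def c_def)
      have \<phi>0: "\<phi> g = (\<lambda>x. 0)" if "g \<in> U" for g
      proof (rule \<psi>_inj[OF that])
        show "invariant_ext2_functional \<rho> (centralizer G g) (\<phi> g)"
          using adm that by (simp add: admissible_def U_def)
        show "\<phi> g b = 0" if "b \<in> B g" for b
          using zero[of "Inr (g, b)"] that \<open>g \<in> U\<close> by (simp add: J_def \<kappa>_def \<phi>_def)
      qed
      have base0: "base_form c \<phi> g v w = 0" if "g \<in> C" for g v w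
        using c0[of g] \<phi>0[of g] that by (simp add: base_form_def K_def U_def)
      have "extends c \<phi> 0"
        using base0 by (simp add: extends_def form_family_def skew_bilinear_form_def)
      then show ?thesis by (rule extends_unique[OF ext])
    qed
    show "\<exists>a\<in>graded_hecke_families G \<rho>. \<forall>i\<in>J. \<kappa> a i = (if i = j then 1 else 0)" if j: "j \<in> J" for j
    proof -
      \<comment> \<open>Data of the family dual to the index \<open>j\<close>: a single scalar 1, or
        a single functional from the dual system, and zero elsewhere.\<close>
      define c where "c g = (if j = Inl g then 1 else 0 :: complex)" for g
      define \<phi> where "\<phi> g = (case j of Inl _ \<Rightarrow> (\<lambda>x. 0) | Inr (g', b) \<Rightarrow> if g' = g then \<psi> g b else (\<lambda>x. 0))" for g
      have zero_inv: "invariant_ext2_functional \<rho> H (\<lambda>x. 0)" for H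
        unfolding invariant_ext2_functional_def by (auto intro: linear_functionalI)
      have adm: "admissible \<phi>"
        unfolding admissible_def \<phi>_def using j \<psi>(1) zero_inv
        by (auto simp: J_def split: sum.split)
      obtain a where ext: "extends c \<phi> a" using extends_exists[OF adm] by blast
      have "\<kappa> a i = (if i = j then 1 else 0)" if i: "i \<in> J" for i
      proof (cases i)
        case (Inl g)
        then have g: "g \<in> C" "special g" using i by (auto simp: J_def K_def)
        have "\<kappa> a i = c g"
          using Inl extends_base[OF ext g(1)] base_special(2)[OF g] by (simp add: \<kappa>_def)
        then show ?thesis using Inl by (auto simp: c_def)
      next
        case (Inr q)
        then obtain g b where q: "q = (g, b)" "g \<in> U" "b \<in> B g" using i by (auto simp: J_def)
        have lin: "Vector_Spaces.linear ext2_scale (*) (\<phi> g)"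
          using adm U[OF q(2)] by (simp add: admissible_def invariant_ext2_functional_def)
        have "\<kappa> a i = \<phi> g b"
          using Inr q extends_base[OF ext U(1)[OF q(2)]] base_UNIV[OF U(3)[OF q(2)]]
          by (simp add: \<kappa>_def ext2_lift_of_functional[OF lin])
        also have "\<dots> = (if i = j then 1 else 0)"
          using j Inr q \<psi>(2)[OF q(2) _ q(3)] by (auto simp: \<phi>_def J_def split: sum.split)
        finally show ?thesis .
      qed
      then show ?thesis using extends_families[OF adm ext] by blast
    qed
  qed
  also have "card J = card K + (\<Sum>g\<in>U. card (B g))"
  proof -
    have "card J = card (Inl ` K :: ('a + 'a \<times> 'c ext2) set) + card (Inr ` (SIGMA g:U. B g) :: ('a + 'a \<times> 'c ext2) set)"
      unfolding J_def using finK finU B(1) by (intro card_Un_disjoint) auto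
    also have "\<dots> = card K + card (SIGMA g:U. B g)" by (simp add: card_image)
    also have "card (SIGMA g:U. B g) = (\<Sum>g\<in>U. card (B g))" using finU B(1) by (intro card_SigmaI) auto
    finally show ?thesis .
  qed
  also have "(\<Sum>g\<in>U. card (B g)) = (\<Sum>g | g \<in> C \<and> fixed_space (\<rho> g) = UNIV. ext2.dim (ext2_invariants \<rho> (centralizer G g)))"
    by (rule sum.cong) (auto simp: U_def B(2))
  finally show ?thesis by (simp add: num_classes K_def)
qed

end

section \<open>The dimension formula and the explicit description of all families\<close>

theorem corollary8p17:
  fixes G :: "('g, 'm) monoid_scheme"
    and \<rho> :: "'g \<Rightarrow> complex^'n::finite^'n"
    and ip :: "complex^'n \<Rightarrow> complex^'n \<Rightarrow> complex"
    and C :: "'g set"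
    and w1 w2 :: "'g \<Rightarrow> complex^'n"
  assumes "group G" and "finite (carrier G)"
    and "matrix_representation G \<rho>"
    and "hermitian_inner_product ip" and "invariant_form G \<rho> ip"
    and "class_representatives G C"
    and "\<And>g. \<lbrakk>g \<in> C; codim2_trivial_chi G \<rho> ip g\<rbrakk> \<Longrightarrow>
           w1 g \<noteq> w2 g \<and> is_basis_of {w1 g, w2 g} (orth_compl ip (fixed_space (\<rho> g)))"
  shows
    "(families.subspace (graded_hecke_families G \<rho>) \<and>
      families.dim (graded_hecke_families G \<rho>) =
        num_codim2_trivial_chi_classes G \<rho> ip +
        (\<Sum>g | g \<in> C \<and> fixed_space (\<rho> g) = UNIV.
           ext2.dim (ext2_invariants \<rho> (centralizer G g)))) \<and>
     (\<forall>c \<phi>. (\<forall>g\<in>C. fixed_space (\<rho> g) = UNIV \<longrightarrow>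
                invariant_ext2_functional \<rho> (centralizer G g) (\<phi> g)) \<longrightarrow>
        (\<exists>!a. constructed_family G \<rho> ip C w1 w2 c \<phi> a)) \<and>
     (\<forall>a. a \<in> graded_hecke_families G \<rho> \<longleftrightarrow>
        (\<exists>c \<phi>. (\<forall>g\<in>C. fixed_space (\<rho> g) = UNIV \<longrightarrow>
                  invariant_ext2_functional \<rho> (centralizer G g) (\<phi> g)) \<and>
               constructed_family G \<rho> ip C w1 w2 c \<phi> a))"
proof -
  interpret class_rep G \<rho> ip C w1 w2
    using assms
    by (intro class_rep.intro hermitian_rep.intro finite_group_rep.intro
        finite_group_rep_axioms.intro hermitian_rep_axioms.intro class_rep_axioms.intro)
  have adm: "(\<forall>g\<in>C. fixed_space (\<rho> g) = UNIV \<longrightarrow> invariant_ext2_functional \<rho> (centralizer G g) (\<phi> g))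
      \<longleftrightarrow> admissible \<phi>" for \<phi>
    by (simp add: admissible_def)
  have "\<exists>!a. constructed_family G \<rho> ip C w1 w2 c \<phi> a" if "admissible \<phi>" for c \<phi>
    using constructed_iff[OF that] extends_exists[OF that] extends_unique by metis
  moreover have "a \<in> graded_hecke_families G \<rho> \<longleftrightarrow>
      (\<exists>c \<phi>. admissible \<phi> \<and> constructed_family G \<rho> ip C w1 w2 c \<phi> a)" for a
    using families_extends[of a] extends_families constructed_iff by metis
  ultimately show ?thesis
    unfolding adm using families_subspace families_dim by blast
qed

end
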